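(* Let $T>0$, $r\ge0$, $\mu\in\mathbb R$, $\rho\in[-1,1]$, $\alpha\ge0$, $K>0$, $\beta:\mathbb R\to(0,\infty)$ non-decreasing, $a(\sigma,t),b(\sigma,t)$ functions on $\mathbb R\times[0,T]$, and $\gamma(\sigma,t)=a(\sigma,t)-\frac{(\mu-r)\rho b(\sigma,t)}{\beta(\sigma)}+\alpha\sqrt{1-\rho^2}\,b(\sigma,t)$. Assume: $a,b,\beta$ are bounded; there is $\delta>0$ with $\max(\beta(\sigma),b(\sigma,t))\ge\delta$; $\beta,b,\gamma$ are Lipschitz in $\sigma$ uniformly in $t$ and differentiable in $\sigma$; $\beta_\sigma,b_\sigma,\gamma_\sigma$ are bounded and $\beta_\sigma,b_\sigma$ are Lipschitz in $\sigma$ uniformly in $t$. Let $g(S)=(K-S)_+$. Then the solution $P$ (continuous viscosity solution in $\mathcal C$) of $$P_t+rSP_S+\Big(a-\frac{(\mu-r)\rho b}{\beta(\sigma)}\Big)P_\sigma+\alpha\sqrt{1-\rho^2}\,b|P_\sigma|+\tfrac12\beta(\sigma)^2S^2P_{SS}+\rho\beta(\sigma)bSP_{S\sigma}+\tfrac12b^2P_{\sigma\sigma}-rP=0,\quad P(S,\sigma,T)=g(S),$$ equals the solution $G$ (in $\mathcal C$) of $$G_t+rSG_S+\gamma(\sigma,t)G_\sigma+\tfrac12\beta(\sigma)^2S^2G_{SS}+\rho\beta(\sigma)bSG_{S\sigma}+\tfrac12b^2G_{\sigma\sigma}-rG=0,\quad G(S,\sigma,T)=g(S),$$ where $a,b$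 are evaluated at $(\sigma,t)$.
   Context: Model: $dS_t=\mu S_tdt+\beta(\sigma_t)S_tdB_t$, $d\sigma_t=a(\sigma_t,t)dt+b(\sigma_t,t)dW_t$, $B,W$ Brownian motions of correlation $\rho$; the nonlinear PDE gives the writer's price of a European put with instantaneous Sharpe ratio $\alpha$. $\mathcal C$ is the class of locally bounded $u$ with $u(S,\sigma,t)/(1+(|\ln S|+|\sigma|)^k)\to0$ uniformly in $t$ as $|\ln S|+|\sigma|\to\infty$ for some $k>0$. *)

theory Defs
  imports "HOL-Analysis.Analysis"
begin

definition dom3 :: "real \<Rightarrow> (real \<times> real \<times> real) set" where
  "dom3 T = {0<..} \<times> UNIV \<times> {0..T}"

definition test_fun ::
  "(real \<Rightarrow> real \<Rightarrow> real \<Rightarrow> real) \<Rightarrow> (real \<Rightarrow> real \<Rightarrow> real \<Rightarrow> real) \<Rightarrow>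
   (real \<Rightarrow> real \<Rightarrow> real \<Rightarrow> real) \<Rightarrow> (real \<Rightarrow> real \<Rightarrow> real \<Rightarrow> real) \<Rightarrow>
   (real \<Rightarrow> real \<Rightarrow> real \<Rightarrow> real) \<Rightarrow> (real \<Rightarrow> real \<Rightarrow> real \<Rightarrow> real) \<Rightarrow>
   (real \<Rightarrow> real \<Rightarrow> real \<Rightarrow> real) \<Rightarrow> bool" where
  "test_fun \<phi> \<phi>t \<phi>S \<phi>x \<phi>SS \<phi>Sx \<phi>xx \<longleftrightarrow>
     (\<forall>s x t.
        ((\<lambda>t'. \<phi> s x t') has_real_derivative \<phi>t s x t) (at t) \<and>
        ((\<lambda>s'. \<phi> s' x t) has_real_derivative \<phi>S s x t) (at s) \<and>
        ((\<lambda>x'. \<phi> s x' t) has_real_derivative \<phi>x s x t) (at x) \<and>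
        ((\<lambda>s'. \<phi>S s' x t) has_real_derivative \<phi>SS s x t) (at s) \<and>
        ((\<lambda>x'. \<phi>S s x' t) has_real_derivative \<phi>Sx s x t) (at x) \<and>
        ((\<lambda>x'. \<phi>x s x' t) has_real_derivative \<phi>xx s x t) (at x)) \<and>
     (\<forall>f \<in> {\<phi>, \<phi>t, \<phi>S, \<phi>x, \<phi>SS, \<phi>Sx, \<phi>xx}.
        continuous_on UNIV (\<lambda>(s, x, t). f s x t))"

definition pde_op ::
  "real \<Rightarrow> real \<Rightarrow> (real \<Rightarrow> real) \<Rightarrow> (real \<Rightarrow> real \<Rightarrow> real) \<Rightarrow>
   (real \<Rightarrow> real \<Rightarrow> real) \<Rightarrow> (real \<Rightarrow> real \<Rightarrow> real) \<Rightarrow>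
   real \<Rightarrow> real \<Rightarrow> real \<Rightarrow> real \<Rightarrow> real \<Rightarrow> real \<Rightarrow> real \<Rightarrow> real \<Rightarrow> real \<Rightarrow> real \<Rightarrow> real" where
  "pde_op r \<rho> \<beta> b c \<kappa> s x t u pt pS px pSS pSx pxx =
     pt + r * s * pS + c x t * px + \<kappa> x t * \<bar>px\<bar> + 1/2 * (\<beta> x)\<^sup>2 * s\<^sup>2 * pSS
     + \<rho> * \<beta> x * b x t * s * pSx + 1/2 * (b x t)\<^sup>2 * pxx - r * u"

definition loc_max_dom ::
  "real \<Rightarrow> (real \<Rightarrow> real \<Rightarrow> real \<Rightarrow> real) \<Rightarrow> real \<Rightarrow> real \<Rightarrow> real \<Rightarrow> bool" where
  "loc_max_dom T w s0 x0 t0 \<longleftrightarrow>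
     (\<exists>e>0. \<forall>s x t. (s, x, t) \<in> dom3 T \<and> \<bar>s - s0\<bar> < e \<and> \<bar>x - x0\<bar> < e \<and> \<bar>t - t0\<bar> < e
        \<longrightarrow> w s x t \<le> w s0 x0 t0)"

definition loc_min_dom ::
  "real \<Rightarrow> (real \<Rightarrow> real \<Rightarrow> real \<Rightarrow> real) \<Rightarrow> real \<Rightarrow> real \<Rightarrow> real \<Rightarrow> bool" where
  "loc_min_dom T w s0 x0 t0 \<longleftrightarrow> loc_max_dom T (\<lambda>s x t. - w s x t) s0 x0 t0"

text \<open>Continuous viscosity solution of  F(u) = 0  on (0,inf) x R x (0,T), u(S,sigma,T) = g(S).
  Subsolution: F(phi) >= 0 at local maxima of u - phi; supersolution: F(phi) <= 0 at
  local minima of u - phi (the equation is backward in time, -u_t - ... + r u proper).\<close>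
definition visc_sol ::
  "real \<Rightarrow> real \<Rightarrow> real \<Rightarrow> (real \<Rightarrow> real) \<Rightarrow> (real \<Rightarrow> real \<Rightarrow> real) \<Rightarrow>
   (real \<Rightarrow> real \<Rightarrow> real) \<Rightarrow> (real \<Rightarrow> real \<Rightarrow> real) \<Rightarrow> (real \<Rightarrow> real) \<Rightarrow>
   (real \<Rightarrow> real \<Rightarrow> real \<Rightarrow> real) \<Rightarrow> bool" where
  "visc_sol T r \<rho> \<beta> b c \<kappa> g u \<longleftrightarrow>
     continuous_on (dom3 T) (\<lambda>(s, x, t). u s x t) \<and>
     (\<forall>s x. s > 0 \<longrightarrow> u s x T = g s) \<and>
     (\<forall>\<phi> \<phi>t \<phi>S \<phi>x \<phi>SS \<phi>Sx \<phi>xx s0 x0 t0.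
        test_fun \<phi> \<phi>t \<phi>S \<phi>x \<phi>SS \<phi>Sx \<phi>xx \<and> s0 > 0 \<and> 0 < t0 \<and> t0 < T \<longrightarrow>
        (loc_max_dom T (\<lambda>s x t. u s x t - \<phi> s x t) s0 x0 t0 \<longrightarrow>
           pde_op r \<rho> \<beta> b c \<kappa> s0 x0 t0 (u s0 x0 t0) (\<phi>t s0 x0 t0) (\<phi>S s0 x0 t0)
             (\<phi>x s0 x0 t0) (\<phi>SS s0 x0 t0) (\<phi>Sx s0 x0 t0) (\<phi>xx s0 x0 t0) \<ge> 0) \<and>
        (loc_min_dom T (\<lambda>s x t. u s x t - \<phi> s x t) s0 x0 t0 \<longrightarrow>
           pde_op r \<rho> \<beta> b c \<kappa> s0 x0 t0 (u s0 x0 t0) (\<phi>t s0 x0 t0) (\<phi>S s0 x0 t0)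
             (\<phi>x s0 x0 t0) (\<phi>SS s0 x0 t0) (\<phi>Sx s0 x0 t0) (\<phi>xx s0 x0 t0) \<le> 0))"

definition class_C :: "real \<Rightarrow> (real \<Rightarrow> real \<Rightarrow> real \<Rightarrow> real) \<Rightarrow> bool" where
  "class_C T u \<longleftrightarrow>
     (\<forall>z \<in> dom3 T. \<exists>e>0. bounded ((\<lambda>(s, x, t). u s x t) ` (dom3 T \<inter> ball z e))) \<and>
     (\<exists>k>0. \<forall>\<epsilon>>0. \<exists>R. \<forall>s x t. s > 0 \<and> t \<in> {0..T} \<and> \<bar>ln s\<bar> + \<bar>x\<bar> \<ge> R \<longrightarrow>
        \<bar>u s x t\<bar> \<le> \<epsilon> * (1 + (\<bar>ln s\<bar> + \<bar>x\<bar>) powr k))"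

definition gamma_coef ::
  "real \<Rightarrow> real \<Rightarrow> real \<Rightarrow> real \<Rightarrow> (real \<Rightarrow> real \<Rightarrow> real) \<Rightarrow> (real \<Rightarrow> real \<Rightarrow> real) \<Rightarrow>
   (real \<Rightarrow> real) \<Rightarrow> real \<Rightarrow> real \<Rightarrow> real" where
  "gamma_coef \<mu> r \<rho> \<alpha> a b \<beta> x t =
     a x t - (\<mu> - r) * \<rho> * b x t / \<beta> x + \<alpha> * sqrt (1 - \<rho>\<^sup>2) * b x t"

definition put_payoff :: "real \<Rightarrow> real \<Rightarrow> real" where
  "put_payoff K s = max (K - s) 0"

end

theory Submission
  imports Defs
begin

text \<open>The two equations differ only in that \<open>\<kappa> \<bar>P\<^sub>\<sigma>\<bar>\<close> stands where \<open>\<kappa> G\<^sub>\<sigma>\<close> does, with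
  \<open>\<kappa> = \<alpha> * sqrt (1 - \<rho>\<^sup>2) * b\<close>; they agree on functions that are nondecreasing in \<open>\<sigma>\<close>. So it suffices to
  exhibit functions that are nearly nondecreasing in \<open>\<sigma>\<close>, nearly solve the linear equation, and are smooth
  enough to be compared with both viscosity solutions.

  After discounting and passing to \<open>y = ln S\<close>, such functions are the values \<open>V\<close> of an explicit binomial
  scheme run on mollified coefficients and a mollified payoff. One step is an average over four shifts, so it
  preserves convexity in \<open>S\<close>; since \<open>\<beta>\<close> is nondecreasing, convexity feeds a nonnegative source into
  \<open>V\<^sub>\<sigma>\<close>, and \<open>V\<^sub>\<sigma> \<ge> - O(\<epsilon>)\<close> persists. Mollification at width \<open>m\<close> costs \<open>O(m\<^sup>2)\<close> in \<open>\<beta>\<close> and \<open>b\<close>,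
  whose derivatives are Lipschitz, and \<open>O(m)\<close> in \<open>\<gamma>\<close>; as the second derivatives of \<open>V\<close> are only \<open>O(1/m)\<close>
  and the first ones are \<open>O(1)\<close>, the total consistency error tends to zero when first \<open>\<epsilon>\<close> and then \<open>m\<close> does.

  For the comparison of a viscosity solution \<open>u\<close> with \<open>V\<close>, interpolated linearly in time, put
  \<open>h t = max (u - V - penalty)\<close>. The equation bounds from below the slopes of the \<open>C\<^sup>1\<close> functions
  touching \<open>h\<close> from above: by a small negative number at the times when the frozen coefficients of the step
  are close to the true ones, and by a constant at all other times. The coefficients depend on time in an
  arbitrary way, but up to any accuracy they take finitely many values as functions of \<open>\<sigma>\<close>, and for a
  finite colouring of an interval one can choose for each short step a colour such that the times of another colour
  matter little; this only uses outer measure and density points.\<close>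

section \<open>Growth of functions with bounded superjets\<close>

text \<open>The obstacle is time. As \<open>a\<close> and \<open>b\<close> are arbitrary functions
  of \<open>t\<close>, the viscosity inequality at one time says nothing about nearby times, and the
  coefficients can be neither mollified in \<open>t\<close> nor compared at slightly different
  times. What remains usable is a fact about one variable: if all superjet slopes of a continuous
  function of time are bounded below, its growth is governed by the slopes at almost all times.

  The scheme is chosen because it gives explicit functions whose derivatives can be bounded by hand.
  The bounds form a hierarchy. That of the first derivatives is free of the smoothing width; that of
  the second is linear in \<open>L2\<close>; that of the third may be arbitrarily bad, since it only
  occurs together with the step size \<open>\<epsilon>\<close>, which is chosen last.

  The two solutions are never compared with each other. \<open>P\<close>, \<open>-P\<close>,
  \<open>G\<close> and \<open>-G\<close> are four subsolutions, and one number \<open>v\<close>,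
  found before any of them is given, bounds each from above as \<open>v\<close> or \<open>-v\<close>
  up to a small error.\<close>

lemma le_of_forward_steps:
  fixes F :: "real \<Rightarrow> real"
  assumes "a \<le> b" and cont: "continuous_on {a..b} F"
    and step: "\<And>t. t \<in> {a..<b} \<Longrightarrow> \<exists>t'\<in>{t<..b}. F t \<le> F t'"
  shows "F a \<le> F b"
proof -
  \<comment> \<open>Continuity induction: the times at which \<open>F\<close> is at least
    \<open>F a\<close> form a compact set, and its last point can only be \<open>b\<close>, because
    \<open>step\<close> would lead further.\<close>
  define S where "S = {a..b} \<inter> F -` {F a..}"
  have "closed S" unfolding S_def
    by (rule continuous_closed_preimage[OF cont]) auto
  moreover have "bounded S" unfolding S_def by (rule bounded_subset[of "{a..b}"]) auto
  ultimately have "compact S" using compact_eq_bounded_closed by blast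
  moreover have "S \<noteq> {}" using \<open>a \<le> b\<close> by (auto simp: S_def)
  ultimately obtain t where t: "t \<in> S" "\<And>s. s \<in> S \<Longrightarrow> s \<le> t"
    using compact_attains_sup[of S] by blast
  show ?thesis
  proof (cases "t = b")
    case True then show ?thesis using t by (auto simp: S_def)
  next
    case False
    then have "t \<in> {a..<b}" using t by (auto simp: S_def)
    from step[OF this] obtain t' where t': "t' \<in> {t<..b}" "F t \<le> F t'" by blast
    then have "t' \<in> S" using t(1) by (auto simp: S_def)
    then show ?thesis using t(2)[of t'] t' by auto
  qed
qed

text \<open>Mirror image under \<open>t \<mapsto> -t\<close>, for estimates that come with
  increments to the left of a point.\<close>

lemma le_of_backward_steps:
  fixes F :: "real \<Rightarrow> real"
  assumes "a \<le> b" and cont: "continuous_on {a..b} F"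
    and step: "\<And>t. t \<in> {a<..b} \<Longrightarrow> \<exists>s\<in>{a..<t}. F s \<le> F t"
  shows "F a \<le> F b"
proof -
  have "- F (- (-b)) \<le> - F (- (-a))"
  proof (rule le_of_forward_steps[of "-b" "-a" "\<lambda>t. - F (- t)"])
    show "continuous_on {-b..-a} (\<lambda>t. - F (- t))"
      by (intro continuous_intros continuous_on_compose2[OF cont]) auto
    fix t assume "t \<in> {-b..<-a}"
    then have "-t \<in> {a<..b}" by auto
    from step[OF this] obtain s where "s \<in> {a..<-t}" "F s \<le> F (-t)" by blast
    then show "\<exists>t'\<in>{t<..- a}. - F (- t) \<le> - F (- t')"
      by (intro bexI[of _ "-s"]) auto
  qed (use \<open>a \<le> b\<close> in auto)
  then show ?thesis by simp
qed

lemma measure_Int_interval_diff: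
  fixes K :: "real set"
  assumes K: "K \<in> sets lebesgue" and "a \<le> s" "s \<le> t"
  shows "measure lebesgue (K \<inter> {a..t}) - measure lebesgue (K \<inter> {a..s}) = measure lebesgue (K \<inter> {s<..t})"
    and "measure lebesgue (K \<inter> {s<..t}) \<le> t - s" "0 \<le> measure lebesgue (K \<inter> {s<..t})"
proof -
  have fin: "K \<inter> {u..v} \<in> lmeasurable" "K \<inter> {u<..v} \<in> lmeasurable" for u v
    using K by (auto intro!: bounded_set_imp_lmeasurable bounded_subset[of "{u..v}" "K \<inter> {u<..v}"]
       bounded_subset[of "{u..v}" "K \<inter> {u..v}"])
  have "K \<inter> {a..t} = (K \<inter> {a..s}) \<union> (K \<inter> {s<..t})" using assms by auto
  then have "measure lebesgue (K \<inter> {a..t}) = measure lebesgue (K \<inter> {a..s}) + measure lebesgue (K \<inter> {s<..t})"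
    using fin by (auto intro!: measure_Un_AE simp: fmeasurableD)
  then show "measure lebesgue (K \<inter> {a..t}) - measure lebesgue (K \<inter> {a..s}) = measure lebesgue (K \<inter> {s<..t})"
    by simp
  have "measure lebesgue (K \<inter> {s<..t}) \<le> measure lebesgue {s..t}"
    using K by (intro measure_mono_fmeasurable) auto
  then show "measure lebesgue (K \<inter> {s<..t}) \<le> t - s" using assms by simp
qed simp

lemma continuous_measure_Int_interval:
  fixes K :: "real set"
  assumes K: "K \<in> sets lebesgue"
  shows "continuous_on {a..b} (\<lambda>t. measure lebesgue (K \<inter> {a..t}))"
proof -
  have "\<bar>measure lebesgue (K \<inter> {a..t}) - measure lebesgue (K \<inter> {a..s})\<bar> \<le> \<bar>t - s\<bar>"
    if "s \<in> {a..b}" "t \<in> {a..b}" for s t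
    using measure_Int_interval_diff[OF K, of a s t] measure_Int_interval_diff[OF K, of a t s] that
    by (smt (verit) atLeastAtMost_iff)
  then have "1-lipschitz_on {a..b} (\<lambda>t. measure lebesgue (K \<inter> {a..t}))"
    by (auto simp: lipschitz_on_def dist_real_def)
  then show ?thesis using lipschitz_on_continuous_on by blast
qed

text \<open>Continuity induction on \<open>f t\<close> minus \<open>c\<close> times the measure of
  \<open>K\<close> up to \<open>t\<close>. At a point of \<open>K\<close> the slope pays for the
  whole step, however much of \<open>K\<close> it contains; off the closed set \<open>K\<close> a
  short step meets no point of \<open>K\<close>, and monotonicity is enough.\<close>

lemma slope_times_measure_le:
  fixes f :: "real \<Rightarrow> real"
  assumes "a \<le> b" and cont: "continuous_on {a..b} f" and mono: "mono_on {a..b} f" and "0 \<le> c"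
    and K: "compact K" and slope: "\<And>t. t \<in> K \<Longrightarrow> t \<in> {a..<b} \<Longrightarrow> \<exists>t'\<in>{t<..b}. c * (t' - t) \<le> f t' - f t"
  shows "c * measure lebesgue (K \<inter> {a..b}) \<le> f b - f a"
proof -
  define F where "F t = f t - c * measure lebesgue (K \<inter> {a..t})" for t
  have KL: "K \<in> sets lebesgue" using K by (simp add: fmeasurableD lmeasurable_compact)
  have "F a \<le> F b"
  proof (rule le_of_forward_steps[where F = F])
    show "continuous_on {a..b} F" unfolding F_def
      by (intro continuous_intros cont continuous_measure_Int_interval KL)
    show "\<exists>t'\<in>{t<..b}. F t \<le> F t'" if t: "t \<in> {a..<b}" for t
    proof (cases "t \<in> K")
      case True
      from slope[OF True t] obtain t' where t': "t'\<in>{t<..b}" "c * (t' - t) \<le> f t' - f t" by blast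
      have "c * (measure lebesgue (K \<inter> {a..t'}) - measure lebesgue (K \<inter> {a..t})) \<le> c * (t' - t)"
        using measure_Int_interval_diff[OF KL, of a t t'] t t' \<open>0 \<le> c\<close> by (intro mult_left_mono) auto
      then show ?thesis using t' by (intro bexI[of _ t']) (auto simp: F_def algebra_simps)
    next
      case False
      then obtain d where d: "d > 0" "ball t d \<inter> K = {}"
        using compact_imp_closed[OF K]
        by (metis ComplD ComplI disjoint_eq_subset_Compl open_Compl open_contains_ball)
      define t' where "t' = min b (t + d/2)"
      have t': "t' \<in> {t<..b}" "t' - t < d" using d t by (auto simp: t'_def)
      have "K \<inter> {t<..t'} = {}"
        using d t' by (auto simp: dist_real_def disjoint_iff)
      then have "measure lebesgue (K \<inter> {a..t'}) = measure lebesgue (K \<inter> {a..t})"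
        using measure_Int_interval_diff(1)[OF KL, of a t t'] t t' by auto
      moreover have "f t \<le> f t'" using mono t t' by (auto simp: mono_on_def)
      ultimately show ?thesis using t' by (intro bexI[of _ t']) (auto simp: F_def)
    qed
  qed fact
  moreover have "negligible (K \<inter> {a..a})" by (rule negligible_subset[of "{a}"]) auto
  then have "measure lebesgue (K \<inter> {a..a}) = 0" by (rule negligible_imp_measure0)
  ultimately show ?thesis by (simp add: F_def)
qed

text \<open>The exceptional sets in Lebesgue's theorem on monotone functions, for the lower left and
  the upper right Dini derivate. This pair is what decides about superjets: a line that touches from
  above to first order must have a slope at least the upper right derivate and at most the lower
  left one.\<close>

definition derivate_gap :: "(real \<Rightarrow> real) \<Rightarrow> real \<Rightarrow> real \<Rightarrow> real \<Rightarrow> real \<Rightarrow> real set" where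
  "derivate_gap f a b r R = {t \<in> {a<..<b}.
     (\<forall>e>0. \<exists>s\<in>{a..<t}. t - s < e \<and> f t - f s < r * (t - s)) \<and>
     (\<forall>e>0. \<exists>t'\<in>{t<..b}. t' - t < e \<and> R * (t' - t) < f t' - f t)}"

text \<open>Once the far endpoint is fixed, each condition is open in \<open>t\<close>. Hence
  \<open>derivate_gap\<close> is a countable intersection of open sets, and in particular
  measurable.\<close>

lemma open_slope_sets:
  fixes f :: "real \<Rightarrow> real"
  assumes cont: "continuous_on {a..b} f"
  shows "open {t\<in>{a<..<b}. \<exists>s\<in>{a..<t}. t - s < e \<and> f t - f s < r * (t - s)}" (is "open ?A")
    and "open {t\<in>{a<..<b}. \<exists>t'\<in>{t<..b}. t' - t < e \<and> R * (t' - t) < f t' - f t}" (is "open ?B")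
proof -
  have cont': "continuous_on T f" if "T \<subseteq> {a..b}" for T using cont that continuous_on_subset by blast
  have A: "open ({max a s<..<min b (s+e)} \<inter> (\<lambda>t. f t - r * t) -` {..< f s - r * s})" if "s \<ge> a" for s
    by (rule continuous_open_preimage) (use that in \<open>auto intro!: continuous_intros cont'\<close>)
  have eqA: "?A = (\<Union>s\<in>{a..}. ({max a s<..<min b (s+e)} \<inter> (\<lambda>t. f t - r * t) -` {..< f s - r * s}))"
    by (auto simp: algebra_simps Bex_def)
  show "open ?A" unfolding eqA by (intro open_UN ballI A) auto
  have B: "open ({max a (s-e)<..<min b s} \<inter> (\<lambda>t. f t - R * t) -` {..< f s - R * s})" if "s \<le> b" for s
    by (rule continuous_open_preimage) (use that in \<open>auto intro!: continuous_intros cont'\<close>)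
  have eqB: "?B = (\<Union>s\<in>{..b}. ({max a (s-e)<..<min b s} \<inter> (\<lambda>t. f t - R * t) -` {..< f s - R * s}))"
    by (auto simp: algebra_simps Bex_def)
  show "open ?B" unfolding eqB by (intro open_UN ballI B) auto
qed

text \<open>Otherwise the set contains a compact \<open>K\<close> of positive measure, inside an
  open \<open>Q\<close> of hardly larger measure. Every point of \<open>K\<close> ends a short
  interval in \<open>Q\<close> across which \<open>f\<close> gains at most \<open>r\<close> times
  the length, but by \<open>slope_times_measure_le\<close> at least \<open>R\<close> times the
  measure of \<open>K\<close> in it. Backward continuity induction over such intervals, in the role
  of a covering theorem, gives \<open>R * \<bar>K\<bar> \<le> r * \<bar>Q\<bar>\<close>, which
  contradicts \<open>r < R\<close>.\<close>

lemma negligible_derivate_gap: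
  fixes f :: "real \<Rightarrow> real"
  assumes "a < b" and cont: "continuous_on {a..b} f" and mono: "mono_on {a..b} f"
    and rR: "0 \<le> r" "r < R"
  shows "negligible (derivate_gap f a b r R)"
proof -
  let ?E = "derivate_gap f a b r R"
  have E_eq: "?E = (\<Inter>n::nat. {t\<in>{a<..<b}. \<exists>s\<in>{a..<t}. t - s < 1/real (Suc n) \<and> f t - f s < r * (t - s)}
       \<inter> {t\<in>{a<..<b}. \<exists>t'\<in>{t<..b}. t' - t < 1/real (Suc n) \<and> R * (t' - t) < f t' - f t})" (is "_ = ?I")
  proof (rule equalityI)
    show "?E \<subseteq> ?I" unfolding derivate_gap_def by fastforce
    show "?I \<subseteq> ?E"
    proof
      fix t assume t: "t \<in> ?I"
      then have t1: "t \<in> {a<..<b}" by auto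
      have "\<exists>s\<in>{a..<t}. t - s < e \<and> f t - f s < r * (t - s)" "\<exists>t'\<in>{t<..b}. t' - t < e \<and> R * (t' - t) < f t' - f t"
        if "e > 0" for e
      proof -
        obtain n where "1 / real (Suc n) < e" using nat_approx_posE[OF \<open>e > 0\<close>] by auto
        moreover from t have "\<exists>s\<in>{a..<t}. t - s < 1/real (Suc n) \<and> f t - f s < r * (t - s)"
          "\<exists>t'\<in>{t<..b}. t' - t < 1/real (Suc n) \<and> R * (t' - t) < f t' - f t" by blast+
        ultimately show "\<exists>s\<in>{a..<t}. t - s < e \<and> f t - f s < r * (t - s)" "\<exists>t'\<in>{t<..b}. t' - t < e \<and> R * (t' - t) < f t' - f t"
          by (meson less_trans)+
      qed
      then show "t \<in> ?E" using t1 by (simp add: derivate_gap_def)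
    qed
  qed
  have E_borel: "?E \<in> sets borel" unfolding E_eq
    by (intro sets.countable_INT'' sets.Int borel_open open_slope_sets[OF cont]) auto
  have E_leb: "?E \<in> sets lebesgue" using E_borel by simp
  have E_lm: "?E \<in> lmeasurable"
    by (rule bounded_set_imp_lmeasurable[OF _ E_leb], rule bounded_subset[of "{a..b}"]) (auto simp: derivate_gap_def)
  show ?thesis
  proof (rule ccontr)
    assume "\<not> negligible ?E"
    then have pos: "measure lebesgue ?E > 0"
      using negligible_iff_measure E_lm by (metis measure_nonneg order_le_less)
    obtain K where K: "closed K" "K \<subseteq> ?E" "?E - K \<in> lmeasurable" "emeasure lebesgue (?E - K) < ennreal (measure lebesgue ?E)"
      using sets_lebesgue_inner_closed[OF E_leb pos] by metis
    have Kb: "K \<subseteq> {a<..<b}" using K by (auto simp: derivate_gap_def)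
    have cK: "compact K" using K Kb by (meson bounded_closed_interval bounded_subset compact_eq_bounded_closed greaterThanLessThan_subseteq_atLeastAtMost_iff order_refl)
    have K_lm: "K \<in> lmeasurable" using cK lmeasurable_compact by blast
    have "measure lebesgue (?E - K) < measure lebesgue ?E"
      using K(3,4) pos by (simp add: emeasure_eq_measure2 ennreal_less_iff)
    moreover have "measure lebesgue (?E - K) = measure lebesgue ?E - measure lebesgue K"
      using E_lm K_lm K(2) by (intro measurable_measure_Diff) (auto simp: fmeasurableD)
    ultimately have Kpos: "measure lebesgue K > 0" by simp
    have main: "R * measure lebesgue K \<le> r * (measure lebesgue K + e)" if "e > 0" for e
    proof -
      obtain Q where Q: "open Q" "K \<subseteq> Q" "Q - K \<in> lmeasurable" "emeasure lebesgue (Q - K) < ennreal e"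
        using sets_lebesgue_outer_open[of K e] K_lm \<open>e > 0\<close> by (metis fmeasurableD)
      have QL: "Q \<in> sets lebesgue" using Q(1) by auto
      have KL: "K \<in> sets lebesgue" using K_lm by auto
      define G where "G t = r * measure lebesgue (Q \<inter> {a..t}) - R * measure lebesgue (K \<inter> {a..t})" for t
      have "G a \<le> G b"
      proof (rule le_of_backward_steps[where F = G])
        show "continuous_on {a..b} G" unfolding G_def
          by (intro continuous_intros continuous_measure_Int_interval QL KL)
        show "\<exists>s\<in>{a..<t}. G s \<le> G t" if t: "t \<in> {a<..b}" for t
        proof (cases "t \<in> K")
          case True
          then obtain d where d: "d > 0" "ball t d \<subseteq> Q" using Q by (meson open_contains_ball subsetD)
          from True K(2) have "t \<in> ?E" by blast
          then obtain s where s: "s\<in>{a..<t}" "t - s < d" "f t - f s < r * (t - s)"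
            using d by (auto simp: derivate_gap_def)
          have "t \<le> b" using t by simp
          have "R * measure lebesgue (K \<inter> {s..t}) \<le> f t - f s"
          proof (rule slope_times_measure_le)
            show "continuous_on {s..t} f" using cont s \<open>t \<le> b\<close> by (auto intro: continuous_on_subset)
            show "mono_on {s..t} f" using mono s \<open>t \<le> b\<close> by (auto simp: mono_on_def)
            fix u assume u: "u \<in> K" "u \<in> {s..<t}"
            then have "u \<in> ?E" "t - u > 0" using K(2) by auto
            then have "\<exists>t'\<in>{u<..b}. t' - u < t - u \<and> R * (t' - u) < f t' - f u"
              unfolding derivate_gap_def by blast
            then obtain t' where "t'\<in>{u<..b}" "t' - u < t - u" "R * (t' - u) < f t' - f u"
              by blast
            then show "\<exists>t'\<in>{u<..t}. R * (t' - u) \<le> f t' - f u" by (intro bexI[of _ t']) auto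
          qed (use s rR cK in auto)
          moreover have "measure lebesgue (K \<inter> {s<..t}) \<le> measure lebesgue (K \<inter> {s..t})"
            by (intro measure_mono_fmeasurable) (use KL in \<open>auto intro!: bounded_set_imp_lmeasurable bounded_subset[of "{s..t}" "K \<inter> {s..t}"]\<close>)
          ultimately have 1: "R * measure lebesgue (K \<inter> {s<..t}) \<le> f t - f s"
            using rR by (smt (verit) mult_left_mono)
          have "Q \<inter> {s<..t} = {s<..t}" using d s by (auto simp: dist_real_def subset_iff)
          then have "measure lebesgue (Q \<inter> {s<..t}) = t - s" using s by simp
          then have "r * (t - s) = r * measure lebesgue (Q \<inter> {a..t}) - r * measure lebesgue (Q \<inter> {a..s})"
            using measure_Int_interval_diff(1)[OF QL, of a s t] s by (simp add: right_diff_distrib [symmetric])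
          moreover have "R * measure lebesgue (K \<inter> {s<..t}) = R * measure lebesgue (K \<inter> {a..t}) - R * measure lebesgue (K \<inter> {a..s})"
            using measure_Int_interval_diff(1)[OF KL, of a s t] s by (simp add: right_diff_distrib [symmetric])
          ultimately show ?thesis using 1 s by (intro bexI[of _ s]) (auto simp: G_def)
        next
          case False
          then obtain d where d: "d > 0" "ball t d \<inter> K = {}"
            using K(1) by (metis ComplD ComplI disjoint_eq_subset_Compl open_Compl open_contains_ball)
          define s where "s = max a (t - d/2)"
          have s: "s \<in> {a..<t}" "t - s < d" using d t by (auto simp: s_def)
          have "K \<inter> {s<..t} = {}" using d s by (auto simp: dist_real_def disjoint_iff)
          then have "measure lebesgue (K \<inter> {a..t}) = measure lebesgue (K \<inter> {a..s})"
            using measure_Int_interval_diff(1)[OF KL, of a s t] s by auto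
          moreover have "r * measure lebesgue (Q \<inter> {a..s}) \<le> r * measure lebesgue (Q \<inter> {a..t})"
            using measure_Int_interval_diff(1)[OF QL, of a s t] measure_nonneg[of lebesgue "Q \<inter> {s<..t}"] s rR
            by (intro mult_left_mono) (auto simp del: measure_nonneg)
          ultimately show ?thesis using s by (intro bexI[of _ s]) (auto simp: G_def)
        qed
      qed (use \<open>a < b\<close> in auto)
      moreover have "measure lebesgue (K \<inter> {a..a}) = 0" "measure lebesgue (Q \<inter> {a..a}) = 0"
        by (rule negligible_imp_measure0, rule negligible_subset[of "{a}"], auto)+
      moreover have "K \<inter> {a..b} = K" using Kb by auto
      ultimately have "R * measure lebesgue K \<le> r * measure lebesgue (Q \<inter> {a..b})" by (simp add: G_def)
      also have "measure lebesgue (Q \<inter> {a..b}) \<le> measure lebesgue (K \<union> (Q - K))"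
          by (rule measure_mono_fmeasurable[OF _ _ fmeasurable.Un[OF K_lm Q(3)]]) (use QL in auto)
      also have "measure lebesgue (K \<union> (Q - K)) \<le> measure lebesgue K + measure lebesgue (Q - K)"
        using K_lm Q(3) by (intro measure_Un_le) auto
      also have "measure lebesgue (Q - K) \<le> e"
        using Q(3,4) \<open>e > 0\<close> by (simp add: emeasure_eq_measure2 ennreal_less_iff)
      finally show ?thesis using rR by (simp add: mult_left_mono)
    qed
    have "R * measure lebesgue K \<le> r * measure lebesgue K + e" if "e > 0" for e
    proof -
      have "r * (e / (r + 1)) \<le> e" using rR that by (simp add: field_simps)
      then show ?thesis using main[of "e / (r + 1)"] rR that by (simp add: algebra_simps)
    qed
    then have "R * measure lebesgue K \<le> r * measure lebesgue K" by (rule field_le_epsilon)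
    then show False using Kpos rR by simp
  qed
qed

text \<open>The majorant is a weighted sum of the \<open>C\<^sup>1\<close> functions \<open>sqrt (s\<^sup>2 + a\<^sup>2) - a\<close>, which vanish to first
  order at \<open>0\<close> but dominate \<open>\<bar>s\<bar>/2\<close> as soon as \<open>\<bar>s\<bar> \<ge> 4a/3\<close>.\<close>

lemma C1_majorant:
  fixes g :: "real \<Rightarrow> real"
  assumes small: "\<And>e. e > 0 \<Longrightarrow> \<exists>d>0. \<forall>s. \<bar>s\<bar> < d \<longrightarrow> g s \<le> e * \<bar>s\<bar>"
  obtains \<theta> \<theta>' d where "\<And>s. (\<theta> has_real_derivative \<theta>' s) (at s)" "continuous_on UNIV \<theta>'"
    "\<theta> 0 = 0" "\<theta>' 0 = 0" "d > 0" "\<And>s. \<bar>s\<bar> < d \<Longrightarrow> g s \<le> \<theta> s"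
proof -
  have "\<exists>d>0. d \<le> (1/2)^k \<and> (\<forall>s. \<bar>s\<bar> < d \<longrightarrow> g s \<le> (1/2)^k * \<bar>s\<bar>)" for k :: nat
  proof -
    obtain d where "d > 0" "\<forall>s. \<bar>s\<bar> < d \<longrightarrow> g s \<le> (1/2)^k * \<bar>s\<bar>" using small[of "(1/2)^k"] by auto
    then show ?thesis by (intro exI[of _ "min d ((1/2)^k)"]) auto
  qed
  then obtain d where d: "\<And>k. d k > 0" "\<And>k. d k \<le> (1/2)^k" "\<And>k s. \<bar>s\<bar> < d k \<Longrightarrow> g s \<le> (1/2)^k * \<bar>s\<bar>"
    by metis
  \<comment> \<open>Chosen so that the term of index \<open>k\<close> becomes large enough exactly
    from \<open>\<bar>s\<bar> = 4/3 * a k = d (Suc k)\<close> on.\<close>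
  define a where "a k = 3/4 * d (Suc k)" for k
  have a: "a k > 0" for k using d by (simp add: a_def)
  define \<psi> where "\<psi> k s = (1/2)^k * (2 * (sqrt (s\<^sup>2 + (a k)\<^sup>2) - a k))" for k s
  define \<psi>' where "\<psi>' k s = (1/2)^k * (2 * (s / sqrt (s\<^sup>2 + (a k)\<^sup>2)))" for k s
  have pos: "s\<^sup>2 + (a k)\<^sup>2 > 0" for s k using a[of k] by (simp add: add_nonneg_pos)
  have d\<psi>: "(\<psi> k has_real_derivative \<psi>' k s) (at s)" for k s
    unfolding \<psi>_def \<psi>'_def using pos[of s k]
    by (auto intro!: derivative_eq_intros simp: field_simps)
  have b\<psi>': "norm (\<psi>' k s) \<le> 2 * (1/2)^k" for k s
  proof -
    have "\<bar>s\<bar> \<le> sqrt (s\<^sup>2 + (a k)\<^sup>2)" by (rule real_le_rsqrt) simp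
    then have "\<bar>s / sqrt (s\<^sup>2 + (a k)\<^sup>2)\<bar> \<le> 1" using pos[of s k] by (simp add: field_simps)
    then have "(1/2)^k * (2 * \<bar>s / sqrt (s\<^sup>2 + (a k)\<^sup>2)\<bar>) \<le> (1/2)^k * (2 * 1)" by (intro mult_left_mono) auto
    then show ?thesis by (simp add: \<psi>'_def abs_mult)
  qed
  have summ: "summable (\<lambda>k. 2 * (1/2::real)^k)" by (intro summable_mult summable_geometric) auto
  have unif: "uniformly_convergent_on UNIV (\<lambda>n x. \<Sum>i<n. \<psi>' i x)"
    by (rule Weierstrass_m_test') (use b\<psi>' summ in auto)
  have summ0: "summable (\<lambda>k. \<psi> k 0)" using a by (simp add: \<psi>_def less_imp_le)
  have summ\<psi>: "summable (\<lambda>k. \<psi> k s)"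
    and der: "((\<lambda>x. \<Sum>n. \<psi> n x) has_real_derivative (\<Sum>n. \<psi>' n s)) (at s)" for s
    using has_field_derivative_series'[where f = \<psi> and f' = \<psi>' and S = UNIV and ?x0.0 = 0 and x = s, OF convex_UNIV d\<psi> unif UNIV_I summ0]
    by simp_all
  have cont: "continuous_on UNIV (\<lambda>s. \<Sum>n. \<psi>' n s)"
  proof (rule uniform_limit_theorem)
    show "uniform_limit UNIV (\<lambda>n x. \<Sum>i<n. \<psi>' i x) (\<lambda>s. \<Sum>n. \<psi>' n s) sequentially"
      by (rule Weierstrass_m_test) (use b\<psi>' summ in auto)
    show "\<forall>\<^sub>F n in sequentially. continuous_on UNIV (\<lambda>x. \<Sum>i<n. \<psi>' i x)"
      unfolding \<psi>'_def by (intro always_eventually allI continuous_intros) (use pos in \<open>force simp: less_le\<close>)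
  qed simp
  have nn: "\<psi> k s \<ge> 0" for k s
  proof -
    have "a k \<le> sqrt (s\<^sup>2 + (a k)\<^sup>2)" using a[of k] by (intro real_le_rsqrt) auto
    then show ?thesis by (simp add: \<psi>_def)
  qed
  have maj: "g s \<le> (\<Sum>n. \<psi> n s)" if s: "\<bar>s\<bar> < d 0" for s
  proof (cases "s = 0")
    case True
    then show ?thesis using d(3)[of 0 0] d(1)[of 0] suminf_nonneg[OF summ\<psi>, of s] nn by auto
  next
    case False
    obtain n where n: "(1/2)^n < \<bar>s\<bar>" using real_arch_pow_inv[of "\<bar>s\<bar>" "1/2"] False by auto
    then have "\<not> \<bar>s\<bar> < d n" using d(2)[of n] by simp
    \<comment> \<open>The first scale that \<open>s\<close> has left. With \<open>m = Suc k\<close>,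
      the point \<open>s\<close> is still within \<open>d k\<close>, where \<open>g\<close> is
      small, and already beyond \<open>d (Suc k)\<close>, where the single term of index
      \<open>k\<close> dominates.\<close>
    define m where "m = (LEAST n. \<not> \<bar>s\<bar> < d n)"
    have m: "\<not> \<bar>s\<bar> < d m" unfolding m_def by (rule LeastI) fact
    then have "m \<noteq> 0" using s by metis
    then obtain k where k: "m = Suc k" using not0_implies_Suc by blast
    have "\<bar>s\<bar> < d k" using not_less_Least[of k "\<lambda>n. \<not> \<bar>s\<bar> < d n"] k unfolding m_def by auto
    then have "g s \<le> (1/2)^k * \<bar>s\<bar>" by (rule d(3))
    also have "\<dots> \<le> \<psi> k s"
    proof -
      have le: "a k \<le> 3/4 * \<bar>s\<bar>" using m k by (simp add: a_def)
      have "(\<bar>s\<bar>/2 + a k)\<^sup>2 = s\<^sup>2/4 + \<bar>s\<bar> * a k + (a k)\<^sup>2" by (simp add: power2_sum power_divide)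
      also have "\<bar>s\<bar> * a k \<le> \<bar>s\<bar> * (3/4 * \<bar>s\<bar>)" using le by (intro mult_left_mono) auto
      also have "s\<^sup>2/4 + \<bar>s\<bar> * (3/4 * \<bar>s\<bar>) + (a k)\<^sup>2 = s\<^sup>2 + (a k)\<^sup>2" by (simp add: power2_eq_square)
      finally have "\<bar>s\<bar>/2 + a k \<le> sqrt (s\<^sup>2 + (a k)\<^sup>2)" by (intro real_le_rsqrt) auto
      then show ?thesis unfolding \<psi>_def by (intro mult_left_mono) auto
    qed
    also have "\<dots> = sum (\<lambda>n. \<psi> n s) {k}" by simp
    also have "\<dots> \<le> (\<Sum>n. \<psi> n s)" by (rule sum_le_suminf[OF summ\<psi>]) (use nn in auto)
    finally show ?thesis .
  qed
  show ?thesis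
  proof (rule that[of "\<lambda>s. \<Sum>n. \<psi> n s" "\<lambda>s. \<Sum>n. \<psi>' n s" "d 0"])
    have "\<psi> n 0 = 0" for n using a[of n] by (simp add: \<psi>_def less_imp_le)
    then show "(\<Sum>n. \<psi> n 0) = 0" by simp
    show "(\<Sum>n. \<psi>' n 0) = 0" by (simp add: \<psi>'_def)
  qed (use der cont maj d in auto)
qed

definition C1_fun :: "(real \<Rightarrow> real) \<Rightarrow> (real \<Rightarrow> real) \<Rightarrow> bool" where
  "C1_fun \<theta> \<theta>' \<longleftrightarrow> (\<forall>t. (\<theta> has_real_derivative \<theta>' t) (at t)) \<and> continuous_on UNIV \<theta>'"

text \<open>A decrease from \<open>t1\<close> to \<open>t2\<close> would persist after adding a
  small slope \<open>\<kappa>\<close>. Adding also an increasing function \<open>\<psi>\<close>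
  moves the maximum into the interior, and there \<open>h\<close> is touched from above by a
  function whose slope is at most \<open>- C - \<kappa>\<close>.\<close>

lemma mono_of_superjets_ge:
  fixes h :: "real \<Rightarrow> real"
  assumes cont: "continuous_on {a..b} h"
    and sub: "\<And>t0 \<theta> \<theta>' d. t0 \<in> {a<..<b} \<Longrightarrow> C1_fun \<theta> \<theta>' \<Longrightarrow> d > 0 \<Longrightarrow>
        (\<And>t. t \<in> {a<..<b} \<Longrightarrow> \<bar>t - t0\<bar> < d \<Longrightarrow> h t - \<theta> t \<le> h t0 - \<theta> t0) \<Longrightarrow> - C \<le> \<theta>' t0"
  shows "mono_on {a..b} (\<lambda>t. h t + C * t)"
proof (rule mono_onI, rule ccontr)
  fix t1 t2 assume t: "t1 \<in> {a..b}" "t2 \<in> {a..b}" "t1 \<le> t2" and neg: "\<not> h t1 + C * t1 \<le> h t2 + C * t2"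
  then have lt: "t1 < t2" by (cases "t1 = t2") auto
  define \<kappa> where "\<kappa> = ((h t1 + C * t1) - (h t2 + C * t2)) / (2 * (t2 - t1))"
  have \<kappa>: "\<kappa> > 0" using neg lt by (simp add: \<kappa>_def)
  define g where "g t = h t + (C + \<kappa>) * t" for t
  have "g t1 - g t2 = ((h t1 + C * t1) - (h t2 + C * t2)) - \<kappa> * (t2 - t1)" by (simp add: g_def algebra_simps)
  also have "\<kappa> * (t2 - t1) = ((h t1 + C * t1) - (h t2 + C * t2)) / 2"
  proof -
    have "X / (2 * w) * w = X / 2" if "w \<noteq> 0" for X w :: real using that by simp
    from this[of "t2 - t1"] show ?thesis unfolding \<kappa>_def using lt by force
  qed
  finally have g12: "g t1 > g t2" using neg by (simp add: field_simps)
  have contg: "continuous_on {t1..t2} g"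
    unfolding g_def using cont t by (auto intro!: continuous_intros intro: continuous_on_subset)
  obtain t3 where t3: "t1 < t3" "t3 < t2" "g t3 > g t2"
  proof -
    obtain d where d: "d > 0" "\<And>s. s \<in> {t1..t2} \<Longrightarrow> dist s t1 < d \<Longrightarrow> dist (g s) (g t1) < g t1 - g t2"
      using contg g12 lt unfolding continuous_on_iff by (metis atLeastAtMost_iff diff_gt_0_iff_gt less_imp_le order_refl)
    define s where "s = t1 + min (d/2) ((t2 - t1)/2)"
    have "0 < min (d/2) ((t2 - t1)/2)" using d(1) lt by (simp add: min_def)
    moreover have "min (d/2) ((t2 - t1)/2) \<le> d/2" "min (d/2) ((t2 - t1)/2) \<le> (t2 - t1)/2"
      by (rule min.cobounded1, rule min.cobounded2)
    ultimately have "t1 < s" "s \<le> t1 + d/2" "s \<le> t1 + (t2 - t1)/2" unfolding s_def by linarith+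
    moreover have "(t2 - t1)/2 < t2 - t1" "d/2 < d" using d(1) lt by auto
    ultimately have "t1 < s" "s < t2" "s - t1 < d" by linarith+
    then have "t1 < s" "s < t2" "dist s t1 < d" by (auto simp: dist_real_def)
    then show ?thesis using d(2)[of s] that[of s] by (auto simp: dist_real_def)
  qed
  \<comment> \<open>\<open>\<psi>\<close> equals \<open>- A\<close> at \<open>t1\<close>, which
    pushes the value there below \<open>g t2\<close>, while \<open>N\<close> will be so large that
    hardly anything is lost at \<open>t3\<close>. Thus \<open>t3\<close> beats both
    endpoints.\<close>
  define A where "A = g t1 - g t2 + 1"
  have A: "A > 0" using g12 by (simp add: A_def)
  obtain N where N: "N > 0" "A * exp (- N * (t3 - t1)) < g t3 - g t2"
  proof -
    define x where "x = (g t3 - g t2) / (A + (g t3 - g t2))"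
    have x: "0 < x" "x < 1" using t3 A by (auto simp: x_def)
    define N where "N = - ln x / (t3 - t1)"
    have "N > 0" using x t3 by (simp add: N_def divide_neg_pos)
    moreover have "exp (- N * (t3 - t1)) = x" using x t3 by (simp add: N_def)
    moreover have "A * x < g t3 - g t2"
    proof -
      have "A * (G / (A + G)) < G" if "G > 0" for G using A that by (simp add: field_simps)
      then show ?thesis using t3 unfolding x_def by simp
    qed
    ultimately show ?thesis using that by metis
  qed
  define \<psi> where "\<psi> t = - A * exp (- N * (t - t1))" for t
  have contG: "continuous_on {t1..t2} (\<lambda>t. g t + \<psi> t)"
    unfolding \<psi>_def by (intro continuous_intros contg)
  obtain t0 where t0: "t0 \<in> {t1..t2}" "\<And>s. s \<in> {t1..t2} \<Longrightarrow> g s + \<psi> s \<le> g t0 + \<psi> t0"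
    using continuous_attains_sup[OF compact_Icc _ contG] lt by fastforce
  have 3: "g t2 < g t3 + \<psi> t3" using N by (simp add: \<psi>_def)
  have "\<psi> t2 \<le> 0" using A by (simp add: \<psi>_def)
  moreover have "\<psi> t1 = - A" by (simp add: \<psi>_def)
  ultimately have "t0 \<noteq> t1" "t0 \<noteq> t2" using t0(2)[of t3] t3 3 by (auto simp: A_def)
  then have t0': "t0 \<in> {t1<..<t2}" using t0(1) by auto
  have "- C \<le> - (C + \<kappa>) - A * N * exp (- N * (t0 - t1))"
  proof (rule sub[of t0 "\<lambda>t. - (C + \<kappa>) * t - \<psi> t" "\<lambda>t. - (C + \<kappa>) - A * N * exp (- N * (t - t1))" "min (t0 - t1) (t2 - t0)"])
    show "t0 \<in> {a<..<b}" using t0' t by auto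
    show "C1_fun (\<lambda>t. - (C + \<kappa>) * t - \<psi> t) (\<lambda>t. - (C + \<kappa>) - A * N * exp (- N * (t - t1)))"
      unfolding C1_fun_def \<psi>_def by (auto intro!: derivative_eq_intros continuous_intros)
    fix t assume "\<bar>t - t0\<bar> < min (t0 - t1) (t2 - t0)"
    then have "t \<in> {t1..t2}" by auto
    then show "h t - (- (C + \<kappa>) * t - \<psi> t) \<le> h t0 - (- (C + \<kappa>) * t0 - \<psi> t0)"
      using t0(2)[of t] by (simp add: g_def algebra_simps)
  qed (use t0' in auto)
  moreover have "0 \<le> A * N * exp (- N * (t0 - t1))" using A N by simp
  ultimately show False using \<kappa> by simp
qed

text \<open>The slope \<open>q\<close> is the upper right Dini derivate. If the lower left one were
  smaller, two rationals in between would put \<open>t\<close> into a \<open>derivate_gap\<close>;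
  with rationals only, the excluded points form a countable union of null sets.\<close>

lemma superjet_of_slope_bound:
  fixes f :: "real \<Rightarrow> real"
  assumes t: "t \<in> {a<..<b}" and mono: "mono_on {a..b} f"
    and gap: "\<And>r R. r \<in> \<rat> \<Longrightarrow> R \<in> \<rat> \<Longrightarrow> 0 \<le> r \<Longrightarrow> r < R \<Longrightarrow> t \<notin> derivate_gap f a b r R"
    and right: "\<And>t'. t' \<in> {t<..b} \<Longrightarrow> f t' - f t \<le> c * (t' - t)"
  obtains q where "0 \<le> q" "q \<le> c"
    "\<And>e. e > 0 \<Longrightarrow> \<exists>d>0. \<forall>s\<in>{a<..<b}. \<bar>s - t\<bar> < d \<longrightarrow> f s \<le> f t + q * (s - t) + e * \<bar>s - t\<bar>"
proof -
  define S where "S = {R. \<exists>d>0. \<forall>t'\<in>{t<..b}. t' - t < d \<longrightarrow> f t' - f t \<le> R * (t' - t)}"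
  have cS: "c \<in> S" using right by (auto simp: S_def intro!: exI[of _ 1])
  have S0: "0 \<le> R" if "R \<in> S" for R
  proof -
    from that obtain d where d: "d > 0" "\<And>t'. t'\<in>{t<..b} \<Longrightarrow> t' - t < d \<Longrightarrow> f t' - f t \<le> R * (t' - t)"
      by (auto simp: S_def)
    define t' where "t' = min b (t + d/2)"
    have t': "t' \<in> {t<..b}" "t' - t < d" using t d by (auto simp: t'_def)
    have "f t \<le> f t'" using mono t t' by (auto simp: mono_on_def)
    then have "0 \<le> R * (t' - t)" using d(2)[OF t'] by simp
    then show ?thesis using t' by (simp add: zero_le_mult_iff)
  qed
  have bdd: "bdd_below S" using S0 by (auto simp: bdd_below_def)
  define q where "q = Inf S"
  have q: "0 \<le> q" "q \<le> c" unfolding q_def using cS S0 bdd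
    by (auto intro: cInf_greatest cInf_lower)
  show thesis
  proof (rule that[OF q])
    fix e :: real assume e: "e > 0"
    obtain R where R: "R \<in> S" "R < q + e"
      using e cInf_lessD[of S "q + e"] cS by (auto simp: q_def)
    then obtain d1 where d1: "d1 > 0" "\<And>t'. t'\<in>{t<..b} \<Longrightarrow> t' - t < d1 \<Longrightarrow> f t' - f t \<le> R * (t' - t)"
      by (auto simp: S_def)
    have "\<exists>d>0. \<forall>s\<in>{a..<t}. t - s < d \<longrightarrow> (q - e) * (t - s) \<le> f t - f s"
    proof (cases "q - e < 0")
      case True
      have "(q - e) * (t - s) \<le> f t - f s" if "s \<in> {a..<t}" for s
      proof -
        have "f s \<le> f t" using mono t that by (auto simp: mono_on_def)
        moreover have "(q - e) * (t - s) \<le> 0" using True that by (simp add: mult_nonpos_nonneg)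
        ultimately show ?thesis by simp
      qed
      then show ?thesis by (intro exI[of _ 1]) auto
    next
      case False
      obtain r where r: "r \<in> \<rat>" "q - e < r" "r < q" using Rats_dense_in_real[of "q - e" q] e by auto
      obtain R' where R': "R' \<in> \<rat>" "r < R'" "R' < q" using Rats_dense_in_real[of r q] r by auto
      have "R' \<notin> S" using R' bdd cInf_lower[of R' S] by (auto simp: q_def)
      then have *: "\<forall>e>0. \<exists>t'\<in>{t<..b}. t' - t < e \<and> R' * (t' - t) < f t' - f t"
        unfolding S_def by (auto simp: not_le)
      have "t \<notin> derivate_gap f a b r R'" using gap r R' False by auto
      then obtain d where d: "d > 0" "\<And>s. s\<in>{a..<t} \<Longrightarrow> t - s < d \<Longrightarrow> \<not> f t - f s < r * (t - s)"
        using t * unfolding derivate_gap_def by blast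
      have "(q - e) * (t - s) \<le> f t - f s" if "s\<in>{a..<t}" "t - s < d" for s
      proof -
        have "(q - e) * (t - s) \<le> r * (t - s)" using r that by (intro mult_right_mono) auto
        then show ?thesis using d(2)[OF that] by simp
      qed
      then show ?thesis using d(1) by blast
    qed
    then obtain d2 where d2: "d2 > 0" "\<And>s. s\<in>{a..<t} \<Longrightarrow> t - s < d2 \<Longrightarrow> (q - e) * (t - s) \<le> f t - f s"
      by blast
    have "f s \<le> f t + q * (s - t) + e * \<bar>s - t\<bar>" if s: "s\<in>{a<..<b}" "\<bar>s - t\<bar> < min d1 d2" for s
    proof -
      consider "s = t" | "s > t" | "s < t" by linarith
      then show ?thesis
      proof cases
        case 2
        have "f s - f t \<le> R * (s - t)" using s 2 by (intro d1(2)) auto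
        also have "\<dots> \<le> (q + e) * (s - t)" using R 2 by (intro mult_right_mono) auto
        finally show ?thesis using 2 by (simp add: algebra_simps)
      next
        case 3
        have "(q - e) * (t - s) \<le> f t - f s" using s 3 by (intro d2(2)) auto
        then show ?thesis using 3 by (simp add: algebra_simps)
      qed auto
    qed
    then show "\<exists>d>0. \<forall>s\<in>{a<..<b}. \<bar>s - t\<bar> < d \<longrightarrow> f s \<le> f t + q * (s - t) + e * \<bar>s - t\<bar>"
      using d1(1) d2(1) by (intro exI[of _ "min d1 d2"]) auto
  qed
qed

text \<open>Adding \<open>C * t\<close> makes \<open>h\<close> a nondecreasing function
  \<open>f\<close>. At a good time outside a null set, either \<open>f\<close> climbs to some later
  point with slope above \<open>c'\<close>, or it has a superjet of slope at most \<open>c'\<close>;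
  the latter would give a function touching \<open>h\<close> with slope below \<open>- e\<close>. So
  the good times lie, up to a null set, in an open set on which \<open>f\<close> gains
  \<open>c'\<close> per unit of measure. The number \<open>m\<close> is a lower bound for the outer
  measure of \<open>Good\<close>, which may fail to be measurable.\<close>

lemma time_comparison:
  fixes h :: "real \<Rightarrow> real"
  assumes ab: "a < b" and cont: "continuous_on {a..b} h" and e: "0 \<le> e" "e \<le> C"
    and sub: "\<And>t0 \<theta> \<theta>' d. t0 \<in> {a<..<b} \<Longrightarrow> C1_fun \<theta> \<theta>' \<Longrightarrow> d > 0 \<Longrightarrow>
        (\<And>t. t \<in> {a<..<b} \<Longrightarrow> \<bar>t - t0\<bar> < d \<Longrightarrow> h t - \<theta> t \<le> h t0 - \<theta> t0) \<Longrightarrow>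
        - C \<le> \<theta>' t0 \<and> (t0 \<in> Good \<longrightarrow> - e \<le> \<theta>' t0)"
    and m: "\<And>Q. Q \<in> sets lebesgue \<Longrightarrow> Good \<inter> {a<..<b} \<subseteq> Q \<Longrightarrow> m \<le> measure lebesgue (Q \<inter> {a..b})"
  shows "h a \<le> h b + e * (b - a) + C * (b - a - m)"
proof -
  define f where "f t = h t + C * t" for t
  have mono: "mono_on {a..b} f" unfolding f_def
    by (rule mono_of_superjets_ge[OF cont]) (use sub in blast)
  have contf: "continuous_on {a..b} f" unfolding f_def by (intro continuous_intros cont)
  have fab: "f a \<le> f b" using mono ab by (auto simp: mono_on_def)
  define I where "I = {p \<in> \<rat> \<times> \<rat>. 0 \<le> fst p \<and> fst p < (snd p :: real)}"
  define N where "N = (\<Union>p\<in>I. derivate_gap f a b (fst p) (snd p))"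
  have "countable (\<rat> \<times> \<rat> :: (real \<times> real) set)" using countable_rat by (intro countable_SIGMA) auto
  then have "countable I" by (rule countable_subset[rotated]) (auto simp: I_def)
  then have N: "negligible N" unfolding N_def
    by (intro negligible_countable_Union[of "_ ` _"] countable_image) (auto simp: I_def intro: negligible_derivate_gap[OF ab contf mono])
  have main: "c' * m \<le> f b - f a" if c': "0 \<le> c'" "c' < C - e" for c'
  proof -
    \<comment> \<open>Open whatever \<open>Good\<close> is, so that the outer bound \<open>m\<close>
      can be applied to the measurable set \<open>X \<union> N\<close>.\<close>
    define X where "X = {t\<in>{a<..<b}. \<exists>t'\<in>{t<..b}. t' - t < b - a \<and> c' * (t' - t) < f t' - f t}"
    have "open X" unfolding X_def by (rule open_slope_sets(2)[OF contf])
    then have XL: "X \<in> sets lebesgue" by auto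
    have Xb: "X \<subseteq> {a<..<b}" by (auto simp: X_def)
    then have Xlm: "X \<in> lmeasurable" using XL
      by (auto intro!: bounded_set_imp_lmeasurable bounded_subset[of "{a<..<b}" X])
    have good: "Good \<inter> {a<..<b} \<subseteq> X \<union> N"
    proof
      fix t assume t: "t \<in> Good \<inter> {a<..<b}"
      show "t \<in> X \<union> N"
      proof (rule ccontr)
        assume nt: "t \<notin> X \<union> N"
        have gap: "t \<notin> derivate_gap f a b r R" if "r \<in> \<rat>" "R \<in> \<rat>" "0 \<le> r" "r < R" for r R
          using nt that unfolding N_def I_def by force
        have right: "f t' - f t \<le> c' * (t' - t)" if "t' \<in> {t<..b}" for t'
          using nt t that by (force simp: X_def not_less)
        obtain q where q: "0 \<le> q" "q \<le> c'"
          "\<And>e. e > 0 \<Longrightarrow> \<exists>d>0. \<forall>s\<in>{a<..<b}. \<bar>s - t\<bar> < d \<longrightarrow> f s \<le> f t + q * (s - t) + e * \<bar>s - t\<bar>"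
          using superjet_of_slope_bound[OF _ mono gap right] t by blast
        \<comment> \<open>The excess of \<open>f\<close> over its superjet. It is only known to be
          \<open>o(\<bar>s\<bar>)\<close>, and \<open>C1_majorant\<close> turns it into an
          admissible touching function; the value 0 outside the interval keeps the required estimate
          true there.\<close>
        define g where "g s = (if t + s \<in> {a<..<b} then f (t + s) - f t - q * s else 0)" for s
        have "\<exists>d>0. \<forall>s. \<bar>s\<bar> < d \<longrightarrow> g s \<le> e * \<bar>s\<bar>" if "e > 0" for e
        proof -
          from q(3)[OF that] obtain d where d: "d > 0" "\<And>s. s\<in>{a<..<b} \<Longrightarrow> \<bar>s - t\<bar> < d \<Longrightarrow> f s \<le> f t + q * (s - t) + e * \<bar>s - t\<bar>"
            by blast
          have "g s \<le> e * \<bar>s\<bar>" if "\<bar>s\<bar> < d" for s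
            using d(2)[of "t + s"] that \<open>e > 0\<close> by (auto simp: g_def)
          then show ?thesis using d(1) by blast
        qed
        then obtain \<theta> \<theta>' d where \<theta>: "\<And>s. (\<theta> has_real_derivative \<theta>' s) (at s)" "continuous_on UNIV \<theta>'"
           "\<theta> 0 = 0" "\<theta>' 0 = 0" "d > 0" "\<And>s. \<bar>s\<bar> < d \<Longrightarrow> g s \<le> \<theta> s"
          using C1_majorant[of g] by blast
        have "- e \<le> \<theta>' (t - t) + q - C"
        proof (rule sub[THEN conjunct2, rule_format, of t "\<lambda>s. \<theta> (s - t) + (q - C) * s" "\<lambda>s. \<theta>' (s - t) + q - C" d])
          show "C1_fun (\<lambda>s. \<theta> (s - t) + (q - C) * s) (\<lambda>s. \<theta>' (s - t) + q - C)"
            unfolding C1_fun_def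
          proof (intro conjI allI)
            fix s
            have "((\<lambda>s. \<theta> (s - t)) has_real_derivative \<theta>' (s - t)) (at s)"
              using DERIV_chain2[OF \<theta>(1)[of "s - t"] DERIV_diff[OF DERIV_ident DERIV_const]] by simp
            then show "((\<lambda>s. \<theta> (s - t) + (q - C) * s) has_real_derivative \<theta>' (s - t) + q - C) (at s)"
              by (auto intro!: derivative_eq_intros)
            show "continuous_on UNIV (\<lambda>s. \<theta>' (s - t) + q - C)"
              by (intro continuous_intros continuous_on_compose2[OF \<theta>(2)]) auto
          qed
          fix s assume s: "s \<in> {a<..<b}" "\<bar>s - t\<bar> < d"
          then show "h s - (\<theta> (s - t) + (q - C) * s) \<le> h t - (\<theta> (t - t) + (q - C) * t)"
            using \<theta>(6)[of "s - t"] \<theta>(3) by (simp add: g_def f_def algebra_simps)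
        qed (use t \<theta> in auto)
        then show False using \<theta>(4) q c' by simp
      qed
    qed
    have NL: "N \<in> sets lebesgue" using N negligible_imp_sets by blast
    have Nlm: "N \<in> lmeasurable" using N by (rule negligible_imp_measurable)
    have "m \<le> measure lebesgue ((X \<union> N) \<inter> {a..b})" by (rule m) (use XL NL good in auto)
    also have "\<dots> \<le> measure lebesgue (X \<union> N)"
    proof (rule measure_mono_fmeasurable)
      show "(X \<union> N) \<inter> {a..b} \<in> sets lebesgue" using XL NL by (intro sets.Int sets.Un) auto
      show "X \<union> N \<in> lmeasurable" using Xlm Nlm by (rule fmeasurable.Un)
    qed auto
    also have "\<dots> \<le> measure lebesgue X + measure lebesgue N"
      using Xlm N by (intro measure_Un_le) (auto simp: NL)
    also have "measure lebesgue N = 0" using N by (rule negligible_imp_measure0)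
    finally have mX: "m \<le> measure lebesgue X" by simp
    have "c' * m \<le> (f b - f a) + \<epsilon>" if \<epsilon>: "\<epsilon> > 0" for \<epsilon>
    proof -
      define \<epsilon>' where "\<epsilon>' = \<epsilon> / (c' + 1)"
      have \<epsilon>': "\<epsilon>' > 0" "c' * \<epsilon>' \<le> \<epsilon>" using \<epsilon> c' by (auto simp: \<epsilon>'_def field_simps)
      obtain K where K: "closed K" "K \<subseteq> X" "X - K \<in> lmeasurable" "emeasure lebesgue (X - K) < ennreal \<epsilon>'"
        using sets_lebesgue_inner_closed[OF XL \<epsilon>'(1)] by metis
      have cK: "compact K" using K Xb
        by (meson bounded_closed_interval bounded_subset compact_eq_bounded_closed greaterThanLessThan_subseteq_atLeastAtMost_iff order_refl)
      have "measure lebesgue (X - K) \<le> \<epsilon>'" using K(3,4) \<epsilon>' by (simp add: emeasure_eq_measure2 ennreal_less_iff)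
      moreover have "measure lebesgue (X - K) = measure lebesgue X - measure lebesgue K"
        using Xlm cK K(2) lmeasurable_compact by (intro measurable_measure_Diff) (auto simp: fmeasurableD)
      ultimately have "m \<le> measure lebesgue K + \<epsilon>'" using mX by simp
      then have "c' * m \<le> c' * (measure lebesgue K + \<epsilon>')" using c' by (intro mult_left_mono) auto
      moreover have "c' * measure lebesgue (K \<inter> {a..b}) \<le> f b - f a"
      proof (rule slope_times_measure_le[OF _ contf mono _ cK])
        fix t assume "t \<in> K"
        then show "\<exists>t'\<in>{t<..b}. c' * (t' - t) \<le> f t' - f t" using K(2) by (force simp: X_def)
      qed (use ab c' in auto)
      moreover have "K \<inter> {a..b} = K" using K(2) Xb by auto
      ultimately show ?thesis using \<epsilon>' by (simp add: algebra_simps)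
    qed
    then show ?thesis by (rule field_le_epsilon)
  qed
  have "(C - e) * m \<le> f b - f a"
  proof (cases "C - e = 0 \<or> m \<le> 0")
    case True
    then have "(C - e) * m \<le> 0" using e by (auto simp: mult_nonneg_nonpos)
    then show ?thesis using fab by simp
  next
    case False
    show ?thesis
    proof (rule field_le_epsilon)
      fix \<epsilon> :: real assume \<epsilon>: "\<epsilon> > 0"
      define c' where "c' = max 0 (C - e - \<epsilon> / m)"
      have "0 \<le> c'" "c' < C - e" using False e \<epsilon> by (auto simp: c'_def)
      from main[OF this] have "c' * m \<le> f b - f a" .
      moreover have "(C - e - \<epsilon> / m) * m \<le> c' * m" using False by (intro mult_right_mono) (auto simp: c'_def)
      moreover have "(C - e - \<epsilon> / m) * m = (C - e) * m - \<epsilon>" using False by (simp add: left_diff_distrib)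
      ultimately show "(C - e) * m \<le> f b - f a + \<epsilon>" by simp
    qed
  qed
  moreover have "m \<le> b - a" using m[of UNIV] ab by simp
  then have "e * m \<le> e * (b - a)" using e by (intro mult_left_mono) auto
  ultimately show ?thesis by (simp add: f_def algebra_simps)
qed

section \<open>Finite colourings of an interval\<close>

text \<open>The colouring \<open>j\<close> is an arbitrary function: nothing is assumed to be measurable, so the
  amount of a colour is measured from outside.\<close>

lemma colour_partition:
  fixes j :: "real \<Rightarrow> nat"
  assumes ab: "a < b" and j: "\<And>t. t \<in> {a..b} \<Longrightarrow> j t < n" and \<eta>: "\<eta> > 0" and \<tau>: "\<tau> > 0"
  obtains N :: nat and c :: "nat \<Rightarrow> nat" and m :: "nat \<Rightarrow> real" where "N > 0" "(b - a) / N \<le> \<tau>"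
    "\<And>k. c k < n"
    "\<And>k Q. k < N \<Longrightarrow> Q \<in> sets lebesgue \<Longrightarrow>
       {t. j t = c k} \<inter> {a + k * ((b - a) / N)<..<a + Suc k * ((b - a) / N)} \<subseteq> Q \<Longrightarrow>
       m k \<le> measure lebesgue (Q \<inter> {a + k * ((b - a) / N)..a + Suc k * ((b - a) / N)})"
    "(\<Sum>k<N. (b - a) / N - m k) \<le> \<eta>"
proof -
  have n0: "n > 0" using j[of a] ab by auto
  define E where "E i = {t\<in>{a..b}. j t = i}" for i
  have "\<exists>H\<in>sets lebesgue. E i \<subseteq> H \<and> outer_measure_of lebesgue (E i) = emeasure lebesgue H" for i
    by (rule outer_measure_of_attain) simp
  then obtain H0 where H0: "\<And>i. H0 i \<in> sets lebesgue" "\<And>i. E i \<subseteq> H0 i"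
     "\<And>i. outer_measure_of lebesgue (E i) = emeasure lebesgue (H0 i)" by metis
  \<comment> \<open>Measurable hulls: \<open>H i\<close> has the outer measure of the colour
    \<open>E i\<close>. Hulls of different colours may overlap even though the colours do not, hence
    the passage to the disjoint \<open>D i\<close>.\<close>
  define H where "H i = H0 i \<inter> {a..b}" for i
  have HL: "H i \<in> sets lebesgue" for i using H0 by (auto simp: H_def)
  have Hlm: "H i \<in> lmeasurable" for i
    by (rule bounded_set_imp_lmeasurable[OF _ HL]) (auto simp: H_def intro: bounded_subset[of "{a..b}"])
  have EH: "E i \<subseteq> H i" for i using H0(2)[of i] by (auto simp: H_def E_def)
  have Hmin: "measure lebesgue (H i) \<le> measure lebesgue Q" if "E i \<subseteq> Q" "Q \<in> lmeasurable" for i Q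
  proof -
    have "emeasure lebesgue (H i) \<le> emeasure lebesgue (H0 i)" by (intro emeasure_mono H0) (auto simp: H_def)
    also have "\<dots> = outer_measure_of lebesgue (E i)" using H0 by simp
    also have "\<dots> \<le> emeasure lebesgue Q" unfolding outer_measure_of_def
      by (rule INF_lower) (use that in \<open>auto simp: fmeasurableD\<close>)
    finally show ?thesis using Hlm that by (simp add: emeasure_eq_measure2 ennreal_le_iff)
  qed
  define D where "D i = H i - (\<Union>l<i. H l)" for i
  have DL: "D i \<in> sets lebesgue" for i using HL by (auto simp: D_def)
  have Dlm: "D i \<in> lmeasurable" for i
    by (rule bounded_set_imp_lmeasurable[OF _ DL]) (auto simp: D_def H_def intro: bounded_subset[of "{a..b}"])
  have D_disj: "D i \<inter> D l = {}" if "i \<noteq> l" for i l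
    using that by (cases "i < l") (auto simp: D_def disjoint_iff)
  have D_cover: "{a..b} \<subseteq> (\<Union>i<n. D i)"
  proof
    fix t assume t: "t \<in> {a..b}"
    then have tH: "t \<in> H (j t)" using EH by (auto simp: E_def)
    define i where "i = (LEAST i. t \<in> H i)"
    have "t \<in> H i" unfolding i_def using tH by (rule LeastI)
    moreover have "t \<notin> H l" if "l < i" for l using that not_less_Least unfolding i_def by blast
    ultimately have "t \<in> D i" by (auto simp: D_def)
    moreover have "i \<le> j t" unfolding i_def using tH by (rule Least_le)
    ultimately show "t \<in> (\<Union>i<n. D i)" using j[OF t] by fastforce
  qed
  have "\<exists>K. compact K \<and> K \<subseteq> D i \<and> measure lebesgue (D i - K) \<le> \<eta> / n" for i
  proof -
    have "\<eta> / n > 0" using \<eta> n0 by simp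
    then obtain K where K: "closed K" "K \<subseteq> D i" "D i - K \<in> lmeasurable" "emeasure lebesgue (D i - K) < ennreal (\<eta> / n)"
      using sets_lebesgue_inner_closed[OF DL] by metis
    moreover have "bounded K" by (rule bounded_subset[of "{a..b}"]) (use K in \<open>auto simp: D_def H_def\<close>)
    moreover have "measure lebesgue (D i - K) \<le> \<eta> / n" using K(3,4) \<eta> n0
      by (simp add: emeasure_eq_measure2 ennreal_less_iff)
    ultimately show ?thesis using compact_eq_bounded_closed by blast
  qed
  then obtain K where K: "\<And>i. compact (K i)" "\<And>i. K i \<subseteq> D i" "\<And>i. measure lebesgue (D i - K i) \<le> \<eta> / n"
    by metis
  have KL: "K i \<in> lmeasurable" for i using K lmeasurable_compact by blast
  \<comment> \<open>Disjoint compact sets have a positive distance, so an interval shorter than all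
    these distances meets at most one \<open>K i\<close>; the index of that set becomes the colour
    of the interval.\<close>
  have "\<exists>d>0. \<forall>x\<in>K i. \<forall>y\<in>K l. d \<le> dist x y" if "i \<noteq> l" for i l
    by (rule separate_compact_closed) (use K compact_imp_closed D_disj[OF that] in blast)+
  then obtain d0 where d0: "\<And>i l. i \<noteq> l \<Longrightarrow> d0 i l > 0" "\<And>i l x y. i \<noteq> l \<Longrightarrow> x \<in> K i \<Longrightarrow> y \<in> K l \<Longrightarrow> d0 i l \<le> dist x y"
    by metis
  define d where "d = Min (insert 1 ((\<lambda>(i,l). if i = l then 1 else d0 i l) ` ({..<n} \<times> {..<n})))"
  have d: "d > 0" unfolding d_def using d0(1) by (subst Min_gr_iff) auto
  have d_le: "d \<le> dist x y" if "i \<noteq> l" "i < n" "l < n" "x \<in> K i" "y \<in> K l" for i l x y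
  proof -
    have "d \<le> d0 i l" unfolding d_def by (rule Min_le) (use that in \<open>auto simp: image_iff intro!: bexI[of _ "(i,l)"]\<close>)
    also have "\<dots> \<le> dist x y" using that d0 by blast
    finally show ?thesis .
  qed
  obtain N0 :: nat where N0: "(b - a) / min d \<tau> < N0" using reals_Archimedean2 by blast
  have N0p: "real N0 > 0" using N0 ab d \<tau> by (smt (verit) divide_pos_pos min_less_iff_conj)
  define N where "N = N0"
  define w where "w = (b - a) / N"
  have Np: "N > 0" using N0p by (simp add: N_def)
  have "(b - a) < N0 * min d \<tau>" using N0 d \<tau> by (simp add: divide_less_eq)
  moreover have "N0 * min d \<tau> \<le> N0 * d" "N0 * min d \<tau> \<le> N0 * \<tau>" by (intro mult_left_mono; simp)+
  ultimately have "b - a < N0 * d" "b - a < N0 * \<tau>" by linarith+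
  then have w: "w < d" "w \<le> \<tau>" "w > 0" "N * w = b - a"
    using Np ab by (auto simp: w_def N_def field_simps)
  define I where "I k = {a + real k * w..a + Suc k * w}" for k
  \<comment> \<open>An interval that meets no \<open>K i\<close> receives colour 0. Its
    \<open>m k\<close> is then 0, and its full length counts as lost.\<close>
  define c where "c k = (if \<exists>i<n. K i \<inter> I k \<noteq> {} then (SOME i. i < n \<and> K i \<inter> I k \<noteq> {}) else 0)" for k
  have cn: "c k < n" for k
  proof (cases "\<exists>i<n. K i \<inter> I k \<noteq> {}")
    case True
    from someI_ex[of "\<lambda>i. i < n \<and> K i \<inter> I k \<noteq> {}"] True show ?thesis by (auto simp: c_def)
  qed (use n0 in \<open>auto simp: c_def\<close>)
  have c_other: "K i \<inter> I k = {}" if "i < n" "i \<noteq> c k" for i k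
  proof (rule ccontr)
    assume ne: "K i \<inter> I k \<noteq> {}"
    then have ex: "\<exists>i<n. K i \<inter> I k \<noteq> {}" using that by blast
    from someI_ex[of "\<lambda>i. i < n \<and> K i \<inter> I k \<noteq> {}"] ex have "K (c k) \<inter> I k \<noteq> {}" by (auto simp: c_def)
    then obtain x y where xy: "x \<in> K i" "x \<in> I k" "y \<in> K (c k)" "y \<in> I k" using ne by blast
    have "dist x y \<le> w" using xy by (auto simp: I_def dist_real_def abs_le_iff algebra_simps)
    then show False using d_le[OF that(2) that(1) cn xy(1) xy(3)] w by simp
  qed
  define m where "m k = measure lebesgue (K (c k) \<inter> I k)" for k
  show thesis
  proof (rule that[of N c m])
    show "N > 0" by fact
    show "(b - a) / N \<le> \<tau>" using w by (simp add: w_def)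
    show "c k < n" for k by (rule cn)
    fix k Q assume k: "k < N" and Q: "Q \<in> sets lebesgue"
      and sub: "{t. j t = c k} \<inter> {a + k * ((b - a) / N)<..<a + Suc k * ((b - a) / N)} \<subseteq> Q"
    define ep where "ep = {a + k * w, a + Suc k * w}"
    have Iab: "I k \<subseteq> {a..b}"
    proof -
      have "Suc k * w \<le> N * w" using k w by (intro mult_right_mono) auto
      then show ?thesis using w by (auto simp: I_def)
    qed
    have IL: "I k \<in> lmeasurable" by (simp add: I_def)
    have QI: "Q \<inter> I k \<in> lmeasurable"
      using Q IL by (intro bounded_set_imp_lmeasurable bounded_subset[of "{a..b}" "Q \<inter> I k"]) (use Iab in \<open>auto simp: fmeasurableD\<close>)
    have epn: "negligible ep" by (simp add: ep_def negligible_finite)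
    \<comment> \<open>Exchange argument: if the part of \<open>H (c k)\<close> in this interval is
      replaced by \<open>Q\<close>, the colour is still covered, so by minimality of the hull
      \<open>Q\<close> cannot have smaller measure there. The endpoints \<open>ep\<close> are added
      because \<open>Q\<close> is only known to cover the colour in the open interval.\<close>
    define Q' where "Q' = (H (c k) - I k) \<union> ((Q \<inter> I k) \<union> ep)"
    have "E (c k) \<subseteq> Q'"
    proof
      fix t assume t: "t \<in> E (c k)"
      show "t \<in> Q'"
      proof (cases "t \<in> I k")
        case True
        then have "t \<in> ep \<or> t \<in> {a + k * w<..<a + Suc k * w}" by (auto simp: I_def ep_def)
        then show ?thesis using sub t True unfolding Q'_def w_def by (auto simp: E_def)
      next
        case False then show ?thesis using t EH[of "c k"] by (auto simp: Q'_def)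
      qed
    qed
    moreover have HI: "H (c k) - I k \<in> lmeasurable" using Hlm IL by (simp add: fmeasurable.Diff)
    moreover have epl: "ep \<in> lmeasurable" using epn by (simp add: negligible_imp_measurable)
    ultimately have "measure lebesgue (H (c k)) \<le> measure lebesgue Q'" using QI
      by (intro Hmin) (auto simp: Q'_def)
    also have "\<dots> \<le> measure lebesgue (H (c k) - I k) + measure lebesgue ((Q \<inter> I k) \<union> ep)"
      unfolding Q'_def using HI QI epl by (intro measure_Un_le) (auto simp: fmeasurableD)
    also have "measure lebesgue ((Q \<inter> I k) \<union> ep) \<le> measure lebesgue (Q \<inter> I k) + measure lebesgue ep"
      using QI epl by (intro measure_Un_le) (auto simp: fmeasurableD)
    also have "measure lebesgue ep = 0" using epn by (rule negligible_imp_measure0)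
    finally have 1: "measure lebesgue (H (c k)) \<le> measure lebesgue (H (c k) - I k) + measure lebesgue (Q \<inter> I k)" by simp
    have HI2: "H (c k) \<inter> I k \<in> lmeasurable" using Hlm IL by (simp add: fmeasurable.Int)
    have "H (c k) - I k = H (c k) - (H (c k) \<inter> I k)" by auto
    then have "measure lebesgue (H (c k) - I k) = measure lebesgue (H (c k)) - measure lebesgue (H (c k) \<inter> I k)"
      using measurable_measure_Diff[OF Hlm, of "H (c k) \<inter> I k" "c k"] HI2 by (auto simp: fmeasurableD)
    with 1 have "measure lebesgue (H (c k) \<inter> I k) \<le> measure lebesgue (Q \<inter> I k)" by simp
    moreover have "m k \<le> measure lebesgue (H (c k) \<inter> I k)" unfolding m_def
      using HI2 KL IL K(2)[of "c k"] by (intro measure_mono_fmeasurable) (auto simp: D_def fmeasurableD)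
    ultimately show "m k \<le> measure lebesgue (Q \<inter> {a + k * ((b - a) / N)..a + Suc k * ((b - a) / N)})"
      by (simp add: I_def w_def)
  next
    define U where "U = (\<Union>i<n. K i)"
    have Ulm: "U \<in> lmeasurable" unfolding U_def using KL by (intro fmeasurable_UN_bound fmeasurable.finite_UN) auto
    have "b - a = measure lebesgue {a..b}" using ab by simp
    also have "\<dots> \<le> measure lebesgue (U \<union> (\<Union>i<n. D i - K i))"
    proof (rule measure_mono_fmeasurable)
      show "{a..b} \<subseteq> U \<union> (\<Union>i<n. D i - K i)" 
      proof
        fix t assume "t \<in> {a..b}"
        then obtain i where "i < n" "t \<in> D i" using D_cover by blast
        then show "t \<in> U \<union> (\<Union>i<n. D i - K i)" unfolding U_def by (cases "t \<in> K i") auto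
      qed
      show "U \<union> (\<Union>i<n. D i - K i) \<in> lmeasurable" using Ulm Dlm KL
        by (intro fmeasurable.Un fmeasurable.finite_UN) (auto simp: fmeasurable.Diff)
    qed auto
    also have "\<dots> \<le> measure lebesgue U + measure lebesgue (\<Union>i<n. D i - K i)"
      using Ulm Dlm KL by (intro measure_Un_le) (auto simp: fmeasurableD)
    also have "measure lebesgue (\<Union>i<n. D i - K i) \<le> (\<Sum>i<n. measure lebesgue (D i - K i))"
      using Dlm KL by (intro measure_UNION_le) (auto simp: fmeasurableD)
    also have "\<dots> \<le> (\<Sum>i<n. \<eta> / n)" using K(3) by (intro sum_mono) auto
    also have "\<dots> = \<eta>" using n0 by simp
    finally have 1: "b - a - \<eta> \<le> measure lebesgue U" by simp
    have Uk: "U \<subseteq> (\<Union>k<N. U \<inter> I k)"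
    proof
      fix t assume t: "t \<in> U"
      then obtain i where "t \<in> K i" by (auto simp: U_def)
      then have tab: "t \<in> {a..b}" using K(2)[of i] by (auto simp: D_def H_def)
      show "t \<in> (\<Union>k<N. U \<inter> I k)"
      proof (cases "t = b")
        case True
        then have "t \<in> I (N - 1)" using Np w by (auto simp: I_def of_nat_diff algebra_simps)
        then show ?thesis using t Np by (intro UN_I[of "N - 1"]) auto
      next
        case False
        define k where "k = nat \<lfloor>(t - a) / w\<rfloor>"
        have q: "(t - a) / w \<ge> 0" using tab w by simp
        have k: "real k \<le> (t - a) / w" "(t - a) / w < real k + 1" using q by (auto simp: k_def)
        have "real k * w \<le> t - a" "t - a < (real k + 1) * w" using k w by (auto simp: field_simps)
        moreover have "k < N"
        proof -
          have "real k * w < N * w" using \<open>real k * w \<le> t - a\<close> w(4) tab False by auto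
          then have "real k < real N" using w(3) mult_less_cancel_right_pos by blast
          then show ?thesis by simp
        qed
        ultimately show ?thesis using t by (intro UN_I[of k]) (auto simp: I_def algebra_simps)
      qed
    qed
    have Ik: "I k \<in> lmeasurable" for k by (simp add: I_def)
    have "measure lebesgue U \<le> measure lebesgue (\<Union>k<N. U \<inter> I k)"
      using Uk Ulm Ik by (intro measure_mono_fmeasurable fmeasurable.finite_UN) (auto simp: fmeasurable.Int fmeasurableD)
    also have "\<dots> \<le> (\<Sum>k<N. measure lebesgue (U \<inter> I k))"
      using Ulm Ik by (intro measure_UNION_le) (auto simp: fmeasurableD)
    also have "\<dots> = (\<Sum>k<N. m k)"
    proof (rule sum.cong)
      fix k
      have "U \<inter> I k = K (c k) \<inter> I k"
      proof (intro equalityI subsetI)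
        fix t assume t: "t \<in> U \<inter> I k"
        then obtain i where "i < n" "t \<in> K i" by (auto simp: U_def)
        then show "t \<in> K (c k) \<inter> I k" using c_other[of i k] t by (cases "i = c k") auto
      qed (use cn[of k] in \<open>auto simp: U_def\<close>)
      then show "measure lebesgue (U \<inter> I k) = m k" by (simp add: m_def)
    qed simp
    finally have "b - a - \<eta> \<le> (\<Sum>k<N. m k)" using 1 by simp
    then show "(\<Sum>k<N. (b - a) / N - m k) \<le> \<eta>"
      using Np by (simp add: sum_subtractf)
  qed
qed

section \<open>Mollification\<close>

text \<open>If \<open>F\<close> is an antiderivative of \<open>f\<close>, this is the mean of
  \<open>f\<close> over the interval of radius \<open>m\<close> about \<open>x\<close>. Smoothing is
  thereby expressed by difference quotients instead of integrals.\<close>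

definition cdiff :: "real \<Rightarrow> (real \<Rightarrow> real) \<Rightarrow> real \<Rightarrow> real" where
  "cdiff m F x = (F (x + m) - F (x - m)) / (2 * m)"

text \<open>Plays the part of the fact that a mean stays within the bounds of the averaged function:
  whatever holds for all values of \<open>g'\<close> holds for all values of
  \<open>cdiff m g\<close>.\<close>

lemma cdiff_mvt:
  assumes m: "m > 0" and d: "\<And>x. (g has_real_derivative g' x) (at x)"
  obtains \<xi> where "\<bar>\<xi> - x\<bar> < m" "cdiff m g x = g' \<xi>"
proof -
  obtain \<xi> where "x - m < \<xi>" "\<xi> < x + m" "g (x + m) - g (x - m) = (x + m - (x - m)) * g' \<xi>"
    using MVT2[of "x - m" "x + m" g g'] m d by auto
  then show thesis using that[of \<xi>] m by (auto simp: cdiff_def)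
qed

lemma cdiff_diff: "cdiff m (\<lambda>x. g x - h x) x = cdiff m g x - cdiff m h x"
  by (simp add: cdiff_def diff_divide_distrib)

lemma DERIV_cdiff:
  assumes d: "\<And>x. (g has_real_derivative g' x) (at x)"
  shows "(cdiff m g has_real_derivative cdiff m g' x) (at x)"
proof -
  have "((\<lambda>x. g (x + c)) has_real_derivative g' (x + c)) (at x)" for c
    using DERIV_chain2[OF d[of "x + c"] DERIV_add[OF DERIV_ident DERIV_const]] by simp
  from this[of m] this[of "-m"] show ?thesis
    unfolding cdiff_def[abs_def] by (auto intro!: DERIV_cdivide DERIV_diff)
qed

lemma cdiff_abs_le:
  assumes m: "m > 0" and "\<And>x. \<bar>g x\<bar> \<le> B"
  shows "\<bar>cdiff m g x\<bar> \<le> B / m"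
proof -
  have "\<bar>g (x + m) - g (x - m)\<bar> \<le> 2 * B" using assms(2)[of "x+m"] assms(2)[of "x-m"] by linarith
  then show ?thesis using m by (simp add: cdiff_def abs_divide field_simps)
qed

lemma antiderivative_ex:
  fixes f :: "real \<Rightarrow> real"
  assumes "continuous_on UNIV f"
  obtains F where "\<And>x. (F has_real_derivative f x) (at x)"
proof -
  have "\<exists>F. \<forall>x. -\<infinity> < ereal x \<longrightarrow> ereal x < \<infinity> \<longrightarrow> (F has_vector_derivative f x) (at x)"
    by (rule einterval_antiderivative) (use assms in \<open>auto simp: continuous_on_eq_continuous_at\<close>)
  then show ?thesis using that by (auto simp: has_real_derivative_iff_has_vector_derivative)
qed

text \<open>\<open>f0\<close> is \<open>f\<close> averaged three times over windows of radius
  \<open>m\<close>, that is, convolved with a quadratic spline. Each derivative turns one mean into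
  a difference quotient; the first is paid by the Lipschitz bound, every further one costs
  \<open>1/m\<close>. Averaging is positive and commutes with translations, so bounds, monotonicity
  and signs of differences are inherited. The windows are symmetric, which improves the error to
  \<open>O(m^2)\<close> if second differences are of second order. The last clause states
  \<open>f'' - f' \<ge> 0\<close>, which is convexity in \<open>S = e^y\<close>, without
  differentiating \<open>f\<close>: an antiderivative is subtracted and a second difference
  taken.\<close>

lemma smoothing:
  fixes f :: "real \<Rightarrow> real"
  assumes m: "m > 0" and L: "L \<ge> 0" and lip: "\<And>x y. \<bar>f x - f y\<bar> \<le> L * \<bar>x - y\<bar>"
  obtains f0 f1 f2 f3 where
    "\<And>x. (f0 has_real_derivative f1 x) (at x)" "\<And>x. (f1 has_real_derivative f2 x) (at x)"
    "\<And>x. (f2 has_real_derivative f3 x) (at x)"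
    "\<And>x. \<bar>f0 x - f x\<bar> \<le> 3 * L * m" "\<And>x. \<bar>f1 x\<bar> \<le> L" "\<And>x. \<bar>f2 x\<bar> \<le> L / m" "\<And>x. \<bar>f3 x\<bar> \<le> L / m / m"
    "\<And>lo x. (\<And>x. lo \<le> f x) \<Longrightarrow> lo \<le> f0 x" "\<And>hi x. (\<And>x. f x \<le> hi) \<Longrightarrow> f0 x \<le> hi"
    "\<And>x. mono f \<Longrightarrow> 0 \<le> f1 x"
    "\<And>L' x. (\<And>x w. \<bar>f (x + w) + f (x - w) - 2 * f x\<bar> \<le> L' * w\<^sup>2) \<Longrightarrow> \<bar>f2 x\<bar> \<le> L'"
    "\<And>L' x. (\<And>x w. \<bar>f (x + w) + f (x - w) - 2 * f x\<bar> \<le> L' * w\<^sup>2) \<Longrightarrow> \<bar>f0 x - f x\<bar> \<le> 3 * L' * m\<^sup>2"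
    "\<And>x. (\<And>F x w. (\<And>x. (F has_real_derivative f x) (at x)) \<Longrightarrow>
        0 \<le> (f (x + w) - F (x + w)) + (f (x - w) - F (x - w)) - 2 * (f x - F x)) \<Longrightarrow> 0 \<le> f2 x - f1 x"
proof -
  have "L-lipschitz_on UNIV f" using lip L by (auto simp: lipschitz_on_def dist_real_def)
  then have cf: "continuous_on UNIV f" by (rule lipschitz_on_continuous_on)
  obtain F1 where F1: "\<And>x. (F1 has_real_derivative f x) (at x)" using antiderivative_ex[OF cf] by blast
  have "continuous_on UNIV F1" using F1 by (meson DERIV_isCont continuous_at_imp_continuous_on)
  then obtain F2 where F2: "\<And>x. (F2 has_real_derivative F1 x) (at x)" using antiderivative_ex by blast
  have "continuous_on UNIV F2" using F2 by (meson DERIV_isCont continuous_at_imp_continuous_on)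
  then obtain F3 where F3: "\<And>x. (F3 has_real_derivative F2 x) (at x)" using antiderivative_ex by blast
  let ?D = "cdiff m"
  note D = DERIV_cdiff
  have lipD: "\<bar>?D f x\<bar> \<le> L" for x
    using lip[of "x + m" "x - m"] m by (simp add: cdiff_def abs_divide field_simps)
  have bF: "P (?D g x)" if "\<And>x. (g has_real_derivative g' x) (at x)" "\<And>x. P (g' x)" for P g g' x
    using cdiff_mvt[OF m that(1)] that(2) by metis
  \<comment> \<open>The error of the innermost mean passes unchanged through the outer ones, which
    only average it again; each of the three layers contributes one \<open>e\<close>.\<close>
  have err: "\<bar>?D (?D (?D F3)) x - f x\<bar> \<le> 3 * e" if e: "\<And>x. \<bar>?D F1 x - f x\<bar> \<le> e" for e x
  proof -
    have "\<bar>?D (\<lambda>x. ?D F2 x - F1 x) x\<bar> \<le> e" for x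
      by (rule bF[where P = "\<lambda>y. \<bar>y\<bar> \<le> e", OF DERIV_diff[OF D[OF F2] F1] e])
    then have e2: "\<bar>?D (?D F2) x - ?D F1 x\<bar> \<le> e" for x by (simp add: cdiff_diff)
    have "\<bar>?D (\<lambda>x. ?D (?D F3) x - ?D F2 x) x\<bar> \<le> e" for x
      by (rule bF[where P = "\<lambda>y. \<bar>y\<bar> \<le> e", OF DERIV_diff[OF D[OF D[OF F3]] D[OF F2]] e2])
    then have e3: "\<bar>?D (?D (?D F3)) x - ?D (?D F2) x\<bar> \<le> e" for x by (simp add: cdiff_diff)
    show ?thesis using e[of x] e2[of x] e3[of x] by linarith
  qed
  show thesis
  proof (rule that[of "?D (?D (?D F3))" "?D (?D (?D F2))" "?D (?D (?D F1))" "?D (?D (?D f))"])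
    show "(?D (?D (?D F3)) has_real_derivative ?D (?D (?D F2)) x) (at x)" for x by (intro D F3)
    show "(?D (?D (?D F2)) has_real_derivative ?D (?D (?D F1)) x) (at x)" for x by (intro D F2)
    show "(?D (?D (?D F1)) has_real_derivative ?D (?D (?D f)) x) (at x)" for x by (intro D F1)
    show "\<bar>?D (?D (?D F3)) x - f x\<bar> \<le> 3 * L * m" for x
    proof -
      have "\<bar>?D F1 x - f x\<bar> \<le> L * m" for x
      proof -
        obtain \<xi> where "\<bar>\<xi> - x\<bar> < m" "?D F1 x = f \<xi>" using cdiff_mvt[OF m F1] by blast
        moreover have "L * \<bar>\<xi> - x\<bar> \<le> L * m" using \<open>\<bar>\<xi> - x\<bar> < m\<close> L by (intro mult_left_mono) auto
        ultimately show ?thesis using lip[of \<xi> x] by simp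
      qed
      from err[OF this] show ?thesis by (simp add: mult.assoc)
    qed
    show "\<bar>?D (?D (?D F2)) x\<bar> \<le> L" for x
      using bF[OF D[OF D[OF F2]], of "\<lambda>y. \<bar>y\<bar> \<le> L"] bF[OF D[OF F1], of "\<lambda>y. \<bar>y\<bar> \<le> L"] lipD by blast
    have 2: "\<bar>?D (?D f) x\<bar> \<le> L / m" for x using cdiff_abs_le[OF m lipD] .
    show "\<bar>?D (?D (?D F1)) x\<bar> \<le> L / m" for x
      using bF[OF D[OF D[OF F1]], of "\<lambda>y. \<bar>y\<bar> \<le> L / m"] 2 by blast
    show "\<bar>?D (?D (?D f)) x\<bar> \<le> L / m / m" for x using cdiff_abs_le[OF m 2] .
    have P: "P (?D (?D (?D F3)) x)" if "\<And>x. P (f x)" for P x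
      using bF[OF D[OF D[OF F3]], of P] bF[OF D[OF F2], of P] bF[OF F1, of P] that by blast
    show "lo \<le> ?D (?D (?D F3)) x" if "\<And>x. lo \<le> f x" for lo x using P[of "\<lambda>y. lo \<le> y"] that by blast
    show "?D (?D (?D F3)) x \<le> hi" if "\<And>x. f x \<le> hi" for hi x using P[of "\<lambda>y. y \<le> hi"] that by blast
    show "0 \<le> ?D (?D (?D F2)) x" if "mono f" for x
    proof -
      have "0 \<le> ?D f x" for x using that m by (auto simp: cdiff_def mono_def)
      then show ?thesis
        using bF[OF D[OF D[OF F2]], of "\<lambda>y. 0 \<le> y"] bF[OF D[OF F1], of "\<lambda>y. 0 \<le> y"] by blast
    qed
    show "0 \<le> ?D (?D (?D F1)) x - ?D (?D (?D F2)) x"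
      if cv: "\<And>F x w. (\<And>x. (F has_real_derivative f x) (at x)) \<Longrightarrow>
        0 \<le> (f (x + w) - F (x + w)) + (f (x - w) - F (x - w)) - 2 * (f x - F x)" for x
    proof -
      have "0 \<le> ?D (?D f) x - ?D (?D F1) x" for x
      proof -
        have "?D (?D f) x - ?D (?D F1) x = ((f (x + 2 * m) - F1 (x + 2 * m)) + (f (x - 2 * m) - F1 (x - 2 * m)) - 2 * (f x - F1 x)) / (2 * m)\<^sup>2"
          using m by (simp add: cdiff_def field_simps power2_eq_square)
        then show ?thesis using cv[of F1 x "2 * m"] F1 by simp
      qed
      from bF[OF DERIV_diff[OF D[OF D[OF F1]] D[OF D[OF F2]]], of "\<lambda>y. 0 \<le> y", OF this]
      show ?thesis by (simp add: cdiff_diff)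
    qed
    fix L' x assume Z: "\<And>x w. \<bar>f (x + w) + f (x - w) - 2 * f x\<bar> \<le> L' * w\<^sup>2"
    have Df2: "\<bar>?D (?D f) x\<bar> \<le> L'" for x
    proof -
      have "?D (?D f) x = (f (x + 2 * m) + f (x - 2 * m) - 2 * f x) / (2 * m)\<^sup>2"
        using m by (simp add: cdiff_def field_simps power2_eq_square)
      then show ?thesis using Z[of x "2 * m"] m by (simp add: abs_divide divide_le_eq)
    qed
    then show "\<bar>?D (?D (?D F1)) x\<bar> \<le> L'"
      using bF[OF D[OF D[OF F1]], of "\<lambda>y. \<bar>y\<bar> \<le> L'"] by blast
    have L': "L' \<ge> 0" using Z[of 0 1] by simp
    have "\<bar>?D F1 x - f x\<bar> \<le> L' * m\<^sup>2" for x
    proof -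
      \<comment> \<open>The integral of the deviation from \<open>f x\<close> over a symmetric
        window. Its derivative in the radius is a second difference, hence of order
        \<open>w^2\<close>.\<close>
      define \<psi> where "\<psi> w = F1 (x + w) - F1 (x - w) - 2 * w * f x" for w
      have d\<psi>: "(\<psi> has_real_derivative f (x + w) + f (x - w) - 2 * f x) (at w)" for w
      proof -
        have "((\<lambda>w. F1 (x + w)) has_real_derivative f (x + w) * 1) (at w)"
          by (rule DERIV_chain2[OF F1]) (auto intro!: derivative_eq_intros)
        moreover have "((\<lambda>w. F1 (x - w)) has_real_derivative f (x - w) * (-1)) (at w)"
          by (rule DERIV_chain2[OF F1]) (auto intro!: derivative_eq_intros)
        ultimately show ?thesis unfolding \<psi>_def by (auto intro!: derivative_eq_intros)
      qed
      obtain w where w: "0 < w" "w < m" "\<psi> m - \<psi> 0 = (m - 0) * (f (x + w) + f (x - w) - 2 * f x)"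
        using MVT2[of 0 m \<psi> "\<lambda>w. f (x + w) + f (x - w) - 2 * f x"] m d\<psi> by auto
      have "\<bar>f (x + w) + f (x - w) - 2 * f x\<bar> \<le> L' * w\<^sup>2" by (rule Z)
      also have "\<dots> \<le> L' * m\<^sup>2" using w L' by (intro mult_left_mono power_mono) auto
      finally have b: "\<bar>f (x + w) + f (x - w) - 2 * f x\<bar> \<le> L' * m\<^sup>2" .
      have "?D F1 x - f x = \<psi> m / (2 * m)" using m by (simp add: cdiff_def \<psi>_def field_simps)
      also have "\<dots> = (f (x + w) + f (x - w) - 2 * f x) / 2" using w(3) m by (simp add: \<psi>_def)
      finally have "\<bar>?D F1 x - f x\<bar> \<le> \<bar>f (x + w) + f (x - w) - 2 * f x\<bar>" by simp
      then show ?thesis using b by simp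
    qed
    from err[OF this, of x] show "\<bar>?D (?D (?D F3)) x - f x\<bar> \<le> 3 * L' * m\<^sup>2" by (simp only: mult.assoc)
  qed
qed

section \<open>Logarithmic variables\<close>

lemma DERIV_pos_part_power:
  "((\<lambda>x::real. (max 0 x) ^ (n + 2)) has_real_derivative real (n + 2) * (max 0 x) ^ (n + 1)) (at x)"
proof -
  consider "x > 0" | "x < 0" | "x = 0" by linarith
  then show ?thesis
  proof cases
    case 1
    have "((\<lambda>x. x ^ (n + 2)) has_real_derivative real (n + 2) * x ^ (n + 1)) (at x)"
      using DERIV_pow[of "n + 2" x] by simp
    then have "((\<lambda>x. (max 0 x) ^ (n + 2)) has_real_derivative real (n + 2) * x ^ (n + 1)) (at x)"
      by (rule has_field_derivative_transform_within_open[where S = "{0<..}"]) (use 1 in auto)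
    then show ?thesis using 1 by simp
  next
    case 2
    have "((\<lambda>x. 0) has_real_derivative 0) (at x)" by simp
    then have "((\<lambda>x. (max 0 x) ^ (n + 2)) has_real_derivative 0) (at x)"
      by (rule has_field_derivative_transform_within_open[where S = "{..<0}"]) (use 2 in auto)
    then show ?thesis using 2 by simp
  next
    case 3
    have "((\<lambda>y. (max 0 y) ^ (n + 2) / y) \<longlongrightarrow> 0) (at (0::real))"
    proof (rule Lim_null_comparison[where g = "\<lambda>y. \<bar>y\<bar> ^ (n + 1)"])
      have "norm ((max 0 y) ^ (n + 2) / y) \<le> \<bar>y\<bar> ^ (n + 1)" for y :: real
      proof (cases "y > 0")
        case False
        then have "norm ((max 0 y) ^ (n + 2) / y) = 0" by simp
        then show ?thesis using zero_le_power[OF abs_ge_zero, of y "n + 1"] by linarith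
      qed auto
      then show "\<forall>\<^sub>F y in at (0::real). norm ((max 0 y) ^ (n + 2) / y) \<le> \<bar>y\<bar> ^ (n + 1)"
        by (intro always_eventually allI)
      have "((\<lambda>y. \<bar>y\<bar> ^ (n + 1)) \<longlongrightarrow> \<bar>0::real\<bar> ^ (n + 1)) (at 0)" by (intro tendsto_intros)
      then show "((\<lambda>y. \<bar>y\<bar> ^ (n + 1)) \<longlongrightarrow> 0) (at (0::real))" by simp
    qed
    then show ?thesis using 3 by (simp add: has_field_derivative_iff)
  qed
qed

text \<open>A \<open>C\<^sup>2\<close> function on the whole line that agrees with \<open>ln\<close> on \<open>[c, \<infinity>)\<close>: test functions must be
  defined and smooth for all real \<open>S\<close>.\<close>

lemma ln_extension:
  assumes c: "c > (0::real)"
  obtains l l1 l2 where "\<And>s. (l has_real_derivative l1 s) (at s)" "\<And>s. (l1 has_real_derivative l2 s) (at s)"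
    "continuous_on UNIV l2" "\<And>s. s \<ge> c \<Longrightarrow> l s = ln s" "\<And>s. s \<ge> c \<Longrightarrow> l1 s = 1 / s" "\<And>s. s \<ge> c \<Longrightarrow> l2 s = - 1 / s\<^sup>2"
proof -
  \<comment> \<open>\<open>p\<close> is the identity from \<open>c\<close> on, and the fourth power
    joins smoothly enough at \<open>c\<close>. Below \<open>c\<close>, with
    \<open>s = c * (1 - v)\<close>, it equals \<open>c * (1 - v + v^4)\<close>, which stays
    positive, so that \<open>ln (p s)\<close> makes sense for all real \<open>s\<close>.\<close>
  define p where "p s = s + (max 0 (c - s)) ^ 4 / c ^ 3" for s
  define p1 where "p1 s = 1 - 4 * (max 0 (c - s)) ^ 3 / c ^ 3" for s
  define p2 where "p2 s = 12 * (max 0 (c - s)) ^ 2 / c ^ 3" for s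
  have D: "((\<lambda>s. (max 0 (c - s)) ^ (n + 2)) has_real_derivative real (n + 2) * (max 0 (c - s)) ^ (n + 1) * (-1)) (at s)" for n s
    by (rule DERIV_chain2[OF DERIV_pos_part_power]) (auto intro!: derivative_eq_intros)
  have dp: "(p has_real_derivative p1 s) (at s)" for s
    using DERIV_add[OF DERIV_ident DERIV_cdivide[OF D[of 2 s], of "c ^ 3"]]
    by (simp add: p_def[abs_def] p1_def)
  have dp1: "(p1 has_real_derivative p2 s) (at s)" for s
    using DERIV_diff[OF DERIV_const[of 1] DERIV_cdivide[OF DERIV_cmult[OF D[of 1 s], of 4], of "c ^ 3"]]
    by (simp add: p1_def[abs_def] p2_def numeral_eq_Suc)
  have pos: "p s > 0" for s
  proof (cases "s \<ge> c")
    case True then show ?thesis using c by (simp add: p_def)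
  next
    case False
    define v where "v = (c - s) / c"
    have v: "v > 0" "s = c * (1 - v)" "c - s = c * v" using False c by (auto simp: v_def field_simps)
    have "0 < 1 - v + v ^ 4"
    proof (cases "v < 1")
      case True then show ?thesis by (smt (verit) v(1) zero_less_power)
    next
      case False
      then have "v ^ 1 \<le> v ^ 4" by (intro power_increasing) auto
      then show ?thesis by simp
    qed
    moreover have "p s = c * (1 - v + v ^ 4)"
    proof -
      have "max 0 (c - s) = c * v" using False v by simp
      then have "p s = c * (1 - v) + (c * v) ^ 4 / c ^ 3" using v by (simp add: p_def)
      then show ?thesis using c by (simp add: power_mult_distrib field_simps eval_nat_numeral)
    qed
    ultimately show ?thesis using c by simp
  qed
  have cp: "continuous_on UNIV p" "continuous_on UNIV p1" "continuous_on UNIV p2"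
    unfolding p_def p1_def p2_def by (intro continuous_intros; use c in simp)+
  show thesis
  proof (rule that[of "\<lambda>s. ln (p s)" "\<lambda>s. p1 s / p s" "\<lambda>s. p2 s / p s - (p1 s / p s)\<^sup>2"])
    show "((\<lambda>s. ln (p s)) has_real_derivative p1 s / p s) (at s)" for s
      using DERIV_chain2[OF DERIV_ln[OF pos[of s]] dp] by (simp add: field_simps)
    have "p s \<noteq> 0" for s using pos[of s] by simp
    then show "((\<lambda>s. p1 s / p s) has_real_derivative p2 s / p s - (p1 s / p s)\<^sup>2) (at s)" for s
      using DERIV_divide[OF dp1[of s] dp[of s]] by (simp add: field_simps power2_eq_square)
    show "continuous_on UNIV (\<lambda>s. p2 s / p s - (p1 s / p s)\<^sup>2)"
      by (intro continuous_intros cp) (use pos in \<open>auto simp: less_le\<close>)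
  qed (use c in \<open>auto simp: p_def p1_def p2_def power_divide\<close>)
qed

text \<open>The part \<open>- B^2/2 * zy\<close> stems from the second derivative in
  \<open>S\<close>: multiplied by \<open>S^2\<close>, it becomes \<open>zyy - zy\<close> in the
  variable \<open>y\<close>. The coefficients \<open>c\<close> and \<open>k\<close> stay apart so
  that both equations have this form, the linear one with \<open>k = 0\<close>.\<close>

definition log_op ::
  "real \<Rightarrow> real \<Rightarrow> real \<Rightarrow> real \<Rightarrow> real \<Rightarrow> real \<Rightarrow> real \<Rightarrow> real \<Rightarrow> real \<Rightarrow> real \<Rightarrow> real \<Rightarrow> real" where
  "log_op r \<rho> B b c k zy zx zyy zyx zxx =
     (r - B\<^sup>2/2) * zy + c * zx + k * \<bar>zx\<bar> + B\<^sup>2/2 * zyy + \<rho> * B * b * zyx + b\<^sup>2/2 * zxx"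

text \<open>Discounting by \<open>e\<^sup>-\<^sup>r\<^sup>t\<close> and passing to \<open>y = ln S\<close> removes the zeroth-order term and the
  degeneracy at \<open>S = 0\<close>. Only the subsolution half is stated: the supersolution half of \<open>u\<close> is the
  subsolution half of \<open>- u\<close> with \<open>- \<kappa>\<close> for \<open>\<kappa>\<close>.\<close>

definition log_sub ::
  "real \<Rightarrow> real \<Rightarrow> real \<Rightarrow> (real \<Rightarrow> real) \<Rightarrow> (real \<Rightarrow> real \<Rightarrow> real) \<Rightarrow> (real \<Rightarrow> real \<Rightarrow> real) \<Rightarrow>
   (real \<Rightarrow> real \<Rightarrow> real) \<Rightarrow> (real \<Rightarrow> real \<Rightarrow> real \<Rightarrow> real) \<Rightarrow> bool" where
  "log_sub T r \<rho> \<beta> b c \<kappa> U \<longleftrightarrow>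
     (\<forall>z zt zy zx zyy zyx zxx y0 x0 t0 e.
        test_fun z zt zy zx zyy zyx zxx \<longrightarrow> 0 < t0 \<longrightarrow> t0 < T \<longrightarrow> e > 0 \<longrightarrow>
        (\<forall>y x t. t \<in> {0..T} \<longrightarrow> \<bar>y - y0\<bar> < e \<longrightarrow> \<bar>x - x0\<bar> < e \<longrightarrow> \<bar>t - t0\<bar> < e \<longrightarrow>
           U y x t - z y x t \<le> U y0 x0 t0 - z y0 x0 t0) \<longrightarrow>
        0 \<le> zt y0 x0 t0 + log_op r \<rho> (\<beta> x0) (b x0 t0) (c x0 t0) (\<kappa> x0 t0)
             (zy y0 x0 t0) (zx y0 x0 t0) (zyy y0 x0 t0) (zyx y0 x0 t0) (zxx y0 x0 t0))"

lemma continuous_comp3: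
  assumes "continuous_on UNIV (\<lambda>(s, x, t). f s x t)" "continuous_on UNIV l"
  shows "continuous_on UNIV (\<lambda>p. f (l (fst p)) (fst (snd p)) (snd (snd p)))"
proof -
  have "continuous_on UNIV (\<lambda>p. (\<lambda>(s, x, t). f s x t) (l (fst p), fst (snd p), snd (snd p)))"
    by (intro continuous_on_compose2[OF assms(1)] continuous_intros continuous_on_compose2[OF assms(2)]) auto
  then show ?thesis by (simp add: case_prod_beta)
qed

text \<open>Chain rule for the way back from \<open>y = ln S\<close> to \<open>S\<close>. The
  parameters \<open>k\<close> and \<open>\<sigma>\<close> are there because the test function has to
  meet \<open>u\<close> in value at the contact point, for contact from either side.\<close>

lemma test_fun_log:
  assumes z: "test_fun z zt zy zx zyy zyx zxx"
    and l: "\<And>s. (l has_real_derivative l1 s) (at s)" "\<And>s. (l1 has_real_derivative l2 s) (at s)"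
    "continuous_on UNIV l2"
  shows "test_fun (\<lambda>s x t. \<sigma> * (exp (r * t) * (z (l s) x t + k)))
    (\<lambda>s x t. \<sigma> * (exp (r * t) * (r * (z (l s) x t + k) + zt (l s) x t)))
    (\<lambda>s x t. \<sigma> * (exp (r * t) * (zy (l s) x t * l1 s)))
    (\<lambda>s x t. \<sigma> * (exp (r * t) * zx (l s) x t))
    (\<lambda>s x t. \<sigma> * (exp (r * t) * (zyy (l s) x t * (l1 s)\<^sup>2 + zy (l s) x t * l2 s)))
    (\<lambda>s x t. \<sigma> * (exp (r * t) * (zyx (l s) x t * l1 s)))
    (\<lambda>s x t. \<sigma> * (exp (r * t) * zxx (l s) x t))"
proof -
  have zd: "((\<lambda>t'. z s x t') has_real_derivative zt s x t) (at t)"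
     "((\<lambda>s'. z s' x t) has_real_derivative zy s x t) (at s)"
     "((\<lambda>x'. z s x' t) has_real_derivative zx s x t) (at x)"
     "((\<lambda>s'. zy s' x t) has_real_derivative zyy s x t) (at s)"
     "((\<lambda>x'. zy s x' t) has_real_derivative zyx s x t) (at x)"
     "((\<lambda>x'. zx s x' t) has_real_derivative zxx s x t) (at x)" for s x t
    using z unfolding test_fun_def by blast+
  have zc: "continuous_on UNIV (\<lambda>(s, x, t). f s x t)" if "f \<in> {z, zt, zy, zx, zyy, zyx, zxx}" for f
    using z that unfolding test_fun_def by blast
  have cl: "continuous_on UNIV l" "continuous_on UNIV l1"
    using l by (meson DERIV_isCont continuous_at_imp_continuous_on)+
  have cc: "continuous_on UNIV (\<lambda>p. f (l (fst p)) (fst (snd p)) (snd (snd p)))"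
    if "f \<in> {z, zt, zy, zx, zyy, zyx, zxx}" for f
    by (rule continuous_comp3[OF zc[OF that] cl(1)])
  have c1: "continuous_on UNIV (\<lambda>p::real\<times>real\<times>real. l1 (fst p))" "continuous_on UNIV (\<lambda>p::real\<times>real\<times>real. l2 (fst p))"
    by (intro continuous_on_compose2[OF cl(2)] continuous_on_compose2[OF l(3)] continuous_intros; simp)+
  show ?thesis
    unfolding test_fun_def
  proof (intro conjI allI ballI)
    fix s x t :: real
    show "((\<lambda>t'. \<sigma> * (exp (r * t') * (z (l s) x t' + k))) has_real_derivative
        \<sigma> * (exp (r * t) * (r * (z (l s) x t + k) + zt (l s) x t))) (at t)"
      by (auto intro!: derivative_eq_intros zd simp: algebra_simps)
    show "((\<lambda>s'. \<sigma> * (exp (r * t) * (z (l s') x t + k))) has_real_derivative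
        \<sigma> * (exp (r * t) * (zy (l s) x t * l1 s))) (at s)"
      by (auto intro!: derivative_eq_intros DERIV_chain2[OF zd(2) l(1)])
    show "((\<lambda>x'. \<sigma> * (exp (r * t) * (z (l s) x' t + k))) has_real_derivative
        \<sigma> * (exp (r * t) * zx (l s) x t)) (at x)"
      by (auto intro!: derivative_eq_intros zd)
    show "((\<lambda>s'. \<sigma> * (exp (r * t) * (zy (l s') x t * l1 s'))) has_real_derivative
        \<sigma> * (exp (r * t) * (zyy (l s) x t * (l1 s)\<^sup>2 + zy (l s) x t * l2 s))) (at s)"
      by (auto intro!: derivative_eq_intros DERIV_chain2[OF zd(4) l(1)] l simp: algebra_simps power2_eq_square)
    show "((\<lambda>x'. \<sigma> * (exp (r * t) * (zy (l s) x' t * l1 s))) has_real_derivative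
        \<sigma> * (exp (r * t) * (zyx (l s) x t * l1 s))) (at x)"
      by (auto intro!: derivative_eq_intros zd)
    show "((\<lambda>x'. \<sigma> * (exp (r * t) * zx (l s) x' t)) has_real_derivative
        \<sigma> * (exp (r * t) * zxx (l s) x t)) (at x)"
      by (auto intro!: derivative_eq_intros zd)
  next
    fix f assume "f \<in> {\<lambda>s x t. \<sigma> * (exp (r * t) * (z (l s) x t + k)),
       \<lambda>s x t. \<sigma> * (exp (r * t) * (r * (z (l s) x t + k) + zt (l s) x t)),
       \<lambda>s x t. \<sigma> * (exp (r * t) * (zy (l s) x t * l1 s)),
       \<lambda>s x t. \<sigma> * (exp (r * t) * zx (l s) x t),
       \<lambda>s x t. \<sigma> * (exp (r * t) * (zyy (l s) x t * (l1 s)\<^sup>2 + zy (l s) x t * l2 s)),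
       \<lambda>s x t. \<sigma> * (exp (r * t) * (zyx (l s) x t * l1 s)),
       \<lambda>s x t. \<sigma> * (exp (r * t) * zxx (l s) x t)}"
    then show "continuous_on UNIV (\<lambda>(s, x, t). f s x t)"
      unfolding case_prod_beta
      by (elim insertE emptyE; hypsubst) (intro continuous_intros cc c1; simp)+
  qed
qed

lemma visc_sol_log:
  assumes vs: "visc_sol T r \<rho> \<beta> b c \<kappa> g u" and \<sigma>: "\<sigma> \<in> {1, -1}"
  shows "log_sub T r \<rho> \<beta> b c (\<lambda>x t. \<sigma> * \<kappa> x t) (\<lambda>y x t. \<sigma> * (exp (- r * t) * u (exp y) x t))"
  unfolding log_sub_def
proof (intro allI impI)
  fix z zt zy zx zyy zyx zxx and y0 x0 t0 e :: real
  let ?U = "\<lambda>y x t. \<sigma> * (exp (- r * t) * u (exp y) x t)"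
  assume z: "test_fun z zt zy zx zyy zyx zxx" and t0: "0 < t0" "t0 < T" and e: "e > 0"
    and mx: "\<forall>y x t. t \<in> {0..T} \<longrightarrow> \<bar>y - y0\<bar> < e \<longrightarrow> \<bar>x - x0\<bar> < e \<longrightarrow> \<bar>t - t0\<bar> < e \<longrightarrow>
           ?U y x t - z y x t \<le> ?U y0 x0 t0 - z y0 x0 t0"
  define s0 where "s0 = exp y0"
  \<comment> \<open>Makes the test function equal to \<open>u\<close> at the contact point. Then the
    term \<open>r * (z + k)\<close>, produced by differentiating \<open>exp (r * t)\<close>, cancels
    the zeroth-order term of \<open>pde_op\<close>, into which the value of \<open>u\<close> itself
    is inserted.\<close>
  define k where "k = ?U y0 x0 t0 - z y0 x0 t0"
  have s0: "s0 > 0" "ln s0 = y0" by (auto simp: s0_def)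
  obtain l l1 l2 where l: "\<And>s. (l has_real_derivative l1 s) (at s)" "\<And>s. (l1 has_real_derivative l2 s) (at s)"
    "continuous_on UNIV l2" "\<And>s. s \<ge> s0/2 \<Longrightarrow> l s = ln s" "\<And>s. s \<ge> s0/2 \<Longrightarrow> l1 s = 1 / s" "\<And>s. s \<ge> s0/2 \<Longrightarrow> l2 s = - 1 / s\<^sup>2"
    using ln_extension[of "s0/2"] s0 by auto
  have ls0: "l s0 = y0" "l1 s0 = 1 / s0" "l2 s0 = - 1 / s0\<^sup>2" using l(4-6)[of s0] s0 by auto
  define \<phi> where "\<phi> = (\<lambda>s x t. \<sigma> * (exp (r * t) * (z (l s) x t + k)))"
  have \<sigma>2: "\<sigma> * (\<sigma> * w) = w" for w using \<sigma> by auto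
  obtain d where d: "d > 0" "\<And>s. \<bar>s - s0\<bar> < d \<Longrightarrow> \<bar>ln s - y0\<bar> < e"
  proof -
    have "isCont ln s0" using s0 by (intro isCont_ln) auto
    then obtain d where "d > 0" "\<And>s. dist s s0 < d \<Longrightarrow> dist (ln s) (ln s0) < e"
      using e unfolding continuous_at_eps_delta by (metis dist_commute)
    then show ?thesis using that[of d] s0 by (auto simp: dist_real_def)
  qed
  \<comment> \<open>The bound \<open>s0/2\<close> keeps \<open>s\<close> in the range where
    \<open>l\<close> is the logarithm.\<close>
  define d' where "d' = min (min d e) (s0/2)"
  have d': "d' > 0" using d e s0 by (simp add: d'_def)
  have ineq: "\<sigma> * (u s x t - \<phi> s x t) \<le> 0"
    if "(s, x, t) \<in> dom3 T" "\<bar>s - s0\<bar> < d'" "\<bar>x - x0\<bar> < d'" "\<bar>t - t0\<bar> < d'" for s x t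
  proof -
    have "d' \<le> s0/2" by (simp add: d'_def)
    then have s: "s > 0" "s \<ge> s0/2" "t \<in> {0..T}" using that by (auto simp: dom3_def)
    have "?U (ln s) x t - z (ln s) x t \<le> k"
      unfolding k_def using mx[rule_format, of t "ln s" x] d(2)[of s] that s by (auto simp: d'_def)
    then have A: "exp (r * t) * (\<sigma> * (exp (- r * t) * u s x t)) \<le> exp (r * t) * (z (ln s) x t + k)"
      using s by (intro mult_left_mono) auto
    have "exp (r * t) * (\<sigma> * (exp (- r * t) * u s x t)) = (exp (r * t) * exp (- r * t)) * (\<sigma> * u s x t)"
      by (simp only: mult_ac)
    also have "exp (r * t) * exp (- r * t) = 1" by (simp add: exp_minus)
    finally have B: "exp (r * t) * (\<sigma> * (exp (- r * t) * u s x t)) = \<sigma> * u s x t" by simp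
    have "\<sigma> * u s x t \<le> exp (r * t) * (z (ln s) x t + k)" using A unfolding B .
    then show ?thesis unfolding \<phi>_def l(4)[OF s(2)] right_diff_distrib \<sigma>2 by simp
  qed
  have eq0: "\<sigma> * (u s0 x0 t0 - \<phi> s0 x0 t0) = 0"
  proof -
    have "\<phi> s0 x0 t0 = \<sigma> * (exp (r * t0) * ?U y0 x0 t0)" by (simp add: \<phi>_def ls0 k_def)
    also have "\<dots> = exp (r * t0) * exp (- r * t0) * (\<sigma> * (\<sigma> * u (exp y0) x0 t0))" by (simp add: mult_ac)
    also have "\<dots> = u s0 x0 t0" by (simp add: \<sigma>2 s0_def exp_minus)
    finally show ?thesis by simp
  qed
  have vsD: "(loc_max_dom T (\<lambda>s x t. u s x t - \<phi> s x t) s0 x0 t0 \<longrightarrow>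
           pde_op r \<rho> \<beta> b c \<kappa> s0 x0 t0 (u s0 x0 t0) (\<phi>t s0 x0 t0) (\<phi>S s0 x0 t0)
             (\<phi>x s0 x0 t0) (\<phi>SS s0 x0 t0) (\<phi>Sx s0 x0 t0) (\<phi>xx s0 x0 t0) \<ge> 0) \<and>
        (loc_min_dom T (\<lambda>s x t. u s x t - \<phi> s x t) s0 x0 t0 \<longrightarrow>
           pde_op r \<rho> \<beta> b c \<kappa> s0 x0 t0 (u s0 x0 t0) (\<phi>t s0 x0 t0) (\<phi>S s0 x0 t0)
             (\<phi>x s0 x0 t0) (\<phi>SS s0 x0 t0) (\<phi>Sx s0 x0 t0) (\<phi>xx s0 x0 t0) \<le> 0)"
    if "test_fun \<phi> \<phi>t \<phi>S \<phi>x \<phi>SS \<phi>Sx \<phi>xx" for \<phi>t \<phi>S \<phi>x \<phi>SS \<phi>Sx \<phi>xx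
    using vs that s0 t0 unfolding visc_sol_def by blast
  note tf = test_fun_log[OF z l(1-3), of \<sigma> r k]
  have "0 \<le> \<sigma> * pde_op r \<rho> \<beta> b c \<kappa> s0 x0 t0 (u s0 x0 t0)
      (\<sigma> * (exp (r * t0) * (r * (z (l s0) x0 t0 + k) + zt (l s0) x0 t0)))
      (\<sigma> * (exp (r * t0) * (zy (l s0) x0 t0 * l1 s0)))
      (\<sigma> * (exp (r * t0) * zx (l s0) x0 t0))
      (\<sigma> * (exp (r * t0) * (zyy (l s0) x0 t0 * (l1 s0)\<^sup>2 + zy (l s0) x0 t0 * l2 s0)))
      (\<sigma> * (exp (r * t0) * (zyx (l s0) x0 t0 * l1 s0)))
      (\<sigma> * (exp (r * t0) * zxx (l s0) x0 t0))"
  proof -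
    consider "\<sigma> = 1" | "\<sigma> = -1" using \<sigma> by auto
    then show ?thesis
    proof cases
      case 1
      have "loc_max_dom T (\<lambda>s x t. u s x t - \<phi> s x t) s0 x0 t0" unfolding loc_max_dom_def
        using ineq eq0 d' 1 by (intro exI[of _ d']) fastforce
      then show ?thesis using vsD[OF tf[folded \<phi>_def]] 1 by simp
    next
      case 2
      have "loc_min_dom T (\<lambda>s x t. u s x t - \<phi> s x t) s0 x0 t0" unfolding loc_min_dom_def loc_max_dom_def
        using ineq eq0 d' 2 by (intro exI[of _ d']) fastforce
      then show ?thesis using vsD[OF tf[folded \<phi>_def]] 2 by simp
    qed
  qed
  also have "\<dots> = exp (r * t0) * (zt y0 x0 t0 + log_op r \<rho> (\<beta> x0) (b x0 t0) (c x0 t0) (\<sigma> * \<kappa> x0 t0)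
             (zy y0 x0 t0) (zx y0 x0 t0) (zyy y0 x0 t0) (zyx y0 x0 t0) (zxx y0 x0 t0))" (is "?l = ?r")
  proof -
    define E where "E = exp (r * t0)"
    have E: "E > 0" by (simp add: E_def)
    have u0: "u s0 x0 t0 = \<sigma> * (E * (z y0 x0 t0 + k))"
      using eq0 \<sigma> by (auto simp: \<phi>_def E_def ls0)
    have s1: "s0 * (\<sigma> * (E * (w * (1 / s0)))) = \<sigma> * (E * w)"
      "s0\<^sup>2 * (\<sigma> * (E * (w * (1 / s0)\<^sup>2 + v * (- 1 / s0\<^sup>2)))) = \<sigma> * (E * (w - v))" for w v
      using s0 by (auto simp: field_simps power2_eq_square)
    have a: "\<bar>\<sigma> * (E * w)\<bar> = E * \<bar>w\<bar>" for w using \<sigma> E by (auto simp: abs_mult)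
    have "?l = \<sigma> * (\<sigma> * (E * (r * (z y0 x0 t0 + k) + zt y0 x0 t0)) + r * (\<sigma> * (E * zy y0 x0 t0))
       + c x0 t0 * (\<sigma> * (E * zx y0 x0 t0)) + \<kappa> x0 t0 * (E * \<bar>zx y0 x0 t0\<bar>)
       + 1/2 * (\<beta> x0)\<^sup>2 * (\<sigma> * (E * (zyy y0 x0 t0 - zy y0 x0 t0)))
       + \<rho> * \<beta> x0 * b x0 t0 * (\<sigma> * (E * zyx y0 x0 t0)) + 1/2 * (b x0 t0)\<^sup>2 * (\<sigma> * (E * zxx y0 x0 t0))
       - r * (\<sigma> * (E * (z y0 x0 t0 + k))))"
      unfolding pde_op_def ls0 E_def[symmetric] u0 a
      by (simp only: s1 mult.assoc)
    also have "\<dots> = ?r" using \<sigma> unfolding E_def[symmetric] log_op_def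
      by (auto simp: algebra_simps)
    finally show ?thesis .
  qed
  finally show "0 \<le> zt y0 x0 t0 + log_op r \<rho> (\<beta> x0) (b x0 t0) (c x0 t0) (\<sigma> * \<kappa> x0 t0)
             (zy y0 x0 t0) (zx y0 x0 t0) (zyy y0 x0 t0) (zyx y0 x0 t0) (zxx y0 x0 t0)"
    by (simp add: zero_le_mult_iff)
qed

section \<open>The binomial scheme\<close>

text \<open>\<open>F i j\<close> stands for \<open>\<partial>\<^sub>y\<^sup>i \<partial>\<^sub>x\<^sup>j\<close> of \<open>F 0 0\<close>, for \<open>i + j \<le> 3\<close>.\<close>

definition jet3 :: "(nat \<Rightarrow> nat \<Rightarrow> real \<Rightarrow> real \<Rightarrow> real) \<Rightarrow> bool" where
  "jet3 F \<longleftrightarrow> (\<forall>i j y x. i + j \<le> 2 \<longrightarrow> ((\<lambda>p. F i j (fst p) (snd p)) has_derivative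
     (\<lambda>h. F (Suc i) j y x * fst h + F i (Suc j) y x * snd h)) (at (y, x)))"

lemma jet3D:
  assumes "jet3 F" "i + j \<le> 2"
  shows "((\<lambda>p. F i j (fst p) (snd p)) has_derivative
     (\<lambda>h. F (Suc i) j y x * fst h + F i (Suc j) y x * snd h)) (at (y, x))"
  using assms by (auto simp: jet3_def)

lemma jet3_line:
  assumes "jet3 F" "i + j \<le> 2"
  shows "((\<lambda>s. F i j (y + s * a) (x + s * c)) has_real_derivative
     F (Suc i) j (y + s * a) (x + s * c) * a + F i (Suc j) (y + s * a) (x + s * c) * c) (at s)"
proof -
  have "((\<lambda>s. (y + s * a, x + s * c)) has_derivative (\<lambda>h. (h * a, h * c))) (at s)"
    by (auto intro!: derivative_eq_intros)
  from diff_chain_at[OF this jet3D[OF assms], unfolded o_def fst_conv snd_conv]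
  show ?thesis unfolding has_field_derivative_def
    by (rule has_derivative_eq_rhs) (simp add: fun_eq_iff algebra_simps)
qed

lemma jet3_DERIV:
  assumes "jet3 F" "i + j \<le> 2"
  shows "((\<lambda>y. F i j y x) has_real_derivative F (Suc i) j y x) (at y)"
    and "((\<lambda>x. F i j y x) has_real_derivative F i (Suc j) y x) (at x)"
proof -
  have "((\<lambda>s. F i j (0 + s * 1) (x + s * 0)) has_real_derivative
     F (Suc i) j (0 + y * 1) (x + y * 0) * 1 + F i (Suc j) (0 + y * 1) (x + y * 0) * 0) (at y)"
    by (rule jet3_line[OF assms])
  then show "((\<lambda>y. F i j y x) has_real_derivative F (Suc i) j y x) (at y)" by simp
  have "((\<lambda>s. F i j (y + s * 0) (0 + s * 1)) has_real_derivative
     F (Suc i) j (y + x * 0) (0 + x * 1) * 0 + F i (Suc j) (y + x * 0) (0 + x * 1) * 1) (at x)"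
    by (rule jet3_line[OF assms])
  then show "((\<lambda>x. F i j y x) has_real_derivative F i (Suc j) y x) (at x)" by simp
qed

lemma jet3_continuous:
  assumes "jet3 F" "i + j \<le> 2"
  shows "continuous_on UNIV (\<lambda>p. F i j (fst p) (snd p))"
  using has_derivative_continuous[OF jet3D[OF assms]]
  by (auto intro!: continuous_at_imp_continuous_on)

text \<open>Jet of \<open>f (y + P x) (x + Q x)\<close>; \<open>P k\<close> and \<open>Q k\<close> are the \<open>k\<close>-th derivatives of the shifts.\<close>

definition shift_jet ::
  "(nat \<Rightarrow> nat \<Rightarrow> real \<Rightarrow> real \<Rightarrow> real) \<Rightarrow> (nat \<Rightarrow> real \<Rightarrow> real) \<Rightarrow> (nat \<Rightarrow> real \<Rightarrow> real) \<Rightarrow>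
   nat \<Rightarrow> nat \<Rightarrow> real \<Rightarrow> real \<Rightarrow> real" where
  "shift_jet F P Q i j y x = (let G = (\<lambda>i j. F i j (y + P 0 x) (x + Q 0 x)); p = P 1 x; q = 1 + Q 1 x in
     if j = 0 then G i 0
     else if j = 1 then G (i+1) 0 * p + G i 1 * q
     else if j = 2 then G (i+2) 0 * p\<^sup>2 + 2 * G (i+1) 1 * p * q + G i 2 * q\<^sup>2 + G (i+1) 0 * P 2 x + G i 1 * Q 2 x
     else G (i+3) 0 * p^3 + 3 * G (i+2) 1 * p\<^sup>2 * q + 3 * G (i+1) 2 * p * q\<^sup>2 + G i 3 * q^3
       + 3 * (G (i+2) 0 * p * P 2 x + G (i+1) 1 * (p * Q 2 x + P 2 x * q) + G i 2 * q * Q 2 x)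
       + G (i+1) 0 * P 3 x + G i 1 * Q 3 x)"

lemma jet3_shift:
  assumes F: "jet3 F" and P: "\<And>k x. k < 3 \<Longrightarrow> (P k has_real_derivative P (Suc k) x) (at x)"
    and Q: "\<And>k x. k < 3 \<Longrightarrow> (Q k has_real_derivative Q (Suc k) x) (at x)"
  shows "jet3 (shift_jet F P Q)"
  unfolding jet3_def
proof (intro allI impI)
  fix i j :: nat and y x :: real
  assume ij: "i + j \<le> 2"
  have snd': "((\<lambda>p. f (snd p)) has_derivative (\<lambda>h. f' * snd h)) (at (y, x))"
    if "(f has_real_derivative f') (at x)" for f f'
  proof -
    have "(snd has_derivative snd) (at (y, x))" by (auto intro!: derivative_eq_intros)
    from diff_chain_at[OF this, of f "\<lambda>h. f' * h"] that show ?thesis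
      by (simp add: has_field_derivative_def o_def)
  qed
  note PQ = snd'[OF P] snd'[OF Q]
  have "(P 1 has_real_derivative P 2 x) (at x)" "(Q 1 has_real_derivative Q 2 x) (at x)"
    "(P 2 has_real_derivative P 3 x) (at x)" "(Q 2 has_real_derivative Q 3 x) (at x)"
    using P[of 1 x] Q[of 1 x] P[of 2 x] Q[of 2 x] by (simp_all add: numeral_2_eq_2 numeral_3_eq_3)
  note PQ' = this[THEN snd']
  have GD: "((\<lambda>p. F i j (fst p + P 0 (snd p)) (snd p + Q 0 (snd p))) has_derivative
     (\<lambda>h. F (Suc i) j (y + P 0 x) (x + Q 0 x) * fst h +
       (F (Suc i) j (y + P 0 x) (x + Q 0 x) * P 1 x + F i (Suc j) (y + P 0 x) (x + Q 0 x) * (1 + Q 1 x)) * snd h)) (at (y, x))"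
    if "i + j \<le> 2" for i j
  proof -
    have "((\<lambda>p. (fst p + P 0 (snd p), snd p + Q 0 (snd p))) has_derivative (\<lambda>h. (fst h + P 1 x * snd h, snd h + Q 1 x * snd h))) (at (y, x))"
      by (auto intro!: derivative_eq_intros PQ)
    from diff_chain_at[OF this, unfolded fst_conv snd_conv, OF jet3D[OF F that], unfolded o_def fst_conv snd_conv]
    show ?thesis by (rule has_derivative_eq_rhs) (simp add: fun_eq_iff algebra_simps)
  qed
  consider "j = 0" | "j = 1" "i \<le> 1" | "j = 2" "i = 0" using ij by linarith
  then show "((\<lambda>p. shift_jet F P Q i j (fst p) (snd p)) has_derivative
     (\<lambda>h. shift_jet F P Q (Suc i) j y x * fst h + shift_jet F P Q i (Suc j) y x * snd h)) (at (y, x))"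
  proof cases
    case 1
    then show ?thesis using GD[of i 0] ij by (simp add: shift_jet_def Let_def)
  next
    case 2
    have h: "Suc i + 0 \<le> 2" "i + 1 \<le> 2" using 2 by auto
    note D = GD[OF h(1)] GD[OF h(2)] PQ'
    have "((\<lambda>p. F (Suc i) 0 (fst p + P 0 (snd p)) (snd p + Q 0 (snd p)) * P 1 (snd p) +
        F i 1 (fst p + P 0 (snd p)) (snd p + Q 0 (snd p)) * (1 + Q 1 (snd p))) has_derivative
        (\<lambda>h. shift_jet F P Q (Suc i) j y x * fst h + shift_jet F P Q i (Suc j) y x * snd h)) (at (y, x))"
      by (rule has_derivative_eq_rhs, (rule derivative_intros D)+)
        (use 2 in \<open>simp_all add: shift_jet_def Let_def fun_eq_iff algebra_simps power2_eq_square numeral_2_eq_2\<close>)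
    then show ?thesis using 2 by (simp add: shift_jet_def Let_def)
  next
    case 3
    have h: "2 + 0 \<le> (2::nat)" "1 + 1 \<le> (2::nat)" "0 + 2 \<le> (2::nat)" "1 + 0 \<le> (2::nat)" "0 + 1 \<le> (2::nat)" by auto
    note D = h[THEN GD] PQ'
    let ?G = "\<lambda>i j p. F i j (fst p + P 0 (snd p)) (snd p + Q 0 (snd p))"
    have "((\<lambda>p. ?G 2 0 p * (P 1 (snd p) * P 1 (snd p)) + 2 * ?G 1 1 p * P 1 (snd p) * (1 + Q 1 (snd p)) +
          ?G 0 2 p * ((1 + Q 1 (snd p)) * (1 + Q 1 (snd p))) + ?G 1 0 p * P 2 (snd p) + ?G 0 1 p * Q 2 (snd p)) has_derivative
        (\<lambda>h. shift_jet F P Q (Suc i) j y x * fst h + shift_jet F P Q i (Suc j) y x * snd h)) (at (y, x))"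
      by (rule has_derivative_eq_rhs, (rule derivative_intros D)+)
        (use 3 in \<open>simp_all add: shift_jet_def Let_def fun_eq_iff algebra_simps power2_eq_square power3_eq_cube eval_nat_numeral\<close>)
    then show ?thesis using 3 by (simp add: shift_jet_def Let_def eval_nat_numeral)
  qed
qed

section \<open>Averages over two independent random signs, and their moments\<close>

definition avg :: "(real \<Rightarrow> real \<Rightarrow> real) \<Rightarrow> real" where
  "avg g = (g 1 1 + g 1 (-1) + g (-1) 1 + g (-1) (-1)) / 4"

lemma jet3_avg:
  assumes "\<And>z e. jet3 (F z e)"
  shows "jet3 (\<lambda>i j y x. avg (\<lambda>z e. F z e i j y x))"
  unfolding jet3_def
proof (intro allI impI)
  fix i j :: nat and y x :: real
  assume ij: "i + j \<le> 2"
  note D = jet3D[OF assms ij]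
  show "((\<lambda>p. avg (\<lambda>z e. F z e i j (fst p) (snd p))) has_derivative
        (\<lambda>h. avg (\<lambda>z e. F z e (Suc i) j y x) * fst h + avg (\<lambda>z e. F z e i (Suc j) y x) * snd h)) (at (y, x))"
    unfolding avg_def
    by (rule has_derivative_eq_rhs, (rule derivative_intros D)+) (simp_all add: fun_eq_iff field_simps)
qed

lemma avg_add: "avg (\<lambda>z e. g z e + h z e) = avg g + avg h" by (simp add: avg_def add_divide_distrib)
lemma avg_diff: "avg (\<lambda>z e. g z e - h z e) = avg g - avg h" by (simp add: avg_def add_divide_distrib diff_divide_distrib)
lemma avg_cmult: "avg (\<lambda>z e. c * g z e) = c * avg g" by (simp add: avg_def algebra_simps)
lemma avg_const: "avg (\<lambda>z e. c) = c" by (simp add: avg_def)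

lemma avg_mono:
  assumes "\<And>z e. \<bar>z\<bar> = 1 \<Longrightarrow> \<bar>e\<bar> = 1 \<Longrightarrow> g z e \<le> h z e"
  shows "avg g \<le> avg h"
  using assms[of 1 1] assms[of 1 "-1"] assms[of "-1" 1] assms[of "-1" "-1"] by (simp add: avg_def)

lemma avg_abs_le_avg:
  assumes "\<And>z e. \<bar>z\<bar> = 1 \<Longrightarrow> \<bar>e\<bar> = 1 \<Longrightarrow> \<bar>g z e\<bar> \<le> h z e"
  shows "\<bar>avg g\<bar> \<le> avg h"
  using assms[of 1 1, simplified] assms[of 1 "-1", simplified] assms[of "-1" 1, simplified]
    assms[of "-1" "-1", simplified] unfolding avg_def by (smt (verit) field_sum_of_halves divide_right_mono minus_divide_left)

lemma avg_abs_le: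
  assumes "\<And>z e. \<bar>z\<bar> = 1 \<Longrightarrow> \<bar>e\<bar> = 1 \<Longrightarrow> \<bar>g z e\<bar> \<le> c"
  shows "\<bar>avg g\<bar> \<le> c"
  using avg_abs_le_avg[of g "\<lambda>_ _. c"] assms by (simp add: avg_const)

text \<open>Mean 0, variance 1 and covariance \<open>\<rho>\<close> with \<open>z\<close>: scaled by
  \<open>\<epsilon>\<close>, \<open>xi\<close> and \<open>z\<close> imitate the increments of the
  two correlated Brownian motions.\<close>

definition xi :: "real \<Rightarrow> real \<Rightarrow> real \<Rightarrow> real" where
  "xi \<rho> z e = \<rho> * z + sqrt (1 - \<rho>\<^sup>2) * e"

lemma avg_lin: "avg (\<lambda>z e. a + b * xi \<rho> z e + c * z) = a"
  by (simp add: avg_def xi_def algebra_simps)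

lemma avg_quad:
  assumes "\<bar>\<rho>\<bar> \<le> 1"
  shows "avg (\<lambda>z e. (a + b * xi \<rho> z e + c * z) * (a' + b' * xi \<rho> z e + c' * z)) =
    a * a' + b * b' + c * c' + \<rho> * (b * c' + b' * c)"
proof -
  define s where "s = sqrt (1 - \<rho>\<^sup>2)"
  have "\<rho>\<^sup>2 \<le> 1" using assms by (simp add: abs_square_le_1)
  then have s: "s * s = 1 - \<rho> * \<rho>" by (simp add: s_def flip: power2_eq_square)
  have "avg (\<lambda>z e. (a + b * (\<rho> * z + s * e) + c * z) * (a' + b' * (\<rho> * z + s * e) + c' * z)) =
    a * a' + b * b' * (\<rho> * \<rho> + s * s) + c * c' + \<rho> * (b * c' + b' * c)"
    by (simp add: avg_def field_simps)
  then show ?thesis by (simp add: xi_def s flip: s_def)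
qed

lemma abs_xi_le: assumes "\<bar>\<rho>\<bar> \<le> 1" "\<bar>z\<bar> = 1" "\<bar>e\<bar> = 1" shows "\<bar>xi \<rho> z e\<bar> \<le> 2"
proof -
  have "\<rho>\<^sup>2 \<le> 1" using assms by (simp add: abs_square_le_1)
  then have "sqrt (1 - \<rho>\<^sup>2) \<le> 1" "0 \<le> sqrt (1 - \<rho>\<^sup>2)" by auto
  then have "\<bar>\<rho> * z\<bar> \<le> 1" "\<bar>sqrt (1 - \<rho>\<^sup>2) * e\<bar> \<le> 1" using assms by (auto simp: abs_mult)
  then show ?thesis unfolding xi_def by linarith
qed

lemma abs_mult_le: "\<bar>a\<bar> \<le> A \<Longrightarrow> \<bar>b\<bar> \<le> B \<Longrightarrow> \<bar>a * b\<bar> \<le> A * (B::real)"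
  by (simp add: abs_mult mult_mono')

lemma abs_add4_le:
  "\<bar>a\<bar> \<le> A \<Longrightarrow> \<bar>b\<bar> \<le> B \<Longrightarrow> \<bar>c\<bar> \<le> C \<Longrightarrow> \<bar>d\<bar> \<le> D \<Longrightarrow> A + B + C + D \<le> E \<Longrightarrow> \<bar>a + b + c + d\<bar> \<le> (E::real)"
  by (auto simp: abs_le_iff)

lemma abs_add3_le:
  "\<bar>a\<bar> \<le> A \<Longrightarrow> \<bar>b\<bar> \<le> B \<Longrightarrow> \<bar>c\<bar> \<le> C \<Longrightarrow> \<bar>a + b + c\<bar> \<le> A + B + (C::real)"
  by (auto simp: abs_le_iff)

lemma abs_add2_le: "\<bar>a\<bar> \<le> A \<Longrightarrow> \<bar>b\<bar> \<le> B \<Longrightarrow> \<bar>a + b\<bar> \<le> A + (B::real)"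
  by (auto simp: abs_le_iff)

text \<open>The directional derivatives of odd order are compared with \<open>1 + \<bar>h\<bar>\<^sup>2\<close> and \<open>\<bar>h\<bar>\<^sup>2 + \<bar>h\<bar>\<^sup>4\<close> because the
  random linear map by which one step of the scheme moves \<open>h\<close> increases the mean of even powers of \<open>\<bar>h\<bar>\<close>
  only by a factor \<open>1 + O(\<tau>)\<close>, whereas it moves \<open>h\<close> itself by \<open>O(\<epsilon>)\<close>.\<close>

definition jet_bd :: "(nat \<Rightarrow> nat \<Rightarrow> real \<Rightarrow> real \<Rightarrow> real) \<Rightarrow> real \<Rightarrow> real \<Rightarrow> real \<Rightarrow> bool" where
  "jet_bd F N1 N2 N3 \<longleftrightarrow> (\<forall>y x v w.
     2 * \<bar>F 1 0 y x * v + F 0 1 y x * w\<bar> \<le> N1 * (1 + (v\<^sup>2 + w\<^sup>2)) \<and>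
     \<bar>F 2 0 y x * v\<^sup>2 + 2 * F 1 1 y x * v * w + F 0 2 y x * w\<^sup>2\<bar> \<le> N2 * (v\<^sup>2 + w\<^sup>2) \<and>
     2 * \<bar>F 3 0 y x * v^3 + 3 * F 2 1 y x * v\<^sup>2 * w + 3 * F 1 2 y x * v * w\<^sup>2 + F 0 3 y x * w^3\<bar>
       \<le> N3 * ((v\<^sup>2 + w\<^sup>2) + (v\<^sup>2 + w\<^sup>2)\<^sup>2))"

lemma jet_bdD:
  assumes "jet_bd F N1 N2 N3"
  shows "2 * \<bar>F 1 0 y x * v + F 0 1 y x * w\<bar> \<le> N1 * (1 + (v\<^sup>2 + w\<^sup>2))"
     "\<bar>F 2 0 y x * v\<^sup>2 + 2 * F 1 1 y x * v * w + F 0 2 y x * w\<^sup>2\<bar> \<le> N2 * (v\<^sup>2 + w\<^sup>2)"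
     "2 * \<bar>F 3 0 y x * v^3 + 3 * F 2 1 y x * v\<^sup>2 * w + 3 * F 1 2 y x * v * w\<^sup>2 + F 0 3 y x * w^3\<bar>
       \<le> N3 * ((v\<^sup>2 + w\<^sup>2) + (v\<^sup>2 + w\<^sup>2)\<^sup>2)"
  using assms unfolding jet_bd_def by blast+

text \<open>Polarisation: the forms are evaluated at \<open>(1,0)\<close>, \<open>(0,1)\<close>,
  \<open>(1,1)\<close> and \<open>(1,-1)\<close>, and sums and differences isolate the mixed
  coefficients. At third order this yields the factor 4/3, rounded up to 2.\<close>

lemma jet_bd_comp:
  assumes "jet_bd F N1 N2 N3"
  shows "\<bar>F 1 0 y x\<bar> \<le> N1" "\<bar>F 0 1 y x\<bar> \<le> N1"
    "\<bar>F 2 0 y x\<bar> \<le> N2" "\<bar>F 1 1 y x\<bar> \<le> N2" "\<bar>F 0 2 y x\<bar> \<le> N2"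
    "\<bar>F 3 0 y x\<bar> \<le> 2 * N3" "\<bar>F 2 1 y x\<bar> \<le> 2 * N3" "\<bar>F 1 2 y x\<bar> \<le> 2 * N3" "\<bar>F 0 3 y x\<bar> \<le> 2 * N3"
    "0 \<le> N1" "0 \<le> N2" "0 \<le> N3"
proof -
  note D = jet_bdD[OF assms, of y x]
  show "\<bar>F 1 0 y x\<bar> \<le> N1" "\<bar>F 0 1 y x\<bar> \<le> N1" using D(1)[of 1 0] D(1)[of 0 1] by auto
  show "\<bar>F 2 0 y x\<bar> \<le> N2" "\<bar>F 0 2 y x\<bar> \<le> N2" using D(2)[of 1 0] D(2)[of 0 1] by auto
  show "\<bar>F 1 1 y x\<bar> \<le> N2" using D(2)[of 1 1] D(2)[of 1 "-1"] by (simp add: abs_le_iff)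
  have 3: "2 * \<bar>F 3 0 y x\<bar> \<le> N3 * 2" "2 * \<bar>F 0 3 y x\<bar> \<le> N3 * 2" using D(3)[of 1 0] D(3)[of 0 1] by auto
  have 4: "2 * \<bar>F 3 0 y x + 3 * F 2 1 y x + 3 * F 1 2 y x + F 0 3 y x\<bar> \<le> N3 * 6"
    "2 * \<bar>F 3 0 y x - 3 * F 2 1 y x + 3 * F 1 2 y x - F 0 3 y x\<bar> \<le> N3 * 6"
    using D(3)[of 1 1] D(3)[of 1 "-1"] by auto
  then have 4: "\<bar>F 3 0 y x + 3 * F 2 1 y x + 3 * F 1 2 y x + F 0 3 y x\<bar> \<le> N3 * 3"
    "\<bar>F 3 0 y x - 3 * F 2 1 y x + 3 * F 1 2 y x - F 0 3 y x\<bar> \<le> N3 * 3" by auto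
  from 3 have 3: "\<bar>F 3 0 y x\<bar> \<le> N3" "\<bar>F 0 3 y x\<bar> \<le> N3" by auto
  show "\<bar>F 3 0 y x\<bar> \<le> 2 * N3" "\<bar>F 2 1 y x\<bar> \<le> 2 * N3" "\<bar>F 1 2 y x\<bar> \<le> 2 * N3" "\<bar>F 0 3 y x\<bar> \<le> 2 * N3"
    using 3 4 unfolding abs_le_iff by linarith+
  show "0 \<le> N1" using D(1)[of 0 0] by simp
  show "0 \<le> N2" using D(2)[of 1 0] by simp
  show "0 \<le> N3" using 3 by linarith
qed

section \<open>Taylor estimates for jets\<close>

lemma jet_increment1:
  assumes F: "jet3 F" and ij: "i + j \<le> 2"
    and b: "\<And>y x. \<bar>F (Suc i) j y x\<bar> \<le> K" "\<And>y x. \<bar>F i (Suc j) y x\<bar> \<le> K"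
  shows "\<bar>F i j (y + a) (x + c) - F i j y x\<bar> \<le> K * (\<bar>a\<bar> + \<bar>c\<bar>)"
proof -
  obtain s :: real where s: "0 < s" "s < 1" "F i j (y + 1 * a) (x + 1 * c) - F i j (y + 0 * a) (x + 0 * c) =
     (1 - 0) * (F (Suc i) j (y + s * a) (x + s * c) * a + F i (Suc j) (y + s * a) (x + s * c) * c)"
    using MVT2[of 0 1 "\<lambda>s. F i j (y + s * a) (x + s * c)" "\<lambda>s. F (Suc i) j (y + s * a) (x + s * c) * a + F i (Suc j) (y + s * a) (x + s * c) * c"]
      jet3_line[OF F ij] by auto
  have "\<bar>F (Suc i) j (y + s * a) (x + s * c) * a\<bar> \<le> K * \<bar>a\<bar>" "\<bar>F i (Suc j) (y + s * a) (x + s * c) * c\<bar> \<le> K * \<bar>c\<bar>"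
    using b by (auto simp: abs_mult intro!: mult_right_mono)
  then show ?thesis using s(3) by (simp add: algebra_simps)
qed

lemma jet_increment2:
  assumes F: "jet3 F" and ij: "i + j \<le> 1"
    and b: "\<And>y x. \<bar>F (Suc (Suc i)) j y x\<bar> \<le> K" "\<And>y x. \<bar>F (Suc i) (Suc j) y x\<bar> \<le> K" "\<And>y x. \<bar>F i (Suc (Suc j)) y x\<bar> \<le> K"
  shows "\<bar>F i j (y + a) (x + c) - F i j y x - F (Suc i) j y x * a - F i (Suc j) y x * c\<bar> \<le> K * (\<bar>a\<bar> + \<bar>c\<bar>)\<^sup>2"
proof -
  have i2: "i + j \<le> 2" "Suc i + j \<le> 2" "i + Suc j \<le> 2" using ij by auto
  obtain s :: real where s: "0 < s" "s < 1" "F i j (y + 1 * a) (x + 1 * c) - F i j (y + 0 * a) (x + 0 * c) =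
     (1 - 0) * (F (Suc i) j (y + s * a) (x + s * c) * a + F i (Suc j) (y + s * a) (x + s * c) * c)"
    using MVT2[of 0 1 "\<lambda>s. F i j (y + s * a) (x + s * c)" "\<lambda>s. F (Suc i) j (y + s * a) (x + s * c) * a + F i (Suc j) (y + s * a) (x + s * c) * c"]
      jet3_line[OF F i2(1)] by auto
  have le: "\<bar>s * a\<bar> + \<bar>s * c\<bar> \<le> \<bar>a\<bar> + \<bar>c\<bar>"
    using s mult_right_mono[of s 1 "\<bar>a\<bar>"] mult_right_mono[of s 1 "\<bar>c\<bar>"] by (simp add: abs_mult)
  have K: "K \<ge> 0" using b(1) abs_ge_zero order_trans by blast
  have "\<bar>F (Suc i) j (y + s * a) (x + s * c) - F (Suc i) j y x\<bar> \<le> K * (\<bar>a\<bar> + \<bar>c\<bar>)"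
    using jet_increment1[OF F i2(2) b(1,2), of y "s * a" x "s * c"] mult_left_mono[OF le K] by linarith
  then have 1: "\<bar>(F (Suc i) j (y + s * a) (x + s * c) - F (Suc i) j y x) * a\<bar> \<le> K * (\<bar>a\<bar> + \<bar>c\<bar>) * \<bar>a\<bar>"
    by (simp add: abs_mult mult_right_mono)
  have "\<bar>F i (Suc j) (y + s * a) (x + s * c) - F i (Suc j) y x\<bar> \<le> K * (\<bar>a\<bar> + \<bar>c\<bar>)"
    using jet_increment1[OF F i2(3) b(2,3), of y "s * a" x "s * c"] mult_left_mono[OF le K] by linarith
  then have 2: "\<bar>(F i (Suc j) (y + s * a) (x + s * c) - F i (Suc j) y x) * c\<bar> \<le> K * (\<bar>a\<bar> + \<bar>c\<bar>) * \<bar>c\<bar>"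
    by (simp add: abs_mult mult_right_mono)
  have "F i j (y + a) (x + c) - F i j y x - F (Suc i) j y x * a - F i (Suc j) y x * c =
     (F (Suc i) j (y + s * a) (x + s * c) - F (Suc i) j y x) * a + (F i (Suc j) (y + s * a) (x + s * c) - F i (Suc j) y x) * c"
    using s(3) by (simp add: algebra_simps)
  also have "\<bar>\<dots>\<bar> \<le> K * (\<bar>a\<bar> + \<bar>c\<bar>) * \<bar>a\<bar> + K * (\<bar>a\<bar> + \<bar>c\<bar>) * \<bar>c\<bar>" using 1 2 by linarith
  also have "\<dots> = K * (\<bar>a\<bar> + \<bar>c\<bar>)\<^sup>2" by (simp add: power2_eq_square algebra_simps)
  finally show ?thesis .
qed

lemma jet_increment3:
  assumes F: "jet3 F"
    and b: "\<And>y x. \<bar>F 3 0 y x\<bar> \<le> K" "\<And>y x. \<bar>F 2 1 y x\<bar> \<le> K" "\<And>y x. \<bar>F 1 2 y x\<bar> \<le> K" "\<And>y x. \<bar>F 0 3 y x\<bar> \<le> K"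
  shows "\<bar>F 0 0 (y + a) (x + c) - F 0 0 y x - F 1 0 y x * a - F 0 1 y x * c
      - (F 2 0 y x * a\<^sup>2 + 2 * F 1 1 y x * a * c + F 0 2 y x * c\<^sup>2) / 2\<bar> \<le> K * (\<bar>a\<bar> + \<bar>c\<bar>)^3"
proof -
  define G where "G i j s = F i j (y + s * a) (x + s * c)" for i j s
  have D: "((\<lambda>s. G i j s) has_real_derivative G (Suc i) j s * a + G i (Suc j) s * c) (at s)" if "i + j \<le> 2" for i j s
    unfolding G_def by (rule jet3_line[OF F that])
  define d where "d n s = (if n = 0 then G 0 0 s else if n = 1 then G 1 0 s * a + G 0 1 s * c
     else if n = 2 then G 2 0 s * a\<^sup>2 + 2 * G 1 1 s * a * c + G 0 2 s * c\<^sup>2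
     else G 3 0 s * a^3 + 3 * G 2 1 s * a\<^sup>2 * c + 3 * G 1 2 s * a * c\<^sup>2 + G 0 3 s * c^3)" for n :: nat and s
  have "DERIV (d m) s :> d (Suc m) s" if m3: "m < 3" for m s
  proof -
    consider "m = 0" | "m = 1" | "m = 2" using m3 by linarith
    then show ?thesis
    proof cases
      case 1 then show ?thesis using D[of 0 0 s] by (simp add: d_def[abs_def])
    next
      case 2 then show ?thesis using D[of 1 0 s] D[of 0 1 s]
        by (auto simp: d_def[abs_def] power2_eq_square eval_nat_numeral algebra_simps intro!: derivative_eq_intros)
    next
      case 3 then show ?thesis using D[of 2 0 s] D[of 1 1 s] D[of 0 2 s]
        by (auto simp: d_def[abs_def] power2_eq_square eval_nat_numeral algebra_simps intro!: derivative_eq_intros)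
    qed
  qed
  then obtain s where s: "0 < s" "s < 1" "d 0 1 = (\<Sum>m<3. d m 0 / fact m * 1 ^ m) + d 3 s / fact 3 * 1 ^ 3"
    using Maclaurin[of 1 3 d "d 0"] by auto
  have "\<bar>G 3 0 s * a^3\<bar> \<le> K * \<bar>a\<bar>^3" "\<bar>G 2 1 s * (a\<^sup>2 * c)\<bar> \<le> K * (\<bar>a\<bar>\<^sup>2 * \<bar>c\<bar>)"
    "\<bar>G 1 2 s * (a * c\<^sup>2)\<bar> \<le> K * (\<bar>a\<bar> * \<bar>c\<bar>\<^sup>2)" "\<bar>G 0 3 s * c^3\<bar> \<le> K * \<bar>c\<bar>^3"
    unfolding G_def by (intro abs_mult_le b; simp add: abs_mult power_abs)+
  then have "\<bar>d 3 s\<bar> \<le> K * \<bar>a\<bar>^3 + 3 * (K * (\<bar>a\<bar>\<^sup>2 * \<bar>c\<bar>)) + 3 * (K * (\<bar>a\<bar> * \<bar>c\<bar>\<^sup>2)) + K * \<bar>c\<bar>^3"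
    unfolding d_def by (simp add: mult.assoc) (smt (verit))
  also have "\<dots> = K * (\<bar>a\<bar> + \<bar>c\<bar>)^3"
  proof -
    have "K * u^3 + 3 * (K * (u\<^sup>2 * v)) + 3 * (K * (u * v\<^sup>2)) + K * v^3 = K * (u + v)^3" for u v :: real
      by (simp add: power2_eq_square power3_eq_cube algebra_simps)
    then show ?thesis .
  qed
  finally have 3: "\<bar>d 3 s\<bar> \<le> K * (\<bar>a\<bar> + \<bar>c\<bar>)^3" .
  have e: "F 0 0 (y + a) (x + c) - F 0 0 y x - F 1 0 y x * a - F 0 1 y x * c
      - (F 2 0 y x * a\<^sup>2 + 2 * F 1 1 y x * a * c + F 0 2 y x * c\<^sup>2) / 2 = d 3 s / 6"
    using s(3) by (simp add: d_def G_def eval_nat_numeral)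
  have "\<bar>d 3 s / 6\<bar> \<le> \<bar>d 3 s\<bar>" by simp
  then show ?thesis unfolding e using 3 by linarith
qed

text \<open>One step, of length \<open>\<tau> = \<epsilon>\<^sup>2\<close>, of the Cox-Ross-Rubinstein type approximation of \<open>(ln S, \<sigma>)\<close> with smooth
  coefficients frozen in time; \<open>A\<close> is the log drift \<open>r - B\<^sup>2/2\<close> with its derivatives. The bounds \<open>M\<close> must not
  see the smoothing width \<open>m\<close>, while \<open>L2 = O(1/m)\<close> and \<open>M3 = O(1/m\<^sup>2)\<close>.\<close>

locale scheme =
  fixes r \<rho> M L2 M3 \<epsilon> \<tau> :: real and B b g :: "nat \<Rightarrow> real \<Rightarrow> real"
  assumes rho: "\<bar>\<rho>\<bar> \<le> 1" and eps: "0 < \<epsilon>" "\<epsilon> \<le> 1" and tau: "\<tau> = \<epsilon>\<^sup>2" and M1: "1 \<le> M" and MM3: "M \<le> M3"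
    and dB: "\<And>k x. k < 3 \<Longrightarrow> (B k has_real_derivative B (Suc k) x) (at x)"
    and db: "\<And>k x. k < 3 \<Longrightarrow> (b k has_real_derivative b (Suc k) x) (at x)"
    and dg: "\<And>k x. k < 3 \<Longrightarrow> (g k has_real_derivative g (Suc k) x) (at x)"
    and bB: "\<And>k x. k \<le> 2 \<Longrightarrow> \<bar>B k x\<bar> \<le> M" and bb: "\<And>k x. k \<le> 2 \<Longrightarrow> \<bar>b k x\<bar> \<le> M"
    and bg: "\<And>k x. k \<le> 1 \<Longrightarrow> \<bar>g k x\<bar> \<le> M" and bg2: "\<And>x. \<bar>g 2 x\<bar> \<le> L2"
    and bA': "\<And>x. \<bar>r - (B 0 x)\<^sup>2 / 2\<bar> \<le> M" "\<And>x. \<bar>B 0 x * B 1 x\<bar> \<le> M" "\<And>x. \<bar>(B 1 x)\<^sup>2 + B 0 x * B 2 x\<bar> \<le> M"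
    and b3': "\<And>x. \<bar>3 * B 1 x * B 2 x + B 0 x * B 3 x\<bar> \<le> M3" "\<And>x. \<bar>B 3 x\<bar> \<le> M3" "\<And>x. \<bar>b 3 x\<bar> \<le> M3"
      "\<And>x. \<bar>g 2 x\<bar> \<le> M3" "\<And>x. \<bar>g 3 x\<bar> \<le> M3"
begin

definition A :: "nat \<Rightarrow> real \<Rightarrow> real" where
  "A k x = (if k = 0 then r - (B 0 x)\<^sup>2 / 2 else if k = 1 then - (B 0 x * B 1 x)
     else if k = 2 then - ((B 1 x)\<^sup>2 + B 0 x * B 2 x) else - (3 * B 1 x * B 2 x + B 0 x * B 3 x))"

text \<open>The increment of \<open>ln S\<close> over one step in the outcome \<open>(z, e)\<close>,
  as \<open>Q\<close> is that of the volatility variable. Drift enters at order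
  \<open>\<tau>\<close> and noise at order \<open>\<epsilon>\<close>.\<close>

definition P :: "real \<Rightarrow> real \<Rightarrow> nat \<Rightarrow> real \<Rightarrow> real" where
  "P z e k x = \<tau> * A k x + \<epsilon> * xi \<rho> z e * B k x"

definition Q :: "real \<Rightarrow> nat \<Rightarrow> real \<Rightarrow> real" where
  "Q z k x = \<tau> * g k x + \<epsilon> * z * b k x"

text \<open>The expectation over one step, acting on whole jets, so that bounds on derivatives can
  be propagated by algebra alone.\<close>

definition T :: "(nat \<Rightarrow> nat \<Rightarrow> real \<Rightarrow> real \<Rightarrow> real) \<Rightarrow> nat \<Rightarrow> nat \<Rightarrow> real \<Rightarrow> real \<Rightarrow> real" where
  "T F i j y x = avg (\<lambda>z e. shift_jet F (P z e) (Q z) i j y x)"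

lemma dA: "k < 3 \<Longrightarrow> (A k has_real_derivative A (Suc k) x) (at x)"
proof -
  assume "k < 3"
  then consider "k = 0" | "k = 1" | "k = 2" by linarith
  then show ?thesis
  proof cases
    case 1 then show ?thesis unfolding A_def[abs_def] using dB[of 0 x]
      by (auto intro!: derivative_eq_intros)
  next
    case 2 then show ?thesis unfolding A_def[abs_def] using dB[of 0 x] dB[of 1 x]
      by (auto intro!: derivative_eq_intros simp: power2_eq_square numeral_2_eq_2)
  next
    case 3 then show ?thesis unfolding A_def[abs_def] using dB[of 0 x] dB[of 1 x] dB[of 2 x]
      by (auto intro!: derivative_eq_intros simp: power2_eq_square numeral_2_eq_2 numeral_3_eq_3 algebra_simps)
  qed
qed

lemma jet3_T: "jet3 F \<Longrightarrow> jet3 (T F)"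
  unfolding T_def[abs_def]
proof (rule jet3_avg, rule jet3_shift)
  show "(P z e k has_real_derivative P z e (Suc k) x) (at x)" if "k < 3" for z e k x
    unfolding P_def[abs_def] using that by (auto intro!: derivative_eq_intros dA dB)
  show "(Q z k has_real_derivative Q z (Suc k) x) (at x)" if "k < 3" for z k x
    unfolding Q_def[abs_def] using that by (auto intro!: derivative_eq_intros dg db)
qed

lemma tau_pos: "0 < \<tau>" "\<tau> \<le> \<epsilon>" "\<tau> \<le> 1" "\<epsilon> * \<epsilon> = \<tau>"
proof -
  show "0 < \<tau>" "\<epsilon> * \<epsilon> = \<tau>" using eps by (simp_all add: tau power2_eq_square)
  show "\<tau> \<le> \<epsilon>" using eps mult_left_mono[of \<epsilon> 1 \<epsilon>] by (simp add: tau power2_eq_square)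
  then show "\<tau> \<le> 1" using eps by simp
qed

lemma bA: "k \<le> 2 \<Longrightarrow> \<bar>A k x\<bar> \<le> M" "\<bar>A 3 x\<bar> \<le> M3"
proof -
  have "\<bar>A 0 x\<bar> \<le> M" "\<bar>A 1 x\<bar> \<le> M" using bA'(1,2)[of x] by (simp_all add: A_def)
  moreover have "\<bar>A 2 x\<bar> \<le> M" using bA'(3)[of x] unfolding A_def abs_le_iff by simp
  ultimately show "k \<le> 2 \<Longrightarrow> \<bar>A k x\<bar> \<le> M" by (auto simp: numeral_2_eq_2 le_Suc_eq)
  show "\<bar>A 3 x\<bar> \<le> M3" using b3'(1)[of x] unfolding A_def abs_le_iff by simp
qed

text \<open>Two families of bounds: with \<open>M\<close> wherever the smoothing width must not
  enter, and with \<open>M3\<close> up to \<open>Q z 2\<close>, which contains the second derivative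
  of the smoothed drift \<open>g\<close>.\<close>

lemma PQ_bd:
  assumes ze: "\<bar>z\<bar> = 1" "\<bar>e\<bar> = 1"
  shows "k \<le> 2 \<Longrightarrow> \<bar>P z e k x\<bar> \<le> 3 * M * \<epsilon>" "k \<le> 1 \<Longrightarrow> \<bar>Q z k x\<bar> \<le> 2 * M * \<epsilon>"
    "k \<le> 2 \<Longrightarrow> \<bar>P z e k x\<bar> \<le> 3 * M3 * \<epsilon>" "k \<le> 2 \<Longrightarrow> \<bar>Q z k x\<bar> \<le> 2 * M3 * \<epsilon>"
proof -
  have p: "\<bar>P z e k x\<bar> \<le> 3 * m * \<epsilon>" if "\<bar>A k x\<bar> \<le> m" "\<bar>B k x\<bar> \<le> m" for m
  proof -
    have "\<bar>\<tau> * A k x\<bar> \<le> \<epsilon> * m" using tau_pos that by (intro abs_mult_le) auto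
    moreover have "\<bar>\<epsilon> * xi \<rho> z e * B k x\<bar> \<le> \<epsilon> * 2 * m"
      using eps that abs_xi_le[OF rho ze] by (intro abs_mult_le) auto
    ultimately have "\<bar>P z e k x\<bar> \<le> \<epsilon> * m + \<epsilon> * 2 * m" unfolding P_def by linarith
    then show ?thesis by (simp add: mult_ac)
  qed
  have q: "\<bar>Q z k x\<bar> \<le> 2 * m * \<epsilon>" if "\<bar>g k x\<bar> \<le> m" "\<bar>b k x\<bar> \<le> m" for m
  proof -
    have "\<bar>\<tau> * g k x\<bar> \<le> \<epsilon> * m" using tau_pos that by (intro abs_mult_le) auto
    moreover have "\<bar>\<epsilon> * z * b k x\<bar> \<le> \<epsilon> * 1 * m" using eps that ze by (intro abs_mult_le) auto
    ultimately have "\<bar>Q z k x\<bar> \<le> \<epsilon> * m + \<epsilon> * 1 * m" unfolding Q_def by linarith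
    then show ?thesis by (simp add: mult_ac)
  qed
  show "k \<le> 2 \<Longrightarrow> \<bar>P z e k x\<bar> \<le> 3 * M * \<epsilon>" using p bA bB by blast
  show "k \<le> 1 \<Longrightarrow> \<bar>Q z k x\<bar> \<le> 2 * M * \<epsilon>" using q bg bb[of k] by auto
  show "k \<le> 2 \<Longrightarrow> \<bar>P z e k x\<bar> \<le> 3 * M3 * \<epsilon>" using p[of M3] bA(1)[of k x] bB[of k x] MM3 by linarith
  assume k: "k \<le> 2"
  have "\<bar>g k x\<bar> \<le> M3" using bg[of k x] b3'(4)[of x] MM3 k by (cases "k = 2") auto
  then show "\<bar>Q z k x\<bar> \<le> 2 * M3 * \<epsilon>" using q[of M3] bb[OF k, of x] MM3 by linarith
qed

text \<open>The factor \<open>c\<close> has size \<open>\<epsilon>\<close>, but its leading part has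
  mean 0 and therefore sees only the variation of \<open>F\<close> over the shift, again of size
  \<open>\<epsilon>\<close>. The product has size \<open>\<tau>\<close>, which can be afforded in
  each of the order of \<open>1/\<tau>\<close> many steps.\<close>

lemma avg_mult_centred_le:
  assumes F: "jet3 F" and ij: "i + j \<le> 2" and K: "\<And>y x. \<bar>F (Suc i) j y x\<bar> \<le> K" "\<And>y x. \<bar>F i (Suc j) y x\<bar> \<le> K"
    and G: "\<And>y x. \<bar>F i j y x\<bar> \<le> G"
    and c: "\<And>z e. \<bar>z\<bar> = 1 \<Longrightarrow> \<bar>e\<bar> = 1 \<Longrightarrow> \<bar>c z e - \<epsilon> * (k1 * xi \<rho> z e + k2 * z)\<bar> \<le> \<tau> * d"
  shows "\<bar>avg (\<lambda>z e. F i j (y + P z e 0 x) (x + Q z 0 x) * c z e)\<bar> \<le> \<tau> * (5 * M * K * (2 * \<bar>k1\<bar> + \<bar>k2\<bar>) + G * d)"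
proof -
  let ?F = "\<lambda>z e. F i j (y + P z e 0 x) (x + Q z 0 x)"
  have K0: "K \<ge> 0" using K(1) abs_ge_zero order_trans by blast
  have "avg (\<lambda>z e. k1 * xi \<rho> z e + k2 * z) = 0" using avg_lin[of 0 k1 \<rho> k2] by simp
  then have "avg (\<lambda>z e. ?F z e * c z e) = avg (\<lambda>z e. ?F z e * c z e) - F i j y x * \<epsilon> * avg (\<lambda>z e. k1 * xi \<rho> z e + k2 * z)"
    by simp
  also have "\<dots> = avg (\<lambda>z e. (?F z e - F i j y x) * (\<epsilon> * (k1 * xi \<rho> z e + k2 * z)) + ?F z e * (c z e - \<epsilon> * (k1 * xi \<rho> z e + k2 * z)))"
    by (simp add: avg_def algebra_simps diff_divide_distrib add_divide_distrib)
  also have "\<bar>\<dots>\<bar> \<le> \<tau> * (5 * M * K * (2 * \<bar>k1\<bar> + \<bar>k2\<bar>) + G * d)"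
  proof (rule avg_abs_le)
    fix z e :: real assume ze: "\<bar>z\<bar> = 1" "\<bar>e\<bar> = 1"
    have "\<bar>?F z e - F i j y x\<bar> \<le> K * (\<bar>P z e 0 x\<bar> + \<bar>Q z 0 x\<bar>)" by (rule jet_increment1[OF F ij K])
    also have "\<dots> \<le> K * (5 * M * \<epsilon>)" using PQ_bd(1)[OF ze, of 0 x] PQ_bd(2)[OF ze, of 0 x] K0
      by (intro mult_left_mono) auto
    finally have 1: "\<bar>?F z e - F i j y x\<bar> \<le> K * (5 * M * \<epsilon>)" .
    have "\<bar>k1 * xi \<rho> z e\<bar> \<le> \<bar>k1\<bar> * 2" "\<bar>k2 * z\<bar> \<le> \<bar>k2\<bar> * 1"
      using abs_xi_le[OF rho ze] ze by (intro abs_mult_le; simp)+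
    then have "\<bar>\<epsilon> * (k1 * xi \<rho> z e + k2 * z)\<bar> \<le> \<epsilon> * (2 * \<bar>k1\<bar> + \<bar>k2\<bar>)"
      using eps by (intro abs_mult_le) auto
    from abs_mult_le[OF 1 this]
    have 2: "\<bar>(?F z e - F i j y x) * (\<epsilon> * (k1 * xi \<rho> z e + k2 * z))\<bar> \<le> \<tau> * (5 * M * K * (2 * \<bar>k1\<bar> + \<bar>k2\<bar>))"
      by (simp add: tau power2_eq_square mult_ac)
    have "\<bar>?F z e * (c z e - \<epsilon> * (k1 * xi \<rho> z e + k2 * z))\<bar> \<le> G * (\<tau> * d)" by (rule abs_mult_le[OF G c[OF ze]])
    with 2 show "\<bar>(?F z e - F i j y x) * (\<epsilon> * (k1 * xi \<rho> z e + k2 * z)) + ?F z e * (c z e - \<epsilon> * (k1 * xi \<rho> z e + k2 * z))\<bar>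
      \<le> \<tau> * (5 * M * K * (2 * \<bar>k1\<bar> + \<bar>k2\<bar>) + G * d)" by (simp add: algebra_simps)
  qed
  finally show ?thesis .
qed

text \<open>The derivative of the random shift moves the direction \<open>(v, w)\<close>. Its terms
  of order \<open>\<epsilon>\<close> are centred and leave only their variances, of order
  \<open>\<tau>\<close>, in the mean square. The constant 7 is 1 from the mixed product of
  \<open>v\<close> and \<open>w\<close> plus 6 from the coefficient of \<open>w^2\<close>.\<close>

lemma avg_norm2:
  "avg (\<lambda>z e. (v + P z e 1 x * w)\<^sup>2 + ((1 + Q z 1 x) * w)\<^sup>2) \<le> (1 + 7 * M\<^sup>2 * \<tau>) * (v\<^sup>2 + w\<^sup>2)"
proof -
  have "avg (\<lambda>z e. (v + P z e 1 x * w)\<^sup>2) = avg (\<lambda>z e. ((v + \<tau> * A 1 x * w) + (\<epsilon> * B 1 x * w) * xi \<rho> z e + 0 * z) * ((v + \<tau> * A 1 x * w) + (\<epsilon> * B 1 x * w) * xi \<rho> z e + 0 * z))"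
    by (simp add: P_def algebra_simps power2_eq_square)
  also have "\<dots> = (v + \<tau> * A 1 x * w)\<^sup>2 + \<tau> * (B 1 x)\<^sup>2 * w\<^sup>2"
    unfolding avg_quad[OF rho] by (simp add: tau power2_eq_square mult_ac)
  finally have 1: "avg (\<lambda>z e. (v + P z e 1 x * w)\<^sup>2) = (v + \<tau> * A 1 x * w)\<^sup>2 + \<tau> * (B 1 x)\<^sup>2 * w\<^sup>2" .
  have "avg (\<lambda>z e. ((1 + Q z 1 x) * w)\<^sup>2) = avg (\<lambda>z e. (((1 + \<tau> * g 1 x) * w) + 0 * xi \<rho> z e + (\<epsilon> * b 1 x * w) * z) * (((1 + \<tau> * g 1 x) * w) + 0 * xi \<rho> z e + (\<epsilon> * b 1 x * w) * z))"
    by (simp add: Q_def algebra_simps power2_eq_square)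
  also have "\<dots> = (1 + \<tau> * g 1 x)\<^sup>2 * w\<^sup>2 + \<tau> * (b 1 x)\<^sup>2 * w\<^sup>2"
    unfolding avg_quad[OF rho] by (simp add: tau power2_eq_square mult_ac)
  finally have 2: "avg (\<lambda>z e. ((1 + Q z 1 x) * w)\<^sup>2) = (1 + \<tau> * g 1 x)\<^sup>2 * w\<^sup>2 + \<tau> * (b 1 x)\<^sup>2 * w\<^sup>2" .
  have sq: "a\<^sup>2 \<le> M\<^sup>2" if "\<bar>a\<bar> \<le> M" for a using that by (simp add: abs_le_square_iff[symmetric])
  have t2: "\<tau>\<^sup>2 \<le> \<tau>" using tau_pos mult_left_mono[of \<tau> 1 \<tau>] by (simp add: power2_eq_square)
  have M2: "M \<le> M\<^sup>2" using M1 mult_left_mono[of 1 M M] by (simp add: power2_eq_square)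
  have m: "\<tau> * M \<le> \<tau> * M\<^sup>2" using M2 tau_pos by simp
  have a1: "\<bar>\<tau> * A 1 x * (2 * (v * w))\<bar> \<le> \<tau> * M * (v\<^sup>2 + w\<^sup>2)"
    using tau_pos bA(1)[of 1 x] sum_squares_bound[of v w] sum_squares_bound[of v "-w"]
    by (intro abs_mult_le) (auto simp: abs_le_iff)
  have a2: "\<tau>\<^sup>2 * (A 1 x)\<^sup>2 \<le> \<tau> * M\<^sup>2" "\<tau>\<^sup>2 * (g 1 x)\<^sup>2 \<le> \<tau> * M\<^sup>2"
    using tau_pos t2 bA(1)[of 1 x] bg[of 1 x] by (intro mult_mono sq; simp)+
  have a3: "\<tau> * (B 1 x)\<^sup>2 \<le> \<tau> * M\<^sup>2" "\<tau> * (b 1 x)\<^sup>2 \<le> \<tau> * M\<^sup>2"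
    using tau_pos bB[of 1 x] bb[of 1 x] by (intro mult_left_mono sq; simp)+
  have a4: "\<tau> * g 1 x \<le> \<tau> * M" using tau_pos bg[of 1 x] by (intro mult_left_mono) auto
  have "\<tau>\<^sup>2 * (A 1 x)\<^sup>2 * w\<^sup>2 + \<tau> * (B 1 x)\<^sup>2 * w\<^sup>2 + 2 * (\<tau> * g 1 x) * w\<^sup>2 + \<tau>\<^sup>2 * (g 1 x)\<^sup>2 * w\<^sup>2 + \<tau> * (b 1 x)\<^sup>2 * w\<^sup>2
     = (\<tau>\<^sup>2 * (A 1 x)\<^sup>2 + \<tau> * (B 1 x)\<^sup>2 + 2 * (\<tau> * g 1 x) + \<tau>\<^sup>2 * (g 1 x)\<^sup>2 + \<tau> * (b 1 x)\<^sup>2) * w\<^sup>2"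
    by (simp add: algebra_simps)
  also have "\<dots> \<le> (6 * (\<tau> * M\<^sup>2)) * w\<^sup>2" using a2 a3 a4 m by (intro mult_right_mono) auto
  finally have S: "\<tau>\<^sup>2 * (A 1 x)\<^sup>2 * w\<^sup>2 + \<tau> * (B 1 x)\<^sup>2 * w\<^sup>2 + 2 * (\<tau> * g 1 x) * w\<^sup>2 + \<tau>\<^sup>2 * (g 1 x)\<^sup>2 * w\<^sup>2 + \<tau> * (b 1 x)\<^sup>2 * w\<^sup>2
     \<le> 6 * (\<tau> * M\<^sup>2) * w\<^sup>2" .
  have "avg (\<lambda>z e. (v + P z e 1 x * w)\<^sup>2 + ((1 + Q z 1 x) * w)\<^sup>2) =
    v\<^sup>2 + w\<^sup>2 + \<tau> * A 1 x * (2 * (v * w)) + (\<tau>\<^sup>2 * (A 1 x)\<^sup>2 * w\<^sup>2 + \<tau> * (B 1 x)\<^sup>2 * w\<^sup>2 + 2 * (\<tau> * g 1 x) * w\<^sup>2 + \<tau>\<^sup>2 * (g 1 x)\<^sup>2 * w\<^sup>2 + \<tau> * (b 1 x)\<^sup>2 * w\<^sup>2)"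
    unfolding avg_add 1 2 by (simp add: power2_eq_square algebra_simps)
  also have "\<dots> \<le> v\<^sup>2 + w\<^sup>2 + \<tau> * M * (v\<^sup>2 + w\<^sup>2) + 6 * (\<tau> * M\<^sup>2) * w\<^sup>2" using S a1 by (simp add: abs_le_iff)
  also have "\<dots> \<le> v\<^sup>2 + w\<^sup>2 + \<tau> * M\<^sup>2 * (v\<^sup>2 + w\<^sup>2) + 6 * (\<tau> * M\<^sup>2) * (v\<^sup>2 + w\<^sup>2)"
    using m tau_pos M1 by (intro add_mono mult_mono) auto
  finally show ?thesis by (simp add: algebra_simps)
qed

text \<open>The squared norm \<open>u\<close> differs from \<open>U\<close> by
  \<open>O(\<epsilon>)\<close> in every outcome, so its second moment about \<open>U\<close> is only
  \<open>O(\<tau>)\<close>, and its mean is known from \<open>avg_norm2\<close>. The constant is 14,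
  twice the 7 there, plus 400, the square of 20.\<close>

lemma avg_norm4:
  "avg (\<lambda>z e. ((v + P z e 1 x * w)\<^sup>2 + ((1 + Q z 1 x) * w)\<^sup>2)\<^sup>2) \<le> (1 + 414 * M^4 * \<tau>) * (v\<^sup>2 + w\<^sup>2)\<^sup>2"
proof -
  define U where "U = v\<^sup>2 + w\<^sup>2"
  define u where "u z e = (v + P z e 1 x * w)\<^sup>2 + ((1 + Q z 1 x) * w)\<^sup>2" for z e
  have U: "U \<ge> 0" by (simp add: U_def)
  have M2: "M \<le> M\<^sup>2" using M1 mult_left_mono[of 1 M M] by (simp add: power2_eq_square)
  have "avg (\<lambda>z e. (u z e)\<^sup>2) = U\<^sup>2 + 2 * U * (avg u - U) + avg (\<lambda>z e. (u z e - U)\<^sup>2)"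
    by (simp add: avg_def power2_eq_square algebra_simps add_divide_distrib diff_divide_distrib)
  also have "2 * U * (avg u - U) \<le> 2 * U * (7 * M\<^sup>2 * \<tau> * U)"
    using avg_norm2[of v x w] U unfolding u_def[symmetric] U_def[symmetric]
    by (intro mult_left_mono) (auto simp: algebra_simps)
  also have "avg (\<lambda>z e. (u z e - U)\<^sup>2) \<le> avg (\<lambda>z e. (20 * M\<^sup>2 * \<epsilon> * U)\<^sup>2)"
  proof (rule avg_mono)
    fix z e :: real assume ze: "\<bar>z\<bar> = 1" "\<bar>e\<bar> = 1"
    have p: "\<bar>P z e 1 x\<bar> \<le> 3 * M * \<epsilon>" and q: "\<bar>Q z 1 x\<bar> \<le> 2 * M * \<epsilon>" using PQ_bd(1,2)[OF ze] by auto
    have eM: "M * \<epsilon> \<le> M\<^sup>2 * \<epsilon>" "M\<^sup>2 * \<tau> \<le> M\<^sup>2 * \<epsilon>" using M2 eps tau_pos by (auto intro!: mult_right_mono mult_left_mono)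
    have "\<bar>P z e 1 x * P z e 1 x\<bar> \<le> (3 * M * \<epsilon>) * (3 * M * \<epsilon>)" by (intro abs_mult_le p)
    then have pp: "\<bar>P z e 1 x * P z e 1 x\<bar> \<le> 9 * (M\<^sup>2 * \<epsilon>)" using eM by (simp add: tau power2_eq_square mult_ac)
    have "\<bar>Q z 1 x * Q z 1 x\<bar> \<le> (2 * M * \<epsilon>) * (2 * M * \<epsilon>)" by (intro abs_mult_le q)
    then have qq: "\<bar>Q z 1 x * Q z 1 x\<bar> \<le> 4 * (M\<^sup>2 * \<epsilon>)" using eM by (simp add: tau power2_eq_square mult_ac)
    have "\<bar>2 * (v * w)\<bar> \<le> U" unfolding U_def
      using sum_squares_bound[of v w] sum_squares_bound[of v "-w"] by (auto simp: abs_le_iff)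
    from abs_mult_le[OF p this] have 1: "\<bar>P z e 1 x * (2 * (v * w))\<bar> \<le> 3 * M * \<epsilon> * U" .
    have "\<bar>P z e 1 x * P z e 1 x + 2 * Q z 1 x + Q z 1 x * Q z 1 x\<bar> \<le> 17 * (M\<^sup>2 * \<epsilon>)"
      using pp qq q eM by linarith
    from abs_mult_le[OF this, of "w\<^sup>2" U] have 2: "\<bar>(P z e 1 x * P z e 1 x + 2 * Q z 1 x + Q z 1 x * Q z 1 x) * w\<^sup>2\<bar> \<le> 17 * (M\<^sup>2 * \<epsilon>) * U"
      by (simp add: U_def)
    have "3 * M * \<epsilon> * U \<le> 3 * (M\<^sup>2 * \<epsilon>) * U" using eM U by (intro mult_right_mono) auto
    moreover have "u z e - U = P z e 1 x * (2 * (v * w)) + (P z e 1 x * P z e 1 x + 2 * Q z 1 x + Q z 1 x * Q z 1 x) * w\<^sup>2"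
      by (simp add: u_def U_def power2_eq_square algebra_simps)
    ultimately have "\<bar>u z e - U\<bar> \<le> 20 * M\<^sup>2 * \<epsilon> * U" using 1 2 by (simp add: abs_le_iff)
    then show "(u z e - U)\<^sup>2 \<le> (20 * M\<^sup>2 * \<epsilon> * U)\<^sup>2" by (metis abs_ge_zero power2_abs power_mono)
  qed
  also have "\<dots> = 400 * M^4 * \<tau> * U\<^sup>2" by (simp add: avg_const tau power_mult_distrib)
  finally have "avg (\<lambda>z e. (u z e)\<^sup>2) \<le> U\<^sup>2 + 14 * (M\<^sup>2 * \<tau> * U\<^sup>2) + 400 * M^4 * \<tau> * U\<^sup>2"
    by (simp add: power2_eq_square mult_ac)
  also have "M\<^sup>2 * \<tau> * U\<^sup>2 \<le> M^4 * \<tau> * U\<^sup>2" using M1 tau_pos by (intro mult_right_mono power_increasing) auto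
  finally show ?thesis by (simp add: u_def U_def algebra_simps)
qed

abbreviation at_shift :: "(real \<Rightarrow> real \<Rightarrow> real) \<Rightarrow> real \<Rightarrow> real \<Rightarrow> real \<Rightarrow> real \<Rightarrow> real" where
  "at_shift G y x z e \<equiv> G (y + P z e 0 x) (x + Q z 0 x)"

text \<open>The derivative of \<open>T F\<close> in a direction is the mean of the derivative of
  \<open>F\<close> in the randomly moved direction. Only first derivatives of the coefficients take
  part, so the growth rate does not see the smoothing width.\<close>

lemma T_bd1:
  assumes bd: "jet_bd F N1 N2 N3"
  shows "2 * \<bar>T F 1 0 y x * v + T F 0 1 y x * w\<bar> \<le> N1 * (1 + 7 * M\<^sup>2 * \<tau>) * (1 + (v\<^sup>2 + w\<^sup>2))"
proof -
  note N = jet_bd_comp[OF bd]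
  let ?u = "\<lambda>z e. (v + P z e 1 x * w)\<^sup>2 + ((1 + Q z 1 x) * w)\<^sup>2"
  let ?h = "\<lambda>z e. at_shift (F 1 0) y x z e * (v + P z e 1 x * w) + at_shift (F 0 1) y x z e * ((1 + Q z 1 x) * w)"
  have "T F 1 0 y x * v + T F 0 1 y x * w = avg ?h"
    by (simp add: T_def shift_jet_def Let_def avg_def field_simps)
  then have "2 * \<bar>T F 1 0 y x * v + T F 0 1 y x * w\<bar> = \<bar>avg (\<lambda>z e. 2 * ?h z e)\<bar>"
    by (simp only: avg_cmult abs_mult abs_numeral)
  also have "\<dots> \<le> avg (\<lambda>z e. N1 * (1 + ?u z e))"
  proof (rule avg_abs_le_avg)
    fix z e :: real
    have "\<bar>2 * ?h z e\<bar> = 2 * \<bar>?h z e\<bar>" by (simp only: abs_mult abs_numeral)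
    also have "\<dots> \<le> N1 * (1 + ?u z e)" by (rule jet_bdD(1)[OF bd])
    finally show "\<bar>2 * ?h z e\<bar> \<le> N1 * (1 + ?u z e)" .
  qed
  also have "\<dots> = N1 * (1 + avg ?u)" by (simp only: avg_cmult avg_add avg_const)
  also have "\<dots> \<le> N1 * (1 + (1 + 7 * M\<^sup>2 * \<tau>) * (v\<^sup>2 + w\<^sup>2))"
    using avg_norm2[of v x w] N by (intro mult_left_mono) auto
  also have "\<dots> \<le> N1 * ((1 + 7 * M\<^sup>2 * \<tau>) * (1 + (v\<^sup>2 + w\<^sup>2)))"
    using N tau_pos by (intro mult_left_mono) (auto simp: algebra_simps)
  finally show ?thesis by (simp add: mult.assoc)
qed

text \<open>Besides the moved quadratic form there are second derivatives of the shifts multiplied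
  by first derivatives of \<open>F\<close>, centred up to order \<open>\<tau>\<close>. Since
  \<open>L2\<close> meets only \<open>N1\<close>, it enters linearly and leaves the growth rate of
  \<open>N2\<close> alone. The constant 22 is 7 from the mean square plus 15 from the centred
  terms.\<close>

lemma T_bd2:
  assumes F: "jet3 F" and bd: "jet_bd F N1 N2 N3"
  shows "\<bar>T F 2 0 y x * v\<^sup>2 + 2 * T F 1 1 y x * v * w + T F 0 2 y x * w\<^sup>2\<bar>
     \<le> (N2 * (1 + 22 * M\<^sup>2 * \<tau>) + \<tau> * (M + L2) * N1) * (v\<^sup>2 + w\<^sup>2)"
proof -
  note N = jet_bd_comp[OF bd]
  let ?u = "\<lambda>z e. (v + P z e 1 x * w)\<^sup>2 + ((1 + Q z 1 x) * w)\<^sup>2"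
  let ?q = "\<lambda>z e. at_shift (F 2 0) y x z e * (v + P z e 1 x * w)\<^sup>2 + 2 * at_shift (F 1 1) y x z e * (v + P z e 1 x * w) * ((1 + Q z 1 x) * w)
     + at_shift (F 0 2) y x z e * ((1 + Q z 1 x) * w)\<^sup>2"
  let ?E1 = "avg (\<lambda>z e. at_shift (F 1 0) y x z e * P z e 2 x)" and ?E2 = "avg (\<lambda>z e. at_shift (F 0 1) y x z e * Q z 2 x)"
  have eq: "T F 2 0 y x * v\<^sup>2 + 2 * T F 1 1 y x * v * w + T F 0 2 y x * w\<^sup>2 = avg ?q + w\<^sup>2 * (?E1 + ?E2)"
    by (simp add: T_def shift_jet_def Let_def avg_def power2_eq_square field_simps)
       (simp add: numeral_2_eq_2)?
  have "\<bar>avg ?q\<bar> \<le> avg (\<lambda>z e. N2 * ?u z e)" by (rule avg_abs_le_avg) (rule jet_bdD(2)[OF bd])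
  also have "\<dots> = N2 * avg ?u" by (simp only: avg_cmult)
  also have "\<dots> \<le> N2 * ((1 + 7 * M\<^sup>2 * \<tau>) * (v\<^sup>2 + w\<^sup>2))"
    using avg_norm2[of v x w] N by (intro mult_left_mono) auto
  finally have 1: "\<bar>avg ?q\<bar> \<le> N2 * ((1 + 7 * M\<^sup>2 * \<tau>) * (v\<^sup>2 + w\<^sup>2))" .
  have N': "\<bar>F (Suc 1) 0 y x\<bar> \<le> N2" "\<bar>F 1 (Suc 0) y x\<bar> \<le> N2" "\<bar>F (Suc 0) 1 y x\<bar> \<le> N2" "\<bar>F 0 (Suc 1) y x\<bar> \<le> N2" for y x
    using N by (simp_all add: numeral_2_eq_2)
  have "\<bar>?E1\<bar> \<le> \<tau> * (5 * M * N2 * (2 * \<bar>B 2 x\<bar> + \<bar>0\<bar>) + N1 * M)"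
  proof (rule avg_mult_centred_le[OF F _ N'(1,2) N(1)])
    fix z e :: real
    have "P z e 2 x - \<epsilon> * (B 2 x * xi \<rho> z e + 0 * z) = \<tau> * A 2 x" by (simp add: P_def)
    then show "\<bar>P z e 2 x - \<epsilon> * (B 2 x * xi \<rho> z e + 0 * z)\<bar> \<le> \<tau> * M"
      using tau_pos bA(1)[of 2 x] by (simp add: abs_mult)
  qed simp
  also have "5 * M * N2 * (2 * \<bar>B 2 x\<bar> + \<bar>0\<bar>) \<le> 5 * M * N2 * (2 * M)" using bB[of 2 x] N M1 by (intro mult_left_mono) auto
  finally have 2: "\<bar>?E1\<bar> \<le> \<tau> * (10 * M\<^sup>2 * N2 + N1 * M)" using tau_pos by (simp add: power2_eq_square mult_ac)
  have "\<bar>?E2\<bar> \<le> \<tau> * (5 * M * N2 * (2 * \<bar>0\<bar> + \<bar>b 2 x\<bar>) + N1 * L2)"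
  proof (rule avg_mult_centred_le[OF F _ N'(3,4) N(2)])
    fix z e :: real
    have "Q z 2 x - \<epsilon> * (0 * xi \<rho> z e + b 2 x * z) = \<tau> * g 2 x" by (simp add: Q_def)
    then show "\<bar>Q z 2 x - \<epsilon> * (0 * xi \<rho> z e + b 2 x * z)\<bar> \<le> \<tau> * L2"
      using tau_pos bg2[of x] by (simp add: abs_mult)
  qed simp
  also have "5 * M * N2 * (2 * \<bar>0\<bar> + \<bar>b 2 x\<bar>) \<le> 5 * M * N2 * M" using bb[of 2 x] N M1 by (intro mult_left_mono) auto
  finally have 3: "\<bar>?E2\<bar> \<le> \<tau> * (5 * M\<^sup>2 * N2 + N1 * L2)" using tau_pos by (simp add: power2_eq_square mult_ac)
  have "\<bar>?E1 + ?E2\<bar> \<le> \<tau> * (15 * M\<^sup>2 * N2 + (M + L2) * N1)" using 2 3 by (simp add: algebra_simps)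
  from abs_mult_le[of "w\<^sup>2" "v\<^sup>2 + w\<^sup>2", OF _ this]
  have "\<bar>w\<^sup>2 * (?E1 + ?E2)\<bar> \<le> (v\<^sup>2 + w\<^sup>2) * (\<tau> * (15 * M\<^sup>2 * N2 + (M + L2) * N1))" by simp
  with 1 show ?thesis unfolding eq by (simp add: algebra_simps)
qed

text \<open>At this order dependence on the smoothing width is harmless, and \<open>M3\<close> is
  used freely. The constant 994 collects 414 from the even moments, 6 times 90 from
  \<open>?E1\<close> to \<open>?E3\<close> and 2 times 20 from \<open>?E4\<close> and
  \<open>?E5\<close>.\<close>

lemma T_bd3:
  assumes F: "jet3 F" and bd: "jet_bd F N1 N2 N3"
  shows "2 * \<bar>T F 3 0 y x * v^3 + 3 * T F 2 1 y x * v\<^sup>2 * w + 3 * T F 1 2 y x * v * w\<^sup>2 + T F 0 3 y x * w^3\<bar>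
     \<le> (N3 + 994 * M3^4 * \<tau> * (N1 + N2 + N3)) * ((v\<^sup>2 + w\<^sup>2) + (v\<^sup>2 + w\<^sup>2)\<^sup>2)"
proof -
  note N = jet_bd_comp[OF bd]
  let ?v = "\<lambda>z e. v + P z e 1 x * w" and ?w = "\<lambda>z. (1 + Q z 1 x) * w"
  let ?u = "\<lambda>z e. (?v z e)\<^sup>2 + (?w z)\<^sup>2"
  let ?q = "\<lambda>z e. at_shift (F 3 0) y x z e * (?v z e)^3 + 3 * at_shift (F 2 1) y x z e * (?v z e)\<^sup>2 * ?w z
     + 3 * at_shift (F 1 2) y x z e * (?v z e) * (?w z)\<^sup>2 + at_shift (F 0 3) y x z e * (?w z)^3"
  let ?E1 = "avg (\<lambda>z e. at_shift (F 2 0) y x z e * (P z e 2 x * ?v z e))"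
  let ?E2 = "avg (\<lambda>z e. at_shift (F 1 1) y x z e * (Q z 2 x * ?v z e + P z e 2 x * ?w z))"
  let ?E3 = "avg (\<lambda>z e. at_shift (F 0 2) y x z e * (Q z 2 x * ?w z))"
  let ?E4 = "avg (\<lambda>z e. at_shift (F 1 0) y x z e * P z e 3 x)" and ?E5 = "avg (\<lambda>z e. at_shift (F 0 1) y x z e * Q z 3 x)"
  define U where "U = v\<^sup>2 + w\<^sup>2"
  have U0: "U \<ge> 0" by (simp add: U_def)
  have M31: "1 \<le> M3" using M1 MM3 by simp
  have M2: "M3 \<le> M3\<^sup>2" using M31 mult_left_mono[of 1 M3 M3] by (simp add: power2_eq_square)
  have eq: "T F 3 0 y x * v^3 + 3 * T F 2 1 y x * v\<^sup>2 * w + 3 * T F 1 2 y x * v * w\<^sup>2 + T F 0 3 y x * w^3 =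
     avg ?q + 3 * (w\<^sup>2 * (?E1 + ?E2 + ?E3)) + w^3 * (?E4 + ?E5)"
  proof -
    have "shift_jet F (P z e) (Q z) 3 0 y x * v^3 + 3 * shift_jet F (P z e) (Q z) 2 1 y x * v\<^sup>2 * w + 3 * shift_jet F (P z e) (Q z) 1 2 y x * v * w\<^sup>2
       + shift_jet F (P z e) (Q z) 0 3 y x * w^3 = ?q z e + 3 * (w\<^sup>2 * (at_shift (F 2 0) y x z e * (P z e 2 x * ?v z e)
       + at_shift (F 1 1) y x z e * (Q z 2 x * ?v z e + P z e 2 x * ?w z) + at_shift (F 0 2) y x z e * (Q z 2 x * ?w z)))
       + w^3 * (at_shift (F 1 0) y x z e * P z e 3 x + at_shift (F 0 1) y x z e * Q z 3 x)" for z e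
      by (simp add: shift_jet_def Let_def eval_nat_numeral algebra_simps)
    then have "avg (\<lambda>z e. shift_jet F (P z e) (Q z) 3 0 y x * v^3 + 3 * shift_jet F (P z e) (Q z) 2 1 y x * v\<^sup>2 * w + 3 * shift_jet F (P z e) (Q z) 1 2 y x * v * w\<^sup>2
       + shift_jet F (P z e) (Q z) 0 3 y x * w^3) = avg ?q + 3 * (w\<^sup>2 * (?E1 + ?E2 + ?E3)) + w^3 * (?E4 + ?E5)"
      by (simp only: avg_add avg_cmult)
    moreover have "T F 3 0 y x * v^3 + 3 * T F 2 1 y x * v\<^sup>2 * w + 3 * T F 1 2 y x * v * w\<^sup>2 + T F 0 3 y x * w^3 =
       avg (\<lambda>z e. shift_jet F (P z e) (Q z) 3 0 y x * v^3 + 3 * shift_jet F (P z e) (Q z) 2 1 y x * v\<^sup>2 * w + 3 * shift_jet F (P z e) (Q z) 1 2 y x * v * w\<^sup>2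
       + shift_jet F (P z e) (Q z) 0 3 y x * w^3)"
      by (simp add: T_def avg_def field_simps)
    ultimately show ?thesis by simp
  qed
  have "\<bar>2 * avg ?q\<bar> = \<bar>avg (\<lambda>z e. 2 * ?q z e)\<bar>" by (simp only: avg_cmult)
  also have "\<dots> \<le> avg (\<lambda>z e. N3 * (?u z e + (?u z e)\<^sup>2))"
  proof (rule avg_abs_le_avg)
    fix z e :: real
    have "\<bar>2 * ?q z e\<bar> = 2 * \<bar>?q z e\<bar>" by (simp only: abs_mult abs_numeral)
    also have "\<dots> \<le> N3 * (?u z e + (?u z e)\<^sup>2)" by (rule jet_bdD(3)[OF bd])
    finally show "\<bar>2 * ?q z e\<bar> \<le> N3 * (?u z e + (?u z e)\<^sup>2)" .
  qed
  also have "\<dots> = N3 * (avg ?u + avg (\<lambda>z e. (?u z e)\<^sup>2))" by (simp only: avg_cmult avg_add)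
  also have "\<dots> \<le> N3 * ((1 + 414 * M3^4 * \<tau>) * (U + U\<^sup>2))"
  proof (rule mult_left_mono[OF _ N(12)])
    have "7 * M\<^sup>2 * \<tau> \<le> 414 * M3^4 * \<tau>" "414 * M^4 * \<tau> \<le> 414 * M3^4 * \<tau>"
    proof -
      have "M\<^sup>2 \<le> M^4" using M1 by (intro power_increasing) auto
      also have m4: "M^4 \<le> M3^4" using M1 MM3 by (intro power_mono) auto
      finally have "M\<^sup>2 \<le> M3^4" .
      moreover have "0 \<le> M3^4" by simp
      ultimately have "7 * M\<^sup>2 \<le> 414 * M3^4" by linarith
      then show "7 * M\<^sup>2 * \<tau> \<le> 414 * M3^4 * \<tau>" using tau_pos by (intro mult_right_mono) auto
      show "414 * M^4 * \<tau> \<le> 414 * M3^4 * \<tau>" using m4 tau_pos by (intro mult_right_mono) auto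
    qed
    then have "(1 + 7 * M\<^sup>2 * \<tau>) * U \<le> (1 + 414 * M3^4 * \<tau>) * U" "(1 + 414 * M^4 * \<tau>) * U\<^sup>2 \<le> (1 + 414 * M3^4 * \<tau>) * U\<^sup>2"
      using U0 by (intro mult_right_mono; simp)+
    then show "avg ?u + avg (\<lambda>z e. (?u z e)\<^sup>2) \<le> (1 + 414 * M3^4 * \<tau>) * (U + U\<^sup>2)"
      using avg_norm2[of v x w] avg_norm4[of v x w] unfolding U_def[symmetric] by (simp add: algebra_simps)
  qed
  finally have main: "\<bar>2 * avg ?q\<bar> \<le> N3 * ((1 + 414 * M3^4 * \<tau>) * (U + U\<^sup>2))" .
  have b2: "\<bar>B 2 x\<bar> \<le> M3" "\<bar>b 2 x\<bar> \<le> M3" "\<bar>A 2 x\<bar> \<le> M3" "\<bar>g 2 x\<bar> \<le> M3" "\<bar>B 3 x\<bar> \<le> M3" "\<bar>b 3 x\<bar> \<le> M3" "\<bar>A 3 x\<bar> \<le> M3" "\<bar>g 3 x\<bar> \<le> M3"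
  proof -
    have le: "\<bar>a\<bar> \<le> M3" if "\<bar>a\<bar> \<le> M" for a using that MM3 by linarith
    show "\<bar>B 2 x\<bar> \<le> M3" "\<bar>b 2 x\<bar> \<le> M3" "\<bar>A 2 x\<bar> \<le> M3" "\<bar>g 2 x\<bar> \<le> M3" "\<bar>B 3 x\<bar> \<le> M3" "\<bar>b 3 x\<bar> \<le> M3" "\<bar>A 3 x\<bar> \<le> M3" "\<bar>g 3 x\<bar> \<le> M3"
      by (rule le[OF bB] le[OF bb] le[OF bA(1)] bA(2) b3'(2-5) order.refl)+
  qed
  have pr: "\<bar>a * c * w\<bar> \<le> \<tau> * (9 * M3\<^sup>2 * \<bar>w\<bar>)" if "\<bar>a\<bar> \<le> 3 * M3 * \<epsilon>" "\<bar>c\<bar> \<le> 3 * M3 * \<epsilon>" for a c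
    using abs_mult_le[OF abs_mult_le[OF that], of w "\<bar>w\<bar>"] by (simp add: tau power2_eq_square mult_ac)
  have pq: "\<bar>P z e k x\<bar> \<le> 3 * M3 * \<epsilon>" "\<bar>Q z k x\<bar> \<le> 3 * M3 * \<epsilon>" if "k \<le> 2" "\<bar>z\<bar> = 1" "\<bar>e\<bar> = 1" for k z e
  proof -
    show "\<bar>P z e k x\<bar> \<le> 3 * M3 * \<epsilon>" by (rule PQ_bd(3)[OF that(2,3,1)])
    have "\<bar>Q z k x\<bar> \<le> 2 * M3 * \<epsilon>" by (rule PQ_bd(4)[OF that(2,3,1)])
    moreover have "0 \<le> M3 * \<epsilon>" using M31 eps by simp
    ultimately show "\<bar>Q z k x\<bar> \<le> 3 * M3 * \<epsilon>" by linarith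
  qed
  have ta: "\<bar>\<tau> * a * c\<bar> \<le> \<tau> * (M3\<^sup>2 * \<bar>c\<bar>)" if "\<bar>a\<bar> \<le> M3" for a c
  proof -
    have "\<bar>\<tau> * a * c\<bar> \<le> \<tau> * M3 * \<bar>c\<bar>" using that tau_pos by (intro abs_mult_le) auto
    also have "\<dots> \<le> \<tau> * M3\<^sup>2 * \<bar>c\<bar>" using M2 tau_pos by (intro mult_right_mono mult_left_mono) auto
    finally show ?thesis by (simp add: mult.assoc)
  qed
  define W where "W = \<bar>v\<bar> + \<bar>w\<bar>"
  have W: "\<bar>v\<bar> \<le> W" "\<bar>w\<bar> \<le> W" "0 \<le> W" by (auto simp: W_def)
  \<comment> \<open>Shared by the three terms that pair a second derivative of \<open>F\<close> with
    a product of derivatives of the shifts: \<open>k1\<close> and \<open>k2\<close> describe the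
    centred part of order \<open>\<epsilon>\<close>, and everything else is of order
    \<open>\<tau>\<close>.\<close>
  have E: "\<bar>avg (\<lambda>z e. at_shift (F i j) y x z e * c z e)\<bar> \<le> \<tau> * (30 * M3\<^sup>2 * (N2 + N3) * W)"
    if ij: "i + j = 2" and k: "\<bar>k1\<bar> \<le> M3 * \<bar>v1\<bar>" "\<bar>k2\<bar> \<le> M3 * \<bar>v2\<bar>" "\<bar>v1\<bar> + \<bar>v2\<bar> \<le> W"
      and c: "\<And>z e. \<bar>z\<bar> = 1 \<Longrightarrow> \<bar>e\<bar> = 1 \<Longrightarrow> \<bar>c z e - \<epsilon> * (k1 * xi \<rho> z e + k2 * z)\<bar> \<le> \<tau> * (30 * M3\<^sup>2 * W)"
    for i j c k1 k2 v1 v2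
  proof -
    have "i = 0 \<and> j = 2 \<or> i = 1 \<and> j = 1 \<or> i = 2 \<and> j = 0" using ij by arith
    then have b: "\<bar>F (Suc i) j y x\<bar> \<le> 2 * N3" "\<bar>F i (Suc j) y x\<bar> \<le> 2 * N3" "\<bar>F i j y x\<bar> \<le> N2" for y x
      using N(3-9)[of y x] by (auto simp: eval_nat_numeral)
    have "\<bar>avg (\<lambda>z e. at_shift (F i j) y x z e * c z e)\<bar> \<le> \<tau> * (5 * M * (2 * N3) * (2 * \<bar>k1\<bar> + \<bar>k2\<bar>) + N2 * (30 * M3\<^sup>2 * W))"
      by (rule avg_mult_centred_le[OF F _ b(1,2,3) c]) (use ij in auto)
    also have "5 * M * (2 * N3) * (2 * \<bar>k1\<bar> + \<bar>k2\<bar>) \<le> 5 * M3 * (2 * N3) * (2 * (M3 * W))"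
    proof -
      have "2 * \<bar>k1\<bar> + \<bar>k2\<bar> \<le> 2 * (M3 * (\<bar>v1\<bar> + \<bar>v2\<bar>))" using k(1,2) M31 abs_ge_zero[of k2] by (simp add: distrib_left)
      also have "\<dots> \<le> 2 * (M3 * W)" using k(3) M31 by simp
      finally show ?thesis using MM3 M1 N(12) W M31 by (intro mult_mono) auto
    qed
    finally have "\<bar>avg (\<lambda>z e. at_shift (F i j) y x z e * c z e)\<bar> \<le> \<tau> * (20 * (M3\<^sup>2 * N3 * W) + 30 * (M3\<^sup>2 * N2 * W))"
      using tau_pos by (simp add: power2_eq_square mult_ac)
    also have "\<dots> \<le> \<tau> * (30 * M3\<^sup>2 * (N2 + N3) * W)"
      using tau_pos N(12) W by (intro mult_left_mono) (auto simp: algebra_simps)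
    finally show ?thesis .
  qed
  have w30: "\<tau> * (M3\<^sup>2 * \<bar>v\<bar>) \<le> \<tau> * (M3\<^sup>2 * W)" "\<tau> * (M3\<^sup>2 * \<bar>w\<bar>) \<le> \<tau> * (M3\<^sup>2 * W)"
    using W tau_pos by (intro mult_left_mono; simp)+
  have tW: "0 \<le> \<tau> * (M3\<^sup>2 * W)" using W tau_pos by simp
  have kB: "\<bar>B 2 x * u\<bar> \<le> M3 * \<bar>u\<bar>" "\<bar>b 2 x * u\<bar> \<le> M3 * \<bar>u\<bar>" for u
    using b2 by (auto intro: abs_mult_le)
  have E1: "\<bar>?E1\<bar> \<le> \<tau> * (30 * M3\<^sup>2 * (N2 + N3) * W)"
  proof (rule E[where ?k1.0 = "B 2 x * v" and ?k2.0 = 0 and ?v1.0 = v and ?v2.0 = 0])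
    fix z e :: real assume ze: "\<bar>z\<bar> = 1" "\<bar>e\<bar> = 1"
    have "P z e 2 x * ?v z e - \<epsilon> * (B 2 x * v * xi \<rho> z e + 0 * z) = \<tau> * A 2 x * v + P z e 2 x * P z e 1 x * w"
      by (simp add: P_def algebra_simps)
    then show "\<bar>P z e 2 x * ?v z e - \<epsilon> * (B 2 x * v * xi \<rho> z e + 0 * z)\<bar> \<le> \<tau> * (30 * M3\<^sup>2 * W)"
      using ta[OF b2(3), of v] pr[OF pq(1)[of 2 z e] pq(1)[of 1 z e]] ze w30 tW by simp
  qed (simp_all add: kB W)
  have E2: "\<bar>?E2\<bar> \<le> \<tau> * (30 * M3\<^sup>2 * (N2 + N3) * W)"
  proof (rule E[where ?k1.0 = "B 2 x * w" and ?k2.0 = "b 2 x * v" and ?v1.0 = w and ?v2.0 = v])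
    fix z e :: real assume ze: "\<bar>z\<bar> = 1" "\<bar>e\<bar> = 1"
    have eq: "Q z 2 x * ?v z e + P z e 2 x * ?w z - \<epsilon> * (B 2 x * w * xi \<rho> z e + b 2 x * v * z) =
       \<tau> * g 2 x * v + Q z 2 x * P z e 1 x * w + \<tau> * A 2 x * w + P z e 2 x * Q z 1 x * w"
      by (simp add: P_def Q_def algebra_simps)
    have w30': "\<tau> * (M3\<^sup>2 * \<bar>v\<bar>) + \<tau> * (9 * M3\<^sup>2 * \<bar>w\<bar>) + \<tau> * (M3\<^sup>2 * \<bar>w\<bar>) + \<tau> * (9 * M3\<^sup>2 * \<bar>w\<bar>) \<le> \<tau> * (30 * M3\<^sup>2 * W)"
    proof -
      have "\<tau> * (9 * M3\<^sup>2 * \<bar>w\<bar>) = 9 * (\<tau> * (M3\<^sup>2 * \<bar>w\<bar>))" "\<tau> * (30 * M3\<^sup>2 * W) = 30 * (\<tau> * (M3\<^sup>2 * W))" by simp_all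
      then show ?thesis using w30 tW by linarith
    qed
    have "\<bar>\<tau> * g 2 x * v + Q z 2 x * P z e 1 x * w + \<tau> * A 2 x * w + P z e 2 x * Q z 1 x * w\<bar> \<le> \<tau> * (30 * M3\<^sup>2 * W)"
      by (rule abs_add4_le[where E = "\<tau> * (30 * M3\<^sup>2 * W)", OF ta[OF b2(4)] pr[OF pq(2)[of 2 z e] pq(1)[of 1 z e]] ta[OF b2(3)] pr[OF pq(1)[of 2 z e] pq(2)[of 1 z e]]])
        (rule w30' order.refl ze | simp)+
    then show "\<bar>Q z 2 x * ?v z e + P z e 2 x * ?w z - \<epsilon> * (B 2 x * w * xi \<rho> z e + b 2 x * v * z)\<bar> \<le> \<tau> * (30 * M3\<^sup>2 * W)"
      unfolding eq .
  qed (simp_all add: kB, simp add: W_def)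
  have E3: "\<bar>?E3\<bar> \<le> \<tau> * (30 * M3\<^sup>2 * (N2 + N3) * W)"
  proof (rule E[where ?k1.0 = 0 and ?k2.0 = "b 2 x * w" and ?v1.0 = 0 and ?v2.0 = w])
    fix z e :: real assume ze: "\<bar>z\<bar> = 1" "\<bar>e\<bar> = 1"
    have "Q z 2 x * ?w z - \<epsilon> * (0 * xi \<rho> z e + b 2 x * w * z) = \<tau> * g 2 x * w + Q z 2 x * Q z 1 x * w"
      by (simp add: Q_def algebra_simps)
    then show "\<bar>Q z 2 x * ?w z - \<epsilon> * (0 * xi \<rho> z e + b 2 x * w * z)\<bar> \<le> \<tau> * (30 * M3\<^sup>2 * W)"
      using ta[OF b2(4), of w] pr[OF pq(2)[of 2 z e] pq(2)[of 1 z e]] ze w30 tW by simp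
  qed (simp_all add: kB W)
  have N': "\<bar>F (Suc 1) 0 y x\<bar> \<le> N2" "\<bar>F 1 (Suc 0) y x\<bar> \<le> N2" "\<bar>F (Suc 0) 1 y x\<bar> \<le> N2" "\<bar>F 0 (Suc 1) y x\<bar> \<le> N2" for y x
    using N by (simp_all add: numeral_2_eq_2)
  have M3c: "5 * M * N2 * (2 * \<bar>k1\<bar> + \<bar>k2\<bar>) + N1 * M3 \<le> 10 * M3\<^sup>2 * (N1 + N2)"
    if "\<bar>k1\<bar> \<le> M3" "k2 = 0 \<or> k1 = 0 \<and> \<bar>k2\<bar> \<le> M3" for k1 k2
  proof -
    have "2 * \<bar>k1\<bar> + \<bar>k2\<bar> \<le> 2 * M3" using that M31 by auto
    then have "5 * M * N2 * (2 * \<bar>k1\<bar> + \<bar>k2\<bar>) \<le> 5 * M3 * N2 * (2 * M3)" using MM3 M1 N(11) M31 by (intro mult_mono) auto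
    moreover have "N1 * M3 \<le> N1 * M3\<^sup>2" using M2 N(10) by (intro mult_left_mono) auto
    moreover have "0 \<le> N1 * M3\<^sup>2" using N(10) by simp
    ultimately show ?thesis by (simp add: power2_eq_square algebra_simps)
  qed
  have "\<bar>?E4\<bar> \<le> \<tau> * (5 * M * N2 * (2 * \<bar>B 3 x\<bar> + \<bar>0\<bar>) + N1 * M3)"
  proof (rule avg_mult_centred_le[OF F _ N'(1,2) N(1)])
    fix z e :: real
    have "P z e 3 x - \<epsilon> * (B 3 x * xi \<rho> z e + 0 * z) = \<tau> * A 3 x" by (simp add: P_def)
    then show "\<bar>P z e 3 x - \<epsilon> * (B 3 x * xi \<rho> z e + 0 * z)\<bar> \<le> \<tau> * M3"
      using tau_pos b2 by (simp add: abs_mult)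
  qed simp
  also have "\<dots> \<le> \<tau> * (10 * M3\<^sup>2 * (N1 + N2))" using M3c[of "B 3 x" 0] b2 tau_pos by (intro mult_left_mono) auto
  finally have E4: "\<bar>?E4\<bar> \<le> \<tau> * (10 * M3\<^sup>2 * (N1 + N2))" .
  have "\<bar>?E5\<bar> \<le> \<tau> * (5 * M * N2 * (2 * \<bar>0\<bar> + \<bar>b 3 x\<bar>) + N1 * M3)"
  proof (rule avg_mult_centred_le[OF F _ N'(3,4) N(2)])
    fix z e :: real
    have "Q z 3 x - \<epsilon> * (0 * xi \<rho> z e + b 3 x * z) = \<tau> * g 3 x" by (simp add: Q_def)
    then show "\<bar>Q z 3 x - \<epsilon> * (0 * xi \<rho> z e + b 3 x * z)\<bar> \<le> \<tau> * M3"
      using tau_pos b2 by (simp add: abs_mult)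
  qed simp
  also have "\<dots> \<le> \<tau> * (10 * M3\<^sup>2 * (N1 + N2))" using M3c[of 0 "b 3 x"] b2 M31 tau_pos by (intro mult_left_mono) auto
  finally have E5: "\<bar>?E5\<bar> \<le> \<tau> * (10 * M3\<^sup>2 * (N1 + N2))" .
  define NN where "NN = N1 + N2 + N3"
  have NN: "N2 + N3 \<le> NN" "N1 + N2 \<le> NN" "0 \<le> NN" "N3 \<le> NN" using N by (auto simp: NN_def)
  \<comment> \<open>Cubic monomials in the direction are absorbed into the even expression
    \<open>U + U^2\<close> by means of \<open>2 * \<bar>a\<bar> \<le> 1 + a^2\<close>.\<close>
  have wU: "w\<^sup>2 * W \<le> U + U\<^sup>2" "\<bar>w\<bar>^3 \<le> U + U\<^sup>2"
  proof -
    have a: "2 * \<bar>a\<bar> \<le> 1 + a\<^sup>2" for a :: real using sum_squares_bound[of 1 "\<bar>a\<bar>"] by simp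
    have "w\<^sup>2 * (2 * W) \<le> w\<^sup>2 * ((1 + v\<^sup>2) + (1 + w\<^sup>2))" using a[of v] a[of w] by (intro mult_left_mono) (auto simp: W_def)
    also have "\<dots> = 2 * w\<^sup>2 + w\<^sup>2 * U" by (simp add: U_def algebra_simps)
    also have "\<dots> \<le> 2 * U + U * U" using U0 by (intro add_mono mult_right_mono) (auto simp: U_def)
    finally have "2 * (w\<^sup>2 * W) \<le> 2 * U + U * U" by simp
    moreover have "0 \<le> U * U" using U0 by simp
    ultimately show 1: "w\<^sup>2 * W \<le> U + U\<^sup>2" unfolding power2_eq_square by linarith
    have "\<bar>w\<bar>^3 = w\<^sup>2 * \<bar>w\<bar>" by (simp add: power3_eq_cube power2_eq_square abs_mult_self_eq)
    also have "\<dots> \<le> w\<^sup>2 * W" using W by (intro mult_left_mono) auto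
    finally show "\<bar>w\<bar>^3 \<le> U + U\<^sup>2" using 1 by simp
  qed
  have "\<bar>?E1 + ?E2 + ?E3\<bar> \<le> \<tau> * (30 * M3\<^sup>2 * (N2 + N3) * W) + \<tau> * (30 * M3\<^sup>2 * (N2 + N3) * W) + \<tau> * (30 * M3\<^sup>2 * (N2 + N3) * W)"
    by (rule abs_add3_le[OF E1 E2 E3])
  also have "\<dots> = \<tau> * (90 * M3\<^sup>2 * (N2 + N3) * W)" by (simp add: mult_ac)
  also have "\<dots> \<le> \<tau> * (90 * M3\<^sup>2 * NN * W)" using NN tau_pos W by (intro mult_left_mono mult_right_mono) auto
  finally have "\<bar>w\<^sup>2 * (?E1 + ?E2 + ?E3)\<bar> \<le> w\<^sup>2 * (\<tau> * (90 * M3\<^sup>2 * NN * W))" by (simp add: abs_mult mult_left_mono)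
  also have "\<dots> = \<tau> * (90 * M3\<^sup>2 * NN) * (w\<^sup>2 * W)" by (simp add: mult_ac)
  also have "\<dots> \<le> \<tau> * (90 * M3\<^sup>2 * NN) * (U + U\<^sup>2)" using wU tau_pos NN by (intro mult_left_mono) auto
  finally have L1: "\<bar>w\<^sup>2 * (?E1 + ?E2 + ?E3)\<bar> \<le> \<tau> * (90 * M3\<^sup>2 * NN) * (U + U\<^sup>2)" .
  have "\<bar>?E4 + ?E5\<bar> \<le> \<tau> * (10 * M3\<^sup>2 * (N1 + N2)) + \<tau> * (10 * M3\<^sup>2 * (N1 + N2))" by (rule abs_add2_le[OF E4 E5])
  also have "\<dots> = \<tau> * (20 * M3\<^sup>2 * (N1 + N2))" by (simp add: mult_ac)
  also have "\<dots> \<le> \<tau> * (20 * M3\<^sup>2 * NN)" using NN tau_pos by (intro mult_left_mono) auto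
  finally have "\<bar>w^3 * (?E4 + ?E5)\<bar> \<le> \<bar>w\<bar>^3 * (\<tau> * (20 * M3\<^sup>2 * NN))" by (simp add: abs_mult power_abs mult_left_mono)
  also have "\<dots> \<le> (U + U\<^sup>2) * (\<tau> * (20 * M3\<^sup>2 * NN))" using wU tau_pos NN by (intro mult_right_mono) auto
  finally have L2: "\<bar>w^3 * (?E4 + ?E5)\<bar> \<le> \<tau> * (20 * M3\<^sup>2 * NN) * (U + U\<^sup>2)" by (simp add: mult_ac)
  have "2 * \<bar>avg ?q + 3 * (w\<^sup>2 * (?E1 + ?E2 + ?E3)) + w^3 * (?E4 + ?E5)\<bar> \<le>
    \<bar>2 * avg ?q\<bar> + 6 * \<bar>w\<^sup>2 * (?E1 + ?E2 + ?E3)\<bar> + 2 * \<bar>w^3 * (?E4 + ?E5)\<bar>"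
  proof -
    have "2 * \<bar>a + 3 * b + c\<bar> \<le> \<bar>2 * a\<bar> + 6 * \<bar>b\<bar> + 2 * \<bar>c\<bar>" for a b c :: real by (smt (verit))
    then show ?thesis .
  qed
  also have "\<dots> \<le> N3 * ((1 + 414 * M3^4 * \<tau>) * (U + U\<^sup>2)) + 6 * (\<tau> * (90 * M3\<^sup>2 * NN) * (U + U\<^sup>2)) + 2 * (\<tau> * (20 * M3\<^sup>2 * NN) * (U + U\<^sup>2))"
    by (intro add_mono main mult_left_mono L1 L2) auto
  also have "\<dots> = (N3 + (414 * (M3^4 * \<tau> * N3) + 580 * (M3\<^sup>2 * \<tau> * NN))) * (U + U\<^sup>2)" by (simp add: algebra_simps)
  also have "\<dots> \<le> (N3 + (994 * M3^4 * \<tau> * NN)) * (U + U\<^sup>2)"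
  proof (intro mult_right_mono add_left_mono)
    have "M3\<^sup>2 \<le> M3^4" using M31 by (intro power_increasing) auto
    then have "M3\<^sup>2 * \<tau> * NN \<le> M3^4 * \<tau> * NN" using tau_pos NN by (intro mult_right_mono) auto
    moreover have "M3^4 * \<tau> * N3 \<le> M3^4 * \<tau> * NN" using tau_pos NN M31 by (intro mult_left_mono) auto
    ultimately show "414 * (M3^4 * \<tau> * N3) + 580 * (M3\<^sup>2 * \<tau> * NN) \<le> 994 * M3^4 * \<tau> * NN" by simp
  qed (use U0 in auto)
  finally show ?thesis unfolding eq U_def[symmetric] NN_def[symmetric] by simp
qed
end

section \<open>Positivity, convexity, consistency and vega of one step\<close>

context scheme begin

definition Lop :: "(nat \<Rightarrow> nat \<Rightarrow> real \<Rightarrow> real \<Rightarrow> real) \<Rightarrow> real \<Rightarrow> real \<Rightarrow> real" where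
  "Lop F y x = A 0 x * F 1 0 y x + g 0 x * F 0 1 y x + (B 0 x)\<^sup>2 / 2 * F 2 0 y x
     + \<rho> * B 0 x * b 0 x * F 1 1 y x + (b 0 x)\<^sup>2 / 2 * F 0 2 y x"

lemma T_bounds:
  assumes "\<And>y x. lo \<le> F 0 0 y x" "\<And>y x. F 0 0 y x \<le> hi"
  shows "lo \<le> T F 0 0 y x" "T F 0 0 y x \<le> hi"
  using avg_mono[of "\<lambda>_ _. lo" "\<lambda>z e. at_shift (F 0 0) y x z e"] avg_mono[of "\<lambda>z e. at_shift (F 0 0) y x z e" "\<lambda>_ _. hi"] assms
  by (auto simp: T_def shift_jet_def avg_const)

text \<open>The shifts depend on \<open>x\<close> only, so derivatives in \<open>y\<close> commute
  with the average. This reflects the homogeneity of the model in \<open>S\<close>.\<close>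

lemma T_convex:
  assumes "\<And>y x. 0 \<le> F 2 0 y x - F 1 0 y x"
  shows "0 \<le> T F 2 0 y x - T F 1 0 y x"
proof -
  have "avg (\<lambda>z e. 0) \<le> avg (\<lambda>z e. at_shift (F 2 0) y x z e - at_shift (F 1 0) y x z e)"
    using assms by (intro avg_mono) blast
  then show ?thesis by (simp add: T_def shift_jet_def avg_const avg_diff)
qed

lemma shift_sum_bd:
  assumes "\<bar>z\<bar> = 1" "\<bar>e\<bar> = 1"
  shows "\<bar>P z e 0 x\<bar> + \<bar>Q z 0 x\<bar> \<le> 5 * M * \<epsilon>"
  using PQ_bd(1)[OF assms, of 0 x] PQ_bd(2)[OF assms, of 0 x] by simp

lemma avg_moments:
  "avg (\<lambda>z e. P z e 0 x) = \<tau> * A 0 x" "avg (\<lambda>z e. Q z 0 x) = \<tau> * g 0 x"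
  "avg (\<lambda>z e. (P z e 0 x)\<^sup>2) = \<tau>\<^sup>2 * (A 0 x)\<^sup>2 + \<tau> * (B 0 x)\<^sup>2"
  "avg (\<lambda>z e. P z e 0 x * Q z 0 x) = \<tau>\<^sup>2 * (A 0 x * g 0 x) + \<tau> * (\<rho> * B 0 x * b 0 x)"
  "avg (\<lambda>z e. (Q z 0 x)\<^sup>2) = \<tau>\<^sup>2 * (g 0 x)\<^sup>2 + \<tau> * (b 0 x)\<^sup>2"
  "avg (\<lambda>z e. xi \<rho> z e * P z e 0 x) = \<epsilon> * B 0 x" "avg (\<lambda>z e. xi \<rho> z e * Q z 0 x) = \<epsilon> * \<rho> * b 0 x"
  "avg (\<lambda>z e. z * P z e 0 x) = \<epsilon> * \<rho> * B 0 x" "avg (\<lambda>z e. z * Q z 0 x) = \<epsilon> * b 0 x"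
  "avg (\<lambda>z e. xi \<rho> z e) = 0" "avg (\<lambda>z e. z) = 0"
proof -
  note q = avg_quad[OF rho]
  have P: "P z e 0 x = \<tau> * A 0 x + (\<epsilon> * B 0 x) * xi \<rho> z e + 0 * z" for z e by (simp add: P_def mult_ac)
  have Q: "Q z 0 x = \<tau> * g 0 x + 0 * xi \<rho> z e + (\<epsilon> * b 0 x) * z" for z e by (simp add: Q_def mult_ac)
  show "avg (\<lambda>z e. P z e 0 x) = \<tau> * A 0 x" unfolding P by (rule avg_lin)
  show "avg (\<lambda>z e. Q z 0 x) = \<tau> * g 0 x" by (simp add: Q_def avg_def field_simps)
  show "avg (\<lambda>z e. (P z e 0 x)\<^sup>2) = \<tau>\<^sup>2 * (A 0 x)\<^sup>2 + \<tau> * (B 0 x)\<^sup>2"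
    unfolding P power2_eq_square q by (simp add: tau power2_eq_square algebra_simps)
  have "avg (\<lambda>z e. P z e 0 x * Q z 0 x) = avg (\<lambda>z e. (\<tau> * A 0 x + (\<epsilon> * B 0 x) * xi \<rho> z e + 0 * z) * (\<tau> * g 0 x + 0 * xi \<rho> z e + (\<epsilon> * b 0 x) * z))"
    using P Q by simp
  then show "avg (\<lambda>z e. P z e 0 x * Q z 0 x) = \<tau>\<^sup>2 * (A 0 x * g 0 x) + \<tau> * (\<rho> * B 0 x * b 0 x)"
    unfolding q by (simp add: tau power2_eq_square algebra_simps)
  have "avg (\<lambda>z e. (Q z 0 x)\<^sup>2) = avg (\<lambda>z e. (\<tau> * g 0 x + 0 * xi \<rho> z e + (\<epsilon> * b 0 x) * z) * (\<tau> * g 0 x + 0 * xi \<rho> z e + (\<epsilon> * b 0 x) * z))"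
    using Q by (simp add: power2_eq_square)
  then show "avg (\<lambda>z e. (Q z 0 x)\<^sup>2) = \<tau>\<^sup>2 * (g 0 x)\<^sup>2 + \<tau> * (b 0 x)\<^sup>2"
    unfolding q by (simp add: tau power2_eq_square algebra_simps)
  have "avg (\<lambda>z e. xi \<rho> z e * P z e 0 x) = avg (\<lambda>z e. (0 + 1 * xi \<rho> z e + 0 * z) * (\<tau> * A 0 x + (\<epsilon> * B 0 x) * xi \<rho> z e + 0 * z))"
    using P by simp
  then show "avg (\<lambda>z e. xi \<rho> z e * P z e 0 x) = \<epsilon> * B 0 x" unfolding q by simp
  have "avg (\<lambda>z e. xi \<rho> z e * Q z 0 x) = avg (\<lambda>z e. (0 + 1 * xi \<rho> z e + 0 * z) * (\<tau> * g 0 x + 0 * xi \<rho> z e + (\<epsilon> * b 0 x) * z))"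
    using Q by simp
  then show "avg (\<lambda>z e. xi \<rho> z e * Q z 0 x) = \<epsilon> * \<rho> * b 0 x" unfolding q by simp
  have "avg (\<lambda>z e. z * P z e 0 x) = avg (\<lambda>z e. (0 + 0 * xi \<rho> z e + 1 * z) * (\<tau> * A 0 x + (\<epsilon> * B 0 x) * xi \<rho> z e + 0 * z))"
    using P by simp
  then show "avg (\<lambda>z e. z * P z e 0 x) = \<epsilon> * \<rho> * B 0 x" unfolding q by simp
  show "avg (\<lambda>z e. z * Q z 0 x) = \<epsilon> * b 0 x" by (simp add: Q_def avg_def field_simps)
  show "avg (\<lambda>z e. xi \<rho> z e) = 0" using avg_lin[of 0 1 \<rho> 0] by simp
  show "avg (\<lambda>z e. z) = 0" by (simp add: avg_def)
qed

text \<open>The third-order Taylor remainder is \<open>O(\<epsilon>^3)\<close>, that is,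
  \<open>O(\<tau> * \<epsilon>)\<close>, and the first and second moments of the shifts reproduce
  \<open>Lop\<close> up to products of drifts, of size \<open>\<tau>^2\<close>.\<close>

lemma T_consistent:
  assumes F: "jet3 F" and bd: "jet_bd F N1 N2 N3"
  shows "\<bar>T F 0 0 y x - F 0 0 y x - \<tau> * Lop F y x\<bar> \<le> 252 * M^3 * (N1 + N2 + N3) * \<tau> * \<epsilon>"
proof -
  note N = jet_bd_comp[OF bd]
  let ?t = "\<lambda>z e. F 1 0 y x * P z e 0 x + F 0 1 y x * Q z 0 x + (1/2 * F 2 0 y x * (P z e 0 x)\<^sup>2 + F 1 1 y x * (P z e 0 x * Q z 0 x) + 1/2 * F 0 2 y x * (Q z 0 x)\<^sup>2)"
  have "\<bar>avg (\<lambda>z e. at_shift (F 0 0) y x z e - F 0 0 y x - ?t z e)\<bar> \<le> 250 * (M^3 * N3 * (\<tau> * \<epsilon>))"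
  proof (rule avg_abs_le)
    fix z e :: real assume ze: "\<bar>z\<bar> = 1" "\<bar>e\<bar> = 1"
    have "\<bar>at_shift (F 0 0) y x z e - F 0 0 y x - F 1 0 y x * P z e 0 x - F 0 1 y x * Q z 0 x
      - (F 2 0 y x * (P z e 0 x)\<^sup>2 + 2 * F 1 1 y x * P z e 0 x * Q z 0 x + F 0 2 y x * (Q z 0 x)\<^sup>2) / 2\<bar> \<le> 2 * N3 * (\<bar>P z e 0 x\<bar> + \<bar>Q z 0 x\<bar>)^3"
      by (rule jet_increment3[OF F N(6-9)])
    also have "\<dots> \<le> 2 * N3 * (5 * M * \<epsilon>)^3" using shift_sum_bd[OF ze, of x] N(12)
      by (intro mult_left_mono power_mono) auto
    also have "\<dots> = 250 * (M^3 * N3 * (\<tau> * \<epsilon>))" by (simp add: tau power_mult_distrib power2_eq_square power3_eq_cube)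
    finally show "\<bar>at_shift (F 0 0) y x z e - F 0 0 y x - ?t z e\<bar> \<le> 250 * (M^3 * N3 * (\<tau> * \<epsilon>))"
      by (simp add: algebra_simps add_divide_distrib)
  qed
  moreover have "avg (\<lambda>z e. at_shift (F 0 0) y x z e - F 0 0 y x - ?t z e) = T F 0 0 y x - F 0 0 y x - avg ?t"
    by (simp add: avg_diff avg_const T_def shift_jet_def)
  moreover have "avg ?t = \<tau> * Lop F y x + \<tau>\<^sup>2 / 2 * (F 2 0 y x * (A 0 x)\<^sup>2 + 2 * F 1 1 y x * (A 0 x * g 0 x) + F 0 2 y x * (g 0 x)\<^sup>2)"
    unfolding avg_add avg_cmult avg_moments by (simp add: Lop_def algebra_simps add_divide_distrib)
  moreover have "\<bar>\<tau>\<^sup>2 / 2 * (F 2 0 y x * (A 0 x)\<^sup>2 + 2 * F 1 1 y x * (A 0 x * g 0 x) + F 0 2 y x * (g 0 x)\<^sup>2)\<bar> \<le> (\<tau> * \<epsilon>) / 2 * (4 * (M^3 * N2))"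
  proof (rule abs_mult_le)
    have "\<tau> * \<tau> \<le> \<tau> * \<epsilon>" using tau_pos by (intro mult_left_mono) auto
    then show "\<bar>\<tau>\<^sup>2 / 2\<bar> \<le> \<tau> * \<epsilon> / 2" by (simp add: power2_eq_square)
    have "\<bar>F 2 0 y x * (A 0 x * A 0 x)\<bar> \<le> N2 * (M * M)" "\<bar>F 1 1 y x * (A 0 x * g 0 x)\<bar> \<le> N2 * (M * M)" "\<bar>F 0 2 y x * (g 0 x * g 0 x)\<bar> \<le> N2 * (M * M)"
      by (intro abs_mult_le N bA bg; simp)+
    moreover have "N2 * (M * M) \<le> M^3 * N2"
      using mult_right_mono[OF power_increasing[of 2 3 M] N(11)] M1 by (simp add: mult.commute power2_eq_square)
    ultimately show "\<bar>F 2 0 y x * (A 0 x)\<^sup>2 + 2 * F 1 1 y x * (A 0 x * g 0 x) + F 0 2 y x * (g 0 x)\<^sup>2\<bar> \<le> 4 * (M^3 * N2)"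
      unfolding power2_eq_square by linarith
  qed
  ultimately have "\<bar>T F 0 0 y x - F 0 0 y x - \<tau> * Lop F y x\<bar> \<le> 250 * (M^3 * N3 * (\<tau> * \<epsilon>)) + 2 * (M^3 * N2 * (\<tau> * \<epsilon>))"
    by (simp add: mult_ac)
  also have "\<dots> \<le> 252 * (M^3 * (N1 + N2 + N3) * (\<tau> * \<epsilon>))"
  proof -
    have "M^3 * N3 * (\<tau> * \<epsilon>) \<le> M^3 * (N1 + N2 + N3) * (\<tau> * \<epsilon>)" "M^3 * N2 * (\<tau> * \<epsilon>) \<le> M^3 * (N1 + N2 + N3) * (\<tau> * \<epsilon>)"
      using N(10-12) M1 tau_pos eps by (intro mult_right_mono mult_left_mono; simp)+
    then show ?thesis by simp
  qed
  finally show ?thesis by (simp add: mult_ac)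
qed

text \<open>Between two grid times the comparison function interpolates between \<open>F\<close> and
  \<open>T F\<close>, and this estimate permits its derivatives to be replaced by those of
  \<open>F\<close>. The constant 61 is the sum of the contributions to the second derivative in
  \<open>x\<close>, the worst of the five.\<close>

lemma T_near:
  assumes F: "jet3 F" and bd: "jet_bd F N1 N2 N3"
    and ij: "(i, j) \<in> {(1,0), (0,1), (2,0), (1,1), (0,2)}"
  shows "\<bar>T F i j y x - F i j y x\<bar> \<le> 61 * M3\<^sup>2 * (N1 + N2 + N3) * \<epsilon>"
proof -
  note N = jet_bd_comp[OF bd]
  define S where "S = N1 + N2 + N3"
  have S: "N1 \<le> S" "N2 \<le> S" "N3 \<le> S" "0 \<le> S" using N by (auto simp: S_def)
  have NS: "\<bar>F 1 0 y x\<bar> \<le> 2 * S" "\<bar>F 0 1 y x\<bar> \<le> 2 * S" "\<bar>F 2 0 y x\<bar> \<le> 2 * S" "\<bar>F 1 1 y x\<bar> \<le> 2 * S" "\<bar>F 0 2 y x\<bar> \<le> 2 * S"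
    "\<bar>F 3 0 y x\<bar> \<le> 2 * S" "\<bar>F 2 1 y x\<bar> \<le> 2 * S" "\<bar>F 1 2 y x\<bar> \<le> 2 * S" "\<bar>F 0 3 y x\<bar> \<le> 2 * S" for y x
  proof -
    have le: "N1 \<le> 2 * S" "N2 \<le> 2 * S" "2 * N3 \<le> 2 * S" using S by auto
    show "\<bar>F 1 0 y x\<bar> \<le> 2 * S" "\<bar>F 0 1 y x\<bar> \<le> 2 * S" "\<bar>F 2 0 y x\<bar> \<le> 2 * S" "\<bar>F 1 1 y x\<bar> \<le> 2 * S" "\<bar>F 0 2 y x\<bar> \<le> 2 * S"
      "\<bar>F 3 0 y x\<bar> \<le> 2 * S" "\<bar>F 2 1 y x\<bar> \<le> 2 * S" "\<bar>F 1 2 y x\<bar> \<le> 2 * S" "\<bar>F 0 3 y x\<bar> \<le> 2 * S"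
      by (rule order_trans[OF N(1) le(1)] order_trans[OF N(2) le(1)] order_trans[OF N(3) le(2)] order_trans[OF N(4) le(2)]
        order_trans[OF N(5) le(2)] order_trans[OF N(6) le(3)] order_trans[OF N(7) le(3)] order_trans[OF N(8) le(3)] order_trans[OF N(9) le(3)])+
  qed
  have M31: "1 \<le> M3" using M1 MM3 by simp
  define m where "m = M3\<^sup>2"
  have m: "M3 \<le> m" "1 \<le> m" using M31 mult_left_mono[of 1 M3 M3] proof -
    show "M3 \<le> m" using M31 mult_left_mono[of 1 M3 M3] by (auto simp: m_def power2_eq_square)
    then show "1 \<le> m" using M31 by linarith
  qed
  have e2: "\<epsilon> * \<epsilon> \<le> \<epsilon>" using tau_pos by simp
  have mS: "M3 * S * \<epsilon> \<le> m * S * \<epsilon>" using m S eps by (intro mult_right_mono) auto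
  have D: "\<bar>at_shift (F i j) y x z e - F i j y x\<bar> \<le> 10 * (m * S * \<epsilon>)"
    if "i + j \<le> 2" "1 \<le> i + j" "\<bar>z\<bar> = 1" "\<bar>e\<bar> = 1" for i j z e
  proof -
    have "i = 1 \<and> j = 0 \<or> i = 0 \<and> j = 1 \<or> i = 2 \<and> j = 0 \<or> i = 1 \<and> j = 1 \<or> i = 0 \<and> j = 2" using that by arith
    then have "\<bar>F (Suc i) j y x\<bar> \<le> 2 * S" "\<bar>F i (Suc j) y x\<bar> \<le> 2 * S" for y x
      using NS[of y x] by (auto simp: eval_nat_numeral)
    then have "\<bar>at_shift (F i j) y x z e - F i j y x\<bar> \<le> 2 * S * (\<bar>P z e 0 x\<bar> + \<bar>Q z 0 x\<bar>)"
      using that by (intro jet_increment1[OF F]) auto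
    also have "\<dots> \<le> 2 * S * (5 * M3 * \<epsilon>)"
    proof (rule mult_left_mono)
      have "5 * M * \<epsilon> \<le> 5 * M3 * \<epsilon>" using MM3 eps by simp
      then show "\<bar>P z e 0 x\<bar> + \<bar>Q z 0 x\<bar> \<le> 5 * M3 * \<epsilon>" using shift_sum_bd[OF that(3,4), of x] by linarith
    qed (use S in simp)
    also have "\<dots> = 10 * (M3 * S * \<epsilon>)" by simp
    finally show ?thesis using mS by simp
  qed
  have FP: "\<bar>f * P z e k x\<bar> \<le> 3 * (m * S * \<epsilon>)" if "\<bar>f\<bar> \<le> S" "k \<le> 2" "\<bar>z\<bar> = 1" "\<bar>e\<bar> = 1" for f k z e
    using abs_mult_le[OF that(1) PQ_bd(3)[OF that(3,4,2), of x]] mS by (simp add: mult_ac)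
  have FQ: "\<bar>f * Q z k x\<bar> \<le> 2 * (m * S * \<epsilon>)" if "\<bar>f\<bar> \<le> S" "k \<le> 2" "\<bar>z\<bar> = 1" "\<bar>e\<bar> = 1" for f k z and e :: real
    using abs_mult_le[OF that(1) PQ_bd(4)[OF that(3,4,2), of x]] mS by (simp add: mult_ac)
  have quad: "\<bar>f * (a * c)\<bar> \<le> 9 * (m * S * \<epsilon>)" if "\<bar>f\<bar> \<le> S" "\<bar>a\<bar> \<le> 3 * M3 * \<epsilon>" "\<bar>c\<bar> \<le> 3 * M3 * \<epsilon>" for f a c
  proof -
    have "\<bar>f * (a * c)\<bar> \<le> S * ((3 * M3 * \<epsilon>) * (3 * M3 * \<epsilon>))" by (intro abs_mult_le that)
    also have "\<dots> = 9 * (m * S * (\<epsilon> * \<epsilon>))" by (simp add: m_def power2_eq_square)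
    also have "\<dots> \<le> 9 * (m * S * \<epsilon>)" using e2 m S by (intro mult_left_mono) auto
    finally show ?thesis .
  qed
  have F1: "\<bar>F 1 0 y x\<bar> \<le> S" "\<bar>F 0 1 y x\<bar> \<le> S" "\<bar>F 2 0 y x\<bar> \<le> S" "\<bar>F 1 1 y x\<bar> \<le> S" "\<bar>F 0 2 y x\<bar> \<le> S" for y x
    using N(1-5)[of y x] S by linarith+
  have mS0: "0 \<le> m * S * \<epsilon>" using m S eps by simp
  have "\<bar>shift_jet F (P z e) (Q z) i j y x - F i j y x\<bar> \<le> 61 * (m * S * \<epsilon>)" if ze: "\<bar>z\<bar> = 1" "\<bar>e\<bar> = 1" for z e
  proof -
    have p: "\<bar>P z e k x\<bar> \<le> 3 * M3 * \<epsilon>" "\<bar>Q z k x\<bar> \<le> 3 * M3 * \<epsilon>" if "k \<le> 2" for k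
    proof -
      have "0 \<le> M3 * \<epsilon>" using M31 eps by simp
      then show "\<bar>P z e k x\<bar> \<le> 3 * M3 * \<epsilon>" "\<bar>Q z k x\<bar> \<le> 3 * M3 * \<epsilon>" using PQ_bd(3,4)[OF ze that, of x] by linarith+
    qed
    consider "i = 1" "j = 0" | "i = 0" "j = 1" | "i = 2" "j = 0" | "i = 1" "j = 1" | "i = 0" "j = 2" using ij by auto
    then show ?thesis
    proof cases
      case 1 then show ?thesis using D[of 1 0 z e] ze mS0 by (simp add: shift_jet_def)
    next
      case 2
      have "shift_jet F (P z e) (Q z) i j y x - F i j y x = at_shift (F 1 0) y x z e * P z e 1 x + at_shift (F 0 1) y x z e * Q z 1 x
        + (at_shift (F 0 1) y x z e - F 0 1 y x)" using 2 by (simp add: shift_jet_def Let_def algebra_simps)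
      moreover have "\<bar>\<dots>\<bar> \<le> 3 * (m * S * \<epsilon>) + 2 * (m * S * \<epsilon>) + 10 * (m * S * \<epsilon>)"
        by (rule abs_add2_le F1 FP[OF _ _ ze] FQ[OF _ _ ze] D[OF _ _ ze] | simp; fail)+
      ultimately have "\<bar>shift_jet F (P z e) (Q z) i j y x - F i j y x\<bar> \<le> 3 * (m * S * \<epsilon>) + 2 * (m * S * \<epsilon>) + 10 * (m * S * \<epsilon>)" by (simp only:)
      then show ?thesis using mS0 by linarith
    next
      case 3 then show ?thesis using D[of 2 0 z e] ze mS0 by (simp add: shift_jet_def)
    next
      case 4
      have "shift_jet F (P z e) (Q z) i j y x - F i j y x = at_shift (F 2 0) y x z e * P z e 1 x + at_shift (F 1 1) y x z e * Q z 1 x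
        + (at_shift (F 1 1) y x z e - F 1 1 y x)" using 4 by (simp add: shift_jet_def Let_def algebra_simps numeral_2_eq_2)
      moreover have "\<bar>\<dots>\<bar> \<le> 3 * (m * S * \<epsilon>) + 2 * (m * S * \<epsilon>) + 10 * (m * S * \<epsilon>)"
        by (rule abs_add2_le F1 FP[OF _ _ ze] FQ[OF _ _ ze] D[OF _ _ ze] | simp; fail)+
      ultimately have "\<bar>shift_jet F (P z e) (Q z) i j y x - F i j y x\<bar> \<le> 3 * (m * S * \<epsilon>) + 2 * (m * S * \<epsilon>) + 10 * (m * S * \<epsilon>)" by (simp only:)
      then show ?thesis using mS0 by linarith
    next
      case 5
      have "shift_jet F (P z e) (Q z) i j y x - F i j y x = at_shift (F 2 0) y x z e * (P z e 1 x * P z e 1 x)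
        + 2 * (at_shift (F 1 1) y x z e * P z e 1 x) + 2 * (at_shift (F 1 1) y x z e * (P z e 1 x * Q z 1 x))
        + 2 * (at_shift (F 0 2) y x z e * Q z 1 x) + at_shift (F 0 2) y x z e * (Q z 1 x * Q z 1 x)
        + at_shift (F 1 0) y x z e * P z e 2 x + at_shift (F 0 1) y x z e * Q z 2 x
        + (at_shift (F 0 2) y x z e - F 0 2 y x)" using 5
        by (simp add: shift_jet_def Let_def algebra_simps power2_eq_square numeral_2_eq_2)
      moreover have "\<bar>\<dots>\<bar> \<le> 9 * (m * S * \<epsilon>) + 2 * (3 * (m * S * \<epsilon>)) + 2 * (9 * (m * S * \<epsilon>)) + 2 * (2 * (m * S * \<epsilon>))
          + 9 * (m * S * \<epsilon>) + 3 * (m * S * \<epsilon>) + 2 * (m * S * \<epsilon>) + 10 * (m * S * \<epsilon>)"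
        by (rule abs_add2_le abs_mult_le[of 2 2] quad F1 p FP[OF _ _ ze] FQ[OF _ _ ze] D[OF _ _ ze] | simp; fail)+
      ultimately have "\<bar>shift_jet F (P z e) (Q z) i j y x - F i j y x\<bar> \<le> 9 * (m * S * \<epsilon>) + 2 * (3 * (m * S * \<epsilon>)) + 2 * (9 * (m * S * \<epsilon>)) + 2 * (2 * (m * S * \<epsilon>)) + 9 * (m * S * \<epsilon>) + 3 * (m * S * \<epsilon>) + 2 * (m * S * \<epsilon>) + 10 * (m * S * \<epsilon>)" by (simp only:)
      then show ?thesis using mS0 by linarith
    qed
  qed
  then have "\<bar>avg (\<lambda>z e. shift_jet F (P z e) (Q z) i j y x - F i j y x)\<bar> \<le> 61 * (m * S * \<epsilon>)" by (rule avg_abs_le)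
  then show ?thesis by (simp add: T_def avg_diff avg_const m_def S_def mult_ac)
qed

text \<open>The volatility enters the step through \<open>A 0\<close> and \<open>B 0\<close>, and to first order its derivative in \<open>x\<close> produces the
  source \<open>\<tau> * B * B' * (F\<^sub>y\<^sub>y - F\<^sub>y)\<close>, where \<open>F\<^sub>y\<^sub>y - F\<^sub>y = S\<^sup>2 F\<^sub>S\<^sub>S\<close>. Convexity of the payoff and monotonicity of
  \<open>\<beta>\<close> make it nonnegative.\<close>

lemma T_vega:
  assumes F: "jet3 F" and bd: "jet_bd F N1 N2 N3" and N0: "0 \<le> N" and V: "\<And>y x. - N \<le> F 0 1 y x"
    and cv: "\<And>y x. 0 \<le> F 2 0 y x - F 1 0 y x" and BB: "\<And>x. 0 \<le> B 0 x" "\<And>x. 0 \<le> B 1 x" and tM: "\<tau> * M \<le> 1"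
  shows "- ((1 + M * \<tau>) * N) - 260 * M^4 * (N1 + N2 + N3) * \<tau> * \<epsilon> \<le> T F 0 1 y x"
proof -
  note N = jet_bd_comp[OF bd]
  define S where "S = N1 + N2 + N3"
  have S: "N1 \<le> S" "N2 \<le> S" "N3 \<le> S" "0 \<le> S" using N by (auto simp: S_def)
  have NS: "\<bar>F 1 0 y x\<bar> \<le> 2 * S" "\<bar>F 0 1 y x\<bar> \<le> 2 * S" "\<bar>F 2 0 y x\<bar> \<le> 2 * S" "\<bar>F 1 1 y x\<bar> \<le> 2 * S" "\<bar>F 0 2 y x\<bar> \<le> 2 * S"
    "\<bar>F 3 0 y x\<bar> \<le> 2 * S" "\<bar>F 2 1 y x\<bar> \<le> 2 * S" "\<bar>F 1 2 y x\<bar> \<le> 2 * S" "\<bar>F 0 3 y x\<bar> \<le> 2 * S" for y x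
  proof -
    have le: "N1 \<le> 2 * S" "N2 \<le> 2 * S" "2 * N3 \<le> 2 * S" using S by auto
    show "\<bar>F 1 0 y x\<bar> \<le> 2 * S" "\<bar>F 0 1 y x\<bar> \<le> 2 * S" "\<bar>F 2 0 y x\<bar> \<le> 2 * S" "\<bar>F 1 1 y x\<bar> \<le> 2 * S" "\<bar>F 0 2 y x\<bar> \<le> 2 * S"
      "\<bar>F 3 0 y x\<bar> \<le> 2 * S" "\<bar>F 2 1 y x\<bar> \<le> 2 * S" "\<bar>F 1 2 y x\<bar> \<le> 2 * S" "\<bar>F 0 3 y x\<bar> \<le> 2 * S"
      by (rule order_trans[OF N(1) le(1)] order_trans[OF N(2) le(1)] order_trans[OF N(3) le(2)] order_trans[OF N(4) le(2)]
        order_trans[OF N(5) le(2)] order_trans[OF N(6) le(3)] order_trans[OF N(7) le(3)] order_trans[OF N(8) le(3)] order_trans[OF N(9) le(3)])+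
  qed
  define h where "h = M^4 * S * (\<tau> * \<epsilon>)"
  have pw: "1 \<le> M" "M \<le> M^4" "M\<^sup>2 \<le> M^4" "M^3 \<le> M^4" using M1 power_increasing[of 1 4 M] power_increasing[of 2 4 M] power_increasing[of 3 4 M] by auto
  have te: "0 < \<tau> * \<epsilon>" "\<tau> * \<tau> \<le> \<tau> * \<epsilon>" using tau_pos eps by auto
  have h: "M^3 * S * (\<tau> * \<epsilon>) \<le> h" "M\<^sup>2 * S * (\<tau> * \<epsilon>) \<le> h" "0 \<le> h" unfolding h_def using pw S te by (auto intro!: mult_right_mono)
  \<comment> \<open>\<open>dV\<close> collects the second derivatives that do not belong to the
    source. Both are first derivatives of the vega \<open>F 0 1\<close>, so
    \<open>\<tau> * dV\<close> acts like moving the argument of the vega by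
    \<open>(\<tau> * k1, \<tau> * k2)\<close>, which respects the bound \<open>- N\<close>. Counted
    as a mere error of size \<open>\<tau>\<close>, it would accumulate to order 1.\<close>
  define k1 where "k1 = \<rho> * (B 1 x * b 0 x + b 1 x * B 0 x)"
  define k2 where "k2 = b 1 x * b 0 x"
  define dV where "dV = k1 * F 1 1 y x + k2 * F 0 2 y x"
  have bbx: "\<bar>B 0 x\<bar> \<le> M" "\<bar>B 1 x\<bar> \<le> M" "\<bar>b 0 x\<bar> \<le> M" "\<bar>b 1 x\<bar> \<le> M" "\<bar>A 1 x\<bar> \<le> M" "\<bar>g 1 x\<bar> \<le> M" using bB bb bA bg by auto
  have k: "\<bar>k1\<bar> \<le> 2 * M\<^sup>2" "\<bar>k2\<bar> \<le> M\<^sup>2"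
  proof -
    have "\<bar>B 1 x * b 0 x\<bar> \<le> M * M" "\<bar>b 1 x * B 0 x\<bar> \<le> M * M" by (intro abs_mult_le bbx)+
    then have "\<bar>B 1 x * b 0 x + b 1 x * B 0 x\<bar> \<le> 2 * M\<^sup>2" by (simp add: power2_eq_square)
    from abs_mult_le[OF rho this] show "\<bar>k1\<bar> \<le> 2 * M\<^sup>2" by (simp add: k1_def)
    show "\<bar>k2\<bar> \<le> M\<^sup>2" unfolding k2_def power2_eq_square by (intro abs_mult_le bbx)
  qed
  let ?R = "\<lambda>G Gy Gx z e. at_shift G y x z e - G y x - Gy y x * P z e 0 x - Gx y x * Q z 0 x"
  have R: "\<bar>?R (F 1 0) (F 2 0) (F 1 1) z e\<bar> \<le> 50 * (M\<^sup>2 * S * \<tau>)" "\<bar>?R (F 0 1) (F 1 1) (F 0 2) z e\<bar> \<le> 50 * (M\<^sup>2 * S * \<tau>)"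
    if "\<bar>z\<bar> = 1" "\<bar>e\<bar> = 1" for z e
  proof -
    have N': "\<bar>F (Suc (Suc 1)) 0 y x\<bar> \<le> 2 * S" "\<bar>F (Suc 1) (Suc 0) y x\<bar> \<le> 2 * S" "\<bar>F 1 (Suc (Suc 0)) y x\<bar> \<le> 2 * S"
      "\<bar>F (Suc (Suc 0)) 1 y x\<bar> \<le> 2 * S" "\<bar>F (Suc 0) (Suc 1) y x\<bar> \<le> 2 * S" "\<bar>F 0 (Suc (Suc 1)) y x\<bar> \<le> 2 * S" for y x
      using NS[of y x] by (auto simp: eval_nat_numeral)
    have sq: "2 * S * (\<bar>P z e 0 x\<bar> + \<bar>Q z 0 x\<bar>)\<^sup>2 \<le> 50 * (M\<^sup>2 * S * \<tau>)"
    proof -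
      have "2 * S * (\<bar>P z e 0 x\<bar> + \<bar>Q z 0 x\<bar>)\<^sup>2 \<le> 2 * S * (5 * M * \<epsilon>)\<^sup>2"
        using shift_sum_bd[OF that, of x] S by (intro mult_left_mono power_mono) auto
      also have "\<dots> = 50 * (M\<^sup>2 * S * \<tau>)" by (simp add: tau power_mult_distrib)
      finally show ?thesis .
    qed
    have "\<bar>at_shift (F 1 0) y x z e - F 1 0 y x - F (Suc 1) 0 y x * P z e 0 x - F 1 (Suc 0) y x * Q z 0 x\<bar> \<le> 2 * S * (\<bar>P z e 0 x\<bar> + \<bar>Q z 0 x\<bar>)\<^sup>2"
      by (rule jet_increment2[OF F _ N'(1-3)]) simp
    then show "\<bar>?R (F 1 0) (F 2 0) (F 1 1) z e\<bar> \<le> 50 * (M\<^sup>2 * S * \<tau>)" using sq by (simp add: numeral_2_eq_2)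
    have "\<bar>at_shift (F 0 1) y x z e - F 0 1 y x - F (Suc 0) 1 y x * P z e 0 x - F 0 (Suc 1) y x * Q z 0 x\<bar> \<le> 2 * S * (\<bar>P z e 0 x\<bar> + \<bar>Q z 0 x\<bar>)\<^sup>2"
      by (rule jet_increment2[OF F _ N'(4-6)]) simp
    then show "\<bar>?R (F 0 1) (F 1 1) (F 0 2) z e\<bar> \<le> 50 * (M\<^sup>2 * S * \<tau>)" using sq by (simp add: numeral_2_eq_2)
  qed
  let ?E1 = "avg (\<lambda>z e. xi \<rho> z e * ?R (F 1 0) (F 2 0) (F 1 1) z e)" and ?E2 = "avg (\<lambda>z e. z * ?R (F 0 1) (F 1 1) (F 0 2) z e)"
  let ?E3 = "avg (\<lambda>z e. at_shift (F 1 0) y x z e - F 1 0 y x)"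
  have e1: "avg (\<lambda>z e. xi \<rho> z e * at_shift (F 1 0) y x z e) = F 2 0 y x * (\<epsilon> * B 0 x) + F 1 1 y x * (\<epsilon> * \<rho> * b 0 x) + ?E1"
  proof -
    have "avg (\<lambda>z e. xi \<rho> z e * at_shift (F 1 0) y x z e) = avg (\<lambda>z e. F 1 0 y x * xi \<rho> z e + F 2 0 y x * (xi \<rho> z e * P z e 0 x) + F 1 1 y x * (xi \<rho> z e * Q z 0 x)
        + xi \<rho> z e * ?R (F 1 0) (F 2 0) (F 1 1) z e)" by (simp add: algebra_simps)
    then show ?thesis unfolding avg_add avg_cmult avg_moments by simp
  qed
  have e2: "avg (\<lambda>z e. z * at_shift (F 0 1) y x z e) = F 1 1 y x * (\<epsilon> * \<rho> * B 0 x) + F 0 2 y x * (\<epsilon> * b 0 x) + ?E2"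
  proof -
    have "avg (\<lambda>z e. z * at_shift (F 0 1) y x z e) = avg (\<lambda>z e. F 0 1 y x * z + F 1 1 y x * (z * P z e 0 x) + F 0 2 y x * (z * Q z 0 x)
        + z * ?R (F 0 1) (F 1 1) (F 0 2) z e)" by (simp add: algebra_simps)
    then show ?thesis unfolding avg_add avg_cmult avg_moments by simp
  qed
  have e3: "avg (\<lambda>z e. at_shift (F 1 0) y x z e) = F 1 0 y x + ?E3" by (simp add: avg_diff avg_const)
  have "T F 0 1 y x = \<tau> * A 1 x * avg (\<lambda>z e. at_shift (F 1 0) y x z e) + \<epsilon> * B 1 x * avg (\<lambda>z e. xi \<rho> z e * at_shift (F 1 0) y x z e)
      + (1 + \<tau> * g 1 x) * avg (\<lambda>z e. at_shift (F 0 1) y x z e) + \<epsilon> * b 1 x * avg (\<lambda>z e. z * at_shift (F 0 1) y x z e)"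
    unfolding T_def avg_cmult[symmetric] avg_add[symmetric]
    by (simp add: shift_jet_def Let_def P_def[of _ _ 1] Q_def[of _ 1] P_def[of _ _ "Suc 0"] Q_def[of _ "Suc 0"] algebra_simps)
  \<comment> \<open>The source assembles here: \<open>F 2 0\<close> arises from the correlation of
    the noise in \<open>P\<close> with the noise in its own derivative, and \<open>- F 1 0\<close>
    from \<open>A 1 = - B 0 * B 1\<close>.\<close>
  also have "\<dots> = \<tau> * (B 0 x * B 1 x * (F 2 0 y x - F 1 0 y x)) + ((1 + \<tau> * g 1 x) * avg (\<lambda>z e. at_shift (F 0 1) y x z e) + \<tau> * dV)
      + (\<epsilon> * B 1 x * ?E1 + \<epsilon> * b 1 x * ?E2 + \<tau> * A 1 x * ?E3)"
    unfolding e1 e2 e3 unfolding dV_def k1_def k2_def tau power2_eq_square by (simp add: A_def algebra_simps)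
  finally have T_eq: "T F 0 1 y x = \<tau> * (B 0 x * B 1 x * (F 2 0 y x - F 1 0 y x))
      + ((1 + \<tau> * g 1 x) * avg (\<lambda>z e. at_shift (F 0 1) y x z e) + \<tau> * dV)
      + (\<epsilon> * B 1 x * ?E1 + \<epsilon> * b 1 x * ?E2 + \<tau> * A 1 x * ?E3)" .
  have p1: "0 \<le> \<tau> * (B 0 x * B 1 x * (F 2 0 y x - F 1 0 y x))" using tau_pos BB cv by simp
  have "\<bar>?E1\<bar> \<le> 2 * (50 * (M\<^sup>2 * S * \<tau>))" by (rule avg_abs_le, rule abs_mult_le) (use abs_xi_le[OF rho] R in auto)
  moreover have "\<bar>\<epsilon> * B 1 x\<bar> \<le> \<epsilon> * M" by (rule abs_mult_le) (use eps bbx in auto)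
  ultimately have "\<bar>\<epsilon> * B 1 x * ?E1\<bar> \<le> (\<epsilon> * M) * (2 * (50 * (M\<^sup>2 * S * \<tau>)))" by (rule abs_mult_le[rotated])
  also have "\<dots> = 100 * (M^3 * S * (\<tau> * \<epsilon>))" by (simp add: power2_eq_square power3_eq_cube)
  finally have q1: "\<bar>\<epsilon> * B 1 x * ?E1\<bar> \<le> 100 * h" using h by simp
  have "\<bar>?E2\<bar> \<le> 1 * (50 * (M\<^sup>2 * S * \<tau>))" by (rule avg_abs_le, rule abs_mult_le) (use R in auto)
  moreover have "\<bar>\<epsilon> * b 1 x\<bar> \<le> \<epsilon> * M" by (rule abs_mult_le) (use eps bbx in auto)
  ultimately have "\<bar>\<epsilon> * b 1 x * ?E2\<bar> \<le> (\<epsilon> * M) * (1 * (50 * (M\<^sup>2 * S * \<tau>)))" by (rule abs_mult_le[rotated])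
  also have "\<dots> = 50 * (M^3 * S * (\<tau> * \<epsilon>))" by (simp add: power2_eq_square power3_eq_cube)
  finally have q2: "\<bar>\<epsilon> * b 1 x * ?E2\<bar> \<le> 50 * h" using h by simp
  have inc: "\<bar>at_shift (F i j) y x z e - F i j y x\<bar> \<le> 2 * S * (5 * M * \<epsilon>)"
    if "(i, j) \<in> {(1,0), (1,1), (0,2)}" "\<bar>z\<bar> = 1" "\<bar>e\<bar> = 1" for i j z e
  proof -
    have "\<bar>F (Suc i) j y x\<bar> \<le> 2 * S" "\<bar>F i (Suc j) y x\<bar> \<le> 2 * S" for y x
      using NS[of y x] that(1) by (auto simp: eval_nat_numeral)
    then have "\<bar>at_shift (F i j) y x z e - F i j y x\<bar> \<le> 2 * S * (\<bar>P z e 0 x\<bar> + \<bar>Q z 0 x\<bar>)"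
      using that by (intro jet_increment1[OF F]) auto
    also have "\<dots> \<le> 2 * S * (5 * M * \<epsilon>)" using shift_sum_bd[OF that(2,3), of x] S by (intro mult_left_mono) auto
    finally show ?thesis .
  qed
  have "\<bar>?E3\<bar> \<le> 2 * S * (5 * M * \<epsilon>)" by (rule avg_abs_le) (use inc[of 1 0] in auto)
  moreover have "\<bar>\<tau> * A 1 x\<bar> \<le> \<tau> * M" by (rule abs_mult_le) (use tau_pos bbx in auto)
  ultimately have "\<bar>\<tau> * A 1 x * ?E3\<bar> \<le> (\<tau> * M) * (2 * S * (5 * M * \<epsilon>))" by (rule abs_mult_le[rotated])
  also have "\<dots> = 10 * (M\<^sup>2 * S * (\<tau> * \<epsilon>))" by (simp add: power2_eq_square)
  finally have q3: "\<bar>\<tau> * A 1 x * ?E3\<bar> \<le> 10 * h" using h by simp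
  have "avg (\<lambda>z e. - N - 48 * h) \<le> avg (\<lambda>z e. at_shift (F 0 1) y x z e + \<tau> * dV)"
  proof (rule avg_mono)
    fix z e :: real assume ze: "\<bar>z\<bar> = 1" "\<bar>e\<bar> = 1"
    let ?y = "y + P z e 0 x" and ?x = "x + Q z 0 x"
    have N': "\<bar>F (Suc (Suc 0)) 1 y x\<bar> \<le> 2 * S" "\<bar>F (Suc 0) (Suc 1) y x\<bar> \<le> 2 * S" "\<bar>F 0 (Suc (Suc 1)) y x\<bar> \<le> 2 * S" for y x
      using NS[of y x] by (auto simp: eval_nat_numeral)
    have "\<bar>F 0 1 (?y + \<tau> * k1) (?x + \<tau> * k2) - F 0 1 ?y ?x - F (Suc 0) 1 ?y ?x * (\<tau> * k1) - F 0 (Suc 1) ?y ?x * (\<tau> * k2)\<bar> \<le> 2 * S * (\<bar>\<tau> * k1\<bar> + \<bar>\<tau> * k2\<bar>)\<^sup>2"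
      by (rule jet_increment2[OF F _ N']) simp
    also have "\<dots> \<le> 2 * S * (3 * M\<^sup>2 * \<tau>)\<^sup>2"
    proof (intro mult_left_mono power_mono)
      have "\<bar>\<tau> * k1\<bar> + \<bar>\<tau> * k2\<bar> = \<tau> * (\<bar>k1\<bar> + \<bar>k2\<bar>)" using tau_pos by (simp add: abs_mult distrib_left)
      also have "\<dots> \<le> \<tau> * (3 * M\<^sup>2)" using k tau_pos by (intro mult_left_mono) auto
      finally show "\<bar>\<tau> * k1\<bar> + \<bar>\<tau> * k2\<bar> \<le> 3 * M\<^sup>2 * \<tau>" by (simp add: mult_ac)
    qed (use S in auto)
    also have "\<dots> = 18 * (M^4 * S * (\<tau> * \<tau>))" by (simp add: power_mult_distrib power2_eq_square eval_nat_numeral)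
    also have "\<dots> \<le> 18 * h" unfolding h_def using mult_left_mono[OF te(2), of "M^4 * S"] S by simp
    finally have 1: "\<bar>F 0 1 (?y + \<tau> * k1) (?x + \<tau> * k2) - F 0 1 ?y ?x - F 1 1 ?y ?x * (\<tau> * k1) - F 0 2 ?y ?x * (\<tau> * k2)\<bar> \<le> 18 * h"
      by (simp add: numeral_2_eq_2)
    have eqs: "(2 * S * (5 * M * \<epsilon>)) * (\<tau> * (2 * M\<^sup>2)) = 20 * (M^3 * S * (\<tau> * \<epsilon>))" "(2 * S * (5 * M * \<epsilon>)) * (\<tau> * M\<^sup>2) = 10 * (M^3 * S * (\<tau> * \<epsilon>))"
      by (simp_all add: power2_eq_square power3_eq_cube)
    have tk: "\<bar>\<tau> * k1\<bar> \<le> \<tau> * (2 * M\<^sup>2)" "\<bar>\<tau> * k2\<bar> \<le> \<tau> * M\<^sup>2"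
      using tau_pos k by (auto intro: abs_mult_le)
    have "\<bar>(F 1 1 ?y ?x - F 1 1 y x) * (\<tau> * k1)\<bar> \<le> (2 * S * (5 * M * \<epsilon>)) * (\<tau> * (2 * M\<^sup>2))"
      "\<bar>(F 0 2 ?y ?x - F 0 2 y x) * (\<tau> * k2)\<bar> \<le> (2 * S * (5 * M * \<epsilon>)) * (\<tau> * M\<^sup>2)"
      by (rule abs_mult_le[OF inc[OF _ ze] tk(1)] abs_mult_le[OF inc[OF _ ze] tk(2)], simp)+
    then have 2: "\<bar>(F 1 1 ?y ?x - F 1 1 y x) * (\<tau> * k1)\<bar> \<le> 20 * h" "\<bar>(F 0 2 ?y ?x - F 0 2 y x) * (\<tau> * k2)\<bar> \<le> 10 * h"
      unfolding eqs using h(1) by linarith+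
    have 3: "F 0 1 ?y ?x + \<tau> * dV = F 0 1 (?y + \<tau> * k1) (?x + \<tau> * k2)
       - (F 0 1 (?y + \<tau> * k1) (?x + \<tau> * k2) - F 0 1 ?y ?x - F 1 1 ?y ?x * (\<tau> * k1) - F 0 2 ?y ?x * (\<tau> * k2))
       - (F 1 1 ?y ?x - F 1 1 y x) * (\<tau> * k1) - (F 0 2 ?y ?x - F 0 2 y x) * (\<tau> * k2)"
      by (simp add: dV_def algebra_simps)
    show "- N - 48 * h \<le> at_shift (F 0 1) y x z e + \<tau> * dV"
      unfolding 3 using 1 2 V[of "?y + \<tau> * k1" "?x + \<tau> * k2"] by linarith
  qed
  then have a1: "- N - 48 * h \<le> avg (\<lambda>z e. at_shift (F 0 1) y x z e) + \<tau> * dV" (is "_ \<le> ?V") by (simp add: avg_const avg_add)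
  have tg: "\<bar>\<tau> * g 1 x\<bar> \<le> \<tau> * M" by (rule abs_mult_le) (use tau_pos bbx in auto)
  then have g0: "0 \<le> 1 + \<tau> * g 1 x" "1 + \<tau> * g 1 x \<le> 1 + M * \<tau>" "1 + \<tau> * g 1 x \<le> 2" using tM by (auto simp: abs_le_iff mult.commute)
  have "(1 + \<tau> * g 1 x) * (- N - 48 * h) \<le> (1 + \<tau> * g 1 x) * ?V" using a1 g0 by (intro mult_left_mono) auto
  moreover have "(1 + \<tau> * g 1 x) * N \<le> (1 + M * \<tau>) * N" using g0 N0 by (intro mult_right_mono) auto
  moreover have "(1 + \<tau> * g 1 x) * (48 * h) \<le> 2 * (48 * h)" using g0 h by (intro mult_right_mono) auto
  ultimately have a2: "- ((1 + M * \<tau>) * N) - 96 * h \<le> (1 + \<tau> * g 1 x) * ?V" by (simp add: algebra_simps)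
  have a3: "\<bar>\<tau> * g 1 x * (\<tau> * dV)\<bar> \<le> 4 * h"
  proof -
    have "\<bar>k1 * F 1 1 y x\<bar> \<le> 2 * M\<^sup>2 * S" "\<bar>k2 * F 0 2 y x\<bar> \<le> M\<^sup>2 * S"
      using N(4,5)[of y x] S by (intro abs_mult_le k; linarith)+
    then have dVb: "\<bar>dV\<bar> \<le> 3 * (M\<^sup>2 * S)" unfolding dV_def by linarith
    have "\<bar>\<tau> * g 1 x * (\<tau> * dV)\<bar> \<le> (\<tau> * M) * (\<tau> * (3 * (M\<^sup>2 * S)))"
      using tau_pos by (intro abs_mult_le tg dVb) auto
    also have "\<dots> = 3 * (M^3 * S * (\<tau> * \<tau>))" by (simp add: power2_eq_square power3_eq_cube)
    also have "\<dots> \<le> 3 * (M^3 * S * (\<tau> * \<epsilon>))" using mult_left_mono[OF te(2), of "M^3 * S"] S pw(1) by simp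
    finally show ?thesis using h by linarith
  qed
  have "(1 + \<tau> * g 1 x) * avg (\<lambda>z e. at_shift (F 0 1) y x z e) + \<tau> * dV = (1 + \<tau> * g 1 x) * ?V - \<tau> * g 1 x * (\<tau> * dV)"
    by (simp add: algebra_simps)
  then have "- ((1 + M * \<tau>) * N) - 100 * h \<le> (1 + \<tau> * g 1 x) * avg (\<lambda>z e. at_shift (F 0 1) y x z e) + \<tau> * dV" using a2 a3 by linarith
  then have "- ((1 + M * \<tau>) * N) - 260 * h \<le> T F 0 1 y x" unfolding T_eq using p1 q1 q2 q3 h by linarith
  then show ?thesis by (simp add: h_def S_def mult_ac)
qed
end

section \<open>Comparison with the scheme\<close>

lemma Sup_compact_continuous:
  fixes w :: "'a::metric_space \<Rightarrow> real \<Rightarrow> real"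
  assumes B: "compact B" "B \<noteq> {}" and cont: "continuous_on (B \<times> {a..b}) (\<lambda>(p, t). w p t)"
  shows "continuous_on {a..b} (\<lambda>t. SUP p\<in>B. w p t)"
    and "\<And>t. t \<in> {a..b} \<Longrightarrow> \<exists>p\<in>B. w p t = (SUP p\<in>B. w p t) \<and> (\<forall>q\<in>B. w q t \<le> w p t)"
proof -
  show at: "\<exists>p\<in>B. w p t = (SUP p\<in>B. w p t) \<and> (\<forall>q\<in>B. w q t \<le> w p t)" if t: "t \<in> {a..b}" for t
  proof -
    have "continuous_on B (\<lambda>p. (\<lambda>(p, t). w p t) (p, t))"
      by (rule continuous_on_compose2[OF cont]) (use t in \<open>auto intro!: continuous_intros\<close>)
    then have "continuous_on B (\<lambda>p. w p t)" by simp
    from continuous_attains_sup[OF B this] obtain p where p: "p \<in> B" "\<And>q. q \<in> B \<Longrightarrow> w q t \<le> w p t"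
      by blast
    then have "(SUP p\<in>B. w p t) = w p t" by (intro cSup_eq_maximum) auto
    then show ?thesis using p by auto
  qed
  have unif: "uniformly_continuous_on (B \<times> {a..b}) (\<lambda>(p, t). w p t)"
    by (rule compact_uniformly_continuous[OF cont]) (intro compact_Times B compact_Icc)
  show "continuous_on {a..b} (\<lambda>t. SUP p\<in>B. w p t)"
    unfolding continuous_on_iff
  proof (intro ballI allI impI)
    fix t e :: real assume t: "t \<in> {a..b}" and e: "e > 0"
    obtain d where d: "d > 0" "\<And>p p' t t'. p \<in> B \<Longrightarrow> p' \<in> B \<Longrightarrow> t \<in> {a..b} \<Longrightarrow> t' \<in> {a..b} \<Longrightarrow> dist (p', t') (p, t) < d \<Longrightarrow> dist (w p' t') (w p t) < e"
      using uniformly_continuous_onE[OF unif e] by (metis (no_types, lifting) SigmaI case_prod_conv)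
    have "dist (SUP p\<in>B. w p t') (SUP p\<in>B. w p t) < e" if t': "t' \<in> {a..b}" "dist t' t < d" for t'
    proof -
      obtain p where p: "p \<in> B" "w p t = (SUP p\<in>B. w p t)" "\<And>q. q \<in> B \<Longrightarrow> w q t \<le> w p t" using at[OF t] by blast
      obtain p' where p': "p' \<in> B" "w p' t' = (SUP p\<in>B. w p t')" "\<And>q. q \<in> B \<Longrightarrow> w q t' \<le> w p' t'" using at[OF t'(1)] by blast
      have "dist (w q t') (w q t) < e" if "q \<in> B" for q
        by (rule d(2)) (use that t t' in \<open>auto simp: dist_Pair_Pair\<close>)
      from this[OF p(1)] this[OF p'(1)] have "\<bar>w p' t' - w p t\<bar> < e"
        using p(3)[OF p'(1)] p'(3)[OF p(1)] unfolding dist_real_def by linarith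
      then show ?thesis using p(2) p'(2) by (simp add: dist_real_def)
    qed
    then show "\<exists>d>0. \<forall>t'\<in>{a..b}. dist t' t < d \<longrightarrow> dist (SUP p\<in>B. w p t') (SUP p\<in>B. w p t) < e"
      using d(1) by blast
  qed
qed

lemma test_fun_add:
  assumes "test_fun z zt zy zx zyy zyx zxx" "test_fun w wt wy wx wyy wyx wxx"
  shows "test_fun (\<lambda>y x t. z y x t + w y x t) (\<lambda>y x t. zt y x t + wt y x t) (\<lambda>y x t. zy y x t + wy y x t)
    (\<lambda>y x t. zx y x t + wx y x t) (\<lambda>y x t. zyy y x t + wyy y x t) (\<lambda>y x t. zyx y x t + wyx y x t) (\<lambda>y x t. zxx y x t + wxx y x t)"
  using assms unfolding test_fun_def
  by (auto simp: case_prod_beta intro!: DERIV_add continuous_on_add)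

lemma test_fun_C1:
  assumes "C1_fun \<theta> \<theta>'"
  shows "test_fun (\<lambda>y x t. \<theta> t) (\<lambda>y x t. \<theta>' t) (\<lambda>y x t. 0) (\<lambda>y x t. 0) (\<lambda>y x t. 0) (\<lambda>y x t. 0) (\<lambda>y x t. 0)"
proof -
  have D: "(\<theta> has_real_derivative \<theta>' t) (at t)" for t using assms by (auto simp: C1_fun_def)
  have c: "continuous_on UNIV \<theta>'" using assms by (auto simp: C1_fun_def)
  have c0: "continuous_on UNIV \<theta>" using D by (meson DERIV_isCont continuous_at_imp_continuous_on)
  have "continuous_on UNIV (\<lambda>p::real\<times>real\<times>real. f (snd (snd p)))" if "continuous_on UNIV f" for f :: "real \<Rightarrow> real"
    by (rule continuous_on_compose2[OF that]) (auto intro!: continuous_intros)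
  with c c0 D show ?thesis unfolding test_fun_def by (auto simp: case_prod_beta intro!: continuous_intros)
qed

lemma test_fun_product:
  assumes a: "C1_fun a a'"
    and d: "\<And>y x. ((\<lambda>y. f y x) has_real_derivative fy y x) (at y)" "\<And>y x. ((\<lambda>x. f y x) has_real_derivative fx y x) (at x)"
      "\<And>y x. ((\<lambda>y. fy y x) has_real_derivative fyy y x) (at y)" "\<And>y x. ((\<lambda>x. fy y x) has_real_derivative fyx y x) (at x)"
      "\<And>y x. ((\<lambda>x. fx y x) has_real_derivative fxx y x) (at x)"
    and c: "\<And>g. g \<in> {f, fy, fx, fyy, fyx, fxx} \<Longrightarrow> continuous_on UNIV (\<lambda>p. g (fst p) (snd p))"
  shows "test_fun (\<lambda>y x t. a t * f y x) (\<lambda>y x t. a' t * f y x) (\<lambda>y x t. a t * fy y x) (\<lambda>y x t. a t * fx y x)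
     (\<lambda>y x t. a t * fyy y x) (\<lambda>y x t. a t * fyx y x) (\<lambda>y x t. a t * fxx y x)"
proof -
  have D: "(a has_real_derivative a' t) (at t)" for t using a by (auto simp: C1_fun_def)
  have ca: "continuous_on UNIV a'" using a by (auto simp: C1_fun_def)
  have c0: "continuous_on UNIV a" using D by (meson DERIV_isCont continuous_at_imp_continuous_on)
  have ct: "continuous_on UNIV (\<lambda>p::real\<times>real\<times>real. f (snd (snd p)))" if "continuous_on UNIV f" for f :: "real \<Rightarrow> real"
    by (rule continuous_on_compose2[OF that]) (auto intro!: continuous_intros)
  have cs: "continuous_on UNIV (\<lambda>p::real\<times>real\<times>real. g (fst p) (fst (snd p)))" if "g \<in> {f, fy, fx, fyy, fyx, fxx}" for g
  proof -
    have "continuous_on UNIV (\<lambda>p::real\<times>real\<times>real. (\<lambda>p. g (fst p) (snd p)) (fst p, fst (snd p)))"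
      by (rule continuous_on_compose2[OF c[OF that]]) (auto intro!: continuous_intros)
    then show ?thesis by simp
  qed
  show ?thesis unfolding test_fun_def
    using cs by (auto simp: case_prod_beta intro!: DERIV_cmult DERIV_cmult_right D d continuous_on_mult ct ca c0)
qed

lemma test_fun_jet:
  assumes "C1_fun a a'" "jet3 F"
  shows "test_fun (\<lambda>y x t. a t * F 0 0 y x) (\<lambda>y x t. a' t * F 0 0 y x) (\<lambda>y x t. a t * F 1 0 y x) (\<lambda>y x t. a t * F 0 1 y x)
     (\<lambda>y x t. a t * F 2 0 y x) (\<lambda>y x t. a t * F 1 1 y x) (\<lambda>y x t. a t * F 0 2 y x)"
proof (rule test_fun_product[OF assms(1)])
  note D = jet3_DERIV[OF assms(2)]
  show "((\<lambda>y. F 0 0 y x) has_real_derivative F 1 0 y x) (at y)" "((\<lambda>x. F 0 0 y x) has_real_derivative F 0 1 y x) (at x)"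
    "((\<lambda>y. F 1 0 y x) has_real_derivative F 2 0 y x) (at y)" "((\<lambda>x. F 1 0 y x) has_real_derivative F 1 1 y x) (at x)"
    "((\<lambda>x. F 0 1 y x) has_real_derivative F 0 2 y x) (at x)" for y x
    using D[of 0 0] D[of 1 0] D[of 0 1] by (simp_all add: numeral_2_eq_2)
  fix g assume "g \<in> {F 0 0, F 1 0, F 0 1, F 2 0, F 1 1, F 0 2}"
  then show "continuous_on UNIV (\<lambda>p. g (fst p) (snd p))"
    using jet3_continuous[OF assms(2)] by (elim insertE emptyE) simp_all
qed

text \<open>Reduction to time alone: \<open>h t\<close> is the maximum of \<open>U - z\<close> over
  a box. By \<open>out\<close> it is attained in the interior, and where a function
  \<open>\<theta>\<close> touches \<open>h\<close> from above, \<open>z + \<theta>\<close> touches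
  \<open>U\<close> from above at a maximiser, up to a constant. The viscosity inequality for this
  test function is a lower bound for the slope of \<open>\<theta>\<close>, as
  \<open>time_comparison\<close> demands.\<close>

lemma step_compare:
  fixes U :: "real \<Rightarrow> real \<Rightarrow> real \<Rightarrow> real"
  assumes sub: "log_sub T r \<rho> \<beta> b c \<kappa> U" and z: "test_fun z zt zy zx zyy zyx zxx"
    and t: "0 \<le> t0" "t0 < t1" "t1 \<le> T"
    and U: "continuous_on (UNIV \<times> UNIV \<times> {0..T}) (\<lambda>(y, x, t). U y x t)"
    and R: "R > 0" and out: "\<And>y x t. t \<in> {t0..t1} \<Longrightarrow> \<not> (\<bar>y\<bar> < R \<and> \<bar>x\<bar> < R) \<Longrightarrow> U y x t - z y x t < U 0 0 t - z 0 0 t"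
    and e: "0 \<le> e" "e \<le> C"
    and op: "\<And>y x t. t \<in> {t0<..<t1} \<Longrightarrow> \<bar>y\<bar> < R \<Longrightarrow> \<bar>x\<bar> < R \<Longrightarrow>
       zt y x t + log_op r \<rho> (\<beta> x) (b x t) (c x t) (\<kappa> x t) (zy y x t) (zx y x t) (zyy y x t) (zyx y x t) (zxx y x t) \<le> (if t \<in> Good then e else C)"
    and m: "\<And>Q. Q \<in> sets lebesgue \<Longrightarrow> Good \<inter> {t0<..<t1} \<subseteq> Q \<Longrightarrow> m \<le> measure lebesgue (Q \<inter> {t0..t1})"
    and H: "\<And>y x. U y x t1 - z y x t1 \<le> H"
  shows "U y x t0 - z y x t0 \<le> H + e * (t1 - t0) + C * (t1 - t0 - m)"
proof -
  define B where "B = {-R..R} \<times> {-R..R}"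
  define w where "w p t = U (fst p) (snd p) t - z (fst p) (snd p) t" for p t
  define h where "h t = (SUP p\<in>B. w p t)" for t
  have B: "compact B" "B \<noteq> {}" unfolding B_def using R by (auto intro!: compact_Times)
  have zc: "continuous_on UNIV (\<lambda>(y, x, t). z y x t)" using z unfolding test_fun_def by blast
  have wc: "continuous_on (B \<times> {t0..t1}) (\<lambda>(p, t). w p t)"
  proof -
    have "continuous_on (B \<times> {t0..t1}) (\<lambda>q. (\<lambda>(y, x, t). U y x t) (fst (fst q), snd (fst q), snd q) - (\<lambda>(y, x, t). z y x t) (fst (fst q), snd (fst q), snd q))"
      by (intro continuous_on_diff continuous_on_compose2[OF U] continuous_on_compose2[OF zc])
        (use t in \<open>auto intro!: continuous_intros\<close>)
    then show ?thesis by (simp add: w_def case_prod_beta)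
  qed
  note hc = Sup_compact_continuous(1)[OF B wc, folded h_def]
  note hat = Sup_compact_continuous(2)[OF B wc, folded h_def]
  have w_le: "w p t \<le> h t" if "t \<in> {t0..t1}" for p t
  proof (cases "p \<in> B")
    case True then show ?thesis using hat[OF that] by force
  next
    case False
    obtain y x where p: "p = (y, x)" by (cases p)
    have "w p t < w (0, 0) t" using out[OF that, of y x] False R by (auto simp: w_def p B_def)
    moreover have "(0, 0) \<in> B" using R by (auto simp: B_def)
    ultimately show ?thesis using hat[OF that] by force
  qed
  have "h t0 \<le> h t1 + e * (t1 - t0) + C * (t1 - t0 - m)"
  proof (rule time_comparison[OF t(2) hc e _ m])
    fix s \<theta> \<theta>' d assume s: "s \<in> {t0<..<t1}" and \<theta>: "C1_fun \<theta> \<theta>'" and d: "d > 0"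
      and mx: "\<And>t. t \<in> {t0<..<t1} \<Longrightarrow> \<bar>t - s\<bar> < d \<Longrightarrow> h t - \<theta> t \<le> h s - \<theta> s"
    have s': "s \<in> {t0..t1}" using s by auto
    obtain y x where p: "(y, x) \<in> B" "w (y, x) s = h s" using hat[OF s'] by (metis surj_pair)
    have int: "\<bar>y\<bar> < R" "\<bar>x\<bar> < R"
    proof -
      have "\<not> w (y, x) s < w (0, 0) s" using w_le[OF s', of "(0,0)"] p by simp
      then show "\<bar>y\<bar> < R" "\<bar>x\<bar> < R" using out[OF s', of y x] by (auto simp: w_def)
    qed
    define d' where "d' = min d (min (s - t0) (t1 - s))"
    have d': "d' > 0" using d s by (simp add: d'_def)
    have "0 \<le> (zt y x s + \<theta>' s) + log_op r \<rho> (\<beta> x) (b x s) (c x s) (\<kappa> x s) (zy y x s + 0) (zx y x s + 0) (zyy y x s + 0) (zyx y x s + 0) (zxx y x s + 0)"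
    proof (rule sub[unfolded log_sub_def, rule_format, OF test_fun_add[OF z test_fun_C1[OF \<theta>]] _ _ d'])
      fix y' x' t' assume "t' \<in> {0..T}" and t'd: "\<bar>t' - s\<bar> < d'"
      have "d' \<le> s - t0" "d' \<le> t1 - s" "d' \<le> d" by (auto simp: d'_def)
      then have t': "t' \<in> {t0<..<t1}" "\<bar>t' - s\<bar> < d" using t'd by auto
      have "w (y', x') t' \<le> h t'" using w_le t' by simp
      then show "U y' x' t' - (z y' x' t' + \<theta> t') \<le> U y x s - (z y x s + \<theta> s)"
        using mx[OF t'] p(2) by (simp add: w_def)
    qed (use s t in auto)
    then have "- (zt y x s + log_op r \<rho> (\<beta> x) (b x s) (c x s) (\<kappa> x s) (zy y x s) (zx y x s) (zyy y x s) (zyx y x s) (zxx y x s)) \<le> \<theta>' s" by simp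
    with op[OF s int] e show "- C \<le> \<theta>' s \<and> (s \<in> Good \<longrightarrow> - e \<le> \<theta>' s)" by (auto split: if_splits)
  qed
  moreover have "h t1 \<le> H"
  proof -
    obtain p where "p \<in> B" "w p t1 = h t1" using hat[of t1] t by auto
    then show ?thesis using H[of "fst p" "snd p"] by (simp add: w_def)
  qed
  moreover have "w (y, x) t0 \<le> h t0" using w_le[of t0] t by simp
  ultimately show ?thesis by (simp add: w_def)
qed

section \<open>The polynomial penalty at infinity\<close>

definition pen :: "nat \<Rightarrow> real \<Rightarrow> real" where "pen n s = (1 + s\<^sup>2) ^ (n + 2)"
definition pen1 :: "nat \<Rightarrow> real \<Rightarrow> real" where "pen1 n s = real (n + 2) * (2 * s) * (1 + s\<^sup>2) ^ (n + 1)"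
definition pen2 :: "nat \<Rightarrow> real \<Rightarrow> real" where
  "pen2 n s = real (n + 2) * 2 * (1 + s\<^sup>2) ^ (n + 1) + real (n + 2) * (2 * s) * (real (n + 1) * (2 * s) * (1 + s\<^sup>2) ^ n)"

lemma pen_deriv: "(pen n has_real_derivative pen1 n s) (at s)" "(pen1 n has_real_derivative pen2 n s) (at s)"
proof -
  have D: "((\<lambda>s. (1 + s\<^sup>2) ^ Suc k) has_real_derivative real (Suc k) * (2 * s) * (1 + s\<^sup>2) ^ k) (at s)" for k and s :: real
  proof -
    have "((\<lambda>s. 1 + s\<^sup>2) has_real_derivative 2 * s) (at s)" by (auto intro!: derivative_eq_intros)
    from DERIV_chain2[OF DERIV_pow[of "Suc k" "1 + s\<^sup>2"] this] show ?thesis by (simp add: algebra_simps)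
  qed
  show "(pen n has_real_derivative pen1 n s) (at s)" using D[of "n + 1" s] by (simp add: pen_def[abs_def] pen1_def)
  show "(pen1 n has_real_derivative pen2 n s) (at s)"
    unfolding pen1_def[abs_def] pen2_def using D[of n s]
    by (auto intro!: derivative_eq_intros simp del: power_Suc)
qed

text \<open>The penalty reproduces itself under the operator. Its first derivative gains a factor
  \<open>1/(1 + \<bar>s\<bar>)\<close>, which pays for a drift of linear growth, and its second
  derivative meets bounded diffusion coefficients only. An exponential weight in time absorbs the
  result.\<close>

lemma pen_bounds:
  "1 \<le> pen n s" "\<bar>pen1 n s\<bar> * (1 + \<bar>s\<bar>) \<le> 4 * (real (n + 2))\<^sup>2 * pen n s" "\<bar>pen1 n s\<bar> \<le> 4 * (real (n + 2))\<^sup>2 * pen n s"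
  "\<bar>pen2 n s\<bar> \<le> 6 * (real (n + 2))\<^sup>2 * pen n s"
proof -
  define N where "N = real (n + 2)"
  have N: "1 \<le> N" "N \<le> N\<^sup>2" by (auto simp: N_def power2_eq_square)
  define u where "u = 1 + s\<^sup>2"
  have u: "1 \<le> u" "\<bar>s\<bar> * (1 + \<bar>s\<bar>) \<le> 2 * u" "s\<^sup>2 \<le> u"
    using sum_squares_bound[of 1 "\<bar>s\<bar>"] by (auto simp: u_def algebra_simps power2_eq_square)
  have un: "1 \<le> u ^ k" for k using u by simp
  show "1 \<le> pen n s" unfolding pen_def u_def[symmetric] by (rule un)
  have "\<bar>pen1 n s\<bar> * (1 + \<bar>s\<bar>) = 2 * N * (\<bar>s\<bar> * (1 + \<bar>s\<bar>)) * u ^ (n + 1)"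
  proof -
    have "\<bar>pen1 n s\<bar> = N * (2 * \<bar>s\<bar>) * u ^ (n + 1)"
      using un[of "n+1"] N by (simp only: pen1_def N_def[symmetric] u_def[symmetric] abs_mult)
    then show ?thesis by simp
  qed
  also have "\<dots> \<le> 2 * N * (2 * u) * u ^ (n + 1)" using u N un[of "n+1"] by (intro mult_right_mono mult_left_mono) auto
  also have "\<dots> = 4 * N * u ^ (n + 2)" by simp
  also have "\<dots> \<le> 4 * N\<^sup>2 * u ^ (n + 2)" using N un[of "n+2"] by (intro mult_right_mono) auto
  finally show 1: "\<bar>pen1 n s\<bar> * (1 + \<bar>s\<bar>) \<le> 4 * (real (n + 2))\<^sup>2 * pen n s" by (simp add: N_def u_def pen_def)
  have "\<bar>pen1 n s\<bar> * 1 \<le> \<bar>pen1 n s\<bar> * (1 + \<bar>s\<bar>)" by (intro mult_left_mono) auto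
  with 1 show "\<bar>pen1 n s\<bar> \<le> 4 * (real (n + 2))\<^sup>2 * pen n s" by simp
  have "\<bar>pen2 n s\<bar> = 2 * N * u ^ (n + 1) + 4 * N * real (n + 1) * s\<^sup>2 * u ^ n"
  proof -
    have "pen2 n s = 2 * N * u ^ (n + 1) + 4 * N * real (n + 1) * s\<^sup>2 * u ^ n"
      unfolding pen2_def u_def[symmetric] N_def[symmetric] by (simp add: power2_eq_square algebra_simps)
    moreover have "0 \<le> 2 * N * u ^ (n + 1) + 4 * N * real (n + 1) * s\<^sup>2 * u ^ n"
      using un[of n] un[of "n+1"] N u by (intro add_nonneg_nonneg mult_nonneg_nonneg) auto
    ultimately show ?thesis by simp
  qed
  also have "\<dots> \<le> 2 * N * u ^ (n + 2) + 4 * N * N * u * u ^ (n + 1)"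
  proof (intro add_mono mult_mono)
    show "u ^ (n + 1) \<le> u ^ (n + 2)" "u ^ n \<le> u ^ (n + 1)" using u by (intro power_increasing; simp)+
    show "real (n + 1) \<le> N" by (simp add: N_def)
  qed (use N u un in auto)
  also have "\<dots> = 2 * N * u ^ (n + 2) + 4 * N\<^sup>2 * u ^ (n + 2)" by (simp add: power2_eq_square)
  also have "\<dots> \<le> 2 * N\<^sup>2 * u ^ (n + 2) + 4 * N\<^sup>2 * u ^ (n + 2)" using N un[of "n+2"] by (intro add_mono mult_right_mono) auto
  finally show "\<bar>pen2 n s\<bar> \<le> 6 * (real (n + 2))\<^sup>2 * pen n s"
    unfolding pen_def u_def[symmetric] N_def[symmetric] by linarith
qed

lemma test_fun_pen:
  "test_fun (\<lambda>y x t. d * exp (l * (T - t)) * (pen n y + pen n x)) (\<lambda>y x t. - (l * (d * exp (l * (T - t)))) * (pen n y + pen n x))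
    (\<lambda>y x t. d * exp (l * (T - t)) * pen1 n y) (\<lambda>y x t. d * exp (l * (T - t)) * pen1 n x)
    (\<lambda>y x t. d * exp (l * (T - t)) * pen2 n y) (\<lambda>y x t. d * exp (l * (T - t)) * 0) (\<lambda>y x t. d * exp (l * (T - t)) * pen2 n x)"
proof (rule test_fun_product)
  show "C1_fun (\<lambda>t. d * exp (l * (T - t))) (\<lambda>t. - (l * (d * exp (l * (T - t)))))"
    unfolding C1_fun_def by (auto intro!: derivative_eq_intros continuous_intros)
  show "((\<lambda>y. pen n y + pen n x) has_real_derivative pen1 n y) (at y)" for x y
    using DERIV_add[OF pen_deriv(1) DERIV_const] by simp
  show "((\<lambda>x. pen n y + pen n x) has_real_derivative pen1 n x) (at x)" for x y
    using DERIV_add[OF DERIV_const pen_deriv(1)] by simp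
  fix g assume "g \<in> {\<lambda>y x. pen n y + pen n x, \<lambda>y x. pen1 n y, \<lambda>y. pen1 n, \<lambda>y x. pen2 n y, \<lambda>y x. 0, \<lambda>y. pen2 n}"
  then show "continuous_on UNIV (\<lambda>p. g (fst p) (snd p))"
    unfolding pen_def pen1_def pen2_def by (elim insertE emptyE; hypsubst) (intro continuous_intros)+
qed (simp_all add: pen_deriv)

text \<open>The constant 10 is 4 + 6, from the first and second derivatives in
  \<open>pen_bounds\<close>. The nonlinear term is Lipschitz in \<open>zx\<close>, so it costs no
  more than a drift of size \<open>\<bar>k\<bar>\<close>; the penalty is a sum of functions of one
  variable and has no mixed derivative.\<close>

lemma log_op_add_le:
  assumes "\<bar>r - B\<^sup>2/2\<bar> \<le> m" "B\<^sup>2/2 \<le> m" "b\<^sup>2/2 \<le> m" "\<bar>c\<bar> + \<bar>k\<bar> \<le> m * (1 + \<bar>x\<bar>)" "0 \<le> E"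
  shows "log_op r \<rho> B b c k (zy + E * pen1 n y) (zx + E * pen1 n x) (zyy + E * pen2 n y) (zyx + E * 0) (zxx + E * pen2 n x)
     \<le> log_op r \<rho> B b c k zy zx zyy zyx zxx + 10 * (real (n + 2))\<^sup>2 * m * E * (pen n y + pen n x)"
proof -
  define N where "N = (real (n + 2))\<^sup>2"
  have N: "0 \<le> N" by (simp add: N_def)
  have m: "0 \<le> m" using assms(1) by linarith
  note pb = pen_bounds[of n, folded N_def]
  have 1: "(r - B\<^sup>2/2) * pen1 n y \<le> m * (4 * N * pen n y)"
    using abs_mult_le[OF assms(1) pb(3)[of y]] by (simp add: abs_le_iff)
  have 2: "B\<^sup>2/2 * pen2 n y \<le> m * (6 * N * pen n y)" "b\<^sup>2/2 * pen2 n x \<le> m * (6 * N * pen n x)"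
    using abs_mult_le[OF _ pb(4)[of y], of "B\<^sup>2/2" m] abs_mult_le[OF _ pb(4)[of x], of "b\<^sup>2/2" m] assms(2,3) by (auto simp: abs_le_iff)
  have "(\<bar>c\<bar> + \<bar>k\<bar>) * \<bar>pen1 n x\<bar> \<le> m * (1 + \<bar>x\<bar>) * \<bar>pen1 n x\<bar>" using assms(4) by (intro mult_right_mono) auto
  also have "\<dots> = m * (\<bar>pen1 n x\<bar> * (1 + \<bar>x\<bar>))" by simp
  also have "\<dots> \<le> m * (4 * N * pen n x)" using pb(2)[of x] m by (intro mult_left_mono) auto
  finally have 3: "(\<bar>c\<bar> + \<bar>k\<bar>) * \<bar>pen1 n x\<bar> \<le> m * (4 * N * pen n x)" .
  have 4: "c * (E * pen1 n x) + k * (\<bar>zx + E * pen1 n x\<bar> - \<bar>zx\<bar>) \<le> E * ((\<bar>c\<bar> + \<bar>k\<bar>) * \<bar>pen1 n x\<bar>)"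
  proof -
    have "\<bar>\<bar>zx + E * pen1 n x\<bar> - \<bar>zx\<bar>\<bar> \<le> E * \<bar>pen1 n x\<bar>"
      using abs_triangle_ineq3[of "zx + E * pen1 n x" zx] assms(5) by (simp add: abs_mult)
    then have "\<bar>k * (\<bar>zx + E * pen1 n x\<bar> - \<bar>zx\<bar>)\<bar> \<le> \<bar>k\<bar> * (E * \<bar>pen1 n x\<bar>)" by (intro abs_mult_le) auto
    moreover have "\<bar>c * (E * pen1 n x)\<bar> \<le> \<bar>c\<bar> * (E * \<bar>pen1 n x\<bar>)" using assms(5) by (simp add: abs_mult)
    ultimately show ?thesis by (simp add: abs_le_iff algebra_simps)
  qed
  have "log_op r \<rho> B b c k (zy + E * pen1 n y) (zx + E * pen1 n x) (zyy + E * pen2 n y) (zyx + E * 0) (zxx + E * pen2 n x)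
     - log_op r \<rho> B b c k zy zx zyy zyx zxx = E * ((r - B\<^sup>2/2) * pen1 n y) + (c * (E * pen1 n x) + k * (\<bar>zx + E * pen1 n x\<bar> - \<bar>zx\<bar>))
       + E * (B\<^sup>2/2 * pen2 n y) + E * (b\<^sup>2/2 * pen2 n x)"
    unfolding log_op_def by (simp add: algebra_simps add_divide_distrib diff_divide_distrib)
  also have "\<dots> \<le> E * (m * (4 * N * pen n y)) + E * (m * (4 * N * pen n x)) + E * (m * (6 * N * pen n y)) + E * (m * (6 * N * pen n x))"
    using 4 mult_left_mono[OF 1 assms(5)] mult_left_mono[OF 2(1) assms(5)] mult_left_mono[OF 2(2) assms(5)] mult_left_mono[OF 3 assms(5)]
    by linarith
  also have "\<dots> = 10 * N * m * E * (pen n y + pen n x)" by (simp add: algebra_simps)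
  finally show ?thesis by (simp add: N_def)
qed

lemma jet_bd_mono: "jet_bd F N1 N2 N3 \<Longrightarrow> N1 \<le> K1 \<Longrightarrow> N2 \<le> K2 \<Longrightarrow> N3 \<le> K3 \<Longrightarrow> jet_bd F K1 K2 K3"
  unfolding jet_bd_def by (intro allI conjI; elim allE conjE; erule order_trans; intro mult_right_mono; simp)

context scheme begin

lemma jet_bd_T:
  assumes "jet3 F" "jet_bd F N1 N2 N3"
  shows "jet_bd (T F) (N1 * (1 + 7 * M\<^sup>2 * \<tau>)) (N2 * (1 + 22 * M\<^sup>2 * \<tau>) + \<tau> * (M + L2) * N1) (N3 + 994 * M3^4 * \<tau> * (N1 + N2 + N3))"
  unfolding jet_bd_def using T_bd1[OF assms(2)] T_bd2[OF assms] T_bd3[OF assms] by blast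

text \<open>The residual of the interpolated scheme in the true equation, one summand for each
  source. Discretisation gives 557, made of 252 from \<open>T_consistent\<close> and 5 times 61 from
  \<open>T_near\<close>; then come the discrepancies \<open>\<eta>1\<close> and
  \<open>\<eta>2\<close> of the coefficients; and last the nonlinearity, where
  \<open>v 0 1 \<ge> - Nv\<close> makes \<open>\<bar>v 0 1\<bar> - v 0 1\<close> at most
  \<open>2 * Nv\<close>. In the last summand lies the only difference between the two
  equations.\<close>

lemma step_op:
  assumes F: "jet3 F" and bd: "jet_bd F K1 K2 K3" "jet_bd (T F) K1 K2 K3"
    and V: "- Nv \<le> F 0 1 y x" "- Nv \<le> T F 0 1 y x" "0 \<le> Nv" and a: "0 \<le> a" "a \<le> 1" and sg: "sg \<in> {1, -1}"
    and cf: "\<bar>\<beta>\<bar> \<le> M" "\<bar>b'\<bar> \<le> M" "\<bar>\<beta> - B 0 x\<bar> \<le> \<eta>1" "\<bar>b' - b 0 x\<bar> \<le> \<eta>1" "\<bar>c + k - g 0 x\<bar> \<le> \<eta>2" "\<bar>k\<bar> \<le> m0"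
    and v: "\<And>i j. v i j = a * T F i j y x + (1 - a) * F i j y x"
  shows "sg * ((F 0 0 y x - T F 0 0 y x) / \<tau>) + log_op r \<rho> \<beta> b' c (sg * k) (sg * v 1 0) (sg * v 0 1) (sg * v 2 0) (sg * v 1 1) (sg * v 0 2)
    \<le> 557 * M3^4 * (K1 + K2 + K3) * \<epsilon> + 4 * M * \<eta>1 * (K1 + K2) + \<eta>2 * K1 + 2 * m0 * Nv"
proof -
  note N = jet_bd_comp[OF bd(1)] and N' = jet_bd_comp[OF bd(2)]
  define S where "S = K1 + K2 + K3"
  have S: "0 \<le> S" using N by (simp add: S_def)
  have M31: "1 \<le> M3" using M1 MM3 by simp
  have conv: "\<bar>a * p + (1 - a) * q\<bar> \<le> K" if "\<bar>p\<bar> \<le> K" "\<bar>q\<bar> \<le> K" for p q K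
  proof -
    have "\<bar>a * p\<bar> \<le> a * K" "\<bar>(1 - a) * q\<bar> \<le> (1 - a) * K" using that a by (intro abs_mult_le; simp)+
    then have "\<bar>a * p + (1 - a) * q\<bar> \<le> a * K + (1 - a) * K" by (rule abs_add2_le)
    then show ?thesis by (simp add: algebra_simps)
  qed
  have v1: "\<bar>v 1 0\<bar> \<le> K1" "\<bar>v 0 1\<bar> \<le> K1" "\<bar>v 2 0\<bar> \<le> K2" "\<bar>v 1 1\<bar> \<le> K2" "\<bar>v 0 2\<bar> \<le> K2"
    unfolding v by (rule conv N N')+
  have vx: "- Nv \<le> v 0 1"
  proof -
    have "a * (- Nv) \<le> a * T F 0 1 y x" "(1 - a) * (- Nv) \<le> (1 - a) * F 0 1 y x" using V a by (intro mult_left_mono; simp)+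
    then have "a * (- Nv) + (1 - a) * (- Nv) \<le> v 0 1" unfolding v by linarith
    then show ?thesis by (simp add: algebra_simps)
  qed
  define \<gamma> where "\<gamma> = c + k"
  define L where "L = (r - \<beta>\<^sup>2/2) * v 1 0 + \<gamma> * v 0 1 + \<beta>\<^sup>2/2 * v 2 0 + \<rho> * \<beta> * b' * v 1 1 + b'\<^sup>2/2 * v 0 2"
  define L' where "L' = A 0 x * v 1 0 + g 0 x * v 0 1 + (B 0 x)\<^sup>2/2 * v 2 0 + \<rho> * B 0 x * b 0 x * v 1 1 + (b 0 x)\<^sup>2/2 * v 0 2"
  have op_eq: "log_op r \<rho> \<beta> b' c (sg * k) (sg * v 1 0) (sg * v 0 1) (sg * v 2 0) (sg * v 1 1) (sg * v 0 2) = sg * L + sg * k * (\<bar>v 0 1\<bar> - v 0 1)"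
    using sg by (auto simp: log_op_def L_def \<gamma>_def algebra_simps)
  have k1: "sg * k * (\<bar>v 0 1\<bar> - v 0 1) \<le> 2 * m0 * Nv"
  proof -
    have a1: "\<bar>\<bar>v 0 1\<bar> - v 0 1\<bar> \<le> 2 * Nv" using vx V(3) by auto
    have a2: "\<bar>sg * k\<bar> \<le> m0" using sg cf(6) by auto
    have "\<bar>sg * k * (\<bar>v 0 1\<bar> - v 0 1)\<bar> \<le> m0 * (2 * Nv)" by (rule abs_mult_le[OF a2 a1])
    then show ?thesis by (simp add: abs_le_iff)
  qed
  have b0: "\<bar>B 0 x\<bar> \<le> M" "\<bar>b 0 x\<bar> \<le> M" "\<bar>g 0 x\<bar> \<le> M" "\<bar>A 0 x\<bar> \<le> M" using bB bb bg bA by auto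
  have K1: "0 \<le> K1" "0 \<le> K2" using N by auto
  have LL: "\<bar>L - L'\<bar> \<le> 4 * M * \<eta>1 * (K1 + K2) + \<eta>2 * K1"
  proof -
    have sq: "\<bar>p\<^sup>2/2 - q\<^sup>2/2\<bar> \<le> M * \<eta>1" if "\<bar>p\<bar> \<le> M" "\<bar>q\<bar> \<le> M" "\<bar>p - q\<bar> \<le> \<eta>1" for p q
    proof -
      have "p\<^sup>2/2 - q\<^sup>2/2 = ((p + q)/2) * (p - q)" by (simp add: power2_eq_square field_simps)
      moreover have "\<bar>(p + q)/2\<bar> \<le> M" using that by (simp add: abs_le_iff)
      ultimately show ?thesis using abs_mult_le[of "(p+q)/2" M "p - q" \<eta>1] that by simp
    qed
    have c1: "\<bar>\<beta>\<^sup>2/2 - (B 0 x)\<^sup>2/2\<bar> \<le> M * \<eta>1" "\<bar>b'\<^sup>2/2 - (b 0 x)\<^sup>2/2\<bar> \<le> M * \<eta>1" using sq cf b0 by auto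
    have c1n: "\<bar>-(\<beta>\<^sup>2/2 - (B 0 x)\<^sup>2/2)\<bar> \<le> M * \<eta>1" unfolding abs_minus_cancel by (rule c1(1))
    have c3: "\<bar>\<gamma> - g 0 x\<bar> \<le> \<eta>2" unfolding \<gamma>_def by (rule cf(5))
    have c2: "\<bar>\<rho> * (\<beta> * (b' - b 0 x) + (\<beta> - B 0 x) * b 0 x)\<bar> \<le> 1 * (M * \<eta>1 + \<eta>1 * M)"
      by (intro abs_mult_le abs_add2_le rho cf b0)
    have "L - L' = (-(\<beta>\<^sup>2/2 - (B 0 x)\<^sup>2/2)) * v 1 0 + (\<gamma> - g 0 x) * v 0 1 + (\<beta>\<^sup>2/2 - (B 0 x)\<^sup>2/2) * v 2 0
       + \<rho> * (\<beta> * (b' - b 0 x) + (\<beta> - B 0 x) * b 0 x) * v 1 1 + (b'\<^sup>2/2 - (b 0 x)\<^sup>2/2) * v 0 2"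
      by (simp add: L_def L'_def A_def algebra_simps)
    also have "\<bar>\<dots>\<bar> \<le> (M * \<eta>1) * K1 + \<eta>2 * K1 + (M * \<eta>1) * K2 + (1 * (M * \<eta>1 + \<eta>1 * M)) * K2 + (M * \<eta>1) * K2"
      by (rule abs_add2_le[OF abs_add2_le[OF abs_add2_le[OF abs_add2_le[OF abs_mult_le[OF c1n v1(1)] abs_mult_le[OF c3 v1(2)]]
        abs_mult_le[OF c1(1) v1(3)]] abs_mult_le[OF c2 v1(4)]] abs_mult_le[OF c1(2) v1(5)]])
    also have "\<dots> \<le> 4 * M * \<eta>1 * (K1 + K2) + \<eta>2 * K1"
    proof -
      have "0 \<le> M * \<eta>1 * K1" using cf(3) M1 K1 by (intro mult_nonneg_nonneg) auto
      then show ?thesis by (simp add: algebra_simps)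
    qed
    finally show ?thesis .
  qed
  have near: "\<bar>a * (T F i j y x - F i j y x)\<bar> \<le> 61 * (M3\<^sup>2 * S * \<epsilon>)" if "(i, j) \<in> {(1,0), (0,1), (2,0), (1,1), (0,2)}" for i j
  proof -
    have "\<bar>a * (T F i j y x - F i j y x)\<bar> \<le> 1 * (61 * M3\<^sup>2 * (K1 + K2 + K3) * \<epsilon>)"
      using T_near[OF F bd(1) that, of y x] a by (intro abs_mult_le) auto
    then show ?thesis by (simp add: S_def mult.assoc)
  qed
  define h where "h = M3^4 * S * \<epsilon>"
  have LX: "L' - Lop F y x = A 0 x * (a * (T F 1 0 y x - F 1 0 y x)) + g 0 x * (a * (T F 0 1 y x - F 0 1 y x))
      + (B 0 x * B 0 x)/2 * (a * (T F 2 0 y x - F 2 0 y x)) + \<rho> * (B 0 x * b 0 x) * (a * (T F 1 1 y x - F 1 1 y x)) + (b 0 x * b 0 x)/2 * (a * (T F 0 2 y x - F 0 2 y x))"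
    by (simp add: L'_def Lop_def v power2_eq_square algebra_simps)
  have "\<bar>L' - Lop F y x\<bar> \<le> M3\<^sup>2 * (61 * (M3\<^sup>2 * S * \<epsilon>)) + M3\<^sup>2 * (61 * (M3\<^sup>2 * S * \<epsilon>)) + M3\<^sup>2 * (61 * (M3\<^sup>2 * S * \<epsilon>)) + M3\<^sup>2 * (61 * (M3\<^sup>2 * S * \<epsilon>)) + M3\<^sup>2 * (61 * (M3\<^sup>2 * S * \<epsilon>))"
  proof -
    have MM: "M \<le> M3\<^sup>2" "M * M \<le> M3\<^sup>2"
    proof -
      show "M * M \<le> M3\<^sup>2" unfolding power2_eq_square using MM3 M1 by (intro mult_mono) auto
      moreover have "M * 1 \<le> M * M" using M1 by (intro mult_left_mono) auto
      ultimately show "M \<le> M3\<^sup>2" by simp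
    qed
    have bbs: "\<bar>B 0 x * B 0 x\<bar> \<le> M * M" "\<bar>B 0 x * b 0 x\<bar> \<le> M * M" "\<bar>b 0 x * b 0 x\<bar> \<le> M * M" by (intro abs_mult_le b0)+
    have cc: "\<bar>A 0 x\<bar> \<le> M3\<^sup>2" "\<bar>g 0 x\<bar> \<le> M3\<^sup>2" "\<bar>(B 0 x * B 0 x)/2\<bar> \<le> M3\<^sup>2" "\<bar>\<rho> * (B 0 x * b 0 x)\<bar> \<le> M3\<^sup>2" "\<bar>(b 0 x * b 0 x)/2\<bar> \<le> M3\<^sup>2"
    proof -
      show "\<bar>A 0 x\<bar> \<le> M3\<^sup>2" "\<bar>g 0 x\<bar> \<le> M3\<^sup>2" using b0 MM by linarith+
      have "\<bar>\<rho> * (B 0 x * b 0 x)\<bar> \<le> 1 * (M * M)" by (rule abs_mult_le[OF rho bbs(2)])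
      then show "\<bar>\<rho> * (B 0 x * b 0 x)\<bar> \<le> M3\<^sup>2" using MM by simp
      have hf: "\<bar>q/2\<bar> \<le> \<bar>q\<bar>" for q :: real by simp
      show "\<bar>(B 0 x * B 0 x)/2\<bar> \<le> M3\<^sup>2" "\<bar>(b 0 x * b 0 x)/2\<bar> \<le> M3\<^sup>2"
        by (rule order_trans[OF hf order_trans[OF bbs(1) MM(2)]] order_trans[OF hf order_trans[OF bbs(3) MM(2)]])+
    qed
    have nr: "\<bar>a * (T F 1 0 y x - F 1 0 y x)\<bar> \<le> 61 * (M3\<^sup>2 * S * \<epsilon>)" "\<bar>a * (T F 0 1 y x - F 0 1 y x)\<bar> \<le> 61 * (M3\<^sup>2 * S * \<epsilon>)"
      "\<bar>a * (T F 2 0 y x - F 2 0 y x)\<bar> \<le> 61 * (M3\<^sup>2 * S * \<epsilon>)" "\<bar>a * (T F 1 1 y x - F 1 1 y x)\<bar> \<le> 61 * (M3\<^sup>2 * S * \<epsilon>)"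
      "\<bar>a * (T F 0 2 y x - F 0 2 y x)\<bar> \<le> 61 * (M3\<^sup>2 * S * \<epsilon>)" by (rule near, simp)+
    show ?thesis unfolding LX
      by (rule abs_add2_le[OF abs_add2_le[OF abs_add2_le[OF abs_add2_le[OF abs_mult_le[OF cc(1) nr(1)] abs_mult_le[OF cc(2) nr(2)]]
        abs_mult_le[OF cc(3) nr(3)]] abs_mult_le[OF cc(4) nr(4)]] abs_mult_le[OF cc(5) nr(5)]])
  qed
  also have "\<dots> = 305 * h" by (simp add: h_def eval_nat_numeral)
  finally have L2: "\<bar>L' - Lop F y x\<bar> \<le> 305 * h" .
  have "\<bar>(F 0 0 y x - T F 0 0 y x) / \<tau> + Lop F y x\<bar> = \<bar>T F 0 0 y x - F 0 0 y x - \<tau> * Lop F y x\<bar> / \<tau>"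
  proof -
    have "(F 0 0 y x - T F 0 0 y x) / \<tau> + Lop F y x = - (T F 0 0 y x - F 0 0 y x - \<tau> * Lop F y x) / \<tau>"
      using tau_pos by (simp add: field_simps)
    then show ?thesis using tau_pos by (simp only: abs_divide abs_minus_cancel abs_of_pos)
  qed
  also have "\<dots> \<le> (252 * M^3 * (K1 + K2 + K3) * \<tau> * \<epsilon>) / \<tau>"
    using T_consistent[OF F bd(1), of y x] tau_pos by (intro divide_right_mono) auto
  also have "\<dots> = 252 * (M^3 * S * \<epsilon>)" using tau_pos by (simp add: S_def)
  also have "\<dots> \<le> 252 * h"
  proof -
    have "M^3 \<le> M3^3" using MM3 M1 by (intro power_mono) auto
    also have "\<dots> \<le> M3^4" using M31 by (intro power_increasing) auto
    finally show ?thesis unfolding h_def using S eps by (intro mult_left_mono mult_right_mono) auto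
  qed
  finally have L3: "\<bar>(F 0 0 y x - T F 0 0 y x) / \<tau> + Lop F y x\<bar> \<le> 252 * h" .
  define D where "D = (F 0 0 y x - T F 0 0 y x) / \<tau>"
  have "D + L = (D + Lop F y x) + (L' - Lop F y x) + (L - L')" by simp
  also have "\<bar>\<dots>\<bar> \<le> 252 * h + 305 * h + (4 * M * \<eta>1 * (K1 + K2) + \<eta>2 * K1)"
    by (rule abs_add3_le[OF L3[folded D_def] L2 LL])
  finally have "\<bar>sg * (D + L)\<bar> \<le> 557 * h + 4 * M * \<eta>1 * (K1 + K2) + \<eta>2 * K1" using sg by auto
  then have "sg * D + sg * L \<le> 557 * h + 4 * M * \<eta>1 * (K1 + K2) + \<eta>2 * K1" by (simp add: distrib_left abs_le_iff)
  then show ?thesis unfolding op_eq using k1 by (simp add: D_def h_def S_def mult_ac)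
qed
end

lemma C1_fun_affine: "C1_fun (\<lambda>t. p * t + q) (\<lambda>t. p)"
  unfolding C1_fun_def by (auto intro!: derivative_eq_intros continuous_intros)

context scheme begin

text \<open>The bound of \<open>step_op\<close> with its parameters left free: it is used with the
  actual \<open>\<epsilon>\<close>, \<open>\<eta>1\<close>, \<open>\<eta>2\<close> at good times,
  and with the crude values 1 and \<open>2 * M\<close> at all others.\<close>

definition err :: "real \<Rightarrow> real \<Rightarrow> real \<Rightarrow> real \<Rightarrow> real \<Rightarrow> real \<Rightarrow> real \<Rightarrow> real \<Rightarrow> real" where
  "err e \<eta>1 \<eta>2 K1 K2 K3 m0 Nv = 557 * M3^4 * (K1 + K2 + K3) * e + 4 * M * \<eta>1 * (K1 + K2) + \<eta>2 * K1 + 2 * m0 * Nv"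

text \<open>The comparison function is \<open>sg\<close> times the linear interpolation in time
  between \<open>T F\<close> at \<open>t0\<close> and \<open>F\<close> at \<open>t1\<close>, plus
  the penalty with weight \<open>\<delta> * exp (lam * (Tm - s))\<close>. As \<open>lam\<close> is
  the constant of \<open>log_op_add_le\<close>, the time derivative of the weight cancels the bound
  for what the penalty adds to the operator. In \<open>out\<close>, \<open>K\<close> covers the
  oscillation of the interpolation, and \<open>2 * \<delta> * exp (lam * Tm)\<close> covers the
  penalty at the origin.\<close>

lemma scheme_compare:
  assumes F: "jet3 F" and bd: "jet_bd F K1 K2 K3" "jet_bd (T F) K1 K2 K3"
    and V: "\<And>y x. - Nv \<le> F 0 1 y x" "\<And>y x. - Nv \<le> T F 0 1 y x" "0 \<le> Nv"
    and rg: "\<And>y x. 0 \<le> F 0 0 y x" "\<And>y x. F 0 0 y x \<le> K"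
    and sg: "sg \<in> {1, -1}" and sub: "log_sub Tm r \<rho> \<beta> b' c (\<lambda>x t. sg * \<kappa> x t) U"
    and U: "continuous_on (UNIV \<times> UNIV \<times> {0..Tm}) (\<lambda>(y, x, t). U y x t)"
    and t: "0 \<le> t0" "t1 = t0 + \<tau>" "t1 \<le> Tm" and R: "R > 0" and \<delta>: "\<delta> > 0" and n: "lam = 10 * (real (n + 2))\<^sup>2 * m0"
    and out: "\<And>y x t. t \<in> {0..Tm} \<Longrightarrow> \<not> (\<bar>y\<bar> < R \<and> \<bar>x\<bar> < R) \<Longrightarrow>
        U y x t - \<delta> * (pen n y + pen n x) + K < U 0 0 t - 2 * \<delta> * exp (lam * Tm)"
    and m0: "\<And>x. \<bar>r - (\<beta> x)\<^sup>2/2\<bar> \<le> m0" "\<And>x. (\<beta> x)\<^sup>2/2 \<le> m0" "\<And>x t. t \<in> {0..Tm} \<Longrightarrow> (b' x t)\<^sup>2/2 \<le> m0"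
      "\<And>x t. t \<in> {0..Tm} \<Longrightarrow> \<bar>c x t\<bar> + \<bar>\<kappa> x t\<bar> \<le> m0 * (1 + \<bar>x\<bar>)" "\<And>x t. t \<in> {0..Tm} \<Longrightarrow> \<bar>\<kappa> x t\<bar> \<le> m0"
    and cM: "\<And>x. \<bar>\<beta> x\<bar> \<le> M" "\<And>x t. t \<in> {0..Tm} \<Longrightarrow> \<bar>b' x t\<bar> \<le> M" "\<And>x t. t \<in> {0..Tm} \<Longrightarrow> \<bar>x\<bar> < R \<Longrightarrow> \<bar>c x t + \<kappa> x t\<bar> \<le> M"
    and \<eta>: "0 \<le> \<eta>1" "0 \<le> \<eta>2" "\<eta>1 \<le> 2 * M" "\<eta>2 \<le> 2 * M"
    and good: "\<And>x t. t \<in> Good \<Longrightarrow> t \<in> {0..Tm} \<Longrightarrow> \<bar>x\<bar> < R \<Longrightarrow> \<bar>\<beta> x - B 0 x\<bar> \<le> \<eta>1 \<and> \<bar>b' x t - b 0 x\<bar> \<le> \<eta>1 \<and> \<bar>c x t + \<kappa> x t - g 0 x\<bar> \<le> \<eta>2"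
    and m: "\<And>Q. Q \<in> sets lebesgue \<Longrightarrow> Good \<inter> {t0<..<t1} \<subseteq> Q \<Longrightarrow> m \<le> measure lebesgue (Q \<inter> {t0..t1})"
    and H: "\<And>y x. U y x t1 - sg * F 0 0 y x - \<delta> * exp (lam * (Tm - t1)) * (pen n y + pen n x) \<le> H"
  shows "U y x t0 - sg * T F 0 0 y x - \<delta> * exp (lam * (Tm - t0)) * (pen n y + pen n x)
    \<le> H + err \<epsilon> \<eta>1 \<eta>2 K1 K2 K3 m0 Nv * \<tau> + err 1 (2 * M) (2 * M) K1 K2 K3 m0 Nv * (\<tau> - m)"
proof -
  note N = jet_bd_comp[OF bd(1)]
  have t01: "t0 < t1" using tau_pos t by simp
  have m00: "0 \<le> m0" using m0(1)[of 0] by linarith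
  have lam0: "0 \<le> lam" using n m00 by simp
  define a where "a t = (t1 - t) / \<tau>" for t
  have a0: "a t0 = 1" "a t1 = 0" using t tau_pos by (auto simp: a_def)
  have a01: "0 \<le> a s" "a s \<le> 1" if "s \<in> {t0..t1}" for s using that t tau_pos by (auto simp: a_def divide_le_eq)
  define v where "v s i j y x = a s * T F i j y x + (1 - a s) * F i j y x" for s i j y x
  define E where "E s = \<delta> * exp (lam * (Tm - s))" for s
  have E: "0 \<le> E s" for s using \<delta> by (simp add: E_def)
  have C1a: "C1_fun (\<lambda>s. sg * a s) (\<lambda>s. - sg / \<tau>)" "C1_fun (\<lambda>s. sg * (1 - a s)) (\<lambda>s. sg / \<tau>)"
  proof -
    have eqs: "(\<lambda>s. sg * a s) = (\<lambda>s. (- sg / \<tau>) * s + sg * t1 / \<tau>)" "(\<lambda>s. sg * (1 - a s)) = (\<lambda>s. (sg / \<tau>) * s + sg * (1 - t1 / \<tau>))"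
      using tau_pos by (auto simp: a_def fun_eq_iff field_simps)
    show "C1_fun (\<lambda>s. sg * a s) (\<lambda>s. - sg / \<tau>)" "C1_fun (\<lambda>s. sg * (1 - a s)) (\<lambda>s. sg / \<tau>)"
      unfolding eqs by (rule C1_fun_affine)+
  qed
  note tf = test_fun_add[OF test_fun_add[OF test_fun_jet[OF C1a(1) jet3_T[OF F]] test_fun_jet[OF C1a(2) F]] test_fun_pen[of \<delta> lam Tm n]]
  have rT: "0 \<le> T F 0 0 y x" "T F 0 0 y x \<le> K" for y x using T_bounds[of 0 F K] rg by auto
  have v0: "0 \<le> v s 0 0 y x" "v s 0 0 y x \<le> K" if "s \<in> {t0..t1}" for s y x
  proof -
    show "0 \<le> v s 0 0 y x" unfolding v_def using a01[OF that] rg rT by auto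
    have "a s * T F 0 0 y x \<le> a s * K" "(1 - a s) * F 0 0 y x \<le> (1 - a s) * K"
      using a01[OF that] rg rT by (intro mult_left_mono; simp)+
    then have "v s 0 0 y x \<le> a s * K + (1 - a s) * K" unfolding v_def by linarith
    then show "v s 0 0 y x \<le> K" by (simp add: algebra_simps)
  qed
  let ?z = "\<lambda>y x s. sg * a s * T F 0 0 y x + sg * (1 - a s) * F 0 0 y x + \<delta> * exp (lam * (Tm - s)) * (pen n y + pen n x)"
  have z_eq: "?z y x s = sg * v s 0 0 y x + E s * (pen n y + pen n x)" for y x s
    by (simp add: v_def E_def algebra_simps)
  have errm: "err \<epsilon> \<eta>1 \<eta>2 K1 K2 K3 m0 Nv \<le> err 1 (2 * M) (2 * M) K1 K2 K3 m0 Nv"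
  proof -
    have "0 \<le> 557 * M3^4 * (K1 + K2 + K3)" using N by simp
    then have "557 * M3^4 * (K1 + K2 + K3) * \<epsilon> \<le> 557 * M3^4 * (K1 + K2 + K3) * 1" using eps by (intro mult_left_mono) auto
    moreover have "4 * M * \<eta>1 * (K1 + K2) \<le> 4 * M * (2 * M) * (K1 + K2)" "\<eta>2 * K1 \<le> 2 * M * K1"
      using \<eta> M1 N by (intro mult_right_mono mult_left_mono; simp)+
    ultimately show ?thesis unfolding err_def by linarith
  qed
  have M0: "0 \<le> M" using M1 by simp
  have err0: "0 \<le> err \<epsilon> \<eta>1 \<eta>2 K1 K2 K3 m0 Nv" unfolding err_def
    using N eps \<eta> M0 m00 V(3) by (intro add_nonneg_nonneg mult_nonneg_nonneg) auto
  have "U y x t0 - ?z y x t0 \<le> H + err \<epsilon> \<eta>1 \<eta>2 K1 K2 K3 m0 Nv * (t1 - t0) + err 1 (2 * M) (2 * M) K1 K2 K3 m0 Nv * (t1 - t0 - m)"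
  proof (rule step_compare[OF sub tf t(1) t01 t(3) U R _ err0 errm _ m])
    fix y x s assume s: "s \<in> {t0..t1}" and o: "\<not> (\<bar>y\<bar> < R \<and> \<bar>x\<bar> < R)"
    have s': "s \<in> {0..Tm}" using s t by auto
    have "1 \<le> exp (lam * (Tm - s))" using s' lam0 by simp
    then have E1: "\<delta> \<le> E s" using \<delta> by (simp add: E_def)
    have "exp (lam * (Tm - s)) \<le> exp (lam * Tm)" using s' lam0 by (simp add: mult_left_mono)
    then have E2: "E s * 2 \<le> 2 * \<delta> * exp (lam * Tm)" using \<delta> by (simp add: E_def)
    have "\<delta> * (pen n y + pen n x) \<le> E s * (pen n y + pen n x)"
      using E1 pen_bounds(1)[of n y] pen_bounds(1)[of n x] by (intro mult_right_mono) auto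
    moreover have "sg * v s 0 0 0 0 - sg * v s 0 0 y x \<le> K" using sg v0[OF s, of 0 0] v0[OF s, of y x] by auto
    moreover have "pen n 0 + pen n 0 = 2" by (simp add: pen_def)
    ultimately show "U y x s - ?z y x s < U 0 0 s - ?z 0 0 s"
      unfolding z_eq using out[OF s' o] E2 by (simp only:)
  next
    fix y x s assume s: "s \<in> {t0<..<t1}" and yx: "\<bar>y\<bar> < R" "\<bar>x\<bar> < R"
    have s': "s \<in> {0..Tm}" "s \<in> {t0..t1}" using s t by auto
    let ?e = "if s \<in> Good then err \<epsilon> \<eta>1 \<eta>2 K1 K2 K3 m0 Nv else err 1 (2 * M) (2 * M) K1 K2 K3 m0 Nv"
    have b0: "\<bar>B 0 x\<bar> \<le> M" "\<bar>b 0 x\<bar> \<le> M" "\<bar>g 0 x\<bar> \<le> M" using bB bb bg by auto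
    have df: "\<bar>p - q\<bar> \<le> 2 * M" if "\<bar>p\<bar> \<le> M" "\<bar>q\<bar> \<le> M" for p q using that by (simp add: abs_le_iff)
    note so = step_op[OF F bd V(1) V(2) V(3) a01[OF s'(2)] sg cM(1)[of x] cM(2)[OF s'(1), of x] _ _ _ m0(5)[OF s'(1), of x] v_def]
    have main: "sg * ((F 0 0 y x - T F 0 0 y x) / \<tau>) + log_op r \<rho> (\<beta> x) (b' x s) (c x s) (sg * \<kappa> x s)
       (sg * v s 1 0 y x) (sg * v s 0 1 y x) (sg * v s 2 0 y x) (sg * v s 1 1 y x) (sg * v s 0 2 y x) \<le> ?e"
    proof (cases "s \<in> Good")
      case True
      have gd: "\<bar>\<beta> x - B 0 x\<bar> \<le> \<eta>1" "\<bar>b' x s - b 0 x\<bar> \<le> \<eta>1" "\<bar>c x s + \<kappa> x s - g 0 x\<bar> \<le> \<eta>2"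
        using good[OF True s'(1) yx(2)] by auto
      show ?thesis unfolding if_P[OF True] err_def by (rule so[OF gd])
    next
      case False
      have "sg * ((F 0 0 y x - T F 0 0 y x) / \<tau>) + log_op r \<rho> (\<beta> x) (b' x s) (c x s) (sg * \<kappa> x s)
       (sg * v s 1 0 y x) (sg * v s 0 1 y x) (sg * v s 2 0 y x) (sg * v s 1 1 y x) (sg * v s 0 2 y x)
        \<le> 557 * M3^4 * (K1 + K2 + K3) * \<epsilon> + 4 * M * (2 * M) * (K1 + K2) + 2 * M * K1 + 2 * m0 * Nv"
        by (rule so) (intro df cM(1) cM(2)[OF s'(1)] cM(3)[OF s'(1) yx(2)] b0)+
      also have "\<dots> \<le> err 1 (2 * M) (2 * M) K1 K2 K3 m0 Nv"
      proof -
        have "0 \<le> 557 * M3^4 * (K1 + K2 + K3)" using N by simp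
        then have "557 * M3^4 * (K1 + K2 + K3) * \<epsilon> \<le> 557 * M3^4 * (K1 + K2 + K3) * 1" using eps by (intro mult_left_mono) auto
        then show ?thesis unfolding err_def by simp
      qed
      finally show ?thesis using False by simp
    qed
    have pm: "log_op r \<rho> (\<beta> x) (b' x s) (c x s) (sg * \<kappa> x s)
       (sg * v s 1 0 y x + E s * pen1 n y) (sg * v s 0 1 y x + E s * pen1 n x) (sg * v s 2 0 y x + E s * pen2 n y) (sg * v s 1 1 y x + E s * 0) (sg * v s 0 2 y x + E s * pen2 n x)
      \<le> log_op r \<rho> (\<beta> x) (b' x s) (c x s) (sg * \<kappa> x s)
       (sg * v s 1 0 y x) (sg * v s 0 1 y x) (sg * v s 2 0 y x) (sg * v s 1 1 y x) (sg * v s 0 2 y x) + 10 * (real (n + 2))\<^sup>2 * m0 * E s * (pen n y + pen n x)"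
      by (rule log_op_add_le[where x = x]) (use m0 s' sg E in \<open>auto simp: abs_mult\<close>)
    have veq: "sg * a s * T F i j y x + sg * (1 - a s) * F i j y x = sg * v s i j y x" for i j
      by (simp add: v_def algebra_simps)
    have zt: "- sg / \<tau> * T F 0 0 y x + sg / \<tau> * F 0 0 y x + - (lam * E s) * (pen n y + pen n x)
        = sg * ((F 0 0 y x - T F 0 0 y x) / \<tau>) - 10 * (real (n + 2))\<^sup>2 * m0 * E s * (pen n y + pen n x)"
      using tau_pos by (simp add: n E_def field_simps)
    show "- sg / \<tau> * T F 0 0 y x + sg / \<tau> * F 0 0 y x + - (lam * (\<delta> * exp (lam * (Tm - s)))) * (pen n y + pen n x) +
      log_op r \<rho> (\<beta> x) (b' x s) (c x s) (sg * \<kappa> x s) (sg * a s * T F 1 0 y x + sg * (1 - a s) * F 1 0 y x + \<delta> * exp (lam * (Tm - s)) * pen1 n y)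
        (sg * a s * T F 0 1 y x + sg * (1 - a s) * F 0 1 y x + \<delta> * exp (lam * (Tm - s)) * pen1 n x)
        (sg * a s * T F 2 0 y x + sg * (1 - a s) * F 2 0 y x + \<delta> * exp (lam * (Tm - s)) * pen2 n y)
        (sg * a s * T F 1 1 y x + sg * (1 - a s) * F 1 1 y x + \<delta> * exp (lam * (Tm - s)) * 0)
        (sg * a s * T F 0 2 y x + sg * (1 - a s) * F 0 2 y x + \<delta> * exp (lam * (Tm - s)) * pen2 n x) \<le> ?e"
      unfolding zt veq E_def[symmetric] using main pm by linarith
  next
    fix y x show "U y x t1 - ?z y x t1 \<le> H" unfolding z_eq using H[of y x] by (simp add: v_def a0 E_def)
  qed
  then show ?thesis unfolding z_eq using t by (simp add: v_def a0 E_def)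
qed
end

text \<open>Discrete Gronwall estimates, where \<open>V j\<close> is the value \<open>j\<close>
  steps before maturity. The rate in \<open>K1\<close> and \<open>K2\<close> contains neither
  \<open>L2\<close> nor \<open>M3\<close>, and \<open>K2\<close> is linear in \<open>L2\<close>;
  nothing is asked of the size of \<open>K3\<close>. Convexity is carried through the induction to
  feed \<open>T_vega\<close>. As the vega is nonnegative at maturity, its lower bound consists of
  accumulated errors only and is of order \<open>\<epsilon>\<close>.\<close>

lemma chain_bounds:
  fixes V :: "nat \<Rightarrow> nat \<Rightarrow> nat \<Rightarrow> real \<Rightarrow> real \<Rightarrow> real" and Tm :: real
  assumes sch: "\<And>i. scheme r \<rho> M L2 M3 \<epsilon> \<tau> B (b i) (g i)" and L2: "0 \<le> L2"
    and V0: "jet3 (V 0)" "jet_bd (V 0) A1 A2 A3" "\<And>y x. 0 \<le> V 0 0 0 y x" "\<And>y x. V 0 0 0 y x \<le> K"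
       "\<And>y x. 0 \<le> V 0 2 0 y x - V 0 1 0 y x" "\<And>y x. 0 \<le> V 0 0 1 y x"
    and VS: "\<And>j. V (Suc j) = scheme.T r \<rho> \<epsilon> \<tau> B (b j) (g j) (V j)"
    and BB: "\<And>x. 0 \<le> B 0 x" "\<And>x. 0 \<le> B 1 x" and tM: "\<tau> * M \<le> 1" and Tm: "0 \<le> Tm"
    and K1: "K1 = A1 * exp (22 * M\<^sup>2 * Tm)" and K2: "K2 = (A2 + Tm * (M + L2) * A1) * exp (22 * M\<^sup>2 * Tm)"
    and K3: "K3 = (A3 + Tm * (994 * M3^4 * (K1 + K2))) * exp (994 * M3^4 * Tm)"
    and j: "real j * \<tau> \<le> Tm"
  shows "jet3 (V j) \<and> jet_bd (V j) K1 K2 K3 \<and> (\<forall>y x. 0 \<le> V j 0 0 y x \<and> V j 0 0 y x \<le> K)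
     \<and> (\<forall>y x. - (260 * M^4 * (K1 + K2 + K3) * Tm * exp (M * Tm) * \<epsilon>) \<le> V j 0 1 y x)"
proof -
  interpret s0: scheme r \<rho> M L2 M3 \<epsilon> \<tau> B "b 0" "g 0" by (rule sch)
  note tp = s0.tau_pos and M1 = s0.M1 and MM3 = s0.MM3 and eps = s0.eps
  have M0: "0 \<le> M" "0 \<le> M3" using M1 MM3 by auto
  note A = jet_bd_comp(10-12)[OF V0(2)]
  define a where "a = 22 * M\<^sup>2" define q where "q = 994 * M3^4"
  have aq: "0 \<le> a" "0 \<le> q" using M0 by (auto simp: a_def q_def)
  define S where "S = K1 + K2 + K3"
  have K0: "0 \<le> K1" "0 \<le> K2" using A M0 L2 Tm by (auto simp: K1 K2)
  then have K30: "0 \<le> K3" using A M0 Tm by (auto simp: K3)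
  have S0: "0 \<le> S" using K0 K30 by (simp add: S_def)
  \<comment> \<open>Explicit majorants of the recursions for the bounds after \<open>j\<close>
    steps. \<open>NV\<close> contains the final \<open>S\<close> throughout, so that the error of
    \<open>T_vega\<close> in one step has a bound uniform in \<open>j\<close>.\<close>
  define N1 where "N1 j = A1 * exp (a * (real j * \<tau>))" for j
  define N2 where "N2 j = (A2 + (real j * \<tau>) * (M + L2) * A1) * exp (a * (real j * \<tau>))" for j
  define N3 where "N3 j = (A3 + (real j * \<tau>) * (q * (K1 + K2))) * exp (q * (real j * \<tau>))" for j
  define NV where "NV j = (real j * \<tau>) * (260 * M^4 * S * \<epsilon>) * exp (M * (real j * \<tau>))" for j
  have le: "N1 j \<le> K1" "N2 j \<le> K2" "N3 j \<le> K3" "NV j \<le> 260 * M^4 * S * Tm * exp (M * Tm) * \<epsilon>" if j: "real j * \<tau> \<le> Tm" for j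
  proof -
    have j0: "0 \<le> real j * \<tau>" using tp by simp
    have ex: "exp (a * (real j * \<tau>)) \<le> exp (a * Tm)" "exp (q * (real j * \<tau>)) \<le> exp (q * Tm)" "exp (M * (real j * \<tau>)) \<le> exp (M * Tm)"
      using j aq M0 by (auto intro!: mult_left_mono)
    show "N1 j \<le> K1" unfolding N1_def K1 a_def[symmetric] using ex A by (intro mult_left_mono) auto
    have "real j * \<tau> * (M + L2) * A1 \<le> Tm * (M + L2) * A1" using j M0 L2 A by (intro mult_right_mono) auto
    then show "N2 j \<le> K2" unfolding N2_def K2 a_def[symmetric] using ex A Tm M0 L2 j0 by (intro mult_mono) auto
    have "real j * \<tau> * (q * (K1 + K2)) \<le> Tm * (q * (K1 + K2))" using j aq K0 by (intro mult_right_mono) auto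
    then show "N3 j \<le> K3" unfolding N3_def K3 q_def[symmetric] using ex A Tm aq K0 j0 by (intro mult_mono) auto
    have "NV j \<le> Tm * (260 * M^4 * S * \<epsilon>) * exp (M * Tm)" unfolding NV_def using ex j S0 eps Tm
      by (intro mult_mono mult_right_mono) auto
    then show "NV j \<le> 260 * M^4 * S * Tm * exp (M * Tm) * \<epsilon>" by (simp add: mult_ac)
  qed
  have "real j * \<tau> \<le> Tm \<Longrightarrow> jet3 (V j) \<and> jet_bd (V j) (N1 j) (N2 j) (N3 j) \<and> (\<forall>y x. 0 \<le> V j 0 0 y x \<and> V j 0 0 y x \<le> K)
     \<and> (\<forall>y x. - NV j \<le> V j 0 1 y x) \<and> (\<forall>y x. 0 \<le> V j 2 0 y x - V j 1 0 y x)" for j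
  proof (induction j)
    case 0
    then show ?case using V0 by (simp add: N1_def N2_def N3_def NV_def)
  next
    case (Suc j)
    interpret scheme r \<rho> M L2 M3 \<epsilon> \<tau> B "b j" "g j" by (rule sch)
    have j: "real j * \<tau> \<le> Tm" using Suc.prems tp by (simp add: algebra_simps)
    have j0: "0 \<le> real j * \<tau>" using tp by simp
    note IH = Suc.IH[OF j]
    have J: "jet3 (V j)" and bd: "jet_bd (V j) (N1 j) (N2 j) (N3 j)" using IH by auto
    note L = le[OF j]
    have nn: "0 \<le> N1 j" "0 \<le> N2 j" "0 \<le> N3 j" using jet_bd_comp(10-12)[OF bd] by auto
    have sj: "real (Suc j) * \<tau> = real j * \<tau> + \<tau>" by (simp add: algebra_simps)
    have ea: "1 + a * \<tau> \<le> exp (a * \<tau>)" "1 + q * \<tau> \<le> exp (q * \<tau>)" "1 + M * \<tau> \<le> exp (M * \<tau>)" by (rule exp_ge_add_one_self)+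
    have e1: "1 \<le> exp (a * \<tau>)" "1 \<le> exp (q * \<tau>)" "1 \<le> exp (M * \<tau>)" using aq tp M0 by auto
    have s1: "exp (a * (real (Suc j) * \<tau>)) = exp (a * (real j * \<tau>)) * exp (a * \<tau>)"
      "exp (q * (real (Suc j) * \<tau>)) = exp (q * (real j * \<tau>)) * exp (q * \<tau>)"
      "exp (M * (real (Suc j) * \<tau>)) = exp (M * (real j * \<tau>)) * exp (M * \<tau>)"
      unfolding sj by (simp_all add: distrib_left exp_add)
    have b1: "N1 j * (1 + 7 * M\<^sup>2 * \<tau>) \<le> N1 (Suc j)"
    proof -
      have "1 + 7 * M\<^sup>2 * \<tau> \<le> 1 + a * \<tau>" using tp by (simp add: a_def)
      then have "N1 j * (1 + 7 * M\<^sup>2 * \<tau>) \<le> N1 j * exp (a * \<tau>)" using nn by (intro mult_left_mono order_trans[OF _ ea(1)]) auto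
      then show ?thesis unfolding N1_def s1 by (simp add: mult.assoc)
    qed
    have b2: "N2 j * (1 + 22 * M\<^sup>2 * \<tau>) + \<tau> * (M + L2) * N1 j \<le> N2 (Suc j)"
    proof -
      have "N2 j * (1 + 22 * M\<^sup>2 * \<tau>) \<le> N2 j * exp (a * \<tau>)" using ea nn by (intro mult_left_mono) (auto simp: a_def)
      moreover have "\<tau> * (M + L2) * N1 j * 1 \<le> \<tau> * (M + L2) * N1 j * exp (a * \<tau>)"
        using e1 tp M0 L2 nn by (intro mult_left_mono) auto
      moreover have "N2 j * exp (a * \<tau>) + \<tau> * (M + L2) * N1 j * exp (a * \<tau>) = N2 (Suc j)"
        unfolding N1_def N2_def s1 unfolding sj by (simp add: algebra_simps)
      ultimately show ?thesis by linarith
    qed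
    have b3: "N3 j + 994 * M3^4 * \<tau> * (N1 j + N2 j + N3 j) \<le> N3 (Suc j)"
    proof -
      have "N3 j + q * \<tau> * (N1 j + N2 j + N3 j) = N3 j * (1 + q * \<tau>) + \<tau> * (q * (N1 j + N2 j))" by (simp add: algebra_simps)
      also have "\<dots> \<le> N3 j * exp (q * \<tau>) + \<tau> * (q * (K1 + K2))"
        using ea nn L aq tp by (intro add_mono mult_left_mono) auto
      also have "\<tau> * (q * (K1 + K2)) \<le> \<tau> * (q * (K1 + K2)) * exp (q * (real (Suc j) * \<tau>))"
        using tp aq K0 mult_left_mono[of 1 "exp (q * (real (Suc j) * \<tau>))" "\<tau> * (q * (K1 + K2))"] by auto
      finally have "N3 j + q * \<tau> * (N1 j + N2 j + N3 j) \<le> N3 j * exp (q * \<tau>) + \<tau> * (q * (K1 + K2)) * exp (q * (real (Suc j) * \<tau>))" by simp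
      also have "\<dots> = N3 (Suc j)" unfolding N3_def s1 unfolding sj by (simp add: algebra_simps)
      finally show ?thesis by (simp add: q_def)
    qed
    have bd': "jet_bd (V (Suc j)) (N1 (Suc j)) (N2 (Suc j)) (N3 (Suc j))"
      unfolding VS by (rule jet_bd_mono[OF jet_bd_T[OF J bd] b1 b2 b3])
    have NV0: "0 \<le> NV j" unfolding NV_def using j0 S0 eps by simp
    have V1: "- NV (Suc j) \<le> V (Suc j) 0 1 y x" for y x
    proof -
      have "jet_bd (V j) K1 K2 K3" by (rule jet_bd_mono[OF bd L(1-3)])
      then have "- ((1 + M * \<tau>) * NV j) - 260 * M^4 * (K1 + K2 + K3) * \<tau> * \<epsilon> \<le> T (V j) 0 1 y x"
        using IH BB tM NV0 by (intro T_vega[OF J]) auto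
      moreover have "(1 + M * \<tau>) * NV j \<le> exp (M * \<tau>) * NV j" using ea NV0 by (intro mult_right_mono) auto
      moreover have "260 * M^4 * S * \<tau> * \<epsilon> * 1 \<le> 260 * M^4 * S * \<tau> * \<epsilon> * exp (M * (real (Suc j) * \<tau>))"
        using S0 tp eps M0 by (intro mult_left_mono) auto
      moreover have "exp (M * \<tau>) * NV j + 260 * M^4 * S * \<tau> * \<epsilon> * exp (M * (real (Suc j) * \<tau>)) = NV (Suc j)"
        unfolding NV_def s1 unfolding sj by (simp add: algebra_simps)
      ultimately show ?thesis unfolding VS S_def by linarith
    qed
    have rg: "0 \<le> V (Suc j) 0 0 y x" "V (Suc j) 0 0 y x \<le> K" for y x
      unfolding VS using T_bounds[of 0 "V j" K] IH by auto
    have cv: "0 \<le> V (Suc j) 2 0 y x - V (Suc j) 1 0 y x" for y x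
      unfolding VS using T_convex[of "V j"] IH by auto
    show ?case using jet3_T[OF J] bd' V1 rg cv unfolding VS by auto
  qed
  from this[OF j] show ?thesis using le[OF j] jet_bd_mono unfolding S_def by (meson neg_le_iff_le order_trans)
qed

text \<open>Adds up \<open>scheme_compare\<close> from maturity back to time \<open>a\<close>. Steps
  are counted from maturity but time intervals from \<open>a\<close>, hence the reversed index
  \<open>N - 1 - k\<close>.\<close>

lemma chain_compare:
  fixes V :: "nat \<Rightarrow> nat \<Rightarrow> nat \<Rightarrow> real \<Rightarrow> real \<Rightarrow> real" and Tm :: real
  assumes sch: "\<And>i. scheme r \<rho> M L2 M3 \<epsilon> \<tau> B (b i) (g i)"
    and VS: "\<And>j. V (Suc j) = scheme.T r \<rho> \<epsilon> \<tau> B (b j) (g j) (V j)"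
    and V: "\<And>j. j \<le> N \<Longrightarrow> jet3 (V j) \<and> jet_bd (V j) K1 K2 K3 \<and> (\<forall>y x. 0 \<le> V j 0 0 y x \<and> V j 0 0 y x \<le> K)
     \<and> (\<forall>y x. - Nv \<le> V j 0 1 y x)" and Nv: "0 \<le> Nv"
    and sg: "sg \<in> {1, -1}" and sub: "log_sub Tm r \<rho> \<beta> b' c (\<lambda>x t. sg * \<kappa> x t) U"
    and U: "continuous_on (UNIV \<times> UNIV \<times> {0..Tm}) (\<lambda>(y, x, t). U y x t)"
    and a: "0 \<le> a" "a + real N * \<tau> = Tm" and R: "R > 0" and \<delta>: "\<delta> > 0" and n: "lam = 10 * (real (n + 2))\<^sup>2 * m0"
    and out: "\<And>y x t. t \<in> {0..Tm} \<Longrightarrow> \<not> (\<bar>y\<bar> < R \<and> \<bar>x\<bar> < R) \<Longrightarrow>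
        U y x t - \<delta> * (pen n y + pen n x) + K < U 0 0 t - 2 * \<delta> * exp (lam * Tm)"
    and m0: "\<And>x. \<bar>r - (\<beta> x)\<^sup>2/2\<bar> \<le> m0" "\<And>x. (\<beta> x)\<^sup>2/2 \<le> m0" "\<And>x t. t \<in> {0..Tm} \<Longrightarrow> (b' x t)\<^sup>2/2 \<le> m0"
      "\<And>x t. t \<in> {0..Tm} \<Longrightarrow> \<bar>c x t\<bar> + \<bar>\<kappa> x t\<bar> \<le> m0 * (1 + \<bar>x\<bar>)" "\<And>x t. t \<in> {0..Tm} \<Longrightarrow> \<bar>\<kappa> x t\<bar> \<le> m0"
    and cM: "\<And>x. \<bar>\<beta> x\<bar> \<le> M" "\<And>x t. t \<in> {0..Tm} \<Longrightarrow> \<bar>b' x t\<bar> \<le> M" "\<And>x t. t \<in> {0..Tm} \<Longrightarrow> \<bar>x\<bar> < R \<Longrightarrow> \<bar>c x t + \<kappa> x t\<bar> \<le> M"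
    and \<eta>: "0 \<le> \<eta>1" "0 \<le> \<eta>2" "\<eta>1 \<le> 2 * M" "\<eta>2 \<le> 2 * M"
    and good: "\<And>k x t. k < N \<Longrightarrow> t \<in> Good k \<Longrightarrow> t \<in> {0..Tm} \<Longrightarrow> \<bar>x\<bar> < R \<Longrightarrow>
       \<bar>\<beta> x - B 0 x\<bar> \<le> \<eta>1 \<and> \<bar>b' x t - b (N - 1 - k) 0 x\<bar> \<le> \<eta>1 \<and> \<bar>c x t + \<kappa> x t - g (N - 1 - k) 0 x\<bar> \<le> \<eta>2"
    and m: "\<And>k Q. k < N \<Longrightarrow> Q \<in> sets lebesgue \<Longrightarrow> Good k \<inter> {a + real k * \<tau><..<a + real (Suc k) * \<tau>} \<subseteq> Q \<Longrightarrow>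
       m k \<le> measure lebesgue (Q \<inter> {a + real k * \<tau>..a + real (Suc k) * \<tau>})"
    and H: "\<And>y x. U y x Tm - sg * V 0 0 0 y x - \<delta> * (pen n y + pen n x) \<le> H"
  shows "U y x a - sg * V N 0 0 y x - \<delta> * exp (lam * (Tm - a)) * (pen n y + pen n x)
    \<le> H + scheme.err M M3 \<epsilon> \<eta>1 \<eta>2 K1 K2 K3 m0 Nv * (Tm - a) + scheme.err M M3 1 (2 * M) (2 * M) K1 K2 K3 m0 Nv * (\<Sum>k<N. \<tau> - m k)"
proof -
  define e where "e = scheme.err M M3 \<epsilon> \<eta>1 \<eta>2 K1 K2 K3 m0 Nv"
  define C where "C = scheme.err M M3 1 (2 * M) (2 * M) K1 K2 K3 m0 Nv"
  define s where "s j = a + real (N - j) * \<tau>" for j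
  have tp: "0 < \<tau>" using scheme.tau_pos(1)[OF sch] .
  have "\<forall>y x. U y x (s j) - sg * V j 0 0 y x - \<delta> * exp (lam * (Tm - s j)) * (pen n y + pen n x)
    \<le> H + e * (real j * \<tau>) + C * (\<Sum>i<j. \<tau> - m (N - 1 - i))" if "j \<le> N" for j
    using that
  proof (induction j)
    case 0
    have "s 0 = Tm" using a by (simp add: s_def)
    then show ?case using H by simp
  next
    case (Suc j)
    interpret scheme r \<rho> M L2 M3 \<epsilon> \<tau> B "b j" "g j" by (rule sch)
    have j: "j < N" using Suc.prems by simp
    define k where "k = N - 1 - j"
    have k: "k < N" "N - 1 - k = j" "N - Suc j = k" "N - j = Suc k" using j by (auto simp: k_def)
    have sk: "s (Suc j) = a + real k * \<tau>" "s j = a + real (Suc k) * \<tau>" by (simp_all only: s_def k)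
    have Vj: "jet3 (V j)" "jet_bd (V j) K1 K2 K3" "\<And>y x. 0 \<le> V j 0 0 y x" "\<And>y x. V j 0 0 y x \<le> K" "\<And>y x. - Nv \<le> V j 0 1 y x"
      using V[of j] j by auto
    have VSj: "jet_bd (T (V j)) K1 K2 K3" "\<And>y x. - Nv \<le> T (V j) 0 1 y x"
      using V[OF Suc.prems] unfolding VS by auto
    have "real (Suc k) * \<tau> \<le> real N * \<tau>" using k tp by (intro mult_right_mono) auto
    then have sT: "s j \<le> Tm" using a sk by simp
    have IH: "U y x (s j) - sg * V j 0 0 y x - \<delta> * exp (lam * (Tm - s j)) * (pen n y + pen n x)
        \<le> H + e * (real j * \<tau>) + C * (\<Sum>i<j. \<tau> - m (N - 1 - i))" for y x using Suc by simp
    have "U y x (s (Suc j)) - sg * T (V j) 0 0 y x - \<delta> * exp (lam * (Tm - s (Suc j))) * (pen n y + pen n x)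
       \<le> (H + e * (real j * \<tau>) + C * (\<Sum>i<j. \<tau> - m (N - 1 - i))) + e * \<tau> + C * (\<tau> - m k)" for y x
      unfolding e_def C_def
    proof (rule scheme_compare[OF Vj(1,2) VSj(1) Vj(5) VSj(2) Nv Vj(3,4) sg sub U _ _ sT R \<delta> n out m0 cM \<eta>, where Good = "Good k"])
      show "0 \<le> s (Suc j)" unfolding sk using a tp by simp
      show "s j = s (Suc j) + \<tau>" unfolding sk by (simp add: algebra_simps)
      show "\<bar>\<beta> x - B 0 x\<bar> \<le> \<eta>1 \<and> \<bar>b' x t - b j 0 x\<bar> \<le> \<eta>1 \<and> \<bar>c x t + \<kappa> x t - g j 0 x\<bar> \<le> \<eta>2"
        if "t \<in> Good k" "t \<in> {0..Tm}" "\<bar>x\<bar> < R" for x t using good[OF k(1) that] by (simp only: k(2))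
      show "m k \<le> measure lebesgue (Q \<inter> {s (Suc j)..s j})" if "Q \<in> sets lebesgue" "Good k \<inter> {s (Suc j)<..<s j} \<subseteq> Q" for Q
        using m[OF k(1)] that unfolding sk by blast
    qed (use IH in \<open>simp_all add: e_def C_def\<close>)
    then show ?case unfolding VS by (simp add: algebra_simps k_def)
  qed
  from this[of N] have "U y x a - sg * V N 0 0 y x - \<delta> * exp (lam * (Tm - a)) * (pen n y + pen n x)
    \<le> H + e * (real N * \<tau>) + C * (\<Sum>i<N. \<tau> - m (N - 1 - i))" by (simp add: s_def)
  moreover have "(\<Sum>i<N. \<tau> - m (N - 1 - i)) = (\<Sum>k<N. \<tau> - m k)"
    using sum.nat_diff_reindex[of "\<lambda>k. \<tau> - m k" N] by simp
  moreover have "real N * \<tau> = Tm - a" using a by simp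
  ultimately show ?thesis unfolding e_def C_def by metis
qed

section \<open>Passage to the limit\<close>

text \<open>The mean value theorem on both sides of \<open>x\<close>, and the Lipschitz bound
  between the two intermediate points. This is how the assumptions on the derivatives of
  \<open>\<beta>\<close> and \<open>b\<close> reach \<open>smoothing\<close>, whose
  \<open>O(m^2)\<close> error is stated in terms of second differences.\<close>

lemma second_difference_bound:
  fixes f :: "real \<Rightarrow> real"
  assumes d: "\<And>x. (f has_real_derivative f' x) (at x)" and L: "\<And>x y. \<bar>f' x - f' y\<bar> \<le> L * \<bar>x - y\<bar>"
  shows "\<bar>f (x + w) + f (x - w) - 2 * f x\<bar> \<le> 2 * L * w\<^sup>2"
proof -
  have L0: "0 \<le> L" using L[of 1 0] by simp
  have pos: "\<bar>f (x + w) + f (x - w) - 2 * f x\<bar> \<le> 2 * L * w\<^sup>2" if w: "w > 0" for w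
  proof -
    obtain p where p: "x < p" "p < x + w" "f (x + w) - f x = (x + w - x) * f' p" using MVT2[of x "x + w" f f'] w d by auto
    obtain q where q: "x - w < q" "q < x" "f x - f (x - w) = (x - (x - w)) * f' q" using MVT2[of "x - w" x f f'] w d by auto
    have "f (x + w) + f (x - w) - 2 * f x = w * (f' p - f' q)" using p(3) q(3) by (simp add: algebra_simps)
    also have "\<bar>\<dots>\<bar> \<le> w * (L * (2 * w))"
    proof (rule abs_mult_le)
      have "\<bar>f' p - f' q\<bar> \<le> L * \<bar>p - q\<bar>" by (rule L)
      also have "\<dots> \<le> L * (2 * w)" using p q L0 by (intro mult_left_mono) auto
      finally show "\<bar>f' p - f' q\<bar> \<le> L * (2 * w)" .
    qed (use w in simp)
    finally show ?thesis by (simp add: power2_eq_square mult_ac)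
  qed
  consider "w = 0" | "w > 0" | "w < 0" by linarith
  then show ?thesis
  proof cases
    case 3 then show ?thesis using pos[of "-w"] by (simp add: add.commute)
  qed (use pos in auto)
qed

text \<open>The payoff is \<open>K - exp (min s (ln K))\<close>, and up to \<open>ln K\<close> the
  slope of \<open>exp\<close> is at most \<open>K\<close>.\<close>

lemma put_lipschitz:
  fixes K :: real
  assumes K: "K > 0"
  shows "\<bar>max (K - exp x) 0 - max (K - exp y) 0\<bar> \<le> K * \<bar>x - y\<bar>"
proof -
  have le: "max (K - exp x) 0 - max (K - exp y) 0 \<le> K * (y - x)" "max (K - exp y) 0 \<le> max (K - exp x) 0" if "x < y" for x y
  proof -
    have "exp x < exp y" using that by simp
    then show "max (K - exp y) 0 \<le> max (K - exp x) 0" by linarith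
    define k where "k = ln K"
    have k: "exp k = K" using K by (simp add: k_def)
    have g: "max (K - exp s) 0 = K - exp (min s k)" for s
      using k by (cases "s \<le> k") (auto simp: max_def min_def)
    show "max (K - exp x) 0 - max (K - exp y) 0 \<le> K * (y - x)"
    proof (cases "min x k < min y k")
      case True
      obtain z where z: "min x k < z" "z < min y k" "exp (min y k) - exp (min x k) = (min y k - min x k) * exp z"
        using MVT2[OF True, of exp exp] by (auto intro: DERIV_exp)
      have "exp z \<le> K" using z k by (metis exp_le_cancel_iff less_imp_le min.strict_boundedE)
      moreover have "min y k - min x k \<le> y - x" using that by auto
      ultimately have "(min y k - min x k) * exp z \<le> (y - x) * K" using that by (intro mult_mono) auto
      then show ?thesis unfolding g using z(3) by (simp add: mult.commute)
    next
      case False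
      then have "min x k = min y k" using that by auto
      then show ?thesis unfolding g using K that by simp
    qed
  qed
  consider "x = y" | "x < y" | "y < x" by linarith
  then show ?thesis
  proof cases
    case 2 then show ?thesis using le[OF 2] by simp
  next
    case 3 then show ?thesis using le[OF 3] by simp
  qed simp
qed

text \<open>Below the strike, \<open>g = K - e\<^sup>y\<close> satisfies \<open>g' - g = - K\<close>, and above it \<open>g' - g = 0\<close>: hence
  \<open>g - \<integral>g\<close> is a translate of the convex function \<open>K (ln K - y)\<^sub>+\<close>.\<close>

lemma put_convex:
  fixes K :: real and F :: "real \<Rightarrow> real"
  assumes K: "K > 0" and F: "\<And>x. (F has_real_derivative max (K - exp x) 0) (at x)"
  shows "0 \<le> (max (K - exp (x + w)) 0 - F (x + w)) + (max (K - exp (x - w)) 0 - F (x - w)) - 2 * (max (K - exp x) 0 - F x)"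
proof -
  define k where "k = ln K"
  have k: "exp k = K" using K by (simp add: k_def)
  define q where "q s = max (K - exp s) 0 - F s" for s
  have cF: "continuous_on A F" for A using F by (meson DERIV_isCont continuous_at_imp_continuous_on)
  have q: "q s = q k + K * max 0 (k - s)" for s
  proof (cases "s \<le> k")
    case True
    define h where "h s = K - exp s - F s + K * s" for s
    have "h s = h k"
    proof (cases "s = k")
      case False
      then have sk: "s < k" using True by simp
      have "(h has_real_derivative - exp u - max (K - exp u) 0 + K) (at u)" for u
        unfolding h_def using F[of u] by (auto intro!: derivative_eq_intros)
      moreover have "- exp u - max (K - exp u) 0 + K = 0" if "u < k" for u
      proof -
        have "exp u < exp k" using that by simp
        then show ?thesis using k by simp
      qed
      ultimately have "(h has_real_derivative 0) (at u)" if "u < k" for u using that by metis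
      moreover have "continuous_on {s..k} h" unfolding h_def by (intro continuous_intros cF)
      ultimately show ?thesis using DERIV_isconst_end[OF sk, of h] by auto
    qed simp
    moreover have "exp s \<le> K" using True k by (metis exp_le_cancel_iff)
    ultimately show ?thesis using True k by (simp add: h_def q_def algebra_simps)
  next
    case False
    have "F s = F k"
    proof -
      have "(F has_real_derivative 0) (at u)" if "k < u" for u
      proof -
        have "exp k < exp u" using that by simp
        then have "max (K - exp u) 0 = 0" using k by simp
        then show ?thesis using F[of u] by simp
      qed
      then show ?thesis using DERIV_isconst_end[of k s F] False cF by auto
    qed
    moreover have "K - exp s < 0" using False k by (metis diff_less_0_iff_less exp_less_cancel_iff not_le)
    ultimately show ?thesis using False k by (simp add: q_def)
  qed
  have "2 * max 0 (k - x) \<le> max 0 (k - (x + w)) + max 0 (k - (x - w))" by (auto simp: max_def)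
  then have "K * (2 * max 0 (k - x)) \<le> K * (max 0 (k - (x + w)) + max 0 (k - (x - w)))" using K by (intro mult_left_mono) auto
  then show ?thesis unfolding q_def[symmetric] q[of x] q[of "x + w"] q[of "x - w"] by (simp add: algebra_simps)
qed

text \<open>The terminal value of the scheme; \<open>d\<close> will be the discount factor at
  maturity. The payoff has a smoothing width of its own, so \<open>A1\<close> to \<open>A3\<close>
  are fixed before the width for the coefficients is chosen.\<close>

lemma put_jet:
  fixes K d \<eta> :: real
  assumes K: "K > 0" and d: "0 < d" "d \<le> 1" and \<eta>: "\<eta> > 0"
  obtains F A1 A2 A3 where "jet3 F" "jet_bd F A1 A2 A3" "\<And>y x. 0 \<le> F 0 0 y x" "\<And>y x. F 0 0 y x \<le> K"
    "\<And>y x. 0 \<le> F 2 0 y x - F 1 0 y x" "\<And>y x. F 0 1 y x = 0" "\<And>y x. \<bar>F 0 0 y x - d * max (K - exp y) 0\<bar> \<le> \<eta>"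
proof -
  let ?g = "\<lambda>y. max (K - exp y) 0"
  \<comment> \<open>Smoothing a \<open>K\<close>-Lipschitz function at width \<open>m\<close> costs
    \<open>3 * K * m\<close>.\<close>
  define m where "m = \<eta> / (3 * K)"
  have m: "m > 0" using K \<eta> by (simp add: m_def)
  obtain f0 f1 f2 f3 where f: "\<And>x. (f0 has_real_derivative f1 x) (at x)" "\<And>x. (f1 has_real_derivative f2 x) (at x)"
    "\<And>x. (f2 has_real_derivative f3 x) (at x)"
    "\<And>x. \<bar>f0 x - ?g x\<bar> \<le> 3 * K * m" "\<And>x. \<bar>f1 x\<bar> \<le> K" "\<And>x. \<bar>f2 x\<bar> \<le> K / m" "\<And>x. \<bar>f3 x\<bar> \<le> K / m / m"
    "\<And>x. 0 \<le> f0 x" "\<And>x. f0 x \<le> K" "\<And>x. 0 \<le> f2 x - f1 x"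
  proof (rule smoothing[of m K ?g])
    fix f0 f1 f2 f3 assume a: "\<And>x. (f0 has_real_derivative f1 x) (at x)" "\<And>x. (f1 has_real_derivative f2 x) (at x)"
      "\<And>x. (f2 has_real_derivative f3 x) (at x)"
      "\<And>x. \<bar>f0 x - ?g x\<bar> \<le> 3 * K * m" "\<And>x. \<bar>f1 x\<bar> \<le> K" "\<And>x. \<bar>f2 x\<bar> \<le> K / m" "\<And>x. \<bar>f3 x\<bar> \<le> K / m / m"
      "\<And>lo x. (\<And>x. lo \<le> ?g x) \<Longrightarrow> lo \<le> f0 x" "\<And>hi x. (\<And>x. ?g x \<le> hi) \<Longrightarrow> f0 x \<le> hi"
      "\<And>x. (\<And>F x w. (\<And>x. (F has_real_derivative ?g x) (at x)) \<Longrightarrow>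
        0 \<le> (?g (x + w) - F (x + w)) + (?g (x - w) - F (x - w)) - 2 * (?g x - F x)) \<Longrightarrow> 0 \<le> f2 x - f1 x"
    show thesis
    proof (rule that[OF a(1-7)])
      show "0 \<le> f0 x" for x by (rule a(8)) simp
      show "f0 x \<le> K" for x by (rule a(9)) (use K in auto)
      show "0 \<le> f2 x - f1 x" for x by (rule a(10)) (rule put_convex[OF K])
    qed
  qed (use m K put_lipschitz[OF K] in auto)
  define h where "h i = (if i = 0 then f0 else if i = 1 then f1 else if i = 2 then f2 else f3)" for i :: nat
  have dh: "(h i has_real_derivative h (Suc i) y) (at y)" if i2: "i \<le> 2" for i y
  proof -
    consider "i = 0" | "i = 1" | "i = 2" using i2 by linarith
    then show ?thesis by cases (use f in \<open>auto simp: h_def\<close>)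
  qed
  define F where "F i j y x = (if j = 0 then d * h i y else 0)" for i j :: nat and y x :: real
  have "jet3 F" unfolding jet3_def
  proof (intro allI impI)
    fix i j :: nat and y x :: real assume ij: "i + j \<le> 2"
    show "((\<lambda>p. F i j (fst p) (snd p)) has_derivative (\<lambda>h. F (Suc i) j y x * fst h + F i (Suc j) y x * snd h)) (at (y, x))"
    proof (cases "j = 0")
      case True
      have "(fst has_derivative fst) (at (y, x))" by (auto intro!: derivative_eq_intros)
      from diff_chain_at[OF this, of "h i" "\<lambda>k. h (Suc i) y * k"] dh[of i y] ij
      have "((\<lambda>p. h i (fst p)) has_derivative (\<lambda>k. h (Suc i) y * fst k)) (at (y, x))"
        by (simp add: has_field_derivative_def o_def)
      from has_derivative_mult_right[OF this, of d] show ?thesis using True by (simp add: F_def mult.assoc)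
    qed (simp add: F_def)
  qed
  moreover have "jet_bd F K (K / m) (K / m / m)" unfolding jet_bd_def
  proof (intro allI conjI)
    fix y x v w :: real
    have dd: "\<bar>d * q\<bar> \<le> Q" if "\<bar>q\<bar> \<le> Q" for q Q using abs_mult_le[of d 1 q Q] that d by simp
    have Q0: "0 \<le> K / m" "0 \<le> K / m / m" using K m by auto
    have a: "2 * \<bar>v\<bar> \<le> 1 + v\<^sup>2" using sum_squares_bound[of 1 "\<bar>v\<bar>"] by simp
    have "\<bar>d * f1 y * v\<bar> \<le> K * \<bar>v\<bar>" by (rule abs_mult_le[OF dd[OF f(5)]]) simp
    then have "2 * \<bar>d * f1 y * v\<bar> \<le> K * (2 * \<bar>v\<bar>)" by simp
    also have "\<dots> \<le> K * (1 + (v\<^sup>2 + w\<^sup>2))"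
    proof (rule mult_left_mono)
      show "2 * \<bar>v\<bar> \<le> 1 + (v\<^sup>2 + w\<^sup>2)" using a zero_le_power2[of w] by linarith
    qed (use K in simp)
    finally show "2 * \<bar>F 1 0 y x * v + F 0 1 y x * w\<bar> \<le> K * (1 + (v\<^sup>2 + w\<^sup>2))" by (simp add: F_def h_def)
    have "\<bar>d * f2 y * v\<^sup>2\<bar> \<le> K / m * v\<^sup>2" by (rule abs_mult_le[OF dd[OF f(6)]]) simp
    also have "\<dots> \<le> K / m * (v\<^sup>2 + w\<^sup>2)" using Q0 by (intro mult_left_mono) auto
    finally show "\<bar>F 2 0 y x * v\<^sup>2 + 2 * F 1 1 y x * v * w + F 0 2 y x * w\<^sup>2\<bar> \<le> K / m * (v\<^sup>2 + w\<^sup>2)" by (simp add: F_def h_def)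
    have "\<bar>d * f3 y * v^3\<bar> \<le> K / m / m * \<bar>v\<bar>^3" by (rule abs_mult_le[OF dd[OF f(7)]]) (simp add: power_abs)
    then have "2 * \<bar>d * f3 y * v^3\<bar> \<le> 2 * (K / m / m * \<bar>v\<bar>^3)" by simp
    also have "\<dots> = K / m / m * (2 * \<bar>v\<bar>^3)" by (simp only: mult.left_commute)
    also have "\<dots> \<le> K / m / m * ((v\<^sup>2 + w\<^sup>2) + (v\<^sup>2 + w\<^sup>2)\<^sup>2)"
    proof (rule mult_left_mono)
      have "2 * \<bar>v\<bar>^3 = v\<^sup>2 * (2 * \<bar>v\<bar>)" by (simp add: power3_eq_cube power2_eq_square)
      also have "\<dots> \<le> v\<^sup>2 * (1 + v\<^sup>2)" using a by (intro mult_left_mono) auto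
      also have "\<dots> = v\<^sup>2 + v\<^sup>2 * v\<^sup>2" by (simp add: algebra_simps)
      also have "\<dots> \<le> (v\<^sup>2 + w\<^sup>2) + (v\<^sup>2 + w\<^sup>2) * (v\<^sup>2 + w\<^sup>2)" by (intro add_mono mult_mono) auto
      finally show "2 * \<bar>v\<bar>^3 \<le> (v\<^sup>2 + w\<^sup>2) + (v\<^sup>2 + w\<^sup>2)\<^sup>2" by (simp add: power2_eq_square)
    qed (use Q0 in simp)
    finally show "2 * \<bar>F 3 0 y x * v^3 + 3 * F 2 1 y x * v\<^sup>2 * w + 3 * F 1 2 y x * v * w\<^sup>2 + F 0 3 y x * w^3\<bar>
       \<le> K / m / m * ((v\<^sup>2 + w\<^sup>2) + (v\<^sup>2 + w\<^sup>2)\<^sup>2)" by (simp add: F_def h_def)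
  qed
  moreover have "0 \<le> F 0 0 y x" "F 0 0 y x \<le> K" "0 \<le> F 2 0 y x - F 1 0 y x" "F 0 1 y x = 0" for y x
  proof -
    show "0 \<le> F 0 0 y x" using f(8) d by (simp add: F_def h_def)
    have "d * f0 y \<le> 1 * K" using f(8,9) d K by (intro mult_mono) auto
    then show "F 0 0 y x \<le> K" by (simp add: F_def h_def)
    have "0 \<le> d * (f2 y - f1 y)" using f(10)[of y] d by simp
    then show "0 \<le> F 2 0 y x - F 1 0 y x" by (simp add: F_def h_def algebra_simps)
    show "F 0 1 y x = 0" by (simp add: F_def)
  qed
  moreover have "\<bar>F 0 0 y x - d * max (K - exp y) 0\<bar> \<le> \<eta>" for y x
  proof -
    have "\<bar>d * (f0 y - ?g y)\<bar> \<le> 1 * (3 * K * m)" using f(4)[of y] d by (intro abs_mult_le) auto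
    then show ?thesis using K by (simp add: F_def h_def m_def algebra_simps)
  qed
  ultimately show thesis by (rule that)
qed

lemma time_net:
  fixes u v :: "real \<Rightarrow> real \<Rightarrow> real"
  assumes T: "0 \<le> T" and R: "0 \<le> R" and e: "e > 0" and L: "0 \<le> L"
    and lip: "\<And>t x y. t \<in> {0..T} \<Longrightarrow> \<bar>u x t - u y t\<bar> \<le> L * \<bar>x - y\<bar>" "\<And>t x y. t \<in> {0..T} \<Longrightarrow> \<bar>v x t - v y t\<bar> \<le> L * \<bar>x - y\<bar>"
    and bd: "\<And>t x. t \<in> {0..T} \<Longrightarrow> \<bar>x\<bar> \<le> R \<Longrightarrow> \<bar>u x t\<bar> \<le> W" "\<And>t x. t \<in> {0..T} \<Longrightarrow> \<bar>x\<bar> \<le> R \<Longrightarrow> \<bar>v x t\<bar> \<le> W"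
  obtains n :: nat and j :: "real \<Rightarrow> nat" and s :: "nat \<Rightarrow> real" where
    "\<And>t. t \<in> {0..T} \<Longrightarrow> j t < n" "\<And>i. s i \<in> {0..T}"
    "\<And>t x. t \<in> {0..T} \<Longrightarrow> \<bar>x\<bar> \<le> R \<Longrightarrow> \<bar>u x t - u x (s (j t))\<bar> \<le> e \<and> \<bar>v x t - v x (s (j t))\<bar> \<le> e"
proof -
  \<comment> \<open>Half of \<open>e\<close> pays for moving to a grid point and back, twice
    \<open>L * h\<close>, and the other half for rounding. The summand 1 avoids division by
    0.\<close>
  define h where "h = e / (4 * (L + 1))"
  have h: "h > 0" "2 * (L * h) \<le> e / 2" using e L by (auto simp: h_def field_simps)
  define q where "q = nat \<lceil>2 * R / h\<rceil>"
  define X where "X i = min R (- R + real i * h)" for i :: nat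
  have X: "\<bar>X i\<bar> \<le> R" for i using R h by (auto simp: X_def min_def abs_le_iff)
  have near: "\<exists>i\<le>q. \<bar>x - X i\<bar> \<le> h" if "\<bar>x\<bar> \<le> R" for x
  proof -
    define i where "i = nat \<lfloor>(x + R) / h\<rfloor>"
    have p: "0 \<le> (x + R) / h" using that h by (intro divide_nonneg_pos) auto
    then have i: "real i \<le> (x + R) / h" "(x + R) / h < real i + 1" by (auto simp: i_def)
    then have i': "real i * h \<le> x + R" "x + R < (real i + 1) * h" using h by (auto simp: field_simps)
    have "X i = - R + real i * h" unfolding X_def using i' that by (intro min_absorb2) linarith
    moreover have "i \<le> q" unfolding i_def q_def
    proof (rule nat_mono)
      have "(x + R) / h \<le> 2 * R / h" using that h by (intro divide_right_mono) auto
      then show "\<lfloor>(x + R) / h\<rfloor> \<le> \<lceil>2 * R / h\<rceil>" by (meson floor_le_ceiling floor_mono order_trans)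
    qed
    ultimately show ?thesis using i' by (intro exI[of _ i]) (auto simp: algebra_simps abs_le_iff)
  qed
  define c where "c w = \<lfloor>w / (e/2)\<rfloor>" for w :: real
  have c_close: "\<bar>p - p'\<bar> \<le> e/2" if "c p = c p'" for p p'
  proof -
    have "of_int (c p) \<le> p / (e/2)" "p / (e/2) < of_int (c p) + 1" "of_int (c p') \<le> p' / (e/2)" "p' / (e/2) < of_int (c p') + 1"
      unfolding c_def by linarith+
    then have "\<bar>p / (e/2) - p' / (e/2)\<bar> \<le> 1" using that by (simp add: abs_le_iff)
    then have "\<bar>p - p'\<bar> / (e/2) \<le> 1" using e by (simp only: diff_divide_distrib[symmetric] abs_divide)
    then show ?thesis using e by (simp only: divide_le_eq) simp
  qed
  have c_bd: "c p \<in> {- \<lceil>W / (e/2)\<rceil> - 1..\<lceil>W / (e/2)\<rceil>}" if "\<bar>p\<bar> \<le> W" for p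
  proof -
    have "p / (e/2) \<le> W / (e/2)" "- (W / (e/2)) \<le> p / (e/2)"
      using that e by (auto simp: divide_right_mono field_simps abs_le_iff)
    moreover have "W / (e/2) \<le> of_int \<lceil>W / (e/2)\<rceil>" by (rule le_of_int_ceiling)
    ultimately have "of_int (- \<lceil>W / (e/2)\<rceil> - 1) \<le> p / (e/2)" "p / (e/2) < of_int \<lceil>W / (e/2)\<rceil> + 1"
      by (simp_all only: of_int_diff of_int_minus of_int_1)
    then show ?thesis unfolding c_def atLeastAtMost_iff by (simp only: le_floor_iff floor_le_iff simp_thms)
  qed
  define \<Phi> where "\<Phi> t = restrict (\<lambda>i. (c (u (X i) t), c (v (X i) t))) {..q}" for t
  define Z where "Z = \<Phi> ` {0..T}"
  have "Z \<subseteq> PiE {..q} (\<lambda>_. {- \<lceil>W / (e/2)\<rceil> - 1..\<lceil>W / (e/2)\<rceil>} \<times> {- \<lceil>W / (e/2)\<rceil> - 1..\<lceil>W / (e/2)\<rceil>})"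
    unfolding Z_def \<Phi>_def using c_bd bd X by (intro image_subsetI restrict_PiE_iff[THEN iffD2]) auto
  then have "finite Z" by (rule finite_subset) (intro finite_PiE; simp)
  then obtain en where en: "bij_betw en {0..<card Z} Z" using ex_bij_betw_nat_finite by blast
  define j where "j t = inv_into {0..<card Z} en (\<Phi> t)" for t
  \<comment> \<open>An index that is the colour of no time receives 0, merely to stay inside
    \<open>{0..T}\<close>.\<close>
  define s where "s i = (if \<exists>t\<in>{0..T}. \<Phi> t = en i then (SOME t. t \<in> {0..T} \<and> \<Phi> t = en i) else 0)" for i
  have j: "j t \<in> {0..<card Z}" "en (j t) = \<Phi> t" if "t \<in> {0..T}" for t
  proof -
    have "\<Phi> t \<in> en ` {0..<card Z}" using en that by (simp add: bij_betw_def Z_def)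
    then show "j t \<in> {0..<card Z}" "en (j t) = \<Phi> t" unfolding j_def by (rule inv_into_into, rule f_inv_into_f)
  qed
  have s: "s i \<in> {0..T}" for i
  proof (cases "\<exists>t\<in>{0..T}. \<Phi> t = en i")
    case True
    then have "\<exists>t. t \<in> {0..T} \<and> \<Phi> t = en i" by blast
    from someI_ex[OF this] True show ?thesis by (simp add: s_def)
  qed (use T in \<open>simp add: s_def\<close>)
  have s\<Phi>: "\<Phi> (s (j t)) = \<Phi> t" if "t \<in> {0..T}" for t
  proof -
    have ex: "\<exists>t'. t' \<in> {0..T} \<and> \<Phi> t' = en (j t)" using j[OF that] that by auto
    from someI_ex[OF this] ex show ?thesis using j[OF that] unfolding s_def by auto
  qed
  have close: "\<bar>f x t - f x t'\<bar> \<le> e"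
    if lp: "\<And>t x y. t \<in> {0..T} \<Longrightarrow> \<bar>f x t - f y t\<bar> \<le> L * \<bar>x - y\<bar>" and c: "\<And>i. i \<le> q \<Longrightarrow> c (f (X i) t) = c (f (X i) t')"
      and t: "t \<in> {0..T}" "t' \<in> {0..T}" and x: "\<bar>x\<bar> \<le> R" for f :: "real \<Rightarrow> real \<Rightarrow> real" and t t' x
  proof -
    obtain i where i: "i \<le> q" "\<bar>x - X i\<bar> \<le> h" using near[OF x] by blast
    have "L * \<bar>x - X i\<bar> \<le> L * h" using i L by (intro mult_left_mono) auto
    then have "\<bar>f x t - f (X i) t\<bar> \<le> L * h" "\<bar>f x t' - f (X i) t'\<bar> \<le> L * h" using lp[OF t(1), of x "X i"] lp[OF t(2), of x "X i"] by linarith+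
    moreover have "\<bar>f (X i) t - f (X i) t'\<bar> \<le> e/2" by (rule c_close[OF c[OF i(1)]])
    ultimately show ?thesis using h(2) by linarith
  qed
  show thesis
  proof (rule that[of j "card Z" s])
    show "j t < card Z" if "t \<in> {0..T}" for t using j[OF that] by simp
    show "s i \<in> {0..T}" for i by (rule s)
    fix t x assume t: "t \<in> {0..T}" and x: "\<bar>x\<bar> \<le> R"
    have ceq: "c (u (X i) t) = c (u (X i) (s (j t)))" "c (v (X i) t) = c (v (X i) (s (j t)))" if "i \<le> q" for i
      using fun_cong[OF s\<Phi>[OF t], of i] that by (auto simp: \<Phi>_def)
    have sj: "s (j t) \<in> {0..T}" by (rule s)
    from close[OF lip(1) ceq(1) t sj x] close[OF lip(2) ceq(2) t sj x]
    show "\<bar>u x t - u x (s (j t))\<bar> \<le> e \<and> \<bar>v x t - v x (s (j t))\<bar> \<le> e" by blast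
  qed
qed

text \<open>What \<open>P\<close>, \<open>G\<close> and their negatives have in common. Only the sum
  \<open>\<gamma>\<close> of \<open>c\<close> and \<open>\<kappa>\<close> is prescribed and not how
  it is split, so that one approximate solution serves both equations. The growth constants are
  parameters because that approximate solution must be built before \<open>U\<close> is
  known.\<close>

definition admissible ::
  "real \<Rightarrow> real \<Rightarrow> real \<Rightarrow> (real \<Rightarrow> real) \<Rightarrow> (real \<Rightarrow> real \<Rightarrow> real) \<Rightarrow> (real \<Rightarrow> real \<Rightarrow> real) \<Rightarrow> real \<Rightarrow> real \<Rightarrow> nat \<Rightarrow>
   real \<Rightarrow> real \<Rightarrow> (real \<Rightarrow> real \<Rightarrow> real \<Rightarrow> real) \<Rightarrow> bool" where
  "admissible T r \<rho> \<beta> b \<gamma> m0 C0 n K sg U \<longleftrightarrow>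
     continuous_on (UNIV \<times> UNIV \<times> {0..T}) (\<lambda>(y, x, t). U y x t) \<and>
     (\<forall>t\<in>{0..T}. \<forall>y x. \<bar>U y x t\<bar> \<le> C0 * ((1 + y\<^sup>2) ^ n + (1 + x\<^sup>2) ^ n)) \<and>
     (\<forall>y x. U y x T = sg * (exp (- r * T) * max (K - exp y) 0)) \<and>
     (\<exists>c \<kappa>. log_sub T r \<rho> \<beta> b c (\<lambda>x t. sg * \<kappa> x t) U \<and>
        (\<forall>t\<in>{0..T}. \<forall>x. c x t + \<kappa> x t = \<gamma> x t \<and> \<bar>\<kappa> x t\<bar> \<le> m0 \<and> \<bar>c x t\<bar> + \<bar>\<kappa> x t\<bar> \<le> m0 * (1 + \<bar>x\<bar>)))"

lemma penalty_dominates: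
  assumes \<delta>: "\<delta> > 0" and C0: "C0 \<ge> 0" and Q: "Q \<ge> 0"
  obtains R where "R > 0" "\<And>y x. \<not> (\<bar>y\<bar> < R \<and> \<bar>x\<bar> < R) \<Longrightarrow>
    C0 * ((1 + y\<^sup>2) ^ n + (1 + x\<^sup>2) ^ n) - \<delta> * (pen n y + pen n x) + Q < 0"
proof -
  \<comment> \<open>A Young-type inequality: where
    \<open>(1 + s^2)^2 \<ge> 2 * C0 / \<delta>\<close>, half of the penalty dominates the growth of
    order \<open>n\<close>; elsewhere \<open>1 + s^2\<close> is bounded, and \<open>D\<close> bounds
    that growth.\<close>
  define D where "D = C0 * (1 + 2 * C0 / \<delta>) ^ n"
  have D: "D \<ge> 0" using \<delta> C0 by (simp add: D_def)
  \<comment> \<open>Outside the box the other half of the penalty exceeds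
    \<open>\<delta> / 2 * R\<close>, which is \<open>\<delta> / 2 + 2 * D + Q\<close>; the term
    \<open>2 * D\<close> is for the two variables.\<close>
  define R where "R = 1 + 2 / \<delta> * (2 * D + Q)"
  have R: "R \<ge> 1" using \<delta> D Q by (simp add: R_def)
  have 1: "C0 * (1 + s\<^sup>2) ^ n \<le> \<delta> / 2 * pen n s + D" for s
  proof (cases "2 * C0 / \<delta> \<le> (1 + s\<^sup>2)\<^sup>2")
    case True
    then have "C0 \<le> \<delta> / 2 * (1 + s\<^sup>2)\<^sup>2" using \<delta> by (simp add: field_simps)
    then have "C0 * (1 + s\<^sup>2) ^ n \<le> \<delta> / 2 * (1 + s\<^sup>2)\<^sup>2 * (1 + s\<^sup>2) ^ n" by (intro mult_right_mono) auto
    also have "\<dots> = \<delta> / 2 * pen n s" by (simp add: pen_def power_add power2_eq_square)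
    finally show ?thesis using D by simp
  next
    case False
    have "1 + s\<^sup>2 \<le> (1 + s\<^sup>2)\<^sup>2" by (simp add: power2_eq_square[of "1 + s\<^sup>2"] algebra_simps)
    then have "1 + s\<^sup>2 \<le> 1 + 2 * C0 / \<delta>" using False by linarith
    then have "(1 + s\<^sup>2) ^ n \<le> (1 + 2 * C0 / \<delta>) ^ n" by (intro power_mono) auto
    then have "C0 * (1 + s\<^sup>2) ^ n \<le> D" unfolding D_def using C0 by (intro mult_left_mono)
    moreover have "0 \<le> \<delta> / 2 * pen n s" using \<delta> pen_bounds(1)[of n s] by simp
    ultimately show ?thesis by simp
  qed
  have big: "R < pen n s" if "R \<le> \<bar>s\<bar>" for s
  proof -
    have "\<bar>s\<bar> * 1 \<le> \<bar>s\<bar> * \<bar>s\<bar>" using R that by (intro mult_left_mono) auto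
    then have "R < 1 + s\<^sup>2" using that by (simp add: power2_eq_square)
    also have "(1 + s\<^sup>2) ^ 1 \<le> (1 + s\<^sup>2) ^ (n + 2)" by (intro power_increasing) auto
    finally show ?thesis by (simp add: pen_def)
  qed
  show thesis
  proof (rule that[of R])
    fix y x assume "\<not> (\<bar>y\<bar> < R \<and> \<bar>x\<bar> < R)"
    then have "R \<le> \<bar>y\<bar> \<or> R \<le> \<bar>x\<bar>" by auto
    then have "R < pen n y + pen n x" using big[of y] big[of x] pen_bounds(1)[of n y] pen_bounds(1)[of n x] by auto
    then have "\<delta> / 2 * R < \<delta> / 2 * (pen n y + pen n x)" using \<delta> by simp
    moreover have "\<delta> / 2 * R = \<delta> / 2 + (2 * D + Q)" using \<delta> by (simp add: R_def field_simps)
    ultimately show "C0 * ((1 + y\<^sup>2) ^ n + (1 + x\<^sup>2) ^ n) - \<delta> * (pen n y + pen n x) + Q < 0"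
      using 1[of y] 1[of x] \<delta> by (simp add: distrib_left)
  qed (use R in simp)
qed

lemma smoothing_family:
  fixes f :: "real \<Rightarrow> real"
  assumes m: "m > 0" and L: "L \<ge> 0" and lip: "\<And>x y. \<bar>f x - f y\<bar> \<le> L * \<bar>x - y\<bar>" and bd: "\<And>x. \<bar>f x\<bar> \<le> W"
  shows "\<exists>S :: nat \<Rightarrow> real \<Rightarrow> real. (\<forall>k<3. \<forall>x. (S k has_real_derivative S (Suc k) x) (at x)) \<and>
    (\<forall>x. \<bar>S 0 x\<bar> \<le> W \<and> \<bar>S 0 x - f x\<bar> \<le> 3 * L * m \<and> \<bar>S 1 x\<bar> \<le> L \<and> \<bar>S 2 x\<bar> \<le> L / m \<and> \<bar>S 3 x\<bar> \<le> L / m / m) \<and>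
    (mono f \<longrightarrow> (\<forall>x. 0 \<le> S 1 x)) \<and> ((\<forall>x. 0 \<le> f x) \<longrightarrow> (\<forall>x. 0 \<le> S 0 x)) \<and>
    ((\<forall>x w. \<bar>f (x + w) + f (x - w) - 2 * f x\<bar> \<le> L * w\<^sup>2) \<longrightarrow> (\<forall>x. \<bar>S 2 x\<bar> \<le> L \<and> \<bar>S 0 x - f x\<bar> \<le> 3 * L * m\<^sup>2))"
proof (rule smoothing[OF m L lip])
  fix f0 f1 f2 f3 assume a: "\<And>x. (f0 has_real_derivative f1 x) (at x)" "\<And>x. (f1 has_real_derivative f2 x) (at x)"
    "\<And>x. (f2 has_real_derivative f3 x) (at x)"
    "\<And>x. \<bar>f0 x - f x\<bar> \<le> 3 * L * m" "\<And>x. \<bar>f1 x\<bar> \<le> L" "\<And>x. \<bar>f2 x\<bar> \<le> L / m" "\<And>x. \<bar>f3 x\<bar> \<le> L / m / m"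
    "\<And>lo x. (\<And>x. lo \<le> f x) \<Longrightarrow> lo \<le> f0 x" "\<And>hi x. (\<And>x. f x \<le> hi) \<Longrightarrow> f0 x \<le> hi"
    "\<And>x. mono f \<Longrightarrow> 0 \<le> f1 x"
    "\<And>L' x. (\<And>x w. \<bar>f (x + w) + f (x - w) - 2 * f x\<bar> \<le> L' * w\<^sup>2) \<Longrightarrow> \<bar>f2 x\<bar> \<le> L'"
    "\<And>L' x. (\<And>x w. \<bar>f (x + w) + f (x - w) - 2 * f x\<bar> \<le> L' * w\<^sup>2) \<Longrightarrow> \<bar>f0 x - f x\<bar> \<le> 3 * L' * m\<^sup>2"
  define S where "S k = (if k = 0 then f0 else if k = 1 then f1 else if k = 2 then f2 else f3)" for k :: nat
  have "(S k has_real_derivative S (Suc k) x) (at x)" if k3: "k < 3" for k x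
  proof -
    consider "k = 0" | "k = 1" | "k = 2" using k3 by linarith
    then show ?thesis by cases (use a in \<open>auto simp: S_def\<close>)
  qed
  moreover have "\<bar>f0 x\<bar> \<le> W" for x
    using a(8)[of "- W" x] a(9)[of W x] bd by (auto simp: abs_le_iff) (meson minus_le_iff)
  ultimately show ?thesis
    using a(4-7) a(8)[of 0] a(10) a(11)[of L] a(12)[of L] by (intro exI[of _ S]) (simp add: S_def)
qed

lemma clamp_lipschitz: "\<bar>max (- G) (min G x) - max (- G) (min G y)\<bar> \<le> \<bar>x - y\<bar>" for G x y :: real
  by (auto simp: max_def min_def abs_if)

text \<open>The order of the choices is the point. First come \<open>\<delta>\<close> and
  \<open>R\<close>, determined by \<open>\<Delta>\<close> and the data; then the smoothed payoff;
  then the width \<open>m\<close>, against constants \<open>P\<close> and \<open>Q\<close> free of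
  \<open>m\<close>; then the finitely many frozen coefficients; and last the step size, against
  \<open>M3\<close> and \<open>K3\<close>, which may be huge in terms of \<open>m\<close>. Five
  errors of size \<open>\<Delta> / 5\<close> are allowed: terminal value, coefficients,
  discretisation together with the lack of monotonicity, bad times, and penalty. Since
  \<open>v\<close> is found before \<open>sg\<close> and \<open>U\<close>, it is common to both
  equations and both signs.\<close>

lemma approx_solution:
  fixes T r \<rho> K C0 m0 L \<Delta> ts ys xs :: real and n :: nat
  assumes T: "T > 0" and r: "0 \<le> r" and \<rho>: "\<bar>\<rho>\<bar> \<le> 1" and K: "K > 0" and C0: "C0 \<ge> 0" and m01: "m0 \<ge> 1" and L1: "L \<ge> 1"
    and \<Delta>: "\<Delta> > 0" and ts: "0 \<le> ts" "ts < T"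
    and \<beta>: "\<And>x. 0 \<le> \<beta> x" "mono \<beta>" "\<And>x. \<bar>\<beta> x\<bar> \<le> m0" "\<And>x y. \<bar>\<beta> x - \<beta> y\<bar> \<le> L * \<bar>x - y\<bar>"
      "\<And>x w. \<bar>\<beta> (x + w) + \<beta> (x - w) - 2 * \<beta> x\<bar> \<le> L * w\<^sup>2"
    and b: "\<And>x t. t \<in> {0..T} \<Longrightarrow> \<bar>b x t\<bar> \<le> m0" "\<And>x y t. t \<in> {0..T} \<Longrightarrow> \<bar>b x t - b y t\<bar> \<le> L * \<bar>x - y\<bar>"
      "\<And>x w t. t \<in> {0..T} \<Longrightarrow> \<bar>b (x + w) t + b (x - w) t - 2 * b x t\<bar> \<le> L * w\<^sup>2"
    and \<gamma>: "\<And>x t. t \<in> {0..T} \<Longrightarrow> \<bar>\<gamma> x t\<bar> \<le> m0 * (1 + \<bar>x\<bar>)" "\<And>x y t. t \<in> {0..T} \<Longrightarrow> \<bar>\<gamma> x t - \<gamma> y t\<bar> \<le> L * \<bar>x - y\<bar>"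
    and m0: "\<And>x. \<bar>r - (\<beta> x)\<^sup>2/2\<bar> \<le> m0" "\<And>x. (\<beta> x)\<^sup>2/2 \<le> m0" "\<And>x t. t \<in> {0..T} \<Longrightarrow> (b x t)\<^sup>2/2 \<le> m0"
  shows "\<exists>v. \<forall>sg\<in>{1,-1}. \<forall>U. admissible T r \<rho> \<beta> b \<gamma> m0 C0 n K sg U \<longrightarrow> U ys xs ts \<le> sg * v + \<Delta>"
proof -
  define lam where "lam = 10 * (real (n + 2))\<^sup>2 * m0"
  have lam: "0 \<le> lam" using m01 by (simp add: lam_def)
  define X where "X = pen n ys + pen n xs"
  have X: "X \<ge> 2" using pen_bounds(1)[of n ys] pen_bounds(1)[of n xs] by (simp add: X_def)
  \<comment> \<open>Makes the penalty at the point \<open>(ys, xs)\<close> at most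
    \<open>\<Delta> / 5\<close> at all times.\<close>
  define \<delta> where "\<delta> = \<Delta> / (5 * exp (lam * T) * X)"
  have \<delta>: "\<delta> > 0" using \<Delta> X by (simp add: \<delta>_def)
  obtain R where R: "R > 0" "\<And>y x. \<not> (\<bar>y\<bar> < R \<and> \<bar>x\<bar> < R) \<Longrightarrow>
    C0 * ((1 + y\<^sup>2) ^ n + (1 + x\<^sup>2) ^ n) - \<delta> * (pen n y + pen n x) + (K + 2 * C0 + 2 * \<delta> * exp (lam * T)) < 0"
    using penalty_dominates[OF \<delta> C0, of "K + 2 * C0 + 2 * \<delta> * exp (lam * T)"] \<delta> K C0 by auto
  \<comment> \<open>\<open>\<gamma>\<close> may grow linearly, whereas the scheme needs bounded
    coefficients. Clamping at \<open>G\<close> changes nothing for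
    \<open>\<bar>x\<bar> \<le> R\<close>, which is all that the comparison sees, and it keeps the
    Lipschitz constant.\<close>
  define G where "G = m0 * (2 + R)"
  have G: "G > 0" using m01 R by (simp add: G_def)
  define \<gamma>c where "\<gamma>c x t = max (- G) (min G (\<gamma> x t))" for x t
  have \<gamma>G: "\<bar>\<gamma> x t\<bar> \<le> G" if "t \<in> {0..T}" "\<bar>x\<bar> \<le> R" for x t
  proof -
    have "m0 * (1 + \<bar>x\<bar>) \<le> m0 * (2 + R)" using that m01 by (intro mult_left_mono) auto
    then show ?thesis using \<gamma>(1)[OF that(1), of x] by (simp add: G_def)
  qed
  have \<gamma>c_eq: "\<gamma>c x t = \<gamma> x t" if "t \<in> {0..T}" "\<bar>x\<bar> \<le> R" for x t
    using \<gamma>G[OF that] by (auto simp: \<gamma>c_def abs_le_iff)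
  have \<gamma>c_bd: "\<bar>\<gamma>c x t\<bar> \<le> G" for x t using G by (simp add: \<gamma>c_def abs_le_iff)
  have \<gamma>c_lip: "\<bar>\<gamma>c x t - \<gamma>c y t\<bar> \<le> L * \<bar>x - y\<bar>" if "t \<in> {0..T}" for x t y
    unfolding \<gamma>c_def by (rule order_trans[OF clamp_lipschitz \<gamma>(2)[OF that]])
  note \<gamma>c = \<gamma>c_bd \<gamma>c_lip
  define M where "M = 1 + r + m0\<^sup>2 + m0 + L + L\<^sup>2 + m0 * L + G"
  have p0: "0 \<le> m0\<^sup>2" "0 \<le> m0" "0 \<le> L" "0 \<le> L\<^sup>2" "0 \<le> m0 * L" using m01 L1 by auto
  have M: "1 \<le> M" "m0 \<le> M" "L \<le> M" "G \<le> M" "r + m0\<^sup>2 \<le> M" "m0 * L \<le> M" "L\<^sup>2 + m0 * L \<le> M" using p0 r G unfolding M_def by linarith+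
  define D where "D = exp (- r * T)"
  have D: "0 < D" "D \<le> 1" using r T by (auto simp: D_def)
  have D5: "\<Delta> / 5 > 0" using \<Delta> by simp
  obtain F A1 A2 A3 where F: "jet3 F" "jet_bd F A1 A2 A3" "\<And>y x. 0 \<le> F 0 0 y x" "\<And>y x. F 0 0 y x \<le> K"
    "\<And>y x. 0 \<le> F 2 0 y x - F 1 0 y x" "\<And>y x. F 0 1 y x = 0" "\<And>y x. \<bar>F 0 0 y x - D * max (K - exp y) 0\<bar> \<le> \<Delta> / 5"
    using put_jet[OF K D D5] by blast
  note A = jet_bd_comp(10-12)[OF F(2)]
  define E where "E = exp (22 * M\<^sup>2 * T)"
  have E: "E \<ge> 1" using M T by (simp add: E_def)
  \<comment> \<open>Will bound both \<open>K1\<close> and \<open>(K1 + K2) * m\<close>: although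
    \<open>K2\<close> is of order \<open>1/m\<close>, the factor \<open>m\<close> turns
    \<open>L2 = L / m\<close> back into \<open>L\<close>.\<close>
  define Q where "Q = (A1 + A2 + T * (M + L) * A1) * E"
  have Q: "Q \<ge> 0" using A T M p0 E by (simp add: Q_def)
  define P where "P = (3 * L + 1) * (4 * M + 1)"
  have P: "P > 0" using L1 M by (simp add: P_def)
  \<comment> \<open>The first bound yields \<open>\<eta>2 \<le> 1\<close>, the second makes
    \<open>P * Q * m * T\<close>, the accumulated coefficient error, at most
    \<open>\<Delta> / 5\<close>.\<close>
  define m where "m = min (1 / (3 * L + 1)) (\<Delta> / (5 * P * (Q + 1) * (T + 1)))"
  have m: "m > 0" using L1 \<Delta> P Q T by (simp add: m_def)
  have mL: "(3 * L + 1) * m \<le> 1"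
  proof -
    have "m \<le> 1 / (3 * L + 1)" by (simp add: m_def)
    then show ?thesis using L1 by (simp add: field_simps)
  qed
  have m1: "m \<le> 1"
  proof -
    have "1 * m \<le> (3 * L + 1) * m" using L1 m by (intro mult_right_mono) auto
    then show ?thesis using mL by simp
  qed
  have mQ: "P * Q * m * T \<le> \<Delta> / 5"
  proof -
    have "m \<le> \<Delta> / (5 * P * (Q + 1) * (T + 1))" by (simp add: m_def)
    then have "m * (5 * P * (Q + 1) * (T + 1)) \<le> \<Delta>" using P Q T by (simp add: pos_le_divide_eq)
    moreover have "m * (5 * P * Q * T) \<le> m * (5 * P * (Q + 1) * (T + 1))"
      using m P Q T by (intro mult_left_mono mult_mono) auto
    ultimately show ?thesis by (simp add: mult_ac)
  qed
  have L0: "0 \<le> L" using L1 by simp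
  obtain B where B: "\<And>k x. k < 3 \<Longrightarrow> (B k has_real_derivative B (Suc k) x) (at x)"
     "\<And>x. \<bar>B 0 x\<bar> \<le> m0" "\<And>x. \<bar>B 0 x - \<beta> x\<bar> \<le> 3 * L * m\<^sup>2" "\<And>x. \<bar>B 1 x\<bar> \<le> L" "\<And>x. \<bar>B 2 x\<bar> \<le> L" "\<And>x. \<bar>B 3 x\<bar> \<le> L / m / m"
     "\<And>x. 0 \<le> B 0 x" "\<And>x. 0 \<le> B 1 x"
    using smoothing_family[OF m L0 \<beta>(4) \<beta>(3)] \<beta>(1,2,5) by (elim exE conjE) blast
  have "\<exists>S. \<forall>t\<in>{0..T}. (\<forall>k<3. \<forall>x. (S t k has_real_derivative S t (Suc k) x) (at x)) \<and>
     (\<forall>x. \<bar>S t 0 x\<bar> \<le> m0 \<and> \<bar>S t 0 x - b x t\<bar> \<le> 3 * L * m\<^sup>2 \<and> \<bar>S t 1 x\<bar> \<le> L \<and> \<bar>S t 2 x\<bar> \<le> L \<and> \<bar>S t 3 x\<bar> \<le> L / m / m)"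
  proof (rule bchoice, intro ballI)
    fix t assume t: "t \<in> {0..T}"
    from smoothing_family[OF m L0 b(2)[OF t] b(1)[OF t]] b(3)[OF t]
    show "\<exists>S. (\<forall>k<3. \<forall>x. (S k has_real_derivative S (Suc k) x) (at x)) \<and>
     (\<forall>x. \<bar>S 0 x\<bar> \<le> m0 \<and> \<bar>S 0 x - b x t\<bar> \<le> 3 * L * m\<^sup>2 \<and> \<bar>S 1 x\<bar> \<le> L \<and> \<bar>S 2 x\<bar> \<le> L \<and> \<bar>S 3 x\<bar> \<le> L / m / m)"
      by (elim exE conjE) blast
  qed
  then obtain bs where bs: "\<And>t k x. t \<in> {0..T} \<Longrightarrow> k < 3 \<Longrightarrow> (bs t k has_real_derivative bs t (Suc k) x) (at x)"
     "\<And>t x. t \<in> {0..T} \<Longrightarrow> \<bar>bs t 0 x\<bar> \<le> m0 \<and> \<bar>bs t 0 x - b x t\<bar> \<le> 3 * L * m\<^sup>2 \<and> \<bar>bs t 1 x\<bar> \<le> L \<and> \<bar>bs t 2 x\<bar> \<le> L \<and> \<bar>bs t 3 x\<bar> \<le> L / m / m"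
    by blast
  have "\<exists>S. \<forall>t\<in>{0..T}. (\<forall>k<3. \<forall>x. (S t k has_real_derivative S t (Suc k) x) (at x)) \<and>
     (\<forall>x. \<bar>S t 0 x\<bar> \<le> G \<and> \<bar>S t 0 x - \<gamma>c x t\<bar> \<le> 3 * L * m \<and> \<bar>S t 1 x\<bar> \<le> L \<and> \<bar>S t 2 x\<bar> \<le> L / m \<and> \<bar>S t 3 x\<bar> \<le> L / m / m)"
  proof (rule bchoice, intro ballI)
    fix t assume t: "t \<in> {0..T}"
    from smoothing_family[OF m L0 \<gamma>c(2)[OF t] \<gamma>c(1)]
    show "\<exists>S. (\<forall>k<3. \<forall>x. (S k has_real_derivative S (Suc k) x) (at x)) \<and>
     (\<forall>x. \<bar>S 0 x\<bar> \<le> G \<and> \<bar>S 0 x - \<gamma>c x t\<bar> \<le> 3 * L * m \<and> \<bar>S 1 x\<bar> \<le> L \<and> \<bar>S 2 x\<bar> \<le> L / m \<and> \<bar>S 3 x\<bar> \<le> L / m / m)"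
      by (elim exE conjE) blast
  qed
  then obtain gs where gs: "\<And>t k x. t \<in> {0..T} \<Longrightarrow> k < 3 \<Longrightarrow> (gs t k has_real_derivative gs t (Suc k) x) (at x)"
     "\<And>t x. t \<in> {0..T} \<Longrightarrow> \<bar>gs t 0 x\<bar> \<le> G \<and> \<bar>gs t 0 x - \<gamma>c x t\<bar> \<le> 3 * L * m \<and> \<bar>gs t 1 x\<bar> \<le> L \<and> \<bar>gs t 2 x\<bar> \<le> L / m \<and> \<bar>gs t 3 x\<bar> \<le> L / m / m"
    by blast
  have m2: "m\<^sup>2 > 0" "m\<^sup>2 \<le> m" using m m1 mult_left_mono[of m 1 m] by (auto simp: power2_eq_square)
  \<comment> \<open>Freezing in time is asked for the accuracy \<open>m^2\<close>, so that it is no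
    worse than the smoothing of \<open>\<beta>\<close> and \<open>b\<close>.\<close>
  obtain nn j s where net: "\<And>t. t \<in> {0..T} \<Longrightarrow> j t < (nn::nat)" "\<And>i. s i \<in> {0..T}"
    "\<And>t x. t \<in> {0..T} \<Longrightarrow> \<bar>x\<bar> \<le> R \<Longrightarrow> \<bar>b x t - b x (s (j t))\<bar> \<le> m\<^sup>2 \<and> \<bar>\<gamma>c x t - \<gamma>c x (s (j t))\<bar> \<le> m\<^sup>2"
  proof (rule time_net[of T R "m\<^sup>2" L b \<gamma>c "m0 + G"])
    show "\<bar>b x t\<bar> \<le> m0 + G" if "t \<in> {0..T}" for t x using b(1)[OF that, of x] G by simp
    show "\<bar>\<gamma>c x t\<bar> \<le> m0 + G" for t x using \<gamma>c(1)[of x t] m01 by simp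
  qed (use T R m2 L0 b(2) \<gamma>c(2) in auto)
  define L2 where "L2 = L / m"
  define M3 where "M3 = M + 3 * L\<^sup>2 + (m0 + 1) * (L / m / m) + L / m"
  have L20: "0 \<le> L2" "0 \<le> L / m / m" using L0 m by (auto simp: L2_def)
  have M3: "M \<le> M3" "3 * L\<^sup>2 + m0 * (L / m / m) \<le> M3" "L / m / m \<le> M3" "L / m \<le> M3"
  proof -
    have "0 \<le> m0 * (L / m / m)" by (rule mult_nonneg_nonneg[OF p0(2) L20(2)])
    moreover have "0 \<le> L / m" using L20(1) by (simp only: L2_def)
    moreover have "(m0 + 1) * (L / m / m) = m0 * (L / m / m) + L / m / m" by (simp only: distrib_right mult_1)
    ultimately show "M \<le> M3" "3 * L\<^sup>2 + m0 * (L / m / m) \<le> M3" "L / m / m \<le> M3" "L / m \<le> M3"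
      using L20 p0 M unfolding M3_def by linarith+
  qed
  have sch: "scheme r \<rho> M L2 M3 \<epsilon> \<tau> B (bs (s i)) (gs (s i))" if \<epsilon>: "0 < \<epsilon>" "\<epsilon> \<le> 1" "\<tau> = \<epsilon>\<^sup>2" for \<epsilon> \<tau> i
  proof
    note bi = bs(2)[OF net(2)] and gi = gs(2)[OF net(2)]
    have Bsq: "(B 0 x)\<^sup>2 \<le> m0\<^sup>2" for x using power_mono[OF B(2)[of x], of 2] by simp
    show "\<bar>\<rho>\<bar> \<le> 1" "0 < \<epsilon>" "\<epsilon> \<le> 1" "\<tau> = \<epsilon>\<^sup>2" "1 \<le> M" "M \<le> M3" using \<rho> \<epsilon> M M3 by auto
    show "\<bar>B k x\<bar> \<le> M" if k2: "k \<le> 2" for k x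
    proof -
      consider "k = 0" | "k = 1" | "k = 2" using k2 by linarith
      then show ?thesis using B(2,4,5)[of x] M by cases (hypsubst, linarith)+
    qed
    show "\<bar>bs (s i) k x\<bar> \<le> M" if k2: "k \<le> 2" for k x
    proof -
      consider "k = 0" | "k = 1" | "k = 2" using k2 by linarith
      then show ?thesis using bi[of i x] M by cases (hypsubst, linarith)+
    qed
    show "\<bar>gs (s i) k x\<bar> \<le> M" if k2: "k \<le> 1" for k x
    proof -
      consider "k = 0" | "k = 1" using k2 by linarith
      then show ?thesis using gi[of i x] M by cases (hypsubst, linarith)+
    qed
    show "\<bar>gs (s i) 2 x\<bar> \<le> L2" for x using gi[of i x] by (simp add: L2_def)
    show "\<bar>r - (B 0 x)\<^sup>2 / 2\<bar> \<le> M" for x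
    proof -
      have "(B 0 x)\<^sup>2 / 2 \<le> m0\<^sup>2" "0 \<le> (B 0 x)\<^sup>2 / 2" using Bsq[of x] p0(1) zero_le_power2[of "B 0 x"] by linarith+
      then show ?thesis using M(5) r p0(1) by (intro abs_leI) linarith+
    qed
    show "\<bar>B 0 x * B 1 x\<bar> \<le> M" for x using abs_mult_le[OF B(2)[of x] B(4)[of x]] M by linarith
    show "\<bar>(B 1 x)\<^sup>2 + B 0 x * B 2 x\<bar> \<le> M" for x
    proof -
      have "\<bar>B 1 x * B 1 x + B 0 x * B 2 x\<bar> \<le> L * L + m0 * L" by (intro abs_add2_le abs_mult_le B)
      then show ?thesis using M(7) by (simp add: power2_eq_square)
    qed
    show "\<bar>3 * B 1 x * B 2 x + B 0 x * B 3 x\<bar> \<le> M3" for x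
    proof -
      have "\<bar>3 * B 1 x * B 2 x + B 0 x * B 3 x\<bar> \<le> 3 * L * L + m0 * (L / m / m)" by (intro abs_add2_le abs_mult_le B) simp
      then show ?thesis using M3(2) by (simp add: power2_eq_square)
    qed
    have "\<bar>bs (s i) 3 x\<bar> \<le> L / m / m" "\<bar>gs (s i) 2 x\<bar> \<le> L / m" "\<bar>gs (s i) 3 x\<bar> \<le> L / m / m" for x
      using bi[of i x] gi[of i x] by blast+
    then show "\<bar>B 3 x\<bar> \<le> M3" "\<bar>bs (s i) 3 x\<bar> \<le> M3" "\<bar>gs (s i) 2 x\<bar> \<le> M3" "\<bar>gs (s i) 3 x\<bar> \<le> M3" for x
      using B(6) M3(3,4) by (meson order_trans)+
  qed (use B(1) bs(1)[OF net(2)] gs(1)[OF net(2)] in auto)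
  define K1 where "K1 = A1 * exp (22 * M\<^sup>2 * T)"
  define K2 where "K2 = (A2 + T * (M + L2) * A1) * exp (22 * M\<^sup>2 * T)"
  define K3 where "K3 = (A3 + T * (994 * M3^4 * (K1 + K2))) * exp (994 * M3^4 * T)"
  have M0: "0 \<le> M" "0 \<le> M3" using M M3 by auto
  have K0: "0 \<le> K1" "0 \<le> K2" "0 \<le> K3"
  proof -
    show "0 \<le> K1" "0 \<le> K2" using A T M0 L20 by (auto simp: K1_def K2_def)
    then show "0 \<le> K3" using A T M0 by (simp add: K3_def)
  qed
  have K12: "(K1 + K2) * m \<le> Q" "K1 \<le> Q"
  proof -
    have a1: "(A1 + A2) * m \<le> (A1 + A2) * 1" using A m1 by (intro mult_left_mono) auto
    have L2m: "L2 * m = L" using m by (simp add: L2_def)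
    have "(A1 + A2 + T * (M + L2) * A1) * m = (A1 + A2) * m + T * (M * m + L) * A1"
      unfolding L2m[symmetric] by (simp add: algebra_simps)
    moreover have "T * (M * m + L) * A1 \<le> T * (M * 1 + L) * A1" using T A m1 M0 by (intro mult_right_mono mult_left_mono add_mono) auto
    ultimately have "(A1 + A2 + T * (M + L2) * A1) * m \<le> A1 + A2 + T * (M + L) * A1" using a1 by (simp only: mult_1_right)
    then have "(A1 + A2 + T * (M + L2) * A1) * m * E \<le> Q" unfolding Q_def using E by (intro mult_right_mono) auto
    moreover have "(K1 + K2) * m = (A1 + A2 + T * (M + L2) * A1) * m * E" by (simp add: K1_def K2_def E_def algebra_simps)
    ultimately show "(K1 + K2) * m \<le> Q" by (simp only:)
    have "A1 \<le> A1 + A2 + T * (M + L) * A1" using A T M0 L0 by simp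
    then show "K1 \<le> Q" unfolding K1_def Q_def E_def by (intro mult_right_mono) auto
  qed
  define S where "S = K1 + K2 + K3"
  have S: "0 \<le> S" using K0 by (simp add: S_def)
  define V0 where "V0 = 260 * M^4 * S * T * exp (M * T)"
  have V0: "0 \<le> V0" using S T M0 by (simp add: V0_def)
  define \<eta>1 where "\<eta>1 = (3 * L + 1) * m\<^sup>2"
  define \<eta>2 where "\<eta>2 = (3 * L + 1) * m"
  have \<eta>: "0 \<le> \<eta>1" "0 \<le> \<eta>2" "\<eta>1 \<le> 2 * M" "\<eta>2 \<le> 2 * M"
  proof -
    show "0 \<le> \<eta>1" "0 \<le> \<eta>2" using L0 m by (auto simp: \<eta>1_def \<eta>2_def)
    have "\<eta>1 \<le> \<eta>2" unfolding \<eta>1_def \<eta>2_def using m2 L0 by (intro mult_left_mono) auto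
    then show "\<eta>1 \<le> 2 * M" "\<eta>2 \<le> 2 * M" using mL M unfolding \<eta>2_def by linarith+
  qed
  define Cb where "Cb = 557 * M3^4 * S * 1 + 4 * M * (2 * M) * (K1 + K2) + 2 * M * K1 + 2 * m0 * V0"
  have Cb: "0 \<le> Cb" unfolding Cb_def using S M0 K0 V0 m01 by simp
  define Z where "Z = 557 * M3^4 * S + 2 * m0 * V0"
  have Z: "0 \<le> Z" unfolding Z_def using S M0 V0 m01 by simp
  \<comment> \<open>\<open>Z * \<epsilon>\<close> is the part of the residual that vanishes with the
    step size: discretisation, and the amount by which the scheme may fail to be nondecreasing in
    \<open>\<sigma>\<close>.\<close>
  define \<epsilon>1 where "\<epsilon>1 = \<Delta> / (5 * (Z + 1) * (T + 1))"
  have \<epsilon>1: "\<epsilon>1 > 0" using \<Delta> Z T by (simp add: \<epsilon>1_def)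
  \<comment> \<open>Besides \<open>\<epsilon> \<le> \<epsilon>1\<close>, the step length has to
    satisfy \<open>\<tau> * M \<le> 1\<close>, as \<open>T_vega\<close> demands.\<close>
  define \<tau>1 where "\<tau>1 = min (1 / M) (\<epsilon>1\<^sup>2)"
  have \<tau>1: "\<tau>1 > 0" using M \<epsilon>1 by (simp add: \<tau>1_def)
  have DC: "\<Delta> / (5 * (Cb + 1)) > 0" using \<Delta> Cb by simp
  have jn: "j t < nn" if "t \<in> {ts..T}" for t using net(1)[of t] that ts by simp
  \<comment> \<open>Bad times weigh at most \<open>Cb\<close>, which is free of the step size; so
    the measure that the colouring may lose can be prescribed before \<open>N\<close> is
    known.\<close>
  obtain N c mm where col: "N > (0::nat)" "(T - ts) / N \<le> \<tau>1" "\<And>k. c k < nn"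
    "\<And>k Q. k < N \<Longrightarrow> Q \<in> sets lebesgue \<Longrightarrow>
       {t. j t = c k} \<inter> {ts + k * ((T - ts) / N)<..<ts + Suc k * ((T - ts) / N)} \<subseteq> Q \<Longrightarrow>
       mm k \<le> measure lebesgue (Q \<inter> {ts + k * ((T - ts) / N)..ts + Suc k * ((T - ts) / N)})"
    "(\<Sum>k<N. (T - ts) / N - mm k) \<le> \<Delta> / (5 * (Cb + 1))"
    by (rule colour_partition[where j = j and n = nn, OF ts(2) _ DC \<tau>1]) (erule jn, rule that)
  define \<tau> where "\<tau> = (T - ts) / N"
  have \<tau>: "0 < \<tau>" "\<tau> \<le> \<tau>1" "real N * \<tau> = T - ts" using ts col(1,2) by (auto simp: \<tau>_def)
  define \<epsilon> where "\<epsilon> = sqrt \<tau>"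
  have \<tau>M: "\<tau> * M \<le> 1"
  proof -
    have "\<tau> \<le> 1 / M" using \<tau>(2) by (simp add: \<tau>1_def)
    then show ?thesis using M by (simp add: field_simps)
  qed
  have "\<tau> \<le> 1"
  proof -
    have "\<tau> * 1 \<le> \<tau> * M" using \<tau> M by (intro mult_left_mono) auto
    then show ?thesis using \<tau>M by simp
  qed
  then have \<epsilon>: "0 < \<epsilon>" "\<epsilon> \<le> 1" "\<tau> = \<epsilon>\<^sup>2" using \<tau> by (auto simp: \<epsilon>_def)
  have "\<epsilon> \<le> \<epsilon>1" unfolding \<epsilon>_def using \<tau>(2) \<epsilon>1 by (intro real_le_lsqrt) (auto simp: \<tau>1_def)
  then have Z\<epsilon>: "Z * \<epsilon> * T \<le> \<Delta> / 5"
  proof -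
    assume "\<epsilon> \<le> \<epsilon>1"
    then have "\<epsilon> * (5 * (Z + 1) * (T + 1)) \<le> \<Delta>" using Z T by (simp add: \<epsilon>1_def pos_le_divide_eq)
    moreover have "\<epsilon> * (5 * Z * T) \<le> \<epsilon> * (5 * (Z + 1) * (T + 1))" using \<epsilon> Z T by (intro mult_left_mono mult_mono) auto
    ultimately show ?thesis by (simp add: mult_ac)
  qed
  \<comment> \<open>Step \<open>i\<close> of the recursion crosses interval number
    \<open>N - 1 - i\<close> and uses the coefficients frozen at the time that represents the colour
    of that interval.\<close>
  define bb where "bb i = bs (s (c (N - 1 - i)))" for i
  define gg where "gg i = gs (s (c (N - 1 - i)))" for i
  define V where "V = rec_nat F (\<lambda>i. scheme.T r \<rho> \<epsilon> \<tau> B (bb i) (gg i))"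
  have VS: "V (Suc i) = scheme.T r \<rho> \<epsilon> \<tau> B (bb i) (gg i) (V i)" for i by (simp add: V_def)
  have V00: "V 0 = F" by (simp add: V_def)
  have sch': "scheme r \<rho> M L2 M3 \<epsilon> \<tau> B (bb i) (gg i)" for i unfolding bb_def gg_def by (rule sch[OF \<epsilon>])
  have Vb: "jet3 (V i) \<and> jet_bd (V i) K1 K2 K3 \<and> (\<forall>y x. 0 \<le> V i 0 0 y x \<and> V i 0 0 y x \<le> K)
     \<and> (\<forall>y x. - (V0 * \<epsilon>) \<le> V i 0 1 y x)" if "i \<le> N" for i
    unfolding V0_def S_def
  proof (rule chain_bounds[where V = V and b = bb and g = gg, OF sch' L20(1) _ _ _ _ _ _ VS B(7,8) \<tau>M _ K1_def K2_def K3_def])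
    have "real i * \<tau> \<le> real N * \<tau>" using that \<tau> by (intro mult_right_mono) auto
    then show "real i * \<tau> \<le> T" using \<tau> ts by simp
  qed (use F T in \<open>auto simp: V00\<close>)
  have Nv: "0 \<le> V0 * \<epsilon>" using V0 \<epsilon> by simp
  have errs: "scheme.err M M3 \<epsilon> \<eta>1 \<eta>2 K1 K2 K3 m0 (V0 * \<epsilon>) * (T - ts) \<le> 2 * \<Delta> / 5"
    "scheme.err M M3 1 (2 * M) (2 * M) K1 K2 K3 m0 (V0 * \<epsilon>) \<le> Cb"
    "0 \<le> scheme.err M M3 1 (2 * M) (2 * M) K1 K2 K3 m0 (V0 * \<epsilon>)"
  proof -
    note ed = scheme.err_def[OF sch'[of 0]]
    have "4 * M * \<eta>1 * (K1 + K2) + \<eta>2 * K1 = 4 * M * (3 * L + 1) * m * ((K1 + K2) * m) + (3 * L + 1) * m * K1"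
      by (simp add: \<eta>1_def \<eta>2_def power2_eq_square algebra_simps)
    also have "\<dots> \<le> 4 * M * (3 * L + 1) * m * Q + (3 * L + 1) * m * Q"
      using K12 M0 L0 m by (intro add_mono mult_left_mono) auto
    also have "\<dots> = P * Q * m" by (simp add: P_def algebra_simps)
    finally have "4 * M * \<eta>1 * (K1 + K2) + \<eta>2 * K1 \<le> P * Q * m" .
    then have e1: "scheme.err M M3 \<epsilon> \<eta>1 \<eta>2 K1 K2 K3 m0 (V0 * \<epsilon>) \<le> Z * \<epsilon> + P * Q * m"
      unfolding ed by (simp add: Z_def S_def algebra_simps)
    have "0 \<le> Z * \<epsilon> + P * Q * m" using Z \<epsilon> P Q m by simp
    then have "scheme.err M M3 \<epsilon> \<eta>1 \<eta>2 K1 K2 K3 m0 (V0 * \<epsilon>) * (T - ts) \<le> (Z * \<epsilon> + P * Q * m) * T"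
      using e1 ts by (intro mult_mono) auto
    also have "\<dots> = Z * \<epsilon> * T + P * Q * m * T" by (simp add: algebra_simps)
    finally show "scheme.err M M3 \<epsilon> \<eta>1 \<eta>2 K1 K2 K3 m0 (V0 * \<epsilon>) * (T - ts) \<le> 2 * \<Delta> / 5" using Z\<epsilon> mQ by simp
    have "V0 * \<epsilon> \<le> V0 * 1" using V0 \<epsilon> by (intro mult_left_mono) auto
    then have "2 * m0 * (V0 * \<epsilon>) \<le> 2 * m0 * V0" using m01 by simp
    then show "scheme.err M M3 1 (2 * M) (2 * M) K1 K2 K3 m0 (V0 * \<epsilon>) \<le> Cb" unfolding ed Cb_def S_def by simp
    show "0 \<le> scheme.err M M3 1 (2 * M) (2 * M) K1 K2 K3 m0 (V0 * \<epsilon>)" unfolding ed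
      using K0 M0 V0 \<epsilon> m01 by (intro add_nonneg_nonneg mult_nonneg_nonneg) auto
  qed
  show ?thesis
  proof (intro exI[of _ "V N 0 0 ys xs"] ballI allI impI)
    fix sg :: real and U assume sg: "sg \<in> {1, -1}" and adm: "admissible T r \<rho> \<beta> b \<gamma> m0 C0 n K sg U"
    from adm have Uc: "continuous_on (UNIV \<times> UNIV \<times> {0..T}) (\<lambda>(y, x, t). U y x t)"
      and Ug: "\<And>y x t. t \<in> {0..T} \<Longrightarrow> \<bar>U y x t\<bar> \<le> C0 * ((1 + y\<^sup>2) ^ n + (1 + x\<^sup>2) ^ n)"
      and UT: "\<And>y x. U y x T = sg * (D * max (K - exp y) 0)" unfolding admissible_def D_def by blast+
    from adm obtain cc \<kappa> where sub: "log_sub T r \<rho> \<beta> b cc (\<lambda>x t. sg * \<kappa> x t) U"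
      and ck: "\<And>x t. t \<in> {0..T} \<Longrightarrow> cc x t + \<kappa> x t = \<gamma> x t" "\<And>x t. t \<in> {0..T} \<Longrightarrow> \<bar>\<kappa> x t\<bar> \<le> m0"
        "\<And>x t. t \<in> {0..T} \<Longrightarrow> \<bar>cc x t\<bar> + \<bar>\<kappa> x t\<bar> \<le> m0 * (1 + \<bar>x\<bar>)" unfolding admissible_def by blast
    have main: "U ys xs ts - sg * V N 0 0 ys xs - \<delta> * exp (lam * (T - ts)) * (pen n ys + pen n xs)
      \<le> \<Delta> / 5 + scheme.err M M3 \<epsilon> \<eta>1 \<eta>2 K1 K2 K3 m0 (V0 * \<epsilon>) * (T - ts)
        + scheme.err M M3 1 (2 * M) (2 * M) K1 K2 K3 m0 (V0 * \<epsilon>) * (\<Sum>k<N. \<tau> - mm k)"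
    proof (rule chain_compare[where Good = "\<lambda>k. {t. j t = c k}" and V = V and b = bb and g = gg, OF sch' VS Vb Nv sg sub Uc ts(1) _ R(1) \<delta> lam_def _ m0 ck(3,2) _ _ _ \<eta>])
      show "ts + real N * \<tau> = T" using \<tau> by simp
      show "U y x t - \<delta> * (pen n y + pen n x) + K < U 0 0 t - 2 * \<delta> * exp (lam * T)"
        if t: "t \<in> {0..T}" and o: "\<not> (\<bar>y\<bar> < R \<and> \<bar>x\<bar> < R)" for y x t
        using R(2)[OF o] Ug[OF t, of y x] Ug[OF t, of 0 0] by simp
      show "\<bar>\<beta> x\<bar> \<le> M" for x using \<beta>(3)[of x] M by simp
      show "\<bar>b x t\<bar> \<le> M" if "t \<in> {0..T}" for x t using b(1)[OF that, of x] M by simp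
      show "\<bar>cc x t + \<kappa> x t\<bar> \<le> M" if "t \<in> {0..T}" "\<bar>x\<bar> < R" for x t
        using \<gamma>G[OF that(1), of x] that ck(1)[OF that(1)] M by simp
      show "\<bar>\<beta> x - B 0 x\<bar> \<le> \<eta>1 \<and> \<bar>b x t - bb (N - 1 - k) 0 x\<bar> \<le> \<eta>1 \<and> \<bar>cc x t + \<kappa> x t - gg (N - 1 - k) 0 x\<bar> \<le> \<eta>2"
        if k: "k < N" and tg: "t \<in> {t. j t = c k}" and t: "t \<in> {0..T}" and x: "\<bar>x\<bar> < R" for k x t
      proof -
        have cj: "c (N - 1 - (N - 1 - k)) = j t" using k tg by simp
        have xR: "\<bar>x\<bar> \<le> R" using x by simp
        note nt = net(3)[OF t xR]
        have \<eta>1e: "\<eta>1 = 3 * L * m\<^sup>2 + m\<^sup>2" by (simp add: \<eta>1_def algebra_simps)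
        have \<eta>2e: "3 * L * m + m\<^sup>2 \<le> \<eta>2" using m2 by (simp add: \<eta>2_def algebra_simps)
        have "\<bar>\<beta> x - B 0 x\<bar> \<le> \<eta>1" using B(3)[of x] m2(1) unfolding \<eta>1e abs_minus_commute[of "\<beta> x"] by linarith
        moreover have "\<bar>b x t - bs (s (j t)) 0 x\<bar> \<le> \<eta>1"
          using bs(2)[OF net(2)[of "j t"], of x] nt unfolding \<eta>1e by linarith
        moreover have "\<bar>\<gamma>c x t - gs (s (j t)) 0 x\<bar> \<le> \<eta>2"
          using gs(2)[OF net(2)[of "j t"], of x] nt \<eta>2e by linarith
        ultimately show ?thesis unfolding bb_def gg_def cj ck(1)[OF t] by (simp add: \<gamma>c_eq[OF t xR])
      qed
      show "mm k \<le> measure lebesgue (Q \<inter> {ts + real k * \<tau>..ts + real (Suc k) * \<tau>})"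
        if "k < N" "Q \<in> sets lebesgue" "{t. j t = c k} \<inter> {ts + real k * \<tau><..<ts + real (Suc k) * \<tau>} \<subseteq> Q" for k Q
        using col(4)[OF that(1,2)] that(3) unfolding \<tau>_def by blast
      show "U y x T - sg * V 0 0 0 y x - \<delta> * (pen n y + pen n x) \<le> \<Delta> / 5" for y x
      proof -
        have sgn_diff: "sg * p - sg * q \<le> \<bar>q - p\<bar>" for p q using sg by auto
        have "sg * (D * max (K - exp y) 0) - sg * F 0 0 y x \<le> \<Delta> / 5" by (rule order_trans[OF sgn_diff F(7)])
        moreover have "0 \<le> \<delta> * (pen n y + pen n x)" using \<delta> pen_bounds(1)[of n y] pen_bounds(1)[of n x] by simp
        ultimately show ?thesis unfolding UT V00 by simp
      qed
    qed
    have "\<delta> * exp (lam * (T - ts)) * X \<le> \<delta> * exp (lam * T) * X"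
      using \<delta> X lam ts by (intro mult_right_mono mult_left_mono) (auto intro: mult_left_mono)
    also have "\<dots> = \<Delta> / 5" using X by (simp add: \<delta>_def field_simps)
    finally have p1: "\<delta> * exp (lam * (T - ts)) * (pen n ys + pen n xs) \<le> \<Delta> / 5" by (simp add: X_def)
    have p2: "scheme.err M M3 1 (2 * M) (2 * M) K1 K2 K3 m0 (V0 * \<epsilon>) * (\<Sum>k<N. \<tau> - mm k) \<le> \<Delta> / 5"
    proof -
      have "scheme.err M M3 1 (2 * M) (2 * M) K1 K2 K3 m0 (V0 * \<epsilon>) * (\<Sum>k<N. \<tau> - mm k)
         \<le> scheme.err M M3 1 (2 * M) (2 * M) K1 K2 K3 m0 (V0 * \<epsilon>) * (\<Delta> / (5 * (Cb + 1)))"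
        using col(5) errs(3) unfolding \<tau>_def by (intro mult_left_mono)
      also have "\<dots> \<le> (Cb + 1) * (\<Delta> / (5 * (Cb + 1)))" using errs(2) \<Delta> Cb by (intro mult_right_mono) auto
      also have "\<dots> = \<Delta> / 5" using Cb by (simp add: field_simps)
      finally show ?thesis .
    qed
    show "U ys xs ts \<le> sg * V N 0 0 ys xs + \<Delta>" using main p1 p2 errs(1) by linarith
  qed
qed

text \<open>The decay condition with \<open>\<epsilon> = 1\<close> far out, and continuity on the
  remaining compact set. \<open>W\<close> is independent of \<open>n\<close>, so two solutions can
  be given a common exponent; \<open>2 ^ n\<close> comes from \<open>1 + \<bar>y\<bar> +
  \<bar>x\<bar> \<le> 2 * max (1 + y^2) (1 + x^2)\<close>.\<close>

lemma class_C_growth: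
  assumes cont: "continuous_on (dom3 T) (\<lambda>(s, x, t). u s x t)" and C: "class_C T u"
  obtains n0 :: nat and W where "W \<ge> 0"
    "\<And>n (y::real) x t. n0 \<le> n \<Longrightarrow> t \<in> {0..T} \<Longrightarrow> \<bar>u (exp y) x t\<bar> \<le> W * 2 ^ n * ((1 + y\<^sup>2) ^ n + (1 + x\<^sup>2) ^ n)"
proof -
  from C obtain k where k: "k > 0" and dec: "\<forall>\<epsilon>>0. \<exists>R. \<forall>s x t. s > 0 \<and> t \<in> {0..T} \<and> \<bar>ln s\<bar> + \<bar>x\<bar> \<ge> R \<longrightarrow>
        \<bar>u s x t\<bar> \<le> \<epsilon> * (1 + (\<bar>ln s\<bar> + \<bar>x\<bar>) powr k)"
    unfolding class_C_def by blast
  obtain R where R: "\<And>s x t. s > 0 \<Longrightarrow> t \<in> {0..T} \<Longrightarrow> \<bar>ln s\<bar> + \<bar>x\<bar> \<ge> R \<Longrightarrow> \<bar>u s x t\<bar> \<le> 1 * (1 + (\<bar>ln s\<bar> + \<bar>x\<bar>) powr k)"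
    using dec[rule_format, of 1] by auto
  define Kc where "Kc = {exp (- R)..exp R} \<times> {- R..R} \<times> {0..T}"
  have "Kc \<subseteq> dom3 T" by (auto simp: Kc_def dom3_def intro: less_le_trans[OF exp_gt_zero])
  then have "compact ((\<lambda>(s, x, t). u s x t) ` Kc)"
    by (intro compact_continuous_image continuous_on_subset[OF cont]) (auto simp: Kc_def intro!: compact_Times)
  then obtain W0 where W0: "\<And>p. p \<in> Kc \<Longrightarrow> \<bar>(\<lambda>(s, x, t). u s x t) p\<bar> \<le> W0"
    using compact_imp_bounded bounded_iff by (metis imageI real_norm_def)
  define W where "W = 2 + \<bar>W0\<bar>"
  show thesis
  proof (rule that[of W "nat \<lceil>k\<rceil>"])
    fix n :: nat and y x t :: real
    assume n: "nat \<lceil>k\<rceil> \<le> n" and t: "t \<in> {0..T}"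
    let ?q = "1 + \<bar>y\<bar> + \<bar>x\<bar>"
    have p1: "1 \<le> (1 + y\<^sup>2) ^ n" "1 \<le> (1 + x\<^sup>2) ^ n" by (auto intro: one_le_power)
    have "?q \<le> 2 * max (1 + y\<^sup>2) (1 + x\<^sup>2)"
    proof -
      have sq: "\<bar>s\<bar> * 2 \<le> 1 + s\<^sup>2" for s :: real
      proof -
        have "0 \<le> (\<bar>s\<bar> - 1)\<^sup>2" by simp
        then show ?thesis by (simp add: power2_eq_square algebra_simps)
      qed
      have "1 + p + q \<le> 2 * w" if "p * 2 \<le> 1 + p'" "q * 2 \<le> 1 + q'" "1 + p' \<le> w" "1 + q' \<le> w" "0 \<le> p'" for p q p' q' w :: real
        using that by linarith
      from this[OF sq sq max.cobounded1 max.cobounded2 zero_le_power2] show ?thesis .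
    qed
    then have "?q ^ n \<le> (2 * max (1 + y\<^sup>2) (1 + x\<^sup>2)) ^ n" by (intro power_mono) auto
    also have "\<dots> = 2 ^ n * max (1 + y\<^sup>2) (1 + x\<^sup>2) ^ n" by (rule power_mult_distrib)
    also have "max (1 + y\<^sup>2) (1 + x\<^sup>2) ^ n \<le> (1 + y\<^sup>2) ^ n + (1 + x\<^sup>2) ^ n" using p1 by (simp add: max_def)
    finally have qn: "?q ^ n \<le> 2 ^ n * ((1 + y\<^sup>2) ^ n + (1 + x\<^sup>2) ^ n)" by simp
    have qn1: "1 \<le> ?q ^ n" by (intro one_le_power) simp
    have "\<bar>u (exp y) x t\<bar> \<le> W * ?q ^ n"
    proof (cases "R \<le> \<bar>y\<bar> + \<bar>x\<bar>")
      case True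
      have "(\<bar>y\<bar> + \<bar>x\<bar>) powr k \<le> ?q powr k" using k by (intro powr_mono2) auto
      also have "\<dots> \<le> ?q powr real n" using n by (intro powr_mono) linarith+
      also have "\<dots> = ?q ^ n" by (intro powr_realpow) simp
      finally have "\<bar>u (exp y) x t\<bar> \<le> 1 + ?q ^ n" using R[of "exp y" t x] t True by simp
      also have "\<dots> \<le> 2 * ?q ^ n" using qn1 by simp
      also have "\<dots> \<le> W * ?q ^ n" using qn1 by (intro mult_right_mono) (auto simp: W_def)
      finally show ?thesis .
    next
      case False
      then have "(exp y, x, t) \<in> Kc" using t by (auto simp: Kc_def)
      then have "\<bar>u (exp y) x t\<bar> \<le> W * 1" using W0[of "(exp y, x, t)"] by (simp add: W_def)
      also have "\<dots> \<le> W * ?q ^ n" using qn1 by (intro mult_left_mono) (auto simp: W_def)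
      finally show ?thesis .
    qed
    also have "\<dots> \<le> W * (2 ^ n * ((1 + y\<^sup>2) ^ n + (1 + x\<^sup>2) ^ n))" using qn by (intro mult_left_mono) (auto simp: W_def)
    finally show "\<bar>u (exp y) x t\<bar> \<le> W * 2 ^ n * ((1 + y\<^sup>2) ^ n + (1 + x\<^sup>2) ^ n)" by (simp only: mult.assoc)
  qed (simp add: W_def)
qed

lemma admissible_of_visc_sol:
  assumes r: "r \<ge> 0" and vs: "visc_sol T r \<rho> \<beta> b c \<kappa> (put_payoff K) u" and sg: "sg \<in> {1, -1}"
    and gr: "\<And>y x t. t \<in> {0..T} \<Longrightarrow> \<bar>u (exp y) x t\<bar> \<le> C0 * ((1 + y\<^sup>2) ^ n + (1 + x\<^sup>2) ^ n)"
    and ck: "\<And>x t. t \<in> {0..T} \<Longrightarrow> c x t + \<kappa> x t = \<gamma> x t \<and> \<bar>\<kappa> x t\<bar> \<le> m0 \<and> \<bar>c x t\<bar> + \<bar>\<kappa> x t\<bar> \<le> m0 * (1 + \<bar>x\<bar>)"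
  shows "admissible T r \<rho> \<beta> b \<gamma> m0 C0 n K sg (\<lambda>y x t. sg * (exp (- r * t) * u (exp y) x t))"
  unfolding admissible_def
proof (intro conjI exI)
  from vs have cont: "continuous_on (dom3 T) (\<lambda>(s, x, t). u s x t)" and uT: "\<And>s x. s > 0 \<Longrightarrow> u s x T = put_payoff K s"
    unfolding visc_sol_def by blast+
  have "continuous_on (UNIV \<times> UNIV \<times> {0..T}) (\<lambda>p. (\<lambda>(s, x, t). u s x t) (exp (fst p), fst (snd p), snd (snd p)))"
    by (rule continuous_on_compose2[OF cont]) (auto simp: dom3_def intro!: continuous_intros)
  then show "continuous_on (UNIV \<times> UNIV \<times> {0..T}) (\<lambda>(y, x, t). sg * (exp (- r * t) * u (exp y) x t))"
    by (auto simp: case_prod_unfold intro!: continuous_intros)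
  show "\<forall>t\<in>{0..T}. \<forall>y x. \<bar>sg * (exp (- r * t) * u (exp y) x t)\<bar> \<le> C0 * ((1 + y\<^sup>2) ^ n + (1 + x\<^sup>2) ^ n)"
  proof (intro ballI allI)
    fix t y x assume t: "t \<in> {0..T}"
    have "\<bar>sg * (exp (- r * t) * u (exp y) x t)\<bar> = exp (- r * t) * \<bar>u (exp y) x t\<bar>" using sg by (auto simp: abs_mult)
    also have "\<dots> \<le> 1 * \<bar>u (exp y) x t\<bar>" using r t by (intro mult_right_mono) auto
    finally show "\<bar>sg * (exp (- r * t) * u (exp y) x t)\<bar> \<le> C0 * ((1 + y\<^sup>2) ^ n + (1 + x\<^sup>2) ^ n)" using gr[OF t, of y x] by simp
  qed
  show "\<forall>y x. sg * (exp (- r * T) * u (exp y) x T) = sg * (exp (- r * T) * max (K - exp y) 0)"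
    using uT by (simp add: put_payoff_def)
  show "log_sub T r \<rho> \<beta> b c (\<lambda>x t. sg * \<kappa> x t) (\<lambda>y x t. sg * (exp (- r * t) * u (exp y) x t))"
    by (rule visc_sol_log[OF vs sg])
  show "\<forall>t\<in>{0..T}. \<forall>x. c x t + \<kappa> x t = \<gamma> x t \<and> \<bar>\<kappa> x t\<bar> \<le> m0 \<and> \<bar>c x t\<bar> + \<bar>\<kappa> x t\<bar> \<le> m0 * (1 + \<bar>x\<bar>)"
    using ck by blast
qed

theorem theorem3p7:
  fixes T r \<mu> \<rho> \<alpha> K :: real
    and \<beta> :: "real \<Rightarrow> real"
    and a b :: "real \<Rightarrow> real \<Rightarrow> real"
  assumes T: "T > 0" and r: "r \<ge> 0" and \<rho>: "\<rho> \<in> {-1..1}" and \<alpha>: "\<alpha> \<ge> 0" and K: "K > 0"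
    and \<beta>_pos: "\<forall>x. \<beta> x > 0" and \<beta>_mono: "mono \<beta>"
    and a_bdd: "\<exists>M. \<forall>x. \<forall>t\<in>{0..T}. \<bar>a x t\<bar> \<le> M"
    and b_bdd: "\<exists>M. \<forall>x. \<forall>t\<in>{0..T}. \<bar>b x t\<bar> \<le> M"
    and \<beta>_bdd: "\<exists>M. \<forall>x. \<bar>\<beta> x\<bar> \<le> M"
    and nondeg: "\<exists>\<delta>>0. \<forall>x. \<forall>t\<in>{0..T}. max (\<beta> x) (b x t) \<ge> \<delta>"
    and \<beta>_lip: "\<exists>L. \<forall>x y. \<bar>\<beta> x - \<beta> y\<bar> \<le> L * \<bar>x - y\<bar>"
    and b_lip: "\<exists>L. \<forall>t\<in>{0..T}. \<forall>x y. \<bar>b x t - b y t\<bar> \<le> L * \<bar>x - y\<bar>"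
    and \<gamma>_lip: "\<exists>L. \<forall>t\<in>{0..T}. \<forall>x y.
        \<bar>gamma_coef \<mu> r \<rho> \<alpha> a b \<beta> x t - gamma_coef \<mu> r \<rho> \<alpha> a b \<beta> y t\<bar> \<le> L * \<bar>x - y\<bar>"
    and \<beta>_diff: "\<forall>x. \<beta> differentiable (at x)"
    and b_diff: "\<forall>t\<in>{0..T}. \<forall>x. (\<lambda>y. b y t) differentiable (at x)"
    and \<gamma>_diff: "\<forall>t\<in>{0..T}. \<forall>x. (\<lambda>y. gamma_coef \<mu> r \<rho> \<alpha> a b \<beta> y t) differentiable (at x)"
    and \<beta>'_bdd: "\<exists>M. \<forall>x. \<bar>deriv \<beta> x\<bar> \<le> M"
    and b'_bdd: "\<exists>M. \<forall>t\<in>{0..T}. \<forall>x. \<bar>deriv (\<lambda>y. b y t) x\<bar> \<le> M"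
    and \<gamma>'_bdd: "\<exists>M. \<forall>t\<in>{0..T}. \<forall>x. \<bar>deriv (\<lambda>y. gamma_coef \<mu> r \<rho> \<alpha> a b \<beta> y t) x\<bar> \<le> M"
    and \<beta>'_lip: "\<exists>L. \<forall>x y. \<bar>deriv \<beta> x - deriv \<beta> y\<bar> \<le> L * \<bar>x - y\<bar>"
    and b'_lip: "\<exists>L. \<forall>t\<in>{0..T}. \<forall>x y.
        \<bar>deriv (\<lambda>z. b z t) x - deriv (\<lambda>z. b z t) y\<bar> \<le> L * \<bar>x - y\<bar>"
  shows "\<forall>P G.
     visc_sol T r \<rho> \<beta> b (\<lambda>x t. a x t - (\<mu> - r) * \<rho> * b x t / \<beta> x)
        (\<lambda>x t. \<alpha> * sqrt (1 - \<rho>\<^sup>2) * b x t) (put_payoff K) P \<and> class_C T P \<and>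
     visc_sol T r \<rho> \<beta> b (gamma_coef \<mu> r \<rho> \<alpha> a b \<beta>) (\<lambda>x t. 0) (put_payoff K) G \<and> class_C T G
     \<longrightarrow> (\<forall>s x t. s > 0 \<and> t \<in> {0..T} \<longrightarrow> P s x t = G s x t)"
proof -
  define \<gamma> where "\<gamma> = gamma_coef \<mu> r \<rho> \<alpha> a b \<beta>"
  define c where "c x t = a x t - (\<mu> - r) * \<rho> * b x t / \<beta> x" for x t
  define \<kappa> where "\<kappa> x t = \<alpha> * sqrt (1 - \<rho>\<^sup>2) * b x t" for x t
  have c\<kappa>: "c x t + \<kappa> x t = \<gamma> x t" for x t by (simp add: c_def \<kappa>_def \<gamma>_def gamma_coef_def)
  from a_bdd obtain Ma where Ma: "\<And>x t. t \<in> {0..T} \<Longrightarrow> \<bar>a x t\<bar> \<le> Ma" by blast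
  from b_bdd obtain Mb where Mb: "\<And>x t. t \<in> {0..T} \<Longrightarrow> \<bar>b x t\<bar> \<le> Mb" by blast
  from \<beta>_bdd obtain M\<beta> where M\<beta>: "\<And>x. \<bar>\<beta> x\<bar> \<le> M\<beta>" by blast
  from \<beta>_lip obtain L1 where L1: "\<And>x y. \<bar>\<beta> x - \<beta> y\<bar> \<le> L1 * \<bar>x - y\<bar>" by blast
  from b_lip obtain L2 where L2: "\<And>t x y. t \<in> {0..T} \<Longrightarrow> \<bar>b x t - b y t\<bar> \<le> L2 * \<bar>x - y\<bar>" by blast
  from \<gamma>_lip obtain L3 where L3: "\<And>t x y. t \<in> {0..T} \<Longrightarrow> \<bar>\<gamma> x t - \<gamma> y t\<bar> \<le> L3 * \<bar>x - y\<bar>" unfolding \<gamma>_def by blast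
  from \<beta>'_lip obtain L4 where L4: "\<And>x y. \<bar>deriv \<beta> x - deriv \<beta> y\<bar> \<le> L4 * \<bar>x - y\<bar>" by blast
  from b'_lip obtain L5 where L5: "\<And>t x y. t \<in> {0..T} \<Longrightarrow> \<bar>deriv (\<lambda>z. b z t) x - deriv (\<lambda>z. b z t) y\<bar> \<le> L5 * \<bar>x - y\<bar>" by blast
  have d\<beta>: "(\<beta> has_real_derivative deriv \<beta> x) (at x)" for x using \<beta>_diff by (simp add: DERIV_deriv_iff_real_differentiable)
  have db: "((\<lambda>z. b z t) has_real_derivative deriv (\<lambda>z. b z t) x) (at x)" if "t \<in> {0..T}" for t x
    using b_diff that by (simp add: DERIV_deriv_iff_real_differentiable)
  \<comment> \<open>The factors 2 are those of \<open>second_difference_bound\<close>.\<close>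
  define L where "L = 1 + \<bar>L1\<bar> + \<bar>L2\<bar> + \<bar>L3\<bar> + 2 * \<bar>L4\<bar> + 2 * \<bar>L5\<bar>"
  have L: "1 \<le> L" "L1 \<le> L" "L2 \<le> L" "L3 \<le> L" "2 * L4 \<le> L" "2 * L5 \<le> L" by (simp_all add: L_def)
  have Llip: "p \<le> L * \<bar>x - y\<bar>" if "p \<le> L' * \<bar>x - y\<bar>" "L' \<le> L" for p L' x y :: real
    using that(1) mult_right_mono[OF that(2), of "\<bar>x - y\<bar>"] by simp
  have Lsq: "p \<le> L * w\<^sup>2" if "p \<le> 2 * L' * w\<^sup>2" "2 * L' \<le> L" for p L' w :: real
    using that(1) mult_right_mono[OF that(2), of "w\<^sup>2"] by simp
  have M0: "0 \<le> Ma" "0 \<le> Mb" "0 \<le> M\<beta>" using Ma[of 0 0] Mb[of 0 0] M\<beta>[of 0] T by auto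
  define k where "k = \<alpha> * sqrt (1 - \<rho>\<^sup>2)"
  have k0: "0 \<le> k" using \<alpha> \<rho> by (simp add: k_def abs_square_le_1 abs_le_iff)
  have \<kappa>b: "\<bar>\<kappa> x t\<bar> \<le> k * Mb" if "t \<in> {0..T}" for x t
    using Mb[OF that, of x] k0 by (simp add: \<kappa>_def k_def[symmetric] abs_mult mult_left_mono)
  \<comment> \<open>\<open>\<beta>\<close> may come arbitrarily close to 0, so the quotient
    \<open>b / \<beta>\<close> is estimated at \<open>x = 0\<close> only. Elsewhere
    \<open>\<gamma>\<close> is controlled by its Lipschitz constant, which allows linear
    growth.\<close>
  define G0 where "G0 = Ma + \<bar>(\<mu> - r) * \<rho>\<bar> * Mb / \<beta> 0 + k * Mb"
  have \<gamma>0: "\<bar>\<gamma> 0 t\<bar> \<le> G0" if t: "t \<in> {0..T}" for t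
  proof -
    have "\<bar>(\<mu> - r) * \<rho> * b 0 t / \<beta> 0\<bar> \<le> \<bar>(\<mu> - r) * \<rho>\<bar> * Mb / \<beta> 0"
      using Mb[OF t, of 0] \<beta>_pos[rule_format, of 0] by (simp add: abs_mult divide_right_mono mult_left_mono)
    then show ?thesis using Ma[OF t, of 0] \<kappa>b[OF t, of 0] unfolding c\<kappa>[symmetric] c_def G0_def by linarith
  qed
  have G0: "0 \<le> G0" using \<gamma>0[of 0] T by auto
  \<comment> \<open>One constant for all growth conditions. \<open>k * Mb\<close> is doubled because
    \<open>c = \<gamma> - \<kappa>\<close> makes \<open>\<bar>c\<bar> + \<bar>\<kappa>\<bar>\<close>
    at most \<open>\<bar>\<gamma>\<bar> + 2 * \<bar>\<kappa>\<bar>\<close>.\<close>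
  define m0 where "m0 = 1 + M\<beta> + Mb + r + M\<beta>\<^sup>2 + Mb\<^sup>2 + 2 * (k * Mb) + G0 + L"
  have kMb: "0 \<le> k * Mb" using k0 M0 by simp
  have m0: "1 \<le> m0" "M\<beta> \<le> m0" "Mb \<le> m0" "r + M\<beta>\<^sup>2 \<le> m0" "M\<beta>\<^sup>2 \<le> m0" "Mb\<^sup>2 \<le> m0" "2 * (k * Mb) + G0 + L \<le> m0" "k * Mb \<le> m0"
    using M0 r kMb G0 L(1) zero_le_power2[of M\<beta>] zero_le_power2[of Mb] unfolding m0_def by linarith+
  have \<gamma>x: "\<bar>\<gamma> x t\<bar> \<le> G0 + L * \<bar>x\<bar>" if "t \<in> {0..T}" for x t
    using \<gamma>0[OF that] Llip[OF L3[OF that, of x 0] L(4)] by simp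
  have grow: "2 * (k * Mb) + G0 + L * \<bar>x\<bar> \<le> m0 * (1 + \<bar>x\<bar>)" for x
  proof -
    have "0 \<le> (2 * (k * Mb) + G0) * \<bar>x\<bar>" using kMb G0 by simp
    then have "2 * (k * Mb) + G0 + L * \<bar>x\<bar> \<le> (2 * (k * Mb) + G0 + L) * (1 + \<bar>x\<bar>)" using L(1) by (simp add: algebra_simps)
    also have "\<dots> \<le> m0 * (1 + \<bar>x\<bar>)" using m0(7) by (intro mult_right_mono) auto
    finally show ?thesis .
  qed
  show ?thesis
  proof (intro allI impI, elim conjE)
    fix P G :: "real \<Rightarrow> real \<Rightarrow> real \<Rightarrow> real" and s x t :: real
    assume "visc_sol T r \<rho> \<beta> b (\<lambda>x t. a x t - (\<mu> - r) * \<rho> * b x t / \<beta> x) (\<lambda>x t. \<alpha> * sqrt (1 - \<rho>\<^sup>2) * b x t) (put_payoff K) P"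
      and "visc_sol T r \<rho> \<beta> b (gamma_coef \<mu> r \<rho> \<alpha> a b \<beta>) (\<lambda>x t. 0) (put_payoff K) G"
      and CP: "class_C T P" and CG: "class_C T G" and s: "0 < s" and t: "t \<in> {0..T}"
    then have vP: "visc_sol T r \<rho> \<beta> b c \<kappa> (put_payoff K) P" and vG: "visc_sol T r \<rho> \<beta> b \<gamma> (\<lambda>x t. 0) (put_payoff K) G"
      unfolding c_def[abs_def] \<kappa>_def[abs_def] \<gamma>_def by blast+
    have cont: "continuous_on (dom3 T) (\<lambda>(s, x, t). P s x t)" "continuous_on (dom3 T) (\<lambda>(s, x, t). G s x t)"
      using vP vG unfolding visc_sol_def by blast+
    obtain n1 W1 where g1: "W1 \<ge> 0" "\<And>n y x t. n1 \<le> n \<Longrightarrow> t \<in> {0..T} \<Longrightarrow> \<bar>P (exp y) x t\<bar> \<le> W1 * 2 ^ n * ((1 + y\<^sup>2) ^ n + (1 + x\<^sup>2) ^ n)"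
      by (rule class_C_growth[OF cont(1) CP]) (rule that)
    obtain n2 W2 where g2: "W2 \<ge> 0" "\<And>n y x t. n2 \<le> n \<Longrightarrow> t \<in> {0..T} \<Longrightarrow> \<bar>G (exp y) x t\<bar> \<le> W2 * 2 ^ n * ((1 + y\<^sup>2) ^ n + (1 + x\<^sup>2) ^ n)"
      by (rule class_C_growth[OF cont(2) CG]) (rule that)
    define n where "n = max n1 n2"
    define C0 where "C0 = (W1 + W2) * 2 ^ n"
    have C0: "0 \<le> C0" using g1 g2 by (simp add: C0_def)
    have aP: "admissible T r \<rho> \<beta> b \<gamma> m0 C0 n K sg (\<lambda>y x t. sg * (exp (- r * t) * P (exp y) x t))" if "sg \<in> {1, -1}" for sg
    proof (rule admissible_of_visc_sol[OF r vP that])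
      fix y x t assume t: "t \<in> {0..T}"
      have "W1 * 2 ^ n * ((1 + y\<^sup>2) ^ n + (1 + x\<^sup>2) ^ n) \<le> C0 * ((1 + y\<^sup>2) ^ n + (1 + x\<^sup>2) ^ n)"
        unfolding C0_def using g2(1) by (intro mult_right_mono) auto
      then show "\<bar>P (exp y) x t\<bar> \<le> C0 * ((1 + y\<^sup>2) ^ n + (1 + x\<^sup>2) ^ n)" using g1(2)[of n t y x] t by (simp add: n_def)
    next
      fix x t assume t: "t \<in> {0..T}"
      have "\<bar>c x t\<bar> \<le> \<bar>\<gamma> x t\<bar> + \<bar>\<kappa> x t\<bar>" using c\<kappa>[of x t] by linarith
      then have "\<bar>c x t\<bar> + \<bar>\<kappa> x t\<bar> \<le> m0 * (1 + \<bar>x\<bar>)" using grow[of x] \<gamma>x[OF t, of x] \<kappa>b[OF t, of x] by linarith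
      moreover have "\<bar>\<kappa> x t\<bar> \<le> m0" using \<kappa>b[OF t, of x] m0 by linarith
      ultimately show "c x t + \<kappa> x t = \<gamma> x t \<and> \<bar>\<kappa> x t\<bar> \<le> m0 \<and> \<bar>c x t\<bar> + \<bar>\<kappa> x t\<bar> \<le> m0 * (1 + \<bar>x\<bar>)" using c\<kappa> by blast
    qed
    have aG: "admissible T r \<rho> \<beta> b \<gamma> m0 C0 n K sg (\<lambda>y x t. sg * (exp (- r * t) * G (exp y) x t))" if "sg \<in> {1, -1}" for sg
    proof (rule admissible_of_visc_sol[OF r vG that])
      fix y x t assume t: "t \<in> {0..T}"
      have "W2 * 2 ^ n * ((1 + y\<^sup>2) ^ n + (1 + x\<^sup>2) ^ n) \<le> C0 * ((1 + y\<^sup>2) ^ n + (1 + x\<^sup>2) ^ n)"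
        unfolding C0_def using g1(1) by (intro mult_right_mono) auto
      then show "\<bar>G (exp y) x t\<bar> \<le> C0 * ((1 + y\<^sup>2) ^ n + (1 + x\<^sup>2) ^ n)" using g2(2)[of n t y x] t by (simp add: n_def)
    next
      fix x t assume t: "t \<in> {0..T}"
      show "\<gamma> x t + 0 = \<gamma> x t \<and> \<bar>0\<bar> \<le> m0 \<and> \<bar>\<gamma> x t\<bar> + \<bar>0\<bar> \<le> m0 * (1 + \<bar>x\<bar>)"
        using grow[of x] \<gamma>x[OF t, of x] kMb m0(1) by simp
    qed
    show "P s x t = G s x t"
    proof (cases "t = T")
      case True
      then show ?thesis using vP vG s unfolding visc_sol_def by simp
    next
      case False
      \<comment> \<open>The time 0 is included: the viscosity inequalities hold at interior times,
        and the comparison reaches the endpoint by continuity.\<close>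
      have ts: "0 \<le> t" "t < T" using t False by auto
      have close: "\<bar>exp (- r * t) * P s x t - exp (- r * t) * G s x t\<bar> \<le> 2 * \<Delta>" if \<Delta>: "\<Delta> > 0" for \<Delta>
      proof -
        have "\<exists>v. \<forall>sg\<in>{1,-1}. \<forall>U. admissible T r \<rho> \<beta> b \<gamma> m0 C0 n K sg U \<longrightarrow> U (ln s) x t \<le> sg * v + \<Delta>"
        proof (rule approx_solution[OF T r _ K C0 m0(1) L(1) \<Delta> ts _ \<beta>_mono])
          show "\<bar>\<rho>\<bar> \<le> 1" using \<rho> by auto
          show "0 \<le> \<beta> x" for x using \<beta>_pos by (simp add: less_imp_le)
          show "\<bar>\<beta> x\<bar> \<le> m0" for x using M\<beta>[of x] m0 by linarith
          show "\<bar>\<beta> x - \<beta> y\<bar> \<le> L * \<bar>x - y\<bar>" for x y by (rule Llip[OF L1 L(2)])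
          show "\<bar>\<beta> (x + w) + \<beta> (x - w) - 2 * \<beta> x\<bar> \<le> L * w\<^sup>2" for x w
            by (rule Lsq[OF second_difference_bound[OF d\<beta> L4] L(5)])
          show "(\<beta> x)\<^sup>2 / 2 \<le> m0" for x
            using power_mono[OF M\<beta>[of x], of 2] m0(5) zero_le_power2[of "\<beta> x"] unfolding power2_abs by linarith
          show "\<bar>r - (\<beta> x)\<^sup>2 / 2\<bar> \<le> m0" for x
          proof -
            have "(\<beta> x)\<^sup>2 \<le> M\<beta>\<^sup>2" using power_mono[OF M\<beta>[of x], of 2] by simp
            then show ?thesis using m0(4) r zero_le_power2[of "\<beta> x"] by (simp only: abs_le_iff) linarith
          qed
          fix x t assume t: "t \<in> {0..T}"
          show "\<bar>b x t\<bar> \<le> m0" using Mb[OF t, of x] m0 by linarith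
          show "\<bar>b x t - b y t\<bar> \<le> L * \<bar>x - y\<bar>" for y by (rule Llip[OF L2[OF t] L(3)])
          show "\<bar>b (x + w) t + b (x - w) t - 2 * b x t\<bar> \<le> L * w\<^sup>2" for w
            by (rule Lsq[OF second_difference_bound[OF db[OF t] L5[OF t]] L(6)])
          show "\<bar>\<gamma> x t\<bar> \<le> m0 * (1 + \<bar>x\<bar>)" using grow[of x] \<gamma>x[OF t, of x] kMb by linarith
          show "\<bar>\<gamma> x t - \<gamma> y t\<bar> \<le> L * \<bar>x - y\<bar>" for y by (rule Llip[OF L3[OF t] L(4)])
          show "(b x t)\<^sup>2 / 2 \<le> m0"
            using power_mono[OF Mb[OF t, of x], of 2] m0(6) zero_le_power2[of "b x t"] unfolding power2_abs by linarith
        qed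
        then obtain v where v: "\<And>sg U. sg \<in> {1,-1} \<Longrightarrow> admissible T r \<rho> \<beta> b \<gamma> m0 C0 n K sg U \<Longrightarrow> U (ln s) x t \<le> sg * v + \<Delta>"
          by blast
        \<comment> \<open>Used with both signs, this places the discounted values of
          \<open>P\<close> and of \<open>G\<close> within \<open>\<Delta>\<close> of the same number
          \<open>v\<close>.\<close>
        have "sg * (exp (- r * t) * P s x t) \<le> sg * v + \<Delta> \<and> sg * (exp (- r * t) * G s x t) \<le> sg * v + \<Delta>"
          if "sg \<in> {1, -1}" for sg
          using v[OF that aP[OF that]] v[OF that aG[OF that]] s by (simp only: exp_ln simp_thms)
        from this[of 1] this[of "-1"] show ?thesis by (simp add: abs_le_iff)
      qed
      have "\<bar>exp (- r * t) * P s x t - exp (- r * t) * G s x t\<bar> \<le> 0"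
      proof (rule field_le_epsilon)
        fix e :: real assume "e > 0"
        then show "\<bar>exp (- r * t) * P s x t - exp (- r * t) * G s x t\<bar> \<le> 0 + e" using close[of "e / 2"] by simp
      qed
      then show ?thesis by simp
    qed
  qed
qed

end
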